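(* Let $k$ be a field, let $H, G_1, G_2$ be $k$-groups, and let $\alpha_1 : k[G_1]\to k[H]$ and $\alpha_2 : k[G_2] \to k[H]$ be morphisms of Hopf algebras. The Hopf algebra $$k[G_1 *_H G_2] = \{ f \in C(k[G_1]\oplus k[G_2]) \mid f \text{ is coherent}\}$$ (as defined in the context), together with the projections $p_1 : k[G_1 *_H G_2]\to k[G_1]$ and $p_2 : k[G_1 *_H G_2] \to k[G_2]$, is the fibre product of $\alpha_1 : k[G_1]\to k[H]$ and $\alpha_2 : k[G_2]\to k[H]$ in the category of (commutative) Hopf algebras over $k$.
   Context: All Hopf algebras are commutative; a $k$-group is an affine group scheme over $k$ and $k[G]$ denotes its Hopf algebra of global sections. Tensor products are over $k$. Cofree coalgebra. For a $k$-vector space $V$ let $\hat{T}V = \prod_{n\ge 0} V^{\otimes n}$ and $\hat{T}V \hat\otimes \hat{T}V = \prod_{i,j\geq 0} V^{\otimes i}\otimes V^{\otimes j}$, with $V^{\otimes 0}=k$. Let $\psi_{i,j} : V^{\otimes (i+j)}\to V^{\otimes i}\otimes V^{\otimes j}$ be the canonical isomorphism, and define $\Delta : \hat{T}V\to\hat{T}V\hat\otimes\hat{T}V$ by $\Delta(f)_{i,j} = \psi_{i,j}(f_{i+j})$ for $f = (f_0,f_1,\ldots)$. Then $C(V) = \{f\in\hat{T}V \mid \Delta(f)\in \hat{T}V\otimes\hat{T}V\subseteq\hat{T}V\hat\otimes\hat{T}V\}$; it is a coalgebra with comultiplication $\Delta$ and counit $\epsilon(f) = f_0$. Let $\pi :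 C(V)\to V$, $f \mapsto f_1$. If $A$ is a commutative $k$-algebra, $C(A)$ is a bialgebra with componentwise multiplication (using the algebra $A^{\otimes n}$ in degree $n$) and unit $\lambda\mapsto(\lambda,\lambda,\ldots)$. Apply this to the product algebra $A = k[G_1]\oplus k[G_2] = k[G_1]\times k[G_2]$. For $i_1,\ldots,i_n\in\{1,2\}$ set $T_{i_1,\ldots,i_n} = k[G_{i_1}]\otimes\cdots\otimes k[G_{i_n}]$ (equal to $k$ for $n=0$), so that $A^{\otimes n} = \bigoplus_{(i_1,\ldots,i_n)\in\{1,2\}^n} T_{i_1,\ldots,i_n}$. Every $f\in\hat{T}(A)$ has components $f_{i_1,\ldots,i_n}\in T_{i_1,\ldots,i_n}$ (with $f_\emptyset \in k$ for $n=0$). For $\ell\in\{1,\ldots,n\}$ define three maps, each acting as the identity on the factors other than the $\ell$-th: - $\psi^\ell_{i_1,\ldots,i_n} : T_{i_1,\ldots,i_n}\to T_{i_1,\ldots,i_{\ell-1},i_\ell,i_\ell,i_{\ell+1},\ldots,i_n}$, applying the comultiplication of $k[G_{i_\ell}]$ to the $\ell$-th factor; - $\delta^\ell_{i_1,\ldots,i_n} : T_{i_1,\ldots,i_n}\to T_{i_1,\ldots,i_{\ell-1},i_{\ell+1},\ldots,i_n}$, applying the counit of $k[G_{i_\ell}]$ to the $\ell$-th factor; - $\theta^\ell_{i_1,\ldots,i_n} : T_{i_1,\ldots,i_n}\to k[G_{i_1}]\otimes\cdots\otimes k[G_{i_{\ell-1}}]\otimes k[H]\otimes k[G_{i_{\ell+1}}]\otimes\cdots\otimes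 k[G_{i_n}]$, applying $\alpha_{i_\ell}$ to the $\ell$-th factor. An element $f\in\hat{T}(A)$ is coherent if for all $n\ge1$, $\ell \in\{1,\ldots,n\}$ and all indices in $\{1,2\}$: (1) (multiplicatively coherent) $\psi^\ell_{i_1,\ldots,i_n}(f_{i_1,\ldots,i_n}) = f_{i_1,\ldots,i_\ell,i_\ell,\ldots,i_n}$; (2) (unitally coherent) $\delta^\ell_{i_1,\ldots,i_n}(f_{i_1,\ldots,i_n}) = f_{i_1,\ldots,i_{\ell-1},i_{\ell+1},\ldots,i_n}$; (3) ($H$-coherent) $\theta^\ell_{i_1,\ldots,i_{\ell-1},1,i_{\ell+1},\ldots,i_n}(f_{i_1,\ldots,i_{\ell-1},1,i_{\ell+1},\ldots,i_n}) = \theta^\ell_{i_1,\ldots,i_{\ell-1},2,i_{\ell+1},\ldots,i_n}(f_{i_1,\ldots,i_{\ell-1},2,i_{\ell+1},\ldots,i_n})$. The set $k[G_1*_HG_2]$ of coherent elements of $C(A)$ is a subbialgebra of $C(A)$ and a Hopf algebra with antipode $S$ given on components by $T_{i_1,\ldots,i_n}\to T_{i_n,\ldots,i_1}$, $h_1\otimes\cdots\otimes h_n\mapsto S_{i_n}(h_n)\otimes\cdots\otimes S_{i_1}(h_1)$, where $S_i$ is the antipode of $k[G_i]$. The maps $p_1,p_2$ are the restriction of $\pi : C(A)\to A = k[G_1]\oplus k[G_2]$ to $k[G_1 *_H G_2]$ followed by the projection to $k[G_1]$, respectively $k[G_2]$; they are morphisms of Hopf algebras with $\alpha_1p_1 =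 \alpha_2p_2$. *)

theory Defs
  imports "HOL-Algebra.Module" "HOL-Algebra.Chinese_Remainder"
begin

section \<open>Algebra homomorphisms\<close>

definition self_module :: "('k, 'm) ring_scheme \<Rightarrow> ('k, 'k) module" where
  "self_module K = ring.extend (ring.truncate K) \<lparr>smult = mult K\<rparr>"

definition alg_hom ::
    "('k, 'm) ring_scheme \<Rightarrow> ('k, 'v, 'n) module_scheme \<Rightarrow> ('k, 'w, 'p) module_scheme \<Rightarrow> ('v \<Rightarrow> 'w) set" where
  "alg_hom K A B =
     {h \<in> ring_hom A B. \<forall>c\<in>carrier K. \<forall>x\<in>carrier A. h (c \<odot>\<^bsub>A\<^esub> x) = c \<odot>\<^bsub>B\<^esub> h x}"

section \<open>Tensor products of lists of modules\<close>

text \<open>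
  The tensor product of \<open>M\<^sub>1, \<dots>, M\<^sub>n\<close> is the usual quotient of the free module on
  \<open>M\<^sub>1 \<times> \<cdots> \<times> M\<^sub>n\<close> (lists, with carrier that of \<^const>\<open>RDirProd_list\<close>) by the
  multilinearity relations. The free module is equipped with the monoid algebra
  multiplication, which induces the usual algebra structure on the quotient when the
  \<open>M\<^sub>i\<close> are algebras; if they are merely modules, the fields \<open>mult\<close> and \<open>one\<close> of the
  quotient carry no meaning. A tensor is a coset, i.e. a set of finitely supported
  functions on lists. The empty tensor product is canonically isomorphic (not equal) to the
  base ring, and a one-fold tensor product to its only factor.
\<close>

type_synonym ('k, 'v) tensor = "('v list \<Rightarrow> 'k) set"

definition monoid_algebra ::
    "('k, 'm) ring_scheme \<Rightarrow> ('x, 'n) monoid_scheme \<Rightarrow> ('k, 'x \<Rightarrow> 'k) module" where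
  "monoid_algebra K P =
     \<lparr>carrier = {\<phi>. finite {x. \<phi> x \<noteq> \<zero>\<^bsub>K\<^esub>} \<and> range \<phi> \<subseteq> carrier K \<and> {x. \<phi> x \<noteq> \<zero>\<^bsub>K\<^esub>} \<subseteq> carrier P},
      mult = (\<lambda>\<phi> \<chi> z. finsum K (\<lambda>(x, y). \<phi> x \<otimes>\<^bsub>K\<^esub> \<chi> y)
                {(x, y). \<phi> x \<noteq> \<zero>\<^bsub>K\<^esub> \<and> \<chi> y \<noteq> \<zero>\<^bsub>K\<^esub> \<and> x \<otimes>\<^bsub>P\<^esub> y = z}),
      one = (\<lambda>z. if z = \<one>\<^bsub>P\<^esub> then \<one>\<^bsub>K\<^esub> else \<zero>\<^bsub>K\<^esub>),
      zero = (\<lambda>_. \<zero>\<^bsub>K\<^esub>),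
      add = (\<lambda>\<phi> \<chi> z. \<phi> z \<oplus>\<^bsub>K\<^esub> \<chi> z),
      smult = (\<lambda>c \<phi> z. c \<otimes>\<^bsub>K\<^esub> \<phi> z)\<rparr>"

definition single :: "('k, 'm) ring_scheme \<Rightarrow> 'x \<Rightarrow> 'x \<Rightarrow> 'k" where
  "single K x = (\<lambda>z. if z = x then \<one>\<^bsub>K\<^esub> else \<zero>\<^bsub>K\<^esub>)"

definition free_tensor ::
    "('k, 'm) ring_scheme \<Rightarrow> ('k, 'v, 'n) module_scheme list \<Rightarrow> ('k, 'v list \<Rightarrow> 'k) module" where
  "free_tensor K Ms = monoid_algebra K (RDirProd_list Ms)"

definition multilinear_relators ::
    "('k, 'm) ring_scheme \<Rightarrow> ('k, 'v, 'n) module_scheme list \<Rightarrow> ('v list \<Rightarrow> 'k) set" where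
  "multilinear_relators K Ms =
     {single K (xs[l := x \<oplus>\<^bsub>Ms ! l\<^esub> y])
        \<ominus>\<^bsub>free_tensor K Ms\<^esub> (single K (xs[l := x]) \<oplus>\<^bsub>free_tensor K Ms\<^esub> single K (xs[l := y])) | xs l x y.
        xs \<in> carrier (RDirProd_list Ms) \<and> l < length Ms \<and>
        x \<in> carrier (Ms ! l) \<and> y \<in> carrier (Ms ! l)} \<union>
     {single K (xs[l := c \<odot>\<^bsub>Ms ! l\<^esub> x])
        \<ominus>\<^bsub>free_tensor K Ms\<^esub> (c \<odot>\<^bsub>free_tensor K Ms\<^esub> single K (xs[l := x])) | xs l c x.
        xs \<in> carrier (RDirProd_list Ms) \<and> l < length Ms \<and>
        c \<in> carrier K \<and> x \<in> carrier (Ms ! l)}"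

definition tensor_relations ::
    "('k, 'm) ring_scheme \<Rightarrow> ('k, 'v, 'n) module_scheme list \<Rightarrow> ('v list \<Rightarrow> 'k) set" where
  "tensor_relations K Ms =
     \<Inter>{N. submodule N K (free_tensor K Ms) \<and> multilinear_relators K Ms \<subseteq> N}"

definition tensor ::
    "('k, 'm) ring_scheme \<Rightarrow> ('k, 'v, 'n) module_scheme list \<Rightarrow> ('k, ('k, 'v) tensor) module" where
  "tensor K Ms =
     ring.extend (free_tensor K Ms Quot tensor_relations K Ms)
       \<lparr>smult = (\<lambda>c X. \<Union>\<phi>\<in>X. tensor_relations K Ms +>\<^bsub>free_tensor K Ms\<^esub> (c \<odot>\<^bsub>free_tensor K Ms\<^esub> \<phi>))\<rparr>"

definition pure ::
    "('k, 'm) ring_scheme \<Rightarrow> ('k, 'v, 'n) module_scheme list \<Rightarrow> 'v list \<Rightarrow> ('k, 'v) tensor" where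
  "pure K Ms xs = tensor_relations K Ms +>\<^bsub>free_tensor K Ms\<^esub> single K xs"

text \<open>
  The linear map into \<open>W\<close> induced by a multilinear map \<open>g\<close>: the common value, over all
  representatives \<open>\<phi>\<close> of the coset \<open>X\<close>, of \<open>\<Sum>\<^sub>x\<^sub>s \<phi>(xs) g(xs)\<close>.
\<close>

definition tensor_lift ::
    "('k, 'm) ring_scheme \<Rightarrow> ('k, 'w, 'n) module_scheme \<Rightarrow> ('v list \<Rightarrow> 'w) \<Rightarrow> ('k, 'v) tensor \<Rightarrow> 'w" where
  "tensor_lift K W g X =
     the_elem ((\<lambda>\<phi>. finsum W (\<lambda>xs. \<phi> xs \<odot>\<^bsub>W\<^esub> g xs) {xs. \<phi> xs \<noteq> \<zero>\<^bsub>K\<^esub>}) ` X)"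

text \<open>
  For \<open>D\<close> linear with values in an \<open>m\<close>-fold tensor product: apply \<open>D\<close> to the factor with
  (zero-based) number \<open>l\<close>, so that this factor is replaced by \<open>m\<close> factors; \<open>Ws\<close> is the
  resulting list of modules.
\<close>

definition expand_at ::
    "('k, 'm) ring_scheme \<Rightarrow> ('k, 'v, 'n) module_scheme list \<Rightarrow> ('v \<Rightarrow> ('k, 'v) tensor) \<Rightarrow> nat
       \<Rightarrow> ('k, 'v) tensor \<Rightarrow> ('k, 'v) tensor" where
  "expand_at K Ws D l =
     tensor_lift K (tensor K Ws) (\<lambda>xs.
       tensor_lift K (tensor K Ws) (\<lambda>ys. pure K Ws (take l xs @ ys @ drop (Suc l) xs)) (D (xs ! l)))"

section \<open>Commutative Hopf algebras\<close>

record ('k, 'v) hopf = "('k, 'v) module" +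
  comult :: "'v \<Rightarrow> ('k, 'v) tensor"
  counit :: "'v \<Rightarrow> 'k"
  antipode :: "'v \<Rightarrow> 'v"

text \<open>Commutativity is part of the locale \<^locale>\<open>algebra\<close>.\<close>

locale hopf_algebra = R?: field K + algebra K B
  for K :: "('k, 'm) ring_scheme" (structure) and B :: "('k, 'v, 'n) hopf_scheme" (structure) +
  assumes comult_hom: "comult B \<in> alg_hom K B (tensor K [B, B])"
    and counit_hom: "counit B \<in> alg_hom K B (self_module K)"
    and antipode_closed: "x \<in> carrier B \<Longrightarrow> antipode B x \<in> carrier B"
    and antipode_add: "\<lbrakk>x \<in> carrier B; y \<in> carrier B\<rbrakk> \<Longrightarrow>
          antipode B (x \<oplus>\<^bsub>B\<^esub> y) = antipode B x \<oplus>\<^bsub>B\<^esub> antipode B y"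
    and antipode_smult: "\<lbrakk>c \<in> carrier K; x \<in> carrier B\<rbrakk> \<Longrightarrow>
          antipode B (c \<odot>\<^bsub>B\<^esub> x) = c \<odot>\<^bsub>B\<^esub> antipode B x"
    and coassoc: "x \<in> carrier B \<Longrightarrow>
          expand_at K [B, B, B] (comult B) 0 (comult B x) = expand_at K [B, B, B] (comult B) 1 (comult B x)"
    and counit_left: "x \<in> carrier B \<Longrightarrow>
          tensor_lift K B (\<lambda>xs. counit B (xs ! 0) \<odot>\<^bsub>B\<^esub> xs ! 1) (comult B x) = x"
    and counit_right: "x \<in> carrier B \<Longrightarrow>
          tensor_lift K B (\<lambda>xs. counit B (xs ! 1) \<odot>\<^bsub>B\<^esub> xs ! 0) (comult B x) = x"
    and antipode_left: "x \<in> carrier B \<Longrightarrow>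
          tensor_lift K B (\<lambda>xs. antipode B (xs ! 0) \<otimes>\<^bsub>B\<^esub> xs ! 1) (comult B x) = counit B x \<odot>\<^bsub>B\<^esub> \<one>\<^bsub>B\<^esub>"
    and antipode_right: "x \<in> carrier B \<Longrightarrow>
          tensor_lift K B (\<lambda>xs. xs ! 0 \<otimes>\<^bsub>B\<^esub> antipode B (xs ! 1)) (comult B x) = counit B x \<odot>\<^bsub>B\<^esub> \<one>\<^bsub>B\<^esub>"

text \<open>Compatibility with the antipode is automatic for bialgebra morphisms of Hopf algebras.\<close>

definition hopf_hom ::
    "('k, 'm) ring_scheme \<Rightarrow> ('k, 'v, 'n) hopf_scheme \<Rightarrow> ('k, 'w, 'p) hopf_scheme \<Rightarrow> ('v \<Rightarrow> 'w) set" where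
  "hopf_hom K B B' =
     {h \<in> alg_hom K B B'. \<forall>x\<in>carrier B.
        tensor_lift K (tensor K [B', B']) (\<lambda>xs. pure K [B', B'] (map h xs)) (comult B x) = comult B' (h x) \<and>
        counit B' (h x) = counit B x \<and>
        antipode B' (h x) = h (antipode B x)}"

section \<open>The completed tensor algebra and the cofree coalgebra\<close>

abbreviation tensor_power ::
    "('k, 'm) ring_scheme \<Rightarrow> ('k, 'v, 'n) module_scheme \<Rightarrow> nat \<Rightarrow> ('k, ('k, 'v) tensor) module" where
  "tensor_power K V n \<equiv> tensor K (replicate n V)"

definition completed_tensor ::
    "('k, 'm) ring_scheme \<Rightarrow> ('k, 'v, 'n) module_scheme \<Rightarrow> ('k, nat \<Rightarrow> ('k, 'v) tensor) module" where
  "completed_tensor K V =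
     \<lparr>carrier = {f. \<forall>n. f n \<in> carrier (tensor_power K V n)},
      mult = (\<lambda>f g n. f n \<otimes>\<^bsub>tensor_power K V n\<^esub> g n),
      one = (\<lambda>n. \<one>\<^bsub>tensor_power K V n\<^esub>),
      zero = (\<lambda>n. \<zero>\<^bsub>tensor_power K V n\<^esub>),
      add = (\<lambda>f g n. f n \<oplus>\<^bsub>tensor_power K V n\<^esub> g n),
      smult = (\<lambda>c f n. c \<odot>\<^bsub>tensor_power K V n\<^esub> f n)\<rparr>"

definition split_tensor ::
    "('k, 'm) ring_scheme \<Rightarrow> ('k, 'v, 'n) module_scheme \<Rightarrow> nat \<Rightarrow> nat
       \<Rightarrow> ('k, 'v) tensor \<Rightarrow> ('k, ('k, 'v) tensor) tensor" where
  "split_tensor K V i j =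
     tensor_lift K (tensor K [tensor_power K V i, tensor_power K V j])
       (\<lambda>xs. pure K [tensor_power K V i, tensor_power K V j]
               [pure K (replicate i V) (take i xs), pure K (replicate j V) (drop i xs)])"

text \<open>
  \<open>represents_comult K V f t\<close> says that the image of \<open>t\<close>, an element of the algebraic tensor
  square of (a subspace of) the completed tensor algebra, under the canonical embedding
  \<open>g \<otimes> h \<mapsto> (g\<^sub>i \<otimes> h\<^sub>j)\<^sub>i\<^sub>,\<^sub>j\<close> into the completed tensor square is \<open>\<Delta>(f)\<close>.
\<close>

definition represents_comult ::
    "('k, 'm) ring_scheme \<Rightarrow> ('k, 'v, 'n) module_scheme
       \<Rightarrow> (nat \<Rightarrow> ('k, 'v) tensor) \<Rightarrow> ('k, nat \<Rightarrow> ('k, 'v) tensor) tensor \<Rightarrow> bool" where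
  "represents_comult K V f t \<longleftrightarrow>
     (\<forall>i j. tensor_lift K (tensor K [tensor_power K V i, tensor_power K V j])
              (\<lambda>gs. pure K [tensor_power K V i, tensor_power K V j] [(gs ! 0) i, (gs ! 1) j]) t
            = split_tensor K V i j (f (i + j)))"

definition cofree ::
    "('k, 'm) ring_scheme \<Rightarrow> ('k, 'v, 'n) module_scheme \<Rightarrow> ('k, nat \<Rightarrow> ('k, 'v) tensor) module" where
  "cofree K V = completed_tensor K V
     \<lparr>carrier := {f \<in> carrier (completed_tensor K V).
        \<exists>t\<in>carrier (tensor K [completed_tensor K V, completed_tensor K V]). represents_comult K V f t}\<rparr>"

text \<open>
  The comultiplication of the cofree coalgebra, restricted to a subcoalgebra \<open>U\<close>; with
  \<open>U = cofree K V\<close> it is the comultiplication of the cofree coalgebra itself.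
\<close>

definition cofree_comult ::
    "('k, 'm) ring_scheme \<Rightarrow> ('k, 'v, 'n) module_scheme \<Rightarrow> ('k, nat \<Rightarrow> ('k, 'v) tensor, 'p) module_scheme
       \<Rightarrow> (nat \<Rightarrow> ('k, 'v) tensor) \<Rightarrow> ('k, nat \<Rightarrow> ('k, 'v) tensor) tensor" where
  "cofree_comult K V U f = (THE t. t \<in> carrier (tensor K [U, U]) \<and> represents_comult K V f t)"

text \<open>\<open>f\<^sub>0\<close> and \<open>f\<^sub>1\<close>, read in the base field and in \<open>V\<close>.\<close>

definition cofree_counit :: "('k, 'm) ring_scheme \<Rightarrow> (nat \<Rightarrow> ('k, 'v) tensor) \<Rightarrow> 'k" where
  "cofree_counit K f = tensor_lift K (self_module K) (\<lambda>_. \<one>\<^bsub>K\<^esub>) (f 0)"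

definition cofree_proj ::
    "('k, 'm) ring_scheme \<Rightarrow> ('k, 'v, 'n) module_scheme \<Rightarrow> (nat \<Rightarrow> ('k, 'v) tensor) \<Rightarrow> 'v" where
  "cofree_proj K V f = tensor_lift K V (\<lambda>xs. xs ! 0) (f 1)"

section \<open>Components with respect to a product of two algebras\<close>

definition prod_algebra ::
    "('k, 'a, 'n) module_scheme \<Rightarrow> ('k, 'b, 'p) module_scheme \<Rightarrow> ('k, 'a \<times> 'b) module" where
  "prod_algebra M N = ring.extend (RDirProd M N) \<lparr>smult = (\<lambda>c (x, y). (c \<odot>\<^bsub>M\<^esub> x, c \<odot>\<^bsub>N\<^esub> y))\<rparr>"

text \<open>
  Mixed tensor products require all factors to have elements of one common type; the factors
  are copied there along the injections \<^const>\<open>Inl\<close> and \<^const>\<open>Inr\<close>.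
\<close>

definition image_module :: "('v \<Rightarrow> 'w) \<Rightarrow> ('k, 'v, 'n) module_scheme \<Rightarrow> ('k, 'w) module" where
  "image_module \<iota> M = ring.extend (image_ring \<iota> M)
     \<lparr>smult = (\<lambda>c y. \<iota> (c \<odot>\<^bsub>M\<^esub> inv_into (carrier M) \<iota> y))\<rparr>"

datatype side = One | Two

fun factor ::
    "('k, 'a, 'n) module_scheme \<Rightarrow> ('k, 'b, 'p) module_scheme \<Rightarrow> side \<Rightarrow> ('k, 'a + 'b) module" where
  "factor G\<^sub>1 G\<^sub>2 One = image_module Inl G\<^sub>1"
| "factor G\<^sub>1 G\<^sub>2 Two = image_module Inr G\<^sub>2"

fun select :: "side \<Rightarrow> 'a \<times> 'b \<Rightarrow> 'a + 'b" where
  "select One p = Inl (fst p)"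
| "select Two p = Inr (snd p)"

fun factor_comult ::
    "('k, 'm) ring_scheme \<Rightarrow> ('k, 'a, 'n) hopf_scheme \<Rightarrow> ('k, 'b, 'p) hopf_scheme
       \<Rightarrow> 'a + 'b \<Rightarrow> ('k, 'a + 'b) tensor" where
  "factor_comult K G\<^sub>1 G\<^sub>2 (Inl a) =
     (let Ms = [factor G\<^sub>1 G\<^sub>2 One, factor G\<^sub>1 G\<^sub>2 One]
      in tensor_lift K (tensor K Ms) (\<lambda>xs. pure K Ms (map Inl xs)) (comult G\<^sub>1 a))"
| "factor_comult K G\<^sub>1 G\<^sub>2 (Inr b) =
     (let Ms = [factor G\<^sub>1 G\<^sub>2 Two, factor G\<^sub>1 G\<^sub>2 Two]
      in tensor_lift K (tensor K Ms) (\<lambda>xs. pure K Ms (map Inr xs)) (comult G\<^sub>2 b))"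

definition factor_counit ::
    "('k, 'a, 'n) hopf_scheme \<Rightarrow> ('k, 'b, 'p) hopf_scheme \<Rightarrow> 'a + 'b \<Rightarrow> 'k" where
  "factor_counit G\<^sub>1 G\<^sub>2 = case_sum (counit G\<^sub>1) (counit G\<^sub>2)"

definition factor_antipode ::
    "('k, 'a, 'n) hopf_scheme \<Rightarrow> ('k, 'b, 'p) hopf_scheme \<Rightarrow> 'a + 'b \<Rightarrow> 'a + 'b" where
  "factor_antipode G\<^sub>1 G\<^sub>2 = map_sum (antipode G\<^sub>1) (antipode G\<^sub>2)"

text \<open>The component \<open>f\<^sub>i\<^sub>s\<close> in the mixed tensor product \<open>T\<^sub>i\<^sub>s\<close>.\<close>

definition component ::
    "('k, 'm) ring_scheme \<Rightarrow> ('k, 'a, 'n) module_scheme \<Rightarrow> ('k, 'b, 'p) module_scheme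
       \<Rightarrow> side list \<Rightarrow> (nat \<Rightarrow> ('k, 'a \<times> 'b) tensor) \<Rightarrow> ('k, 'a + 'b) tensor" where
  "component K G\<^sub>1 G\<^sub>2 is f =
     (let Ms = map (factor G\<^sub>1 G\<^sub>2) is
      in tensor_lift K (tensor K Ms) (\<lambda>xs. pure K Ms (map2 select is xs)) (f (length is)))"

section \<open>Coherent elements\<close>

text \<open>The maps \<open>\<psi>\<close>, \<open>\<delta>\<close>, \<open>\<theta>\<close> at position \<open>l\<close>, where positions are counted from \<open>0\<close>.\<close>

definition psi_at ::
    "('k, 'm) ring_scheme \<Rightarrow> ('k, 'a, 'n) hopf_scheme \<Rightarrow> ('k, 'b, 'p) hopf_scheme
       \<Rightarrow> side list \<Rightarrow> nat \<Rightarrow> ('k, 'a + 'b) tensor \<Rightarrow> ('k, 'a + 'b) tensor" where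
  "psi_at K G\<^sub>1 G\<^sub>2 is l =
     expand_at K (map (factor G\<^sub>1 G\<^sub>2) (take l is @ [is ! l, is ! l] @ drop (Suc l) is))
       (factor_comult K G\<^sub>1 G\<^sub>2) l"

definition delta_at ::
    "('k, 'm) ring_scheme \<Rightarrow> ('k, 'a, 'n) hopf_scheme \<Rightarrow> ('k, 'b, 'p) hopf_scheme
       \<Rightarrow> side list \<Rightarrow> nat \<Rightarrow> ('k, 'a + 'b) tensor \<Rightarrow> ('k, 'a + 'b) tensor" where
  "delta_at K G\<^sub>1 G\<^sub>2 is l =
     (let Ms = map (factor G\<^sub>1 G\<^sub>2) (take l is @ drop (Suc l) is)
      in tensor_lift K (tensor K Ms)
           (\<lambda>xs. factor_counit G\<^sub>1 G\<^sub>2 (xs ! l) \<odot>\<^bsub>tensor K Ms\<^esub> pure K Ms (take l xs @ drop (Suc l) xs)))"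

definition theta_at ::
    "('k, 'm) ring_scheme \<Rightarrow> ('k, 'a, 'n) hopf_scheme \<Rightarrow> ('k, 'b, 'p) hopf_scheme \<Rightarrow> ('k, 'h, 'q) hopf_scheme
       \<Rightarrow> ('a \<Rightarrow> 'h) \<Rightarrow> ('b \<Rightarrow> 'h) \<Rightarrow> side list \<Rightarrow> nat
       \<Rightarrow> ('k, 'a + 'b) tensor \<Rightarrow> ('k, ('a + 'b) + 'h) tensor" where
  "theta_at K G\<^sub>1 G\<^sub>2 H \<alpha>\<^sub>1 \<alpha>\<^sub>2 is l =
     (let Ms = (map (image_module Inl \<circ> factor G\<^sub>1 G\<^sub>2) is)[l := image_module Inr H]
      in tensor_lift K (tensor K Ms)
           (\<lambda>xs. pure K Ms ((map Inl xs)[l := Inr (case_sum \<alpha>\<^sub>1 \<alpha>\<^sub>2 (xs ! l))])))"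

definition coherent ::
    "('k, 'm) ring_scheme \<Rightarrow> ('k, 'a, 'n) hopf_scheme \<Rightarrow> ('k, 'b, 'p) hopf_scheme \<Rightarrow> ('k, 'h, 'q) hopf_scheme
       \<Rightarrow> ('a \<Rightarrow> 'h) \<Rightarrow> ('b \<Rightarrow> 'h) \<Rightarrow> (nat \<Rightarrow> ('k, 'a \<times> 'b) tensor) \<Rightarrow> bool" where
  "coherent K G\<^sub>1 G\<^sub>2 H \<alpha>\<^sub>1 \<alpha>\<^sub>2 f \<longleftrightarrow>
     (\<forall>is. \<forall>l<length is.
        psi_at K G\<^sub>1 G\<^sub>2 is l (component K G\<^sub>1 G\<^sub>2 is f)
          = component K G\<^sub>1 G\<^sub>2 (take l is @ [is ! l, is ! l] @ drop (Suc l) is) f \<and>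
        delta_at K G\<^sub>1 G\<^sub>2 is l (component K G\<^sub>1 G\<^sub>2 is f)
          = component K G\<^sub>1 G\<^sub>2 (take l is @ drop (Suc l) is) f \<and>
        theta_at K G\<^sub>1 G\<^sub>2 H \<alpha>\<^sub>1 \<alpha>\<^sub>2 (is[l := One]) l (component K G\<^sub>1 G\<^sub>2 (is[l := One]) f)
          = theta_at K G\<^sub>1 G\<^sub>2 H \<alpha>\<^sub>1 \<alpha>\<^sub>2 (is[l := Two]) l (component K G\<^sub>1 G\<^sub>2 (is[l := Two]) f))"

section \<open>The Hopf algebra of coherent elements\<close>

text \<open>
  The antipode is determined by its components \<open>T\<^sub>i\<^sub>s \<rightarrow> T\<^bsub>rev is\<^esub>\<close>; the element \<open>g\<close> below is unique
  because a tensor power of a product algebra is the direct sum of its components \<open>T\<^sub>i\<^sub>s\<close>.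
\<close>

definition coherent_antipode ::
    "('k, 'm) ring_scheme \<Rightarrow> ('k, 'a, 'n) hopf_scheme \<Rightarrow> ('k, 'b, 'p) hopf_scheme
       \<Rightarrow> (nat \<Rightarrow> ('k, 'a \<times> 'b) tensor) \<Rightarrow> (nat \<Rightarrow> ('k, 'a \<times> 'b) tensor)" where
  "coherent_antipode K G\<^sub>1 G\<^sub>2 f =
     (THE g. g \<in> carrier (completed_tensor K (prod_algebra G\<^sub>1 G\<^sub>2)) \<and>
        (\<forall>is. component K G\<^sub>1 G\<^sub>2 (rev is) g =
           (let Ms = map (factor G\<^sub>1 G\<^sub>2) (rev is)
            in tensor_lift K (tensor K Ms)
                 (\<lambda>xs. pure K Ms (rev (map (factor_antipode G\<^sub>1 G\<^sub>2) xs))) (component K G\<^sub>1 G\<^sub>2 is f))))"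

definition coherent_algebra ::
    "('k, 'm) ring_scheme \<Rightarrow> ('k, 'a, 'n) hopf_scheme \<Rightarrow> ('k, 'b, 'p) hopf_scheme \<Rightarrow> ('k, 'h, 'q) hopf_scheme
       \<Rightarrow> ('a \<Rightarrow> 'h) \<Rightarrow> ('b \<Rightarrow> 'h) \<Rightarrow> ('k, nat \<Rightarrow> ('k, 'a \<times> 'b) tensor) module" where
  "coherent_algebra K G\<^sub>1 G\<^sub>2 H \<alpha>\<^sub>1 \<alpha>\<^sub>2 =
     (let C = cofree K (prod_algebra G\<^sub>1 G\<^sub>2)
      in C\<lparr>carrier := {f \<in> carrier C. coherent K G\<^sub>1 G\<^sub>2 H \<alpha>\<^sub>1 \<alpha>\<^sub>2 f}\<rparr>)"

definition coherent_hopf ::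
    "('k, 'm) ring_scheme \<Rightarrow> ('k, 'a, 'n) hopf_scheme \<Rightarrow> ('k, 'b, 'p) hopf_scheme \<Rightarrow> ('k, 'h, 'q) hopf_scheme
       \<Rightarrow> ('a \<Rightarrow> 'h) \<Rightarrow> ('b \<Rightarrow> 'h) \<Rightarrow> ('k, nat \<Rightarrow> ('k, 'a \<times> 'b) tensor) hopf" where
  "coherent_hopf K G\<^sub>1 G\<^sub>2 H \<alpha>\<^sub>1 \<alpha>\<^sub>2 =
     module.extend (coherent_algebra K G\<^sub>1 G\<^sub>2 H \<alpha>\<^sub>1 \<alpha>\<^sub>2)
       \<lparr>comult = cofree_comult K (prod_algebra G\<^sub>1 G\<^sub>2) (coherent_algebra K G\<^sub>1 G\<^sub>2 H \<alpha>\<^sub>1 \<alpha>\<^sub>2),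
        counit = cofree_counit K,
        antipode = coherent_antipode K G\<^sub>1 G\<^sub>2\<rparr>"

definition coherent_proj\<^sub>1 ::
    "('k, 'm) ring_scheme \<Rightarrow> ('k, 'a, 'n) hopf_scheme \<Rightarrow> ('k, 'b, 'p) hopf_scheme
       \<Rightarrow> (nat \<Rightarrow> ('k, 'a \<times> 'b) tensor) \<Rightarrow> 'a" where
  "coherent_proj\<^sub>1 K G\<^sub>1 G\<^sub>2 f = fst (cofree_proj K (prod_algebra G\<^sub>1 G\<^sub>2) f)"

definition coherent_proj\<^sub>2 ::
    "('k, 'm) ring_scheme \<Rightarrow> ('k, 'a, 'n) hopf_scheme \<Rightarrow> ('k, 'b, 'p) hopf_scheme
       \<Rightarrow> (nat \<Rightarrow> ('k, 'a \<times> 'b) tensor) \<Rightarrow> 'b" where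
  "coherent_proj\<^sub>2 K G\<^sub>1 G\<^sub>2 f = snd (cofree_proj K (prod_algebra G\<^sub>1 G\<^sub>2) f)"

end

theory Submission
 imports Defs
begin

text \<open>
  The proof computes with functionals and matrices instead of with elements of mixed tensor
  products.

  Linear functionals separate the points of a tensor product (\<open>tensor_separated\<close>), so an
  element \<open>f\<close> of the completed tensor algebra of \<open>A = k[G\<^sub>1] \<times> k[G\<^sub>2]\<close> is known from its
  values \<open>fev w f\<close> on words \<open>w\<close> of functionals, where each letter factors through one of the
  two projections of \<open>A\<close>. In this language \<open>\<Delta>\<close> cuts words, and coherence says that two
  adjacent letters on the same side may be multiplied (convolution of functionals), that the
  counit may be deleted, and that a letter pulled back from \<open>k[H]\<close> may change sides
  (\<open>coherent_iff\<close>). So \<open>f\<close> is a function on words in the two dual algebras that respects the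
  relations of the amalgam.

  By the finiteness theorem for coalgebras every element of a Hopf algebra is a combination of
  entries of a matrix \<open>Z\<close> with \<open>\<Delta> Z\<^sub>a\<^sub>b = \<Sum>\<^sub>c Z\<^sub>a\<^sub>c \<otimes> Z\<^sub>c\<^sub>b\<close> and \<open>\<epsilon> Z\<^sub>a\<^sub>b = \<delta>\<^sub>a\<^sub>b\<close>, that is, of a
  finite-dimensional representation (\<open>comat_span\<close>). Likewise every coherent element of \<open>C(A)\<close> is
  a combination of entries of \<open>Emat I X\<close>, the matrix whose degree \<open>n\<close> part is the \<open>n\<close>-fold
  tensor power of \<open>X\<close>, for a matrix \<open>X\<close> over \<open>A\<close> made of a representation of \<open>G\<^sub>1\<close> and one of
  \<open>G\<^sub>2\<close> that agree on \<open>H\<close> (\<open>coherent_span\<close>). Both come from one argument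
  (\<open>matrix_coefficients\<close>). A representation of the amalgam is thus a compatible pair of
  representations, and all operations on coherent elements are visible on such pairs: products
  are Kronecker products, \<open>\<Delta>\<close> is matrix multiplication, and the antipode is the
  contragredient. This gives the Hopf algebra axioms.

  For the universal property, compatible \<open>q\<^sub>1, q\<^sub>2\<close> turn a representation \<open>Z\<close> over \<open>B\<close> into the
  compatible pair \<open>(q\<^sub>1 Z, q\<^sub>2 Z)\<close>, and the induced map sends \<open>Z\<^sub>a\<^sub>b\<close> to the entry of the
  corresponding \<open>Emat\<close>. It is forced, since a matrix with \<open>\<Delta> Z\<^sub>a\<^sub>b = \<Sum>\<^sub>c Z\<^sub>a\<^sub>c \<otimes> Z\<^sub>c\<^sub>b\<close> in the completed
  tensor algebra is determined by its degree one part (\<open>Emat_unique\<close>).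
\<close>

section \<open>Algebras over a field and linear maps\<close>

text \<open>Everything below is relative to one base field, which the abbreviations suppress.\<close>

locale ground_field = field K for K :: "('k, 'm) ring_scheme" (structure)
begin

abbreviation alg :: "('k, 'v, 'n) module_scheme \<Rightarrow> bool" where "alg \<equiv> algebra K"
abbreviation hopf :: "('k, 'v, 'n) hopf_scheme \<Rightarrow> bool" where "hopf \<equiv> hopf_algebra K"
abbreviation homs :: "('k, 'v, 'n) hopf_scheme \<Rightarrow> ('k, 'w, 'p) hopf_scheme \<Rightarrow> ('v \<Rightarrow> 'w) set" where "homs \<equiv> hopf_hom K"
abbreviation tens :: "('k, 'v, 'n) module_scheme list \<Rightarrow> ('k, ('k, 'v) tensor) module" where "tens \<equiv> tensor K"
abbreviation pur :: "('k, 'v, 'n) module_scheme list \<Rightarrow> 'v list \<Rightarrow> ('k, 'v) tensor" where "pur \<equiv> pure K"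
abbreviation "\<K> \<equiv> carrier K"
abbreviation tlift :: "('k, 'w, 'n) module_scheme \<Rightarrow> ('v list \<Rightarrow> 'w) \<Rightarrow> ('k, 'v) tensor \<Rightarrow> 'w" where "tlift \<equiv> tensor_lift K"
abbreviation TC :: "('k, 'v, 'n) module_scheme list \<Rightarrow> ('k, 'v) tensor set" where "TC Ms \<equiv> carrier (tens Ms)"
abbreviation mon :: "('x, 'n) monoid_scheme \<Rightarrow> ('k, 'x \<Rightarrow> 'k) module" where "mon \<equiv> monoid_algebra K"
abbreviation free :: "('k, 'v, 'n) module_scheme list \<Rightarrow> ('k, 'v list \<Rightarrow> 'k) module" where "free \<equiv> free_tensor K"
abbreviation rels :: "('k, 'v, 'n) module_scheme list \<Rightarrow> ('v list \<Rightarrow> 'k) set" where "rels \<equiv> tensor_relations K"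
abbreviation Ks :: "('k, 'k) module" where "Ks \<equiv> self_module K"
abbreviation ksum :: "('i \<Rightarrow> 'k) \<Rightarrow> 'i set \<Rightarrow> 'k" where "ksum \<equiv> finsum K"
abbreviation img :: "('v \<Rightarrow> 'w) \<Rightarrow> ('k, 'v, 'n) module_scheme \<Rightarrow> ('k, 'w) module" where "img \<equiv> image_module"

lemma alg_simps [simp]:
 assumes "alg M"
 shows "x \<in> carrier M \<Longrightarrow> y \<in> carrier M \<Longrightarrow> x \<oplus>\<^bsub>M\<^esub> y \<in> carrier M"
  and "x \<in> carrier M \<Longrightarrow> y \<in> carrier M \<Longrightarrow> x \<otimes>\<^bsub>M\<^esub> y \<in> carrier M"
  and "\<zero>\<^bsub>M\<^esub> \<in> carrier M" and "\<one>\<^bsub>M\<^esub> \<in> carrier M"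
  and "c \<in> \<K> \<Longrightarrow> x \<in> carrier M \<Longrightarrow> c \<odot>\<^bsub>M\<^esub> x \<in> carrier M"
  and "x \<in> carrier M \<Longrightarrow> x \<oplus>\<^bsub>M\<^esub> \<zero>\<^bsub>M\<^esub> = x" and "x \<in> carrier M \<Longrightarrow> \<zero>\<^bsub>M\<^esub> \<oplus>\<^bsub>M\<^esub> x = x"
  and "x \<in> carrier M \<Longrightarrow> x \<otimes>\<^bsub>M\<^esub> \<one>\<^bsub>M\<^esub> = x" and "x \<in> carrier M \<Longrightarrow> \<one>\<^bsub>M\<^esub> \<otimes>\<^bsub>M\<^esub> x = x"
  and "x \<in> carrier M \<Longrightarrow> x \<otimes>\<^bsub>M\<^esub> \<zero>\<^bsub>M\<^esub> = \<zero>\<^bsub>M\<^esub>" and "x \<in> carrier M \<Longrightarrow> \<zero>\<^bsub>M\<^esub> \<otimes>\<^bsub>M\<^esub> x = \<zero>\<^bsub>M\<^esub>"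
  and "x \<in> carrier M \<Longrightarrow> \<one> \<odot>\<^bsub>M\<^esub> x = x" and "x \<in> carrier M \<Longrightarrow> \<zero> \<odot>\<^bsub>M\<^esub> x = \<zero>\<^bsub>M\<^esub>"
  and "c \<in> \<K> \<Longrightarrow> c \<odot>\<^bsub>M\<^esub> \<zero>\<^bsub>M\<^esub> = \<zero>\<^bsub>M\<^esub>"
  and "x \<in> carrier M \<Longrightarrow> y \<in> carrier M \<Longrightarrow> x \<ominus>\<^bsub>M\<^esub> y \<in> carrier M"
  and "x \<in> carrier M \<Longrightarrow> \<ominus>\<^bsub>M\<^esub> x \<in> carrier M"
proof -
 interpret M: algebra K M by fact
 show "x \<in> carrier M \<Longrightarrow> y \<in> carrier M \<Longrightarrow> x \<oplus>\<^bsub>M\<^esub> y \<in> carrier M"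
  and "x \<in> carrier M \<Longrightarrow> y \<in> carrier M \<Longrightarrow> x \<otimes>\<^bsub>M\<^esub> y \<in> carrier M"
  and "\<zero>\<^bsub>M\<^esub> \<in> carrier M" and "\<one>\<^bsub>M\<^esub> \<in> carrier M"
  and "c \<in> \<K> \<Longrightarrow> x \<in> carrier M \<Longrightarrow> c \<odot>\<^bsub>M\<^esub> x \<in> carrier M"
  and "x \<in> carrier M \<Longrightarrow> x \<oplus>\<^bsub>M\<^esub> \<zero>\<^bsub>M\<^esub> = x" and "x \<in> carrier M \<Longrightarrow> \<zero>\<^bsub>M\<^esub> \<oplus>\<^bsub>M\<^esub> x = x"
  and "x \<in> carrier M \<Longrightarrow> x \<otimes>\<^bsub>M\<^esub> \<one>\<^bsub>M\<^esub> = x" and "x \<in> carrier M \<Longrightarrow> \<one>\<^bsub>M\<^esub> \<otimes>\<^bsub>M\<^esub> x = x"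
  and "x \<in> carrier M \<Longrightarrow> x \<otimes>\<^bsub>M\<^esub> \<zero>\<^bsub>M\<^esub> = \<zero>\<^bsub>M\<^esub>" and "x \<in> carrier M \<Longrightarrow> \<zero>\<^bsub>M\<^esub> \<otimes>\<^bsub>M\<^esub> x = \<zero>\<^bsub>M\<^esub>"
  and "x \<in> carrier M \<Longrightarrow> \<one> \<odot>\<^bsub>M\<^esub> x = x" and "x \<in> carrier M \<Longrightarrow> \<zero> \<odot>\<^bsub>M\<^esub> x = \<zero>\<^bsub>M\<^esub>"
  and "c \<in> \<K> \<Longrightarrow> c \<odot>\<^bsub>M\<^esub> \<zero>\<^bsub>M\<^esub> = \<zero>\<^bsub>M\<^esub>"
  and "x \<in> carrier M \<Longrightarrow> y \<in> carrier M \<Longrightarrow> x \<ominus>\<^bsub>M\<^esub> y \<in> carrier M"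
  and "x \<in> carrier M \<Longrightarrow> \<ominus>\<^bsub>M\<^esub> x \<in> carrier M"
  by simp_all
qed

lemma alg_add_ac:
 assumes "alg M" "x \<in> carrier M" "y \<in> carrier M"
 shows "z \<in> carrier M \<Longrightarrow> (x \<oplus>\<^bsub>M\<^esub> y) \<oplus>\<^bsub>M\<^esub> z = x \<oplus>\<^bsub>M\<^esub> (y \<oplus>\<^bsub>M\<^esub> z)"
  and "x \<oplus>\<^bsub>M\<^esub> y = y \<oplus>\<^bsub>M\<^esub> x"
  and "z \<in> carrier M \<Longrightarrow> x \<oplus>\<^bsub>M\<^esub> (y \<oplus>\<^bsub>M\<^esub> z) = y \<oplus>\<^bsub>M\<^esub> (x \<oplus>\<^bsub>M\<^esub> z)"
proof -
 interpret M: algebra K M by fact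
 show "z \<in> carrier M \<Longrightarrow> (x \<oplus>\<^bsub>M\<^esub> y) \<oplus>\<^bsub>M\<^esub> z = x \<oplus>\<^bsub>M\<^esub> (y \<oplus>\<^bsub>M\<^esub> z)" "x \<oplus>\<^bsub>M\<^esub> y = y \<oplus>\<^bsub>M\<^esub> x"
   "z \<in> carrier M \<Longrightarrow> x \<oplus>\<^bsub>M\<^esub> (y \<oplus>\<^bsub>M\<^esub> z) = y \<oplus>\<^bsub>M\<^esub> (x \<oplus>\<^bsub>M\<^esub> z)"
  using assms by (simp_all add: M.add.m_ac)
qed

lemma alg_mult_ac:
 assumes "alg M" "x \<in> carrier M" "y \<in> carrier M"
 shows "z \<in> carrier M \<Longrightarrow> (x \<otimes>\<^bsub>M\<^esub> y) \<otimes>\<^bsub>M\<^esub> z = x \<otimes>\<^bsub>M\<^esub> (y \<otimes>\<^bsub>M\<^esub> z)"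
  and "x \<otimes>\<^bsub>M\<^esub> y = y \<otimes>\<^bsub>M\<^esub> x"
  and "z \<in> carrier M \<Longrightarrow> x \<otimes>\<^bsub>M\<^esub> (y \<otimes>\<^bsub>M\<^esub> z) = y \<otimes>\<^bsub>M\<^esub> (x \<otimes>\<^bsub>M\<^esub> z)"
proof -
 interpret M: algebra K M by fact
 show "z \<in> carrier M \<Longrightarrow> (x \<otimes>\<^bsub>M\<^esub> y) \<otimes>\<^bsub>M\<^esub> z = x \<otimes>\<^bsub>M\<^esub> (y \<otimes>\<^bsub>M\<^esub> z)" "x \<otimes>\<^bsub>M\<^esub> y = y \<otimes>\<^bsub>M\<^esub> x"
   "z \<in> carrier M \<Longrightarrow> x \<otimes>\<^bsub>M\<^esub> (y \<otimes>\<^bsub>M\<^esub> z) = y \<otimes>\<^bsub>M\<^esub> (x \<otimes>\<^bsub>M\<^esub> z)"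
  using assms by (simp_all add: M.m_ac)
qed

lemma alg_distrib_add:
 assumes "alg M" "x \<in> carrier M" "y \<in> carrier M"
 shows "z \<in> carrier M \<Longrightarrow> (x \<oplus>\<^bsub>M\<^esub> y) \<otimes>\<^bsub>M\<^esub> z = x \<otimes>\<^bsub>M\<^esub> z \<oplus>\<^bsub>M\<^esub> y \<otimes>\<^bsub>M\<^esub> z"
  and "z \<in> carrier M \<Longrightarrow> z \<otimes>\<^bsub>M\<^esub> (x \<oplus>\<^bsub>M\<^esub> y) = z \<otimes>\<^bsub>M\<^esub> x \<oplus>\<^bsub>M\<^esub> z \<otimes>\<^bsub>M\<^esub> y"
  and "c \<in> \<K> \<Longrightarrow> c \<odot>\<^bsub>M\<^esub> (x \<oplus>\<^bsub>M\<^esub> y) = c \<odot>\<^bsub>M\<^esub> x \<oplus>\<^bsub>M\<^esub> c \<odot>\<^bsub>M\<^esub> y"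
proof -
 interpret M: algebra K M by fact
 show "z \<in> carrier M \<Longrightarrow> (x \<oplus>\<^bsub>M\<^esub> y) \<otimes>\<^bsub>M\<^esub> z = x \<otimes>\<^bsub>M\<^esub> z \<oplus>\<^bsub>M\<^esub> y \<otimes>\<^bsub>M\<^esub> z"
  "z \<in> carrier M \<Longrightarrow> z \<otimes>\<^bsub>M\<^esub> (x \<oplus>\<^bsub>M\<^esub> y) = z \<otimes>\<^bsub>M\<^esub> x \<oplus>\<^bsub>M\<^esub> z \<otimes>\<^bsub>M\<^esub> y"
  "c \<in> \<K> \<Longrightarrow> c \<odot>\<^bsub>M\<^esub> (x \<oplus>\<^bsub>M\<^esub> y) = c \<odot>\<^bsub>M\<^esub> x \<oplus>\<^bsub>M\<^esub> c \<odot>\<^bsub>M\<^esub> y"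
  using assms by (simp_all add: M.l_distr M.r_distr M.smult_r_distr)
qed

lemma alg_add_smult:
 assumes "alg M" "c \<in> \<K>" "d \<in> \<K>" "x \<in> carrier M"
 shows "(c \<oplus> d) \<odot>\<^bsub>M\<^esub> x = c \<odot>\<^bsub>M\<^esub> x \<oplus>\<^bsub>M\<^esub> d \<odot>\<^bsub>M\<^esub> x"
proof -
 interpret M: algebra K M by fact
 show ?thesis using assms by (simp add: M.smult_l_distr)
qed

lemmas alg_distrib = alg_distrib_add alg_add_smult

lemma alg_smult:
 assumes "alg M" "c \<in> \<K>" "x \<in> carrier M"
 shows "d \<in> \<K> \<Longrightarrow> c \<odot>\<^bsub>M\<^esub> (d \<odot>\<^bsub>M\<^esub> x) = (c \<otimes> d) \<odot>\<^bsub>M\<^esub> x"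
  and "y \<in> carrier M \<Longrightarrow> (c \<odot>\<^bsub>M\<^esub> x) \<otimes>\<^bsub>M\<^esub> y = c \<odot>\<^bsub>M\<^esub> (x \<otimes>\<^bsub>M\<^esub> y)"
  and "y \<in> carrier M \<Longrightarrow> y \<otimes>\<^bsub>M\<^esub> (c \<odot>\<^bsub>M\<^esub> x) = c \<odot>\<^bsub>M\<^esub> (y \<otimes>\<^bsub>M\<^esub> x)"
proof -
 interpret M: algebra K M by fact
 show "d \<in> \<K> \<Longrightarrow> c \<odot>\<^bsub>M\<^esub> (d \<odot>\<^bsub>M\<^esub> x) = (c \<otimes> d) \<odot>\<^bsub>M\<^esub> x"
  using assms by (simp add: M.smult_assoc1)
 show 1: "(c \<odot>\<^bsub>M\<^esub> x) \<otimes>\<^bsub>M\<^esub> y = c \<odot>\<^bsub>M\<^esub> (x \<otimes>\<^bsub>M\<^esub> y)" if "y \<in> carrier M" for y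
  using assms that by (simp add: M.smult_assoc2)
 show "y \<otimes>\<^bsub>M\<^esub> (c \<odot>\<^bsub>M\<^esub> x) = c \<odot>\<^bsub>M\<^esub> (y \<otimes>\<^bsub>M\<^esub> x)" if "y \<in> carrier M"
  using 1[OF that] assms that by (metis M.m_comm M.smult_closed)
qed

lemma alg_minus:
 assumes "alg M" "x \<in> carrier M" "y \<in> carrier M"
 shows "x \<ominus>\<^bsub>M\<^esub> y = x \<oplus>\<^bsub>M\<^esub> (\<ominus> \<one>) \<odot>\<^bsub>M\<^esub> y" and "x \<ominus>\<^bsub>M\<^esub> y = \<zero>\<^bsub>M\<^esub> \<longleftrightarrow> x = y"
  and "(\<ominus> \<one>) \<odot>\<^bsub>M\<^esub> y = \<ominus>\<^bsub>M\<^esub> y"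
proof -
 interpret M: algebra K M by fact
 have "(\<ominus> \<one>) \<odot>\<^bsub>M\<^esub> y \<oplus>\<^bsub>M\<^esub> y = (\<ominus> \<one> \<oplus> \<one>) \<odot>\<^bsub>M\<^esub> y"
  using assms by (simp add: M.smult_l_distr del: l_neg)
 then have "(\<ominus> \<one>) \<odot>\<^bsub>M\<^esub> y \<oplus>\<^bsub>M\<^esub> y = \<zero>\<^bsub>M\<^esub>" using assms by (simp add: l_neg)
 then show "(\<ominus> \<one>) \<odot>\<^bsub>M\<^esub> y = \<ominus>\<^bsub>M\<^esub> y" using assms by (metis M.minus_equality M.smult_closed a_inv_closed one_closed)
 then show "x \<ominus>\<^bsub>M\<^esub> y = x \<oplus>\<^bsub>M\<^esub> (\<ominus> \<one>) \<odot>\<^bsub>M\<^esub> y" by (simp add: M.minus_eq)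
 have "(x \<ominus>\<^bsub>M\<^esub> y) \<oplus>\<^bsub>M\<^esub> y = x" using assms by (simp add: M.minus_eq M.a_assoc M.l_neg)
 then show "x \<ominus>\<^bsub>M\<^esub> y = \<zero>\<^bsub>M\<^esub> \<longleftrightarrow> x = y" using assms by (auto simp: M.minus_eq M.r_neg)
qed

lemma self_module_simps [simp]:
 "carrier (Ks) = \<K>" "add (Ks) = add K" "mult (Ks) = mult K"
 "one (Ks) = \<one>" "zero (Ks) = \<zero>" "smult (Ks) = mult K"
 by (simp_all add: self_module_def ring.defs)

lemma algebra_Ks [simp]: "alg (Ks)"
proof -
 have "cring (Ks)"
 proof (intro cringI abelian_groupI comm_monoidI)
  show "\<exists>y\<in>carrier (Ks). y \<oplus>\<^bsub>Ks\<^esub> x = \<zero>\<^bsub>Ks\<^esub>"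
   if "x \<in> carrier (Ks)" for x
   using that by (intro bexI[of _ "\<ominus> x"]) (simp_all add: l_neg)
 qed (simp_all add: a_ac m_ac l_distr r_distr)
 then show ?thesis
  by (intro algebraI) (auto simp: l_distr r_distr m_assoc is_cring)
qed

lemma finsum_self_module [simp]: "finsum (Ks) f I = ksum f I"
 by (simp add: finsum_def finprod_def)

subsection \<open>Finite sums\<close>

lemma fsum_closed [simp]:
 assumes "alg M" "\<And>i. i \<in> I \<Longrightarrow> f i \<in> carrier M"
 shows "finsum M f I \<in> carrier M"
proof -
 interpret M: algebra K M by fact
 show ?thesis using assms by (intro M.finsum_closed) auto
qed

lemma fsum_cong:
 assumes "alg M" "I = J" "\<And>i. i \<in> J \<Longrightarrow> f i = g i" "\<And>i. i \<in> J \<Longrightarrow> g i \<in> carrier M"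
 shows "finsum M f I = finsum M g J"
proof -
 interpret M: algebra K M by fact
 show ?thesis using assms by (intro M.finsum_cong') auto
qed

lemma fsum_empty [simp]:
 assumes "alg M"
 shows "finsum M f {} = \<zero>\<^bsub>M\<^esub>"
proof -
 interpret M: algebra K M by fact
 show ?thesis by simp
qed

lemma fsum_insert:
 assumes "alg M" "finite I" "i \<notin> I" "f i \<in> carrier M" "\<And>j. j \<in> I \<Longrightarrow> f j \<in> carrier M"
 shows "finsum M f (insert i I) = f i \<oplus>\<^bsub>M\<^esub> finsum M f I"
proof -
 interpret M: algebra K M by fact
 show ?thesis using assms by (intro M.finsum_insert) auto
qed

lemma fsum_add:
 assumes "alg M" "finite I" "\<And>j. j \<in> I \<Longrightarrow> f j \<in> carrier M" "\<And>j. j \<in> I \<Longrightarrow> g j \<in> carrier M"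
 shows "finsum M (\<lambda>i. f i \<oplus>\<^bsub>M\<^esub> g i) I = finsum M f I \<oplus>\<^bsub>M\<^esub> finsum M g I"
proof -
 interpret M: algebra K M by fact
 show ?thesis using assms by (intro M.finsum_addf) auto
qed

lemma fsum_zero:
 assumes "alg M" "\<And>j. j \<in> I \<Longrightarrow> f j = \<zero>\<^bsub>M\<^esub>"
 shows "finsum M f I = \<zero>\<^bsub>M\<^esub>"
proof -
 interpret M: algebra K M by fact
 show ?thesis using assms by (intro M.add.finprod_one_eqI) auto
qed

lemma fsum_mono_neutral:
 assumes "alg M" "finite J" "I \<subseteq> J" "\<And>i. i \<in> J - I \<Longrightarrow> f i = \<zero>\<^bsub>M\<^esub>" "\<And>j. j \<in> J \<Longrightarrow> f j \<in> carrier M"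
 shows "finsum M f I = finsum M f J"
proof -
 interpret M: algebra K M by fact
 show ?thesis using assms by (intro M.add.finprod_mono_neutral_cong_left) auto
qed

lemma fsum_remove:
 assumes "alg M" "finite I" "i \<in> I" "\<And>j. j \<in> I \<Longrightarrow> f j \<in> carrier M"
 shows "finsum M f I = f i \<oplus>\<^bsub>M\<^esub> finsum M f (I - {i})"
 using fsum_insert[of M "I - {i}" i f] assms by (simp add: insert_absorb)

lemma fsum_delta:
 assumes "alg M" "finite I" "i \<in> I" "\<And>j. j \<in> I \<Longrightarrow> j \<noteq> i \<Longrightarrow> f j = \<zero>\<^bsub>M\<^esub>" "f i \<in> carrier M"
 shows "finsum M f I = f i"
proof -
 have cl: "f j \<in> carrier M" if "j \<in> I" for j
  using assms that by (cases "j = i") auto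
 have "finsum M f (I - {i}) = \<zero>\<^bsub>M\<^esub>"
  using assms by (intro fsum_zero) auto
 then show ?thesis using fsum_remove[of M I i f, OF assms(1-3) cl] assms by simp
qed

definition lin :: "('k, 'v, 'n) module_scheme \<Rightarrow> ('k, 'w, 'p) module_scheme \<Rightarrow> ('v \<Rightarrow> 'w) \<Rightarrow> bool" where
 "lin M N h \<longleftrightarrow> (\<forall>x\<in>carrier M. h x \<in> carrier N) \<and>
   (\<forall>x\<in>carrier M. \<forall>y\<in>carrier M. h (x \<oplus>\<^bsub>M\<^esub> y) = h x \<oplus>\<^bsub>N\<^esub> h y) \<and>
   (\<forall>c\<in>\<K>. \<forall>x\<in>carrier M. h (c \<odot>\<^bsub>M\<^esub> x) = c \<odot>\<^bsub>N\<^esub> h x)"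

abbreviation fnl :: "('k, 'v, 'n) module_scheme \<Rightarrow> ('v \<Rightarrow> 'k) \<Rightarrow> bool" where
 "fnl M \<equiv> lin M (Ks)"

lemma linI:
 assumes "\<And>x. x \<in> carrier M \<Longrightarrow> h x \<in> carrier N"
  "\<And>x y. x \<in> carrier M \<Longrightarrow> y \<in> carrier M \<Longrightarrow> h (x \<oplus>\<^bsub>M\<^esub> y) = h x \<oplus>\<^bsub>N\<^esub> h y"
  "\<And>c x. c \<in> \<K> \<Longrightarrow> x \<in> carrier M \<Longrightarrow> h (c \<odot>\<^bsub>M\<^esub> x) = c \<odot>\<^bsub>N\<^esub> h x"
 shows "lin M N h"
 using assms by (simp add: lin_def)

lemma linD:
 assumes "lin M N h"
 shows "x \<in> carrier M \<Longrightarrow> h x \<in> carrier N"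
  "x \<in> carrier M \<Longrightarrow> y \<in> carrier M \<Longrightarrow> h (x \<oplus>\<^bsub>M\<^esub> y) = h x \<oplus>\<^bsub>N\<^esub> h y"
  "c \<in> \<K> \<Longrightarrow> x \<in> carrier M \<Longrightarrow> h (c \<odot>\<^bsub>M\<^esub> x) = c \<odot>\<^bsub>N\<^esub> h x"
 using assms by (simp_all add: lin_def)

lemma fnl_closed: "fnl M h \<Longrightarrow> x \<in> carrier M \<Longrightarrow> h x \<in> \<K>"
 using linD(1)[of M "Ks"] by simp

lemma lin_cong: "\<lbrakk>lin M N g; alg M; (\<And>x. x \<in> carrier M \<Longrightarrow> f x = g x)\<rbrakk> \<Longrightarrow> lin M N f"
 by (simp add: lin_def)

lemma lin_zero [simp]:
 assumes "lin M N h" "alg M" "alg N"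
 shows "h \<zero>\<^bsub>M\<^esub> = \<zero>\<^bsub>N\<^esub>"
 using linD(3)[OF assms(1), of \<zero> "\<zero>\<^bsub>M\<^esub>"] assms linD(1)[OF assms(1), of "\<zero>\<^bsub>M\<^esub>"] by simp

lemma lin_minus:
 assumes "lin M N h" "alg M" "alg N" "x \<in> carrier M" "y \<in> carrier M"
 shows "h (x \<ominus>\<^bsub>M\<^esub> y) = h x \<ominus>\<^bsub>N\<^esub> h y"
 using assms linD[OF assms(1)] by (simp add: alg_minus(1))

lemma lin_fsum:
 assumes "lin M N h" "alg M" "alg N" "finite I" "\<And>i. i \<in> I \<Longrightarrow> f i \<in> carrier M"
 shows "h (finsum M f I) = finsum N (\<lambda>i. h (f i)) I"
 using assms(4,5)
proof (induction I)
 case empty then show ?case using assms(1-3) by simp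
next
 case (insert i I)
 then show ?case using assms(1-3) linD[OF assms(1)] by (simp add: fsum_insert)
qed

lemma lin_comp: "lin M N f \<Longrightarrow> lin N L g \<Longrightarrow> lin M L (\<lambda>x. g (f x))"
 by (simp add: lin_def)

lemma lin_add: "\<lbrakk>alg N; lin M N f; lin M N g\<rbrakk> \<Longrightarrow> lin M N (\<lambda>x. f x \<oplus>\<^bsub>N\<^esub> g x)"
 by (simp add: lin_def alg_add_ac alg_distrib)

lemma lin_smult: "\<lbrakk>alg N; c \<in> \<K>; lin M N f\<rbrakk> \<Longrightarrow> lin M N (\<lambda>x. c \<odot>\<^bsub>N\<^esub> f x)"
 by (simp add: lin_def alg_distrib alg_smult m_comm)

lemma lin_smult_left: "\<lbrakk>alg N; y \<in> carrier N; fnl M f\<rbrakk> \<Longrightarrow> lin M N (\<lambda>x. f x \<odot>\<^bsub>N\<^esub> y)"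
 by (simp add: lin_def alg_distrib alg_smult)

lemma lin_mult_left: "\<lbrakk>alg N; y \<in> carrier N; lin M N f\<rbrakk> \<Longrightarrow> lin M N (\<lambda>x. f x \<otimes>\<^bsub>N\<^esub> y)"
 by (simp add: lin_def alg_distrib alg_smult)

lemma lin_mult_right: "\<lbrakk>alg N; y \<in> carrier N; lin M N f\<rbrakk> \<Longrightarrow> lin M N (\<lambda>x. y \<otimes>\<^bsub>N\<^esub> f x)"
 by (simp add: lin_def alg_distrib alg_smult)

lemma lin_zero_map: "alg N \<Longrightarrow> lin M N (\<lambda>x. \<zero>\<^bsub>N\<^esub>)"
 by (simp add: lin_def)

lemma lin_id [simp]: "lin M M (\<lambda>x. x)"
 by (simp add: lin_def)

lemma fsum_smult:
 assumes "alg M" "finite I" "c \<in> \<K>" "\<And>i. i \<in> I \<Longrightarrow> f i \<in> carrier M"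
 shows "c \<odot>\<^bsub>M\<^esub> finsum M f I = finsum M (\<lambda>i. c \<odot>\<^bsub>M\<^esub> f i) I"
 using lin_fsum[OF lin_smult[OF assms(1) assms(3) lin_id], of I f] assms by simp

lemma fsum_mult_left:
 assumes "alg M" "finite I" "x \<in> carrier M" "\<And>i. i \<in> I \<Longrightarrow> f i \<in> carrier M"
 shows "finsum M f I \<otimes>\<^bsub>M\<^esub> x = finsum M (\<lambda>i. f i \<otimes>\<^bsub>M\<^esub> x) I"
 using lin_fsum[OF lin_mult_left[OF assms(1) assms(3) lin_id], of I f] assms by simp

lemma fsum_mult_right:
 assumes "alg M" "finite I" "x \<in> carrier M" "\<And>i. i \<in> I \<Longrightarrow> f i \<in> carrier M"
 shows "x \<otimes>\<^bsub>M\<^esub> finsum M f I = finsum M (\<lambda>i. x \<otimes>\<^bsub>M\<^esub> f i) I"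
 using lin_fsum[OF lin_mult_right[OF assms(1) assms(3) lin_id], of I f] assms by simp

lemma fsum_swap:
 assumes M: "alg M" and "finite I" "finite J" "\<And>i j. i \<in> I \<Longrightarrow> j \<in> J \<Longrightarrow> f i j \<in> carrier M"
 shows "finsum M (\<lambda>i. finsum M (f i) J) I = finsum M (\<lambda>j. finsum M (\<lambda>i. f i j) I) J"
 using assms(2,4)
proof (induction I)
 case empty then show ?case using M by (simp add: fsum_zero)
next
 case (insert i I)
 have "finsum M (\<lambda>j. finsum M (\<lambda>i. f i j) (insert i I)) J
   = finsum M (\<lambda>j. f i j \<oplus>\<^bsub>M\<^esub> finsum M (\<lambda>i. f i j) I) J"
  using insert M by (intro fsum_cong) (simp_all add: fsum_insert)
 also have "\<dots> = finsum M (f i) J \<oplus>\<^bsub>M\<^esub> finsum M (\<lambda>j. finsum M (\<lambda>i. f i j) I) J"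
  using insert M assms(3) by (simp add: fsum_add)
 finally show ?case using insert M by (simp add: fsum_insert)
qed

lemma fsum_product:
 assumes M: "alg M" and "finite I" "finite J" "\<And>i j. i \<in> I \<Longrightarrow> j \<in> J \<Longrightarrow> f i j \<in> carrier M"
 shows "finsum M (\<lambda>i. finsum M (f i) J) I = finsum M (\<lambda>p. f (fst p) (snd p)) (I \<times> J)"
 using assms(2,4)
proof (induction I)
 case empty then show ?case using M by simp
next
 case (insert i I)
 interpret M: algebra K M by fact
 have "finsum M (\<lambda>p. f (fst p) (snd p)) (insert i I \<times> J)
   = finsum M (\<lambda>p. f (fst p) (snd p)) (Pair i ` J \<union> I \<times> J)"
  by (rule arg_cong[where f="finsum M _"]) auto
 also have "\<dots> = finsum M (\<lambda>p. f (fst p) (snd p)) (Pair i ` J) \<oplus>\<^bsub>M\<^esub> finsum M (\<lambda>p. f (fst p) (snd p)) (I \<times> J)"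
  using insert assms(3) by (intro M.finsum_Un_disjoint) auto
 also have "finsum M (\<lambda>p. f (fst p) (snd p)) (Pair i ` J) = finsum M (f i) J"
  using insert by (subst M.finsum_reindex) (auto simp: inj_on_def)
 finally show ?case using insert M by (simp add: fsum_insert)
qed

subsection \<open>Monoid algebras\<close>

abbreviation supp :: "('x \<Rightarrow> 'k) \<Rightarrow> 'x set" where "supp \<phi> \<equiv> {x. \<phi> x \<noteq> \<zero>}"

lemma mon_simps:
 "\<phi> \<in> carrier (mon P) \<longleftrightarrow>
   finite (supp \<phi>) \<and> (\<forall>x. \<phi> x \<in> \<K>) \<and> supp \<phi> \<subseteq> carrier P"
 "zero (mon P) = (\<lambda>_. \<zero>)"
 "one (mon P) = single K \<one>\<^bsub>P\<^esub>"
 "add (mon P) \<phi> \<chi> = (\<lambda>z. \<phi> z \<oplus> \<chi> z)"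
 "smult (mon P) c \<phi> = (\<lambda>z. c \<otimes> \<phi> z)"
 by (auto simp: monoid_algebra_def single_def)

lemma single_carrier: "x \<in> carrier P \<Longrightarrow> single K x \<in> carrier (mon P)"
 by (auto simp: mon_simps single_def)

lemma monoid_algebra_closed:
 assumes "\<phi> \<in> carrier (mon P)" "\<chi> \<in> carrier (mon P)"
 shows "(\<lambda>z. \<phi> z \<oplus> \<chi> z) \<in> carrier (mon P)"
  and "c \<in> \<K> \<Longrightarrow> (\<lambda>z. c \<otimes> \<phi> z) \<in> carrier (mon P)"
  and "(\<lambda>_. \<zero>) \<in> carrier (mon P)"
proof -
 have "supp (\<lambda>z. \<phi> z \<oplus> \<chi> z) \<subseteq> supp \<phi> \<union> supp \<chi>" by auto
 then show "(\<lambda>z. \<phi> z \<oplus> \<chi> z) \<in> carrier (mon P)"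
  using assms unfolding mon_simps by (meson a_closed finite_UnI finite_subset le_sup_iff order_trans)
 have "supp (\<lambda>z. c \<otimes> \<phi> z) \<subseteq> supp \<phi>" if "c \<in> \<K>"
  using that by auto
 then show "c \<in> \<K> \<Longrightarrow> (\<lambda>z. c \<otimes> \<phi> z) \<in> carrier (mon P)"
  using assms unfolding mon_simps by (meson finite_subset m_closed order_trans)
 show "(\<lambda>_. \<zero>) \<in> carrier (mon P)" by (simp add: mon_simps)
qed

lemma monoid_algebra_induct [consumes 1, case_names zero add single]:
 assumes "\<phi> \<in> carrier (mon P)"
  and zero: "Q (\<lambda>_. \<zero>)"
  and add: "\<And>\<phi> \<chi>. \<lbrakk>\<phi> \<in> carrier (mon P); \<chi> \<in> carrier (mon P); Q \<phi>; Q \<chi>\<rbrakk> \<Longrightarrow>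
   Q (\<lambda>z. \<phi> z \<oplus> \<chi> z)"
  and single: "\<And>c x. c \<in> \<K> \<Longrightarrow> x \<in> carrier P \<Longrightarrow> Q (\<lambda>z. c \<otimes> single K x z)"
 shows "Q \<phi>"
 using assms(1)
proof (induction "card (supp \<phi>)" arbitrary: \<phi>)
 case 0
 then have "\<phi> = (\<lambda>_. \<zero>)" by (auto simp: mon_simps)
 then show ?case using zero by simp
next
 case (Suc n)
 then obtain x where x: "x \<in> supp \<phi>" by (metis all_not_in_conv card.empty nat.distinct(1))
 let ?\<chi> = "\<phi>(x := \<zero>)"
 have s: "supp ?\<chi> = supp \<phi> - {x}" by auto
 have *: "finite (supp \<phi>)" "\<And>y. \<phi> y \<in> \<K>" "supp \<phi> \<subseteq> carrier P"
  using Suc.prems by (auto simp: mon_simps)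
 have "?\<chi> \<in> carrier (mon P)"
  unfolding mon_simps s using * by auto
 moreover have "n = card (supp ?\<chi>)" unfolding s using Suc.hyps(2) x * by simp
 ultimately have "Q ?\<chi>" using Suc.hyps(1) by blast
 moreover have "Q (\<lambda>z. \<phi> x \<otimes> single K x z)" using single x * by auto
 ultimately have "Q (\<lambda>z. \<phi> x \<otimes> single K x z \<oplus> ?\<chi> z)"
  using add \<open>?\<chi> \<in> carrier (mon P)\<close> single_carrier[of x P] x *
   monoid_algebra_closed(2)[of "single K x" P "single K x" "\<phi> x"] by blast
 moreover have "(\<lambda>z. \<phi> x \<otimes> single K x z \<oplus> ?\<chi> z) = \<phi>"
  using * by (auto simp: single_def fun_eq_iff)
 ultimately show ?case by simp
qed

lemma monoid_algebra_mult:
 assumes "\<phi> \<in> carrier (mon P)" "\<chi> \<in> carrier (mon P)"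
  and "finite A" "finite B" "supp \<phi> \<subseteq> A" "supp \<chi> \<subseteq> B"
 shows "(\<phi> \<otimes>\<^bsub>mon P\<^esub> \<chi>) z =
  ksum (\<lambda>p. if fst p \<otimes>\<^bsub>P\<^esub> snd p = z then \<phi> (fst p) \<otimes> \<chi> (snd p) else \<zero>) (A \<times> B)"
proof -
 let ?f = "\<lambda>p. if fst p \<otimes>\<^bsub>P\<^esub> snd p = z then \<phi> (fst p) \<otimes> \<chi> (snd p) else \<zero>"
 let ?S = "{(x, y). \<phi> x \<noteq> \<zero> \<and> \<chi> y \<noteq> \<zero> \<and> x \<otimes>\<^bsub>P\<^esub> y = z}"
 have *: "\<And>y. \<phi> y \<in> \<K>" "\<And>y. \<chi> y \<in> \<K>"
  using assms(1,2) by (auto simp: mon_simps)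
 have "(\<phi> \<otimes>\<^bsub>mon P\<^esub> \<chi>) z = ksum (\<lambda>(x, y). \<phi> x \<otimes> \<chi> y) ?S"
  by (simp add: monoid_algebra_def)
 also have "\<dots> = ksum ?f ?S"
  using * by (intro finsum_cong') (auto split: prod.splits)
 also have "\<dots> = ksum ?f (A \<times> B)"
  using assms * by (intro fsum_mono_neutral[of "Ks", simplified]) auto
 finally show ?thesis .
qed

lemma monoid_algebra_mult_closed:
 assumes P: "Group.comm_monoid P"
  and "\<phi> \<in> carrier (mon P)" "\<chi> \<in> carrier (mon P)"
 shows "\<phi> \<otimes>\<^bsub>mon P\<^esub> \<chi> \<in> carrier (mon P)"
proof -
 interpret P: Group.comm_monoid P by fact
 have *: "\<And>y. \<phi> y \<in> \<K>" "\<And>y. \<chi> y \<in> \<K>" "finite (supp \<phi>)" "finite (supp \<chi>)"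
  "supp \<phi> \<subseteq> carrier P" "supp \<chi> \<subseteq> carrier P"
  using assms(2,3) by (auto simp: mon_simps)
 note m = monoid_algebra_mult[OF assms(2,3) *(3,4) subset_refl subset_refl]
 have s: "supp (\<phi> \<otimes>\<^bsub>mon P\<^esub> \<chi>) \<subseteq> (\<lambda>p. fst p \<otimes>\<^bsub>P\<^esub> snd p) ` (supp \<phi> \<times> supp \<chi>)"
 proof
  fix z assume "z \<in> supp (\<phi> \<otimes>\<^bsub>mon P\<^esub> \<chi>)"
  moreover have "(\<phi> \<otimes>\<^bsub>mon P\<^esub> \<chi>) z = \<zero>"
   if "\<not> (\<exists>p\<in>supp \<phi> \<times> supp \<chi>. fst p \<otimes>\<^bsub>P\<^esub> snd p = z)"
   unfolding m by (rule fsum_zero[of "Ks", simplified]) (use that in force)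
  ultimately have "\<exists>p\<in>supp \<phi> \<times> supp \<chi>. fst p \<otimes>\<^bsub>P\<^esub> snd p = z" by blast
  then show "z \<in> (\<lambda>p. fst p \<otimes>\<^bsub>P\<^esub> snd p) ` (supp \<phi> \<times> supp \<chi>)" by blast
 qed
 show ?thesis unfolding mon_simps
 proof (intro conjI allI)
  show "finite (supp (\<phi> \<otimes>\<^bsub>mon P\<^esub> \<chi>))" using s * finite_subset by fastforce
  show "supp (\<phi> \<otimes>\<^bsub>mon P\<^esub> \<chi>) \<subseteq> carrier P" using s *(5,6) by force
  show "(\<phi> \<otimes>\<^bsub>mon P\<^esub> \<chi>) z \<in> \<K>" for z unfolding m using * by (intro finsum_closed) auto
 qed
qed

lemma monoid_algebra_mult_comm:
 assumes P: "Group.comm_monoid P"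
  and "\<phi> \<in> carrier (mon P)" "\<chi> \<in> carrier (mon P)"
 shows "\<phi> \<otimes>\<^bsub>mon P\<^esub> \<chi> = \<chi> \<otimes>\<^bsub>mon P\<^esub> \<phi>"
proof
 fix z
 interpret P: Group.comm_monoid P by fact
 have *: "\<And>y. \<phi> y \<in> \<K>" "\<And>y. \<chi> y \<in> \<K>" "finite (supp \<phi>)" "finite (supp \<chi>)"
  "supp \<phi> \<subseteq> carrier P" "supp \<chi> \<subseteq> carrier P"
  using assms(2,3) by (auto simp: mon_simps)
 let ?f = "\<lambda>p. if fst p \<otimes>\<^bsub>P\<^esub> snd p = z then \<phi> (fst p) \<otimes> \<chi> (snd p) else \<zero>"
 let ?g = "\<lambda>p. if fst p \<otimes>\<^bsub>P\<^esub> snd p = z then \<chi> (fst p) \<otimes> \<phi> (snd p) else \<zero>"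
 have eq: "y \<otimes>\<^bsub>P\<^esub> x = x \<otimes>\<^bsub>P\<^esub> y" if "\<chi> x \<noteq> \<zero>" "\<phi> y \<noteq> \<zero>" for x y
  using that *(5,6) by (intro P.m_comm) auto
 have "ksum ?f (supp \<phi> \<times> supp \<chi>) = ksum ?f (prod.swap ` (supp \<chi> \<times> supp \<phi>))"
  by (simp add: product_swap)
 also have "\<dots> = ksum (\<lambda>p. ?f (prod.swap p)) (supp \<chi> \<times> supp \<phi>)"
  using * by (intro finsum_reindex) auto
 also have "\<dots> = ksum ?g (supp \<chi> \<times> supp \<phi>)"
  using * by (intro finsum_cong') (auto simp: eq m_comm)
 finally show "(\<phi> \<otimes>\<^bsub>mon P\<^esub> \<chi>) z = (\<chi> \<otimes>\<^bsub>mon P\<^esub> \<phi>) z"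
  by (simp add: monoid_algebra_mult[OF assms(2,3) *(3,4) subset_refl subset_refl]
    monoid_algebra_mult[OF assms(3,2) *(4,3) subset_refl subset_refl])
qed

lemma monoid_algebra_mult_lin:
 assumes P: "Group.comm_monoid P" and \<chi>: "\<chi> \<in> carrier (mon P)"
 shows "lin (mon P) (mon P) (\<lambda>\<phi>. \<phi> \<otimes>\<^bsub>mon P\<^esub> \<chi>)"
proof (rule linI)
 fix \<phi> assume \<phi>: "\<phi> \<in> carrier (mon P)"
 then show "\<phi> \<otimes>\<^bsub>mon P\<^esub> \<chi> \<in> carrier (mon P)"
  by (rule monoid_algebra_mult_closed[OF P _ \<chi>])
 have *: "\<And>y. \<phi> y \<in> \<K>" "\<And>y. \<chi> y \<in> \<K>" "finite (supp \<phi>)" "finite (supp \<chi>)"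
  using \<phi> \<chi> by (auto simp: mon_simps)
 { fix \<phi>' assume \<phi>': "\<phi>' \<in> carrier (mon P)"
  have **: "\<And>y. \<phi>' y \<in> \<K>" "finite (supp \<phi>')"
   using \<phi>' by (auto simp: mon_simps)
  let ?A = "supp \<phi> \<union> supp \<phi>'"
  have f: "finite ?A" using * ** by simp
  let ?f = "\<lambda>z \<phi> p. if fst p \<otimes>\<^bsub>P\<^esub> snd p = z then \<phi> (fst p) \<otimes> \<chi> (snd p) else \<zero>"
  have "((\<lambda>z. \<phi> z \<oplus> \<phi>' z) \<otimes>\<^bsub>mon P\<^esub> \<chi>) z = (\<phi> \<otimes>\<^bsub>mon P\<^esub> \<chi>) z \<oplus> (\<phi>' \<otimes>\<^bsub>mon P\<^esub> \<chi>) z" for z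
  proof -
   have "((\<lambda>z. \<phi> z \<oplus> \<phi>' z) \<otimes>\<^bsub>mon P\<^esub> \<chi>) z = ksum (?f z (\<lambda>z. \<phi> z \<oplus> \<phi>' z)) (?A \<times> supp \<chi>)"
    using monoid_algebra_closed(1)[OF \<phi> \<phi>'] \<chi> f * by (intro monoid_algebra_mult) auto
   also have "\<dots> = ksum (\<lambda>p. ?f z \<phi> p \<oplus> ?f z \<phi>' p) (?A \<times> supp \<chi>)"
    using * ** by (intro finsum_cong') (auto simp: l_distr)
   also have "\<dots> = ksum (?f z \<phi>) (?A \<times> supp \<chi>) \<oplus> ksum (?f z \<phi>') (?A \<times> supp \<chi>)"
    using * ** f by (intro finsum_addf) auto
   also have "ksum (?f z \<phi>) (?A \<times> supp \<chi>) = (\<phi> \<otimes>\<^bsub>mon P\<^esub> \<chi>) z"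
    using \<phi> \<chi> f * by (intro monoid_algebra_mult[symmetric]) auto
   also have "ksum (?f z \<phi>') (?A \<times> supp \<chi>) = (\<phi>' \<otimes>\<^bsub>mon P\<^esub> \<chi>) z"
    using \<phi>' \<chi> f * by (intro monoid_algebra_mult[symmetric]) auto
   finally show ?thesis .
  qed
  then show "(\<phi> \<oplus>\<^bsub>mon P\<^esub> \<phi>') \<otimes>\<^bsub>mon P\<^esub> \<chi> =
    \<phi> \<otimes>\<^bsub>mon P\<^esub> \<chi> \<oplus>\<^bsub>mon P\<^esub> \<phi>' \<otimes>\<^bsub>mon P\<^esub> \<chi>"
   by (auto simp: mon_simps(4))
 }
 fix c assume c: "c \<in> \<K>"
 let ?f = "\<lambda>z \<phi> p. if fst p \<otimes>\<^bsub>P\<^esub> snd p = z then \<phi> (fst p) \<otimes> \<chi> (snd p) else \<zero>"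
 have "((\<lambda>z. c \<otimes> \<phi> z) \<otimes>\<^bsub>mon P\<^esub> \<chi>) z = c \<otimes> (\<phi> \<otimes>\<^bsub>mon P\<^esub> \<chi>) z" for z
 proof -
  have "((\<lambda>z. c \<otimes> \<phi> z) \<otimes>\<^bsub>mon P\<^esub> \<chi>) z = ksum (?f z (\<lambda>z. c \<otimes> \<phi> z)) (supp \<phi> \<times> supp \<chi>)"
   using monoid_algebra_closed(2)[OF \<phi> \<phi> c] \<chi> c * by (intro monoid_algebra_mult) auto
  also have "\<dots> = ksum (\<lambda>p. c \<otimes> ?f z \<phi> p) (supp \<phi> \<times> supp \<chi>)"
   using * c by (intro finsum_cong') (auto simp: m_assoc)
  also have "\<dots> = c \<otimes> ksum (?f z \<phi>) (supp \<phi> \<times> supp \<chi>)"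
   using * c by (intro finsum_rdistr[symmetric]) auto
  also have "ksum (?f z \<phi>) (supp \<phi> \<times> supp \<chi>) = (\<phi> \<otimes>\<^bsub>mon P\<^esub> \<chi>) z"
    using \<phi> \<chi> * by (intro monoid_algebra_mult[symmetric]) auto
  finally show ?thesis .
 qed
 then show "(c \<odot>\<^bsub>mon P\<^esub> \<phi>) \<otimes>\<^bsub>mon P\<^esub> \<chi> =
    c \<odot>\<^bsub>mon P\<^esub> (\<phi> \<otimes>\<^bsub>mon P\<^esub> \<chi>)"
  by (auto simp: mon_simps(5))
qed

lemma single_mult:
 assumes P: "Group.comm_monoid P" and "x \<in> carrier P" "y \<in> carrier P"
 shows "single K x \<otimes>\<^bsub>mon P\<^esub> single K y = single K (x \<otimes>\<^bsub>P\<^esub> y)"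
proof
 fix z
 have "(single K x \<otimes>\<^bsub>mon P\<^esub> single K y) z =
  ksum (\<lambda>p. if fst p \<otimes>\<^bsub>P\<^esub> snd p = z then single K x (fst p) \<otimes> single K y (snd p) else \<zero>) ({x} \<times> {y})"
  by (rule monoid_algebra_mult) (auto simp: single_carrier assms, auto simp: single_def split: if_splits)
 then show "(single K x \<otimes>\<^bsub>mon P\<^esub> single K y) z = single K (x \<otimes>\<^bsub>P\<^esub> y) z"
  by (simp add: single_def finsum_insert)
qed

lemma monoid_algebra_ext:
 assumes f: "lin (mon P) W f" and g: "lin (mon P) W g"
  and z: "\<And>w. w \<in> carrier W \<Longrightarrow> \<zero> \<odot>\<^bsub>W\<^esub> w = \<zero>\<^bsub>W\<^esub>"
  and eq: "\<And>x. x \<in> carrier P \<Longrightarrow> f (single K x) = g (single K x)"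
  and \<phi>: "\<phi> \<in> carrier (mon P)"
 shows "f \<phi> = g \<phi>"
 using \<phi>
proof (induction rule: monoid_algebra_induct)
 case zero
 have m: "(\<lambda>_. \<zero>) \<in> carrier (mon P)" by (simp add: mon_simps)
 then show ?case
  using linD(3)[OF f, of \<zero> "\<lambda>_. \<zero>"] linD(3)[OF g, of \<zero> "\<lambda>_. \<zero>"] z linD(1)[OF f m] linD(1)[OF g m]
  by (simp add: mon_simps(5))
next
 case (add \<phi> \<chi>)
 then show ?case
  using linD(2)[OF f, of \<phi> \<chi>] linD(2)[OF g, of \<phi> \<chi>] by (simp add: mon_simps(4))
next
 case (single c x)
 then show ?case
  using linD(3)[OF f, of c "single K x"] linD(3)[OF g, of c "single K x"] eq[of x]
  by (simp add: mon_simps(5) single_carrier)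
qed

lemma algebra_monoid_algebra:
 assumes P: "Group.comm_monoid P"
 shows "alg (mon P)" (is "alg ?A")
proof -
 interpret P: Group.comm_monoid P by fact
 note s = mon_simps and cl = monoid_algebra_closed and L = monoid_algebra_mult_lin[OF P]
 have R: "lin ?A ?A (\<lambda>\<phi>. \<chi> \<otimes>\<^bsub>?A\<^esub> \<phi>)" if "\<chi> \<in> carrier ?A" for \<chi>
 proof -
  have c: "\<chi> \<otimes>\<^bsub>?A\<^esub> \<phi> = \<phi> \<otimes>\<^bsub>?A\<^esub> \<chi>" if "\<phi> \<in> carrier ?A" for \<phi>
   by (rule monoid_algebra_mult_comm[OF P \<open>\<chi> \<in> carrier ?A\<close> that])
  have a: "x \<oplus>\<^bsub>?A\<^esub> y \<in> carrier ?A" if "x \<in> carrier ?A" "y \<in> carrier ?A" for x y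
   unfolding s(4) by (rule cl(1)[OF that])
  have m: "d \<odot>\<^bsub>?A\<^esub> x \<in> carrier ?A" if "d \<in> \<K>" "x \<in> carrier ?A" for d x
   unfolding s(5) by (rule cl(2)[OF that(2,2,1)])
  show ?thesis
   using linD[OF L[OF that]] by (intro linI) (simp_all only: c a m)
 qed
 have z: "\<zero> \<odot>\<^bsub>?A\<^esub> w = \<zero>\<^bsub>?A\<^esub>" if "w \<in> carrier ?A" for w
  using that by (auto simp: s)
 have ab: "abelian_group ?A"
 proof (rule abelian_groupI)
  fix x assume "x \<in> carrier ?A"
  then have "(\<lambda>z. (\<ominus> \<one>) \<otimes> x z) \<in> carrier ?A" "\<And>z. x z \<in> \<K>"
   using cl(2)[of x P x "\<ominus> \<one>"] s(1)[of x P] by simp_all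
  moreover have "(\<lambda>z. ((\<ominus> \<one>) \<otimes> x z) \<oplus> x z) = (\<lambda>z. \<zero>)"
   using \<open>\<And>z. x z \<in> \<K>\<close> by (simp add: l_minus l_neg)
  ultimately show "\<exists>y\<in>carrier ?A. y \<oplus>\<^bsub>?A\<^esub> x = \<zero>\<^bsub>?A\<^esub>"
   unfolding s(2,4) by (intro bexI[of _ "\<lambda>z. (\<ominus> \<one>) \<otimes> x z"])
 qed (simp_all add: s(2,4) cl, simp_all add: s(1) a_ac)
 have assoc: "(x \<otimes>\<^bsub>?A\<^esub> y) \<otimes>\<^bsub>?A\<^esub> w = x \<otimes>\<^bsub>?A\<^esub> (y \<otimes>\<^bsub>?A\<^esub> w)"
  if "x \<in> carrier ?A" "y \<in> carrier ?A" "w \<in> carrier ?A" for x y w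
 proof (rule monoid_algebra_ext[of P ?A "\<lambda>x. (x \<otimes>\<^bsub>?A\<^esub> y) \<otimes>\<^bsub>?A\<^esub> w" "\<lambda>x. x \<otimes>\<^bsub>?A\<^esub> (y \<otimes>\<^bsub>?A\<^esub> w)", OF _ _ z])
  show "lin ?A ?A (\<lambda>x. (x \<otimes>\<^bsub>?A\<^esub> y) \<otimes>\<^bsub>?A\<^esub> w)" using lin_comp[OF L L] that by blast
  show "lin ?A ?A (\<lambda>x. x \<otimes>\<^bsub>?A\<^esub> (y \<otimes>\<^bsub>?A\<^esub> w))"
   using L[OF monoid_algebra_mult_closed[OF P]] that by blast
  fix a assume a: "a \<in> carrier P"
  then have a': "single K a \<in> carrier ?A" by (rule single_carrier)
  show "(single K a \<otimes>\<^bsub>?A\<^esub> y) \<otimes>\<^bsub>?A\<^esub> w = single K a \<otimes>\<^bsub>?A\<^esub> (y \<otimes>\<^bsub>?A\<^esub> w)"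
  proof (rule monoid_algebra_ext[of P ?A "\<lambda>y. (single K a \<otimes>\<^bsub>?A\<^esub> y) \<otimes>\<^bsub>?A\<^esub> w" "\<lambda>y. single K a \<otimes>\<^bsub>?A\<^esub> (y \<otimes>\<^bsub>?A\<^esub> w)", OF _ _ z])
   show "lin ?A ?A (\<lambda>y. (single K a \<otimes>\<^bsub>?A\<^esub> y) \<otimes>\<^bsub>?A\<^esub> w)"
    using lin_comp[OF R L] that a' by blast
   show "lin ?A ?A (\<lambda>y. single K a \<otimes>\<^bsub>?A\<^esub> (y \<otimes>\<^bsub>?A\<^esub> w))"
    using lin_comp[OF L R] that a' by blast
   fix b assume b: "b \<in> carrier P"
   then have b': "single K b \<in> carrier ?A" by (rule single_carrier)
   show "(single K a \<otimes>\<^bsub>?A\<^esub> single K b) \<otimes>\<^bsub>?A\<^esub> w = single K a \<otimes>\<^bsub>?A\<^esub> (single K b \<otimes>\<^bsub>?A\<^esub> w)"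
   proof (rule monoid_algebra_ext[of P ?A "\<lambda>w. (single K a \<otimes>\<^bsub>?A\<^esub> single K b) \<otimes>\<^bsub>?A\<^esub> w" "\<lambda>w. single K a \<otimes>\<^bsub>?A\<^esub> (single K b \<otimes>\<^bsub>?A\<^esub> w)", OF _ _ z])
    show "lin ?A ?A (\<lambda>w. (single K a \<otimes>\<^bsub>?A\<^esub> single K b) \<otimes>\<^bsub>?A\<^esub> w)"
     using R[OF monoid_algebra_mult_closed[OF P]] a' b' by blast
    show "lin ?A ?A (\<lambda>w. single K a \<otimes>\<^bsub>?A\<^esub> (single K b \<otimes>\<^bsub>?A\<^esub> w))"
     using lin_comp[OF R R] a' b' by blast
    fix c assume c: "c \<in> carrier P"
    then show "(single K a \<otimes>\<^bsub>?A\<^esub> single K b) \<otimes>\<^bsub>?A\<^esub> single K c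
     = single K a \<otimes>\<^bsub>?A\<^esub> (single K b \<otimes>\<^bsub>?A\<^esub> single K c)"
     using a b by (simp add: single_mult[OF P] P.m_assoc)
   qed (use that in auto)
  qed (use that in auto)
 qed (use that in auto)
 have one: "\<one>\<^bsub>?A\<^esub> \<otimes>\<^bsub>?A\<^esub> x = x" if "x \<in> carrier ?A" for x
 proof (rule monoid_algebra_ext[of P ?A "\<lambda>x. \<one>\<^bsub>?A\<^esub> \<otimes>\<^bsub>?A\<^esub> x" "\<lambda>x. x", OF _ _ z])
  show "lin ?A ?A (\<lambda>x. \<one>\<^bsub>?A\<^esub> \<otimes>\<^bsub>?A\<^esub> x)" using R single_carrier[OF P.one_closed] by (simp add: s(3))
  show "\<one>\<^bsub>?A\<^esub> \<otimes>\<^bsub>?A\<^esub> single K x = single K x" if "x \<in> carrier P" for x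
   using that by (simp add: s(3) single_mult[OF P])
 qed (use that in auto)
 have "cring ?A"
 proof (intro cringI ab comm_monoidI)
  show "\<one>\<^bsub>?A\<^esub> \<in> carrier ?A" by (simp add: s(3) single_carrier)
  show "(x \<oplus>\<^bsub>?A\<^esub> y) \<otimes>\<^bsub>?A\<^esub> w = x \<otimes>\<^bsub>?A\<^esub> w \<oplus>\<^bsub>?A\<^esub> y \<otimes>\<^bsub>?A\<^esub> w"
   if "x \<in> carrier ?A" "y \<in> carrier ?A" "w \<in> carrier ?A" for x y w
   using linD(2)[OF L[OF that(3)]] that by simp
 qed (use assoc one monoid_algebra_mult_closed[OF P] monoid_algebra_mult_comm[OF P] in auto)
 then show ?thesis
 proof (rule algebraI[OF is_cring])
  show "(a \<odot>\<^bsub>?A\<^esub> x) \<otimes>\<^bsub>?A\<^esub> y = a \<odot>\<^bsub>?A\<^esub> (x \<otimes>\<^bsub>?A\<^esub> y)"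
   if "a \<in> \<K>" "x \<in> carrier ?A" "y \<in> carrier ?A" for a x y
   using linD(3)[OF L[OF that(3)]] that by simp
 qed (simp_all add: s(4,5) cl(2), simp_all add: s(1) l_distr r_distr m_assoc)
qed

section \<open>Tensor products of algebras\<close>

abbreviation RD :: "('k, 'v, 'n) module_scheme list \<Rightarrow> 'v list set" where
 "RD Ms \<equiv> carrier (RDirProd_list Ms)"

abbreviation algs :: "('k, 'v, 'n) module_scheme list \<Rightarrow> bool" where
 "algs Ms \<equiv> \<forall>M\<in>set Ms. alg M"

lemma RD_Cons [simp]: "x # xs \<in> RD (M # Ms) \<longleftrightarrow> x \<in> carrier M \<and> xs \<in> RD Ms"
 by (auto simp: RDirProd_list_carrier)

lemma RD_ConsE:
 assumes "xs \<in> RD (M # Ms)"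
 obtains y ys where "xs = y # ys" "y \<in> carrier M" "ys \<in> RD Ms"
 using assms by (auto simp: RDirProd_list_carrier)

lemma RD_length: "xs \<in> RD Ms \<Longrightarrow> length xs = length Ms"
 by (rule RDirProd_list_carrier_mem(1))

lemma RD_nth: "xs \<in> RD Ms \<Longrightarrow> l < length Ms \<Longrightarrow> xs ! l \<in> carrier (Ms ! l)"
 by (rule RDirProd_list_carrier_mem(2))

lemma RD_append: "length xs = length Ms \<Longrightarrow> xs @ ys \<in> RD (Ms @ Ns) \<longleftrightarrow> xs \<in> RD Ms \<and> ys \<in> RD Ns"
 by (induction xs Ms rule: list_induct2) auto

lemma RD_appendE:
 assumes "zs \<in> RD (Ms @ Ns)"
 obtains xs ys where "zs = xs @ ys" "length xs = length Ms" "xs \<in> RD Ms" "ys \<in> RD Ns"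
proof
 show "zs = take (length Ms) zs @ drop (length Ms) zs" by simp
 show l: "length (take (length Ms) zs) = length Ms" using RD_length[OF assms] by simp
 show "take (length Ms) zs \<in> RD Ms" "drop (length Ms) zs \<in> RD Ns"
  using RD_append[OF l, of "drop (length Ms) zs" Ns] assms by auto
qed

lemma RD_append' [simp]: "xs \<in> RD Ms \<Longrightarrow> ys \<in> RD Ns \<Longrightarrow> xs @ ys \<in> RD (Ms @ Ns)"
 using RD_append[OF RD_length] by blast

lemma RD_update: "\<lbrakk>xs \<in> RD Ms; l < length Ms; x \<in> carrier (Ms ! l)\<rbrakk> \<Longrightarrow> xs[l := x] \<in> RD Ms"
proof (induction Ms arbitrary: xs l)
 case (Cons M Ms)
 then show ?case by (cases l) (auto elim!: RD_ConsE)
qed simp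

lemma RD_mult_Nil [simp]: "[] \<otimes>\<^bsub>RDirProd_list []\<^esub> [] = []"
 by (simp add: monoid.defs)

lemma RD_mult_Cons [simp]:
 assumes "x \<in> carrier M" "y \<in> carrier M" "xs \<in> RD Ms" "ys \<in> RD Ms"
 shows "(x # xs) \<otimes>\<^bsub>RDirProd_list (M # Ms)\<^esub> (y # ys) = (x \<otimes>\<^bsub>M\<^esub> y) # (xs \<otimes>\<^bsub>RDirProd_list Ms\<^esub> ys)"
proof -
 let ?f = "\<lambda>(a, as). a # as" and ?R = "RDirProd M (RDirProd_list Ms)"
 have R: "RDirProd_list (M # Ms) = image_ring ?f ?R" by (simp add: RDirProd_list_def)
 have "inv_into (carrier ?R) ?f (x # xs) = (x, xs)" "inv_into (carrier ?R) ?f (y # ys) = (y, ys)"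
  using inv_into_f_f[OF inj_on_RDirProd_carrier, of "(x, xs)" M Ms] inv_into_f_f[OF inj_on_RDirProd_carrier, of "(y, ys)" M Ms] assms
  by (simp_all add: RDirProd_carrier)
 then show ?thesis
  unfolding R by (simp add: image_ring_def image_group_def monoid.defs RDirProd_def DirProd_def)
qed

lemma RD_one: "\<one>\<^bsub>RDirProd_list Ms\<^esub> = map one Ms"
 unfolding RDirProd_list_one by (induction Ms) auto

lemma RD_mult_closed: "\<lbrakk>algs Ms; xs \<in> RD Ms; ys \<in> RD Ms\<rbrakk> \<Longrightarrow> xs \<otimes>\<^bsub>RDirProd_list Ms\<^esub> ys \<in> RD Ms"
 by (induction Ms arbitrary: xs ys) (auto elim!: RD_ConsE simp: monoid.defs)

lemma RD_mult_update:
 "\<lbrakk>xs \<in> RD Ms; ys \<in> RD Ms; l < length Ms; x \<in> carrier (Ms ! l)\<rbrakk> \<Longrightarrow>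
   xs[l := x] \<otimes>\<^bsub>RDirProd_list Ms\<^esub> ys = (xs \<otimes>\<^bsub>RDirProd_list Ms\<^esub> ys)[l := x \<otimes>\<^bsub>Ms ! l\<^esub> ys ! l]"
proof (induction Ms arbitrary: xs ys l)
 case (Cons M Ms)
 then show ?case by (cases l) (auto elim!: RD_ConsE simp: RD_update)
qed simp

lemma RD_comm_monoid:
 assumes "algs Ms"
 shows "Group.comm_monoid (RDirProd_list Ms)"
proof (rule comm_monoidI)
 fix x y z assume xyz: "x \<in> RD Ms" "y \<in> RD Ms" "z \<in> RD Ms"
 show "x \<otimes>\<^bsub>RDirProd_list Ms\<^esub> y \<in> RD Ms" using RD_mult_closed assms xyz by blast
 show "(x \<otimes>\<^bsub>RDirProd_list Ms\<^esub> y) \<otimes>\<^bsub>RDirProd_list Ms\<^esub> z = x \<otimes>\<^bsub>RDirProd_list Ms\<^esub> (y \<otimes>\<^bsub>RDirProd_list Ms\<^esub> z)"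
  using assms xyz
  by (induction Ms arbitrary: x y z) (auto elim!: RD_ConsE simp: monoid.defs RD_mult_closed alg_mult_ac(1))
 show "x \<otimes>\<^bsub>RDirProd_list Ms\<^esub> y = y \<otimes>\<^bsub>RDirProd_list Ms\<^esub> x"
  using assms xyz by (induction Ms arbitrary: x y z) (auto elim!: RD_ConsE simp: alg_mult_ac(2))
next
 show "\<one>\<^bsub>RDirProd_list Ms\<^esub> \<in> RD Ms" unfolding RD_one using assms by (induction Ms) auto
 show "\<one>\<^bsub>RDirProd_list Ms\<^esub> \<otimes>\<^bsub>RDirProd_list Ms\<^esub> x = x" if "x \<in> RD Ms" for x
  unfolding RD_one using assms that
 proof (induction Ms arbitrary: x)
  case (Cons M Ms)
  have "map one Ms \<in> RD Ms" using Cons.prems(1) by (induction Ms) auto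
  then show ?case using Cons by (auto elim!: RD_ConsE)
 qed (simp add: monoid.defs)
qed

subsection \<open>Multilinear maps\<close>

text \<open>Recursion on the list, rather than a condition on every position, suits induction on the
  number of factors; it forces a case distinction only when lists are concatenated.\<close>

primrec multilin :: "('k, 'v, 'n) module_scheme list \<Rightarrow> ('k, 'w, 'p) module_scheme \<Rightarrow> ('v list \<Rightarrow> 'w) \<Rightarrow> bool" where
 "multilin [] W g \<longleftrightarrow> g [] \<in> carrier W"
| "multilin (M # Ms) W g \<longleftrightarrow> (\<forall>ys\<in>RD Ms. lin M W (\<lambda>x. g (x # ys))) \<and>
   (\<forall>x\<in>carrier M. multilin Ms W (\<lambda>ys. g (x # ys)))"

lemma multilin_closed: "multilin Ms W g \<Longrightarrow> xs \<in> RD Ms \<Longrightarrow> g xs \<in> carrier W"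
 by (induction Ms arbitrary: g xs) (auto elim!: RD_ConsE)

lemma multilin_update:
 "\<lbrakk>multilin Ms W g; xs \<in> RD Ms; l < length Ms\<rbrakk> \<Longrightarrow> lin (Ms ! l) W (\<lambda>x. g (xs[l := x]))"
proof (induction Ms arbitrary: g xs l)
 case (Cons M Ms)
 obtain y ys where xs: "xs = y # ys" "y \<in> carrier M" "ys \<in> RD Ms" using Cons.prems(2) by (rule RD_ConsE)
 show ?case
 proof (cases l)
  case 0 then show ?thesis using Cons.prems xs by simp
 next
  case (Suc k)
  then show ?thesis using Cons.IH[of "\<lambda>ys. g (y # ys)" ys k] Cons.prems xs by simp
 qed
qed simp

lemma multilinI_update:
 assumes "algs Ms" "\<And>xs. xs \<in> RD Ms \<Longrightarrow> g xs \<in> carrier W"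
  "\<And>xs l. xs \<in> RD Ms \<Longrightarrow> l < length Ms \<Longrightarrow> lin (Ms ! l) W (\<lambda>x. g (xs[l := x]))"
 shows "multilin Ms W g"
 using assms
proof (induction Ms arbitrary: g)
 case (Cons M Ms)
 have "lin M W (\<lambda>x. g (x # ys))" if "ys \<in> RD Ms" for ys
  using Cons.prems(3)[of "\<zero>\<^bsub>M\<^esub> # ys" 0] Cons.prems(1) that by simp
 moreover have "multilin Ms W (\<lambda>ys. g (x # ys))" if x: "x \<in> carrier M" for x
 proof (rule Cons.IH)
  show "lin (Ms ! l) W (\<lambda>z. g (x # ys[l := z]))" if "ys \<in> RD Ms" "l < length Ms" for ys l
   using Cons.prems(3)[of "x # ys" "Suc l"] x that by simp
  show "algs Ms" using Cons.prems(1) by simp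
  show "g (x # ys) \<in> carrier W" if "ys \<in> RD Ms" for ys
   using Cons.prems(2)[of "x # ys"] x that by simp
 qed
 ultimately show ?case by simp
qed simp

lemma multilin_cong:
 "\<lbrakk>algs Ms; multilin Ms W g; (\<And>xs. xs \<in> RD Ms \<Longrightarrow> f xs = g xs)\<rbrakk> \<Longrightarrow> multilin Ms W f"
proof (induction Ms arbitrary: f g)
 case Nil
 show ?case using Nil.prems(2) Nil.prems(3)[of "[]"] by simp
next
 case (Cons M Ms)
 have "lin M W (\<lambda>x. f (x # ys))" if "ys \<in> RD Ms" for ys
 proof (rule lin_cong)
  show "lin M W (\<lambda>x. g (x # ys))" using Cons.prems(2) that by simp
  show "alg M" using Cons.prems(1) by simp
  show "f (x # ys) = g (x # ys)" if "x \<in> carrier M" for x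
   using Cons.prems(3)[of "x # ys"] that \<open>ys \<in> RD Ms\<close> by simp
 qed
 moreover have "multilin Ms W (\<lambda>ys. f (x # ys))" if "x \<in> carrier M" for x
 proof (rule Cons.IH)
  show "multilin Ms W (\<lambda>ys. g (x # ys))" using Cons.prems(2) that by simp
  show "algs Ms" using Cons.prems(1) by simp
  show "f (x # ys) = g (x # ys)" if "ys \<in> RD Ms" for ys
   using Cons.prems(3)[of "x # ys"] that \<open>x \<in> carrier M\<close> by simp
 qed
 ultimately show ?case by simp
qed

lemma lin_multilin: "multilin Ms U g \<Longrightarrow> lin U W h \<Longrightarrow> multilin Ms W (\<lambda>xs. h (g xs))"
proof (induction Ms arbitrary: g)
 case Nil then show ?case by (simp add: linD(1)[of U W h])
next
 case (Cons M Ms)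
 have "lin M W (\<lambda>x. h (g (x # ys)))" if "ys \<in> RD Ms" for ys
  using Cons.prems that by (intro lin_comp[of M U "\<lambda>x. g (x # ys)" W h]) simp_all
 then show ?case using Cons by simp
qed

lemma multilin_append:
 "multilin (Ms @ Ns) W g \<longleftrightarrow>
   (\<forall>ys\<in>RD Ns. multilin Ms W (\<lambda>xs. g (xs @ ys))) \<and> (\<forall>xs\<in>RD Ms. multilin Ns W (\<lambda>ys. g (xs @ ys)))"
proof (induction Ms arbitrary: g)
 case Nil
 then show ?case by (auto intro: multilin_closed)
next
 case (Cons M Ms)
 have "(\<forall>zs\<in>RD (Ms @ Ns). lin M W (\<lambda>x. g (x # zs))) \<longleftrightarrow>
   (\<forall>xs\<in>RD Ms. \<forall>ys\<in>RD Ns. lin M W (\<lambda>x. g (x # xs @ ys)))"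
 proof (intro iffI ballI)
  fix zs assume *: "\<forall>xs\<in>RD Ms. \<forall>ys\<in>RD Ns. lin M W (\<lambda>x. g (x # xs @ ys))" "zs \<in> RD (Ms @ Ns)"
  obtain xs ys where "zs = xs @ ys" "xs \<in> RD Ms" "ys \<in> RD Ns" using *(2) by (rule RD_appendE)
  then show "lin M W (\<lambda>x. g (x # zs))" using *(1) by simp
 qed simp
 moreover have "(\<forall>zs\<in>RD (M # Ms). multilin Ns W (\<lambda>ys. g (zs @ ys))) \<longleftrightarrow>
   (\<forall>x\<in>carrier M. \<forall>xs\<in>RD Ms. multilin Ns W (\<lambda>ys. g (x # xs @ ys)))"
 proof (intro iffI ballI)
  fix x xs assume "\<forall>zs\<in>RD (M # Ms). multilin Ns W (\<lambda>ys. g (zs @ ys))" "x \<in> carrier M" "xs \<in> RD Ms"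
  then show "multilin Ns W (\<lambda>ys. g (x # xs @ ys))" by (auto dest: bspec[of _ _ "x # xs"])
 qed (auto elim!: RD_ConsE)
 ultimately show ?case by (auto simp: Cons.IH)
qed

subsection \<open>The tensor product as an algebra\<close>

lemma algebra_free_tensor: "algs Ms \<Longrightarrow> alg (free Ms)"
 unfolding free_tensor_def by (intro algebra_monoid_algebra RD_comm_monoid)

lemma single_free_tensor: "xs \<in> RD Ms \<Longrightarrow> single K xs \<in> carrier (free Ms)"
 unfolding free_tensor_def by (rule single_carrier)

lemma relator_add:
 "\<lbrakk>xs \<in> RD Ms; l < length Ms; x \<in> carrier (Ms ! l); y \<in> carrier (Ms ! l)\<rbrakk> \<Longrightarrow>
   single K (xs[l := x \<oplus>\<^bsub>Ms ! l\<^esub> y]) \<ominus>\<^bsub>free Ms\<^esub>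
   (single K (xs[l := x]) \<oplus>\<^bsub>free Ms\<^esub> single K (xs[l := y])) \<in> multilinear_relators K Ms"
 unfolding multilinear_relators_def by (intro UnI1 CollectI exI[of _ xs] exI[of _ l] exI[of _ x] exI[of _ y] conjI refl)

lemma relator_smult:
 "\<lbrakk>xs \<in> RD Ms; l < length Ms; c \<in> \<K>; x \<in> carrier (Ms ! l)\<rbrakk> \<Longrightarrow>
   single K (xs[l := c \<odot>\<^bsub>Ms ! l\<^esub> x]) \<ominus>\<^bsub>free Ms\<^esub>
   (c \<odot>\<^bsub>free Ms\<^esub> single K (xs[l := x])) \<in> multilinear_relators K Ms"
 unfolding multilinear_relators_def by (intro UnI2 CollectI exI[of _ xs] exI[of _ l] exI[of _ c] exI[of _ x] conjI refl)

lemma multilinear_relators_carrier: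
 "algs Ms \<Longrightarrow> multilinear_relators K Ms \<subseteq> carrier (free Ms)"
 unfolding multilinear_relators_def
 by (auto simp: RD_update single_free_tensor algebra_free_tensor)

lemma tensor_relations_submodule:
 assumes "algs Ms"
 shows "submodule (rels Ms) K (free Ms)"
  and "multilinear_relators K Ms \<subseteq> rels Ms"
  and "\<And>N. submodule N K (free Ms) \<Longrightarrow> multilinear_relators K Ms \<subseteq> N \<Longrightarrow> rels Ms \<subseteq> N"
proof -
 interpret F: algebra K "free_tensor K Ms" using algebra_free_tensor[OF assms] .
 note E = F.submoduleE
 have "carrier (free Ms) \<in> {N. submodule N K (free Ms) \<and> multilinear_relators K Ms \<subseteq> N}"
  using F.carrier_is_submodule multilinear_relators_carrier[OF assms] by simp
 then show "submodule (rels Ms) K (free Ms)"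
  unfolding tensor_relations_def
  by (intro F.submoduleI)
    (auto intro: E(3,4,5) subgroup.one_closed[OF submodule.axioms(1), simplified] simp: subset_iff)
 show "multilinear_relators K Ms \<subseteq> rels Ms" by (auto simp: tensor_relations_def)
 show "rels Ms \<subseteq> N" if "submodule N K (free Ms)" "multilinear_relators K Ms \<subseteq> N" for N
  using that by (auto simp: tensor_relations_def)
qed

lemma single_mult_relator:
 assumes Ms: "algs Ms" and ys: "ys \<in> RD Ms" and r: "r \<in> multilinear_relators K Ms"
 shows "r \<otimes>\<^bsub>free Ms\<^esub> single K ys \<in> multilinear_relators K Ms"
proof -
 let ?F = "free Ms" and ?R = "RDirProd_list Ms"
 have F: "alg ?F" by (rule algebra_free_tensor[OF Ms])
 have sm: "single K xs \<otimes>\<^bsub>?F\<^esub> single K ys = single K (xs \<otimes>\<^bsub>?R\<^esub> ys)" if "xs \<in> RD Ms" for xs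
  unfolding free_tensor_def using single_mult[OF RD_comm_monoid[OF Ms] that ys] .
 note [simp] = F single_free_tensor RD_update ys RD_mult_closed[OF Ms] alg_distrib[OF F] alg_smult[OF F] alg_minus(1)[OF F] sm RD_mult_update
 have Ml: "alg (Ms ! l)" if "l < length Ms" for l using Ms that by simp
 from r consider (add) xs l x y where "r = single K (xs[l := x \<oplus>\<^bsub>Ms ! l\<^esub> y])
    \<ominus>\<^bsub>?F\<^esub> (single K (xs[l := x]) \<oplus>\<^bsub>?F\<^esub> single K (xs[l := y]))"
    "xs \<in> RD Ms" "l < length Ms" "x \<in> carrier (Ms ! l)" "y \<in> carrier (Ms ! l)"
  | (smult) xs l c x where "r = single K (xs[l := c \<odot>\<^bsub>Ms ! l\<^esub> x]) \<ominus>\<^bsub>?F\<^esub> (c \<odot>\<^bsub>?F\<^esub> single K (xs[l := x]))"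
    "xs \<in> RD Ms" "l < length Ms" "c \<in> \<K>" "x \<in> carrier (Ms ! l)"
  unfolding multilinear_relators_def by blast
 then show ?thesis
 proof cases
  case add
  let ?z = "ys ! l" and ?xs = "xs \<otimes>\<^bsub>?R\<^esub> ys"
  have z: "?z \<in> carrier (Ms ! l)" using add ys by (simp add: RD_nth)
  have "r \<otimes>\<^bsub>?F\<^esub> single K ys = single K (?xs[l := (x \<otimes>\<^bsub>Ms ! l\<^esub> ?z) \<oplus>\<^bsub>Ms ! l\<^esub> (y \<otimes>\<^bsub>Ms ! l\<^esub> ?z)])
    \<ominus>\<^bsub>?F\<^esub> (single K (?xs[l := x \<otimes>\<^bsub>Ms ! l\<^esub> ?z]) \<oplus>\<^bsub>?F\<^esub> single K (?xs[l := y \<otimes>\<^bsub>Ms ! l\<^esub> ?z]))"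
   using add z by (simp add: Ml alg_distrib(1))
  moreover have "?xs \<in> RD Ms" "x \<otimes>\<^bsub>Ms ! l\<^esub> ?z \<in> carrier (Ms ! l)" "y \<otimes>\<^bsub>Ms ! l\<^esub> ?z \<in> carrier (Ms ! l)"
   using add z by (simp_all add: Ml)
  ultimately show ?thesis using add(3) relator_add[of ?xs Ms l "x \<otimes>\<^bsub>Ms ! l\<^esub> ?z" "y \<otimes>\<^bsub>Ms ! l\<^esub> ?z"] by simp
 next
  case smult
  let ?z = "ys ! l" and ?xs = "xs \<otimes>\<^bsub>?R\<^esub> ys"
  have z: "?z \<in> carrier (Ms ! l)" using smult ys by (simp add: RD_nth)
  have "r \<otimes>\<^bsub>?F\<^esub> single K ys = single K (?xs[l := c \<odot>\<^bsub>Ms ! l\<^esub> (x \<otimes>\<^bsub>Ms ! l\<^esub> ?z)])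
    \<ominus>\<^bsub>?F\<^esub> (c \<odot>\<^bsub>?F\<^esub> single K (?xs[l := x \<otimes>\<^bsub>Ms ! l\<^esub> ?z]))"
   using smult z by (simp add: Ml alg_smult(2))
  moreover have "?xs \<in> RD Ms" "x \<otimes>\<^bsub>Ms ! l\<^esub> ?z \<in> carrier (Ms ! l)"
   using smult z by (simp_all add: Ml)
  ultimately show ?thesis using smult(3,4) relator_smult[of ?xs Ms l c "x \<otimes>\<^bsub>Ms ! l\<^esub> ?z"] by simp
 qed
qed

text \<open>A basis element times a relator is again a relator, because multiplication in each factor
  is linear. By bilinearity the submodule spanned by the relators is then an ideal, and the
  quotient of the monoid algebra is an algebra.\<close>

lemma tensor_relations_ideal:
 assumes Ms: "algs Ms"
 shows "ideal (rels Ms) (free Ms)"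
proof -
 let ?F = "free Ms" and ?N = "rels Ms"
 have aF: "alg ?F" by (rule algebra_free_tensor[OF Ms])
 interpret F: algebra K ?F using aF .
 note N = tensor_relations_submodule[OF Ms]
 note E = F.submoduleE[OF N(1)]
 have z: "\<zero>\<^bsub>?F\<^esub> \<in> ?N" using subgroup.one_closed[OF submodule.axioms(1)[OF N(1)]] by simp
 let ?I = "{r \<in> ?N. \<forall>x\<in>carrier ?F. r \<otimes>\<^bsub>?F\<^esub> x \<in> ?N}"
 have ic: "?I \<subseteq> carrier ?F" using E(1) by auto
 have "submodule ?I K ?F"
 proof (rule F.submoduleI[OF ic])
  show "\<ominus>\<^bsub>?F\<^esub> a \<in> ?I" if "a \<in> ?I" for a
   using that E(3) ic by (auto simp: F.l_minus)
  show "a \<oplus>\<^bsub>?F\<^esub> b \<in> ?I" if "a \<in> ?I" "b \<in> ?I" for a b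
   using that E(5) ic by (auto simp: F.l_distr subset_iff)
  show "a \<odot>\<^bsub>?F\<^esub> x \<in> ?I" if "a \<in> \<K>" "x \<in> ?I" for a x
   using that E(4) ic by (auto simp: F.smult_assoc2 subset_iff)
 qed (use z in simp)
 moreover have "r \<in> ?I" if r: "r \<in> multilinear_relators K Ms" for r
 proof -
  have rF: "r \<in> carrier ?F" using r multilinear_relators_carrier[OF Ms] by blast
  have "r \<otimes>\<^bsub>?F\<^esub> x \<in> ?N" if "x \<in> carrier ?F" for x
   using that[unfolded free_tensor_def]
  proof (induction rule: monoid_algebra_induct)
   case zero
   have "(\<lambda>_. \<zero>) = \<zero>\<^bsub>?F\<^esub>" by (simp add: free_tensor_def mon_simps)
   then show ?case using rF z by simp
  next
   case (add \<phi> \<chi>)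
   have "r \<otimes>\<^bsub>?F\<^esub> (\<phi> \<oplus>\<^bsub>?F\<^esub> \<chi>) \<in> ?N"
    using add rF E(5) unfolding free_tensor_def[symmetric] by (simp add: F.r_distr)
   then show ?case by (simp add: free_tensor_def mon_simps)
  next
   case (single c x)
   have "r \<otimes>\<^bsub>?F\<^esub> (c \<odot>\<^bsub>?F\<^esub> single K x) \<in> ?N"
    using single rF E(4) single_mult_relator[OF Ms _ r] N(2)
    by (simp add: alg_smult[OF aF] single_free_tensor subset_iff)
   then show ?case by (simp add: free_tensor_def mon_simps)
  qed
  then show ?thesis using r N(2) by auto
 qed
 ultimately have I: "?N \<subseteq> ?I" using N(3) by blast
 show ?thesis
 proof (rule idealI)
  show "subgroup ?N (add_monoid ?F)" by (rule submodule.axioms(1)[OF N(1)])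
  show "a \<otimes>\<^bsub>?F\<^esub> x \<in> ?N" if "a \<in> ?N" "x \<in> carrier ?F" for a x using I that by blast
  then show "x \<otimes>\<^bsub>?F\<^esub> a \<in> ?N" if "a \<in> ?N" "x \<in> carrier ?F" for a x
   using that F.m_comm[of x a] subsetD[OF E(1)] by simp
 qed (rule F.ring_axioms)
qed

definition tproj :: "('k, 'v, 'n) module_scheme list \<Rightarrow> ('v list \<Rightarrow> 'k) \<Rightarrow> ('k, 'v) tensor" where
 "tproj Ms \<phi> = rels Ms +>\<^bsub>free Ms\<^esub> \<phi>"

lemma tproj_mem:
 assumes "algs Ms" "\<phi> \<in> carrier (free Ms)"
 shows "\<phi> \<in> tproj Ms \<phi>"
  and "\<chi> \<in> tproj Ms \<phi> \<Longrightarrow> \<chi> \<in> carrier (free Ms) \<and> tproj Ms \<chi> = tproj Ms \<phi>"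
proof -
 interpret I: ideal "tensor_relations K Ms" "free_tensor K Ms" by (rule tensor_relations_ideal[OF assms(1)])
 show "\<phi> \<in> tproj Ms \<phi>" using assms(2) unfolding tproj_def by (rule I.a_rcos_self)
 show "\<chi> \<in> carrier (free Ms) \<and> tproj Ms \<chi> = tproj Ms \<phi>" if "\<chi> \<in> tproj Ms \<phi>"
  using that assms(2) unfolding tproj_def
  using I.a_elemrcos_carrier[of \<phi> \<chi>] I.a_repr_independence'[where y=\<chi> and x=\<phi>] by auto
qed

lemma tproj_eq_iff:
 assumes "algs Ms" "\<phi> \<in> carrier (free Ms)" "\<chi> \<in> carrier (free Ms)"
 shows "tproj Ms \<phi> = tproj Ms \<chi> \<longleftrightarrow> \<phi> \<ominus>\<^bsub>free Ms\<^esub> \<chi> \<in> rels Ms"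
proof -
 interpret I: ideal "tensor_relations K Ms" "free_tensor K Ms" by (rule tensor_relations_ideal[OF assms(1)])
 show ?thesis unfolding tproj_def using assms I.quotient_eq_iff_same_a_r_cos[OF I.ideal_axioms] by blast
qed

lemma tensor_simps:
 assumes Ms: "algs Ms"
 shows "TC Ms = tproj Ms ` carrier (free Ms)"
  and "\<zero>\<^bsub>tens Ms\<^esub> = tproj Ms \<zero>\<^bsub>free Ms\<^esub>"
  and "\<one>\<^bsub>tens Ms\<^esub> = tproj Ms \<one>\<^bsub>free Ms\<^esub>"
  and "\<phi> \<in> carrier (free Ms) \<Longrightarrow> \<chi> \<in> carrier (free Ms) \<Longrightarrow>
   tproj Ms \<phi> \<oplus>\<^bsub>tens Ms\<^esub> tproj Ms \<chi> = tproj Ms (\<phi> \<oplus>\<^bsub>free Ms\<^esub> \<chi>)"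
  and "\<phi> \<in> carrier (free Ms) \<Longrightarrow> \<chi> \<in> carrier (free Ms) \<Longrightarrow>
   tproj Ms \<phi> \<otimes>\<^bsub>tens Ms\<^esub> tproj Ms \<chi> = tproj Ms (\<phi> \<otimes>\<^bsub>free Ms\<^esub> \<chi>)"
  and "c \<in> \<K> \<Longrightarrow> \<phi> \<in> carrier (free Ms) \<Longrightarrow>
   c \<odot>\<^bsub>tens Ms\<^esub> tproj Ms \<phi> = tproj Ms (c \<odot>\<^bsub>free Ms\<^esub> \<phi>)"
proof -
 let ?F = "free Ms" and ?N = "rels Ms"
 have aF: "alg ?F" by (rule algebra_free_tensor[OF Ms])
 interpret F: algebra K ?F using aF .
 interpret I: ideal ?N ?F by (rule tensor_relations_ideal[OF Ms])
 note d = tensor_def FactRing_def ring.defs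
 show "TC Ms = tproj Ms ` carrier ?F"
  by (auto simp: d A_RCOSETS_def' tproj_def)
 show "\<zero>\<^bsub>tens Ms\<^esub> = tproj Ms \<zero>\<^bsub>?F\<^esub>"
  using F.a_rcos_zero[OF I.ideal_axioms I.zero_closed] by (simp add: d tproj_def)
 show "\<one>\<^bsub>tens Ms\<^esub> = tproj Ms \<one>\<^bsub>?F\<^esub>" by (simp add: d tproj_def)
 show "tproj Ms \<phi> \<oplus>\<^bsub>tens Ms\<^esub> tproj Ms \<chi> = tproj Ms (\<phi> \<oplus>\<^bsub>?F\<^esub> \<chi>)"
  if "\<phi> \<in> carrier ?F" "\<chi> \<in> carrier ?F"
  using I.a_rcos_sum that by (simp add: d tproj_def)
 show "tproj Ms \<phi> \<otimes>\<^bsub>tens Ms\<^esub> tproj Ms \<chi> = tproj Ms (\<phi> \<otimes>\<^bsub>?F\<^esub> \<chi>)"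
  if "\<phi> \<in> carrier ?F" "\<chi> \<in> carrier ?F"
  using I.rcoset_mult_add that by (simp add: d tproj_def)
 show "c \<odot>\<^bsub>tens Ms\<^esub> tproj Ms \<phi> = tproj Ms (c \<odot>\<^bsub>?F\<^esub> \<phi>)" if c: "c \<in> \<K>" and \<phi>: "\<phi> \<in> carrier ?F"
 proof -
  have "tproj Ms (c \<odot>\<^bsub>?F\<^esub> \<chi>) = tproj Ms (c \<odot>\<^bsub>?F\<^esub> \<phi>)" if "\<chi> \<in> tproj Ms \<phi>" for \<chi>
  proof -
   have \<chi>: "\<chi> \<in> carrier ?F" "tproj Ms \<chi> = tproj Ms \<phi>" using tproj_mem(2)[OF Ms \<phi> that] by simp_all
   then have "\<chi> \<ominus>\<^bsub>?F\<^esub> \<phi> \<in> ?N" using tproj_eq_iff[OF Ms] \<phi> by blast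
   then have "c \<odot>\<^bsub>?F\<^esub> (\<chi> \<ominus>\<^bsub>?F\<^esub> \<phi>) \<in> ?N"
    using submodule.smult_closed[OF tensor_relations_submodule(1)[OF Ms] c] by blast
   then have "c \<odot>\<^bsub>?F\<^esub> \<chi> \<ominus>\<^bsub>?F\<^esub> c \<odot>\<^bsub>?F\<^esub> \<phi> \<in> ?N"
    using lin_minus[OF lin_smult[OF aF c lin_id] aF aF \<chi>(1) \<phi>] by simp
   then show ?thesis using tproj_eq_iff[OF Ms] c \<phi> \<chi>(1) by simp
  qed
  moreover have "c \<odot>\<^bsub>tens Ms\<^esub> tproj Ms \<phi> = (\<Union>\<chi>\<in>tproj Ms \<phi>. tproj Ms (c \<odot>\<^bsub>?F\<^esub> \<chi>))"
   by (simp add: d tproj_def)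
  moreover have "(\<Union>\<chi>\<in>tproj Ms \<phi>. tproj Ms (c \<odot>\<^bsub>?F\<^esub> \<chi>)) = (\<Union>\<chi>\<in>tproj Ms \<phi>. tproj Ms (c \<odot>\<^bsub>?F\<^esub> \<phi>))"
   by (rule SUP_cong) (use calculation in simp_all)
  moreover have "tproj Ms \<phi> \<noteq> {}" using tproj_mem(1)[OF Ms \<phi>] by blast
  ultimately show ?thesis by (simp only: UN_constant if_False)
 qed
qed

lemma alg_tens [simp]:
 assumes Ms: "algs Ms"
 shows "alg (tens Ms)"
proof -
 let ?F = "free Ms" and ?N = "rels Ms" and ?T = "tens Ms"
 have aF: "alg ?F" by (rule algebra_free_tensor[OF Ms])
 interpret F: algebra K ?F using aF .
 interpret I: ideal ?N ?F by (rule tensor_relations_ideal[OF Ms])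
 note s = tensor_simps[OF Ms]
 note a = alg_add_ac[OF aF] alg_mult_ac[OF aF] alg_distrib[OF aF] alg_smult[OF aF] aF
 have c: "cring ?T"
 proof (intro cringI abelian_groupI comm_monoidI)
  show "\<exists>y\<in>carrier ?T. y \<oplus>\<^bsub>?T\<^esub> x = \<zero>\<^bsub>?T\<^esub>" if "x \<in> carrier ?T" for x
  proof -
   from that obtain \<phi> where \<phi>: "\<phi> \<in> carrier ?F" "x = tproj Ms \<phi>" unfolding s by blast
   then show ?thesis unfolding s(1) by (auto simp: s(2,4) F.l_neg intro!: bexI[of _ "\<ominus>\<^bsub>?F\<^esub> \<phi>"])
  qed
 qed (auto simp: s a intro!: imageI)
 show ?thesis by (rule algebraI[OF is_cring c]) (auto simp: s a intro!: imageI)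
qed

lemma lin_tproj: "algs Ms \<Longrightarrow> lin (free Ms) (tens Ms) (tproj Ms)"
 by (rule linI) (auto simp: tensor_simps)

lemma pure_tproj: "pur Ms xs = tproj Ms (single K xs)"
 by (simp add: pure_def tproj_def)

lemma pure_closed [simp]: "algs Ms \<Longrightarrow> xs \<in> RD Ms \<Longrightarrow> pur Ms xs \<in> TC Ms"
 by (simp add: pure_tproj tensor_simps single_free_tensor)

lemma pure_mult:
 "\<lbrakk>algs Ms; xs \<in> RD Ms; ys \<in> RD Ms\<rbrakk> \<Longrightarrow>
   pur Ms xs \<otimes>\<^bsub>tens Ms\<^esub> pur Ms ys = pur Ms (xs \<otimes>\<^bsub>RDirProd_list Ms\<^esub> ys)"
 by (simp add: pure_tproj tensor_simps single_free_tensor)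
   (simp add: free_tensor_def single_mult RD_comm_monoid)

lemma pure_one: "algs Ms \<Longrightarrow> pur Ms (map one Ms) = \<one>\<^bsub>tens Ms\<^esub>"
 by (simp add: pure_tproj tensor_simps) (simp add: free_tensor_def mon_simps RD_one)

lemma multilin_pure [simp]:
 assumes Ms: "algs Ms"
 shows "multilin Ms (tens Ms) (pur Ms)"
proof (rule multilinI_update[OF Ms])
 fix xs l assume xs: "xs \<in> RD Ms" and l: "l < length Ms"
 let ?F = "free Ms"
 have aF: "alg ?F" by (rule algebra_free_tensor[OF Ms])
 have Ml: "alg (Ms ! l)" using l Ms by simp
 note N = tensor_relations_submodule(2)[OF Ms]
 show "lin (Ms ! l) (tens Ms) (\<lambda>x. pur Ms (xs[l := x]))"
 proof (rule linI)
  fix x assume x: "x \<in> carrier (Ms ! l)"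
  show "pur Ms (xs[l := x]) \<in> TC Ms" using x xs l Ms by (simp add: RD_update)
  show "pur Ms (xs[l := x \<oplus>\<^bsub>Ms ! l\<^esub> y]) = pur Ms (xs[l := x]) \<oplus>\<^bsub>tens Ms\<^esub> pur Ms (xs[l := y])"
   if y: "y \<in> carrier (Ms ! l)" for y
  proof -
   have "single K (xs[l := x \<oplus>\<^bsub>Ms ! l\<^esub> y]) \<ominus>\<^bsub>?F\<^esub> (single K (xs[l := x]) \<oplus>\<^bsub>?F\<^esub> single K (xs[l := y])) \<in> rels Ms"
    using N relator_add[OF xs l x y] by (rule subsetD)
   then show ?thesis using Ms x y xs l Ml aF
    by (simp add: pure_tproj tensor_simps single_free_tensor RD_update tproj_eq_iff)
  qed
  show "pur Ms (xs[l := c \<odot>\<^bsub>Ms ! l\<^esub> x]) = c \<odot>\<^bsub>tens Ms\<^esub> pur Ms (xs[l := x])"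
   if c: "c \<in> \<K>" for c
  proof -
   have "single K (xs[l := c \<odot>\<^bsub>Ms ! l\<^esub> x]) \<ominus>\<^bsub>?F\<^esub> (c \<odot>\<^bsub>?F\<^esub> single K (xs[l := x])) \<in> rels Ms"
    using N relator_smult[OF xs l c x] by (rule subsetD)
   then show ?thesis using Ms x c xs l Ml aF
    by (simp add: pure_tproj tensor_simps single_free_tensor RD_update tproj_eq_iff)
  qed
 qed
qed (use Ms in simp)

lemma tensor_ext:
 assumes Ms: "algs Ms" and W: "alg W" and f: "lin (tens Ms) W f" and g: "lin (tens Ms) W g"
  and eq: "\<And>xs. xs \<in> RD Ms \<Longrightarrow> f (pur Ms xs) = g (pur Ms xs)"
  and t: "t \<in> TC Ms"
 shows "f t = g t"
proof -
 obtain \<phi> where \<phi>: "\<phi> \<in> carrier (free Ms)" "t = tproj Ms \<phi>"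
  using t unfolding tensor_simps[OF Ms] by blast
 have "f (tproj Ms \<phi>) = g (tproj Ms \<phi>)"
  using lin_comp[OF lin_tproj[OF Ms] f] lin_comp[OF lin_tproj[OF Ms] g] \<phi>(1) eq W
   monoid_algebra_ext[of "RDirProd_list Ms" W "\<lambda>\<phi>. f (tproj Ms \<phi>)" "\<lambda>\<phi>. g (tproj Ms \<phi>)" \<phi>]
  unfolding free_tensor_def[symmetric] by (simp add: pure_tproj)
 then show ?thesis using \<phi> by simp
qed

lemma tensor_induct [consumes 2, case_names zero add pure]:
 assumes Ms: "algs Ms" and t: "t \<in> TC Ms"
  and zero: "Q \<zero>\<^bsub>tens Ms\<^esub>"
  and add: "\<And>s t. \<lbrakk>s \<in> TC Ms; t \<in> TC Ms; Q s; Q t\<rbrakk> \<Longrightarrow> Q (s \<oplus>\<^bsub>tens Ms\<^esub> t)"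
  and pure: "\<And>c xs. c \<in> \<K> \<Longrightarrow> xs \<in> RD Ms \<Longrightarrow> Q (c \<odot>\<^bsub>tens Ms\<^esub> pur Ms xs)"
 shows "Q t"
proof -
 note s = tensor_simps[OF Ms]
 obtain \<phi> where \<phi>: "\<phi> \<in> carrier (free Ms)" "t = tproj Ms \<phi>" using t unfolding s by blast
 from \<phi>(1)[unfolded free_tensor_def] have "Q (tproj Ms \<phi>)"
 proof (induction rule: monoid_algebra_induct)
  case zero
  then show ?case using assms(3) by (simp add: s(2) free_tensor_def mon_simps(2))
 next
  case (add \<phi> \<chi>)
  then show ?case
   using assms(4)[of "tproj Ms \<phi>" "tproj Ms \<chi>"] s(4)[of \<phi> \<chi>]
   unfolding free_tensor_def[symmetric] by (simp add: s(1)) (simp add: free_tensor_def mon_simps(4))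
 next
  case (single c x)
  then show ?case
   using pure[of c x] s(6)[of c "single K x"] single_free_tensor[of x Ms]
   by (simp add: pure_tproj) (simp add: free_tensor_def mon_simps(5))
 qed
 then show ?thesis using \<phi> by simp
qed

subsection \<open>The universal property of the tensor product\<close>

definition free_lift :: "('k, 'w, 'n) module_scheme \<Rightarrow> ('x \<Rightarrow> 'w) \<Rightarrow> ('x \<Rightarrow> 'k) \<Rightarrow> 'w" where
 "free_lift W g \<phi> = finsum W (\<lambda>x. \<phi> x \<odot>\<^bsub>W\<^esub> g x) (supp \<phi>)"

lemma free_lift_superset:
 assumes "alg W" "\<And>x. x \<in> carrier P \<Longrightarrow> g x \<in> carrier W"
  "\<phi> \<in> carrier (mon P)" "finite A" "supp \<phi> \<subseteq> A" "A \<subseteq> carrier P"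
 shows "free_lift W g \<phi> = finsum W (\<lambda>x. \<phi> x \<odot>\<^bsub>W\<^esub> g x) A"
 unfolding free_lift_def using assms
 by (intro fsum_mono_neutral) (auto simp: mon_simps subset_iff)

lemma lin_free_lift:
 assumes W: "alg W" and g: "\<And>x. x \<in> carrier P \<Longrightarrow> g x \<in> carrier W"
 shows "lin (mon P) W (free_lift W g)"
proof (rule linI)
 let ?A = "mon P"
 fix \<phi> assume \<phi>: "\<phi> \<in> carrier ?A"
 then have *: "finite (supp \<phi>)" "\<And>x. \<phi> x \<in> \<K>" "supp \<phi> \<subseteq> carrier P" by (auto simp: mon_simps)
 have g\<phi>: "g x \<in> carrier W" if "x \<in> supp \<phi>" for x using g subsetD[OF *(3) that] .
 show "free_lift W g \<phi> \<in> carrier W"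
  unfolding free_lift_def by (rule fsum_closed[OF W], rule alg_simps(5)[OF W *(2) g\<phi>])
 show "free_lift W g (\<phi> \<oplus>\<^bsub>?A\<^esub> \<chi>) = free_lift W g \<phi> \<oplus>\<^bsub>W\<^esub> free_lift W g \<chi>" if \<chi>: "\<chi> \<in> carrier ?A" for \<chi>
 proof -
  have **: "finite (supp \<chi>)" "\<And>x. \<chi> x \<in> \<K>" "supp \<chi> \<subseteq> carrier P" using \<chi> by (auto simp: mon_simps)
  obtain A where A: "A = supp \<phi> \<union> supp \<chi>" by simp
  have f: "finite A" "A \<subseteq> carrier P" using * ** unfolding A by auto
  have gA: "g x \<in> carrier W" if "x \<in> A" for x using g subsetD[OF f(2) that] .
  have "free_lift W g (\<phi> \<oplus>\<^bsub>mon P\<^esub> \<chi>) = finsum W (\<lambda>x. (\<phi> x \<oplus> \<chi> x) \<odot>\<^bsub>W\<^esub> g x) A"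
   unfolding mon_simps using f W g monoid_algebra_closed(1)[OF \<phi> \<chi>]
   by (intro free_lift_superset[of W P]) (auto simp: A)
  also have "\<dots> = finsum W (\<lambda>x. \<phi> x \<odot>\<^bsub>W\<^esub> g x \<oplus>\<^bsub>W\<^esub> \<chi> x \<odot>\<^bsub>W\<^esub> g x) A"
   using gA *(2) **(2) W by (intro fsum_cong) (simp_all add: alg_distrib)
  also have "\<dots> = finsum W (\<lambda>x. \<phi> x \<odot>\<^bsub>W\<^esub> g x) A \<oplus>\<^bsub>W\<^esub> finsum W (\<lambda>x. \<chi> x \<odot>\<^bsub>W\<^esub> g x) A"
   using f gA * ** W by (intro fsum_add) auto
  also have "\<dots> = free_lift W g \<phi> \<oplus>\<^bsub>W\<^esub> free_lift W g \<chi>"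
   using free_lift_superset[OF W g \<phi>, where A=A] free_lift_superset[OF W g \<chi>, where A=A] f A by auto
  finally show ?thesis .
 qed
 show "free_lift W g (c \<odot>\<^bsub>?A\<^esub> \<phi>) = c \<odot>\<^bsub>W\<^esub> free_lift W g \<phi>" if c: "c \<in> \<K>" for c
 proof -
  note gA = g\<phi>
  have "free_lift W g (c \<odot>\<^bsub>?A\<^esub> \<phi>) = finsum W (\<lambda>x. (c \<otimes> \<phi> x) \<odot>\<^bsub>W\<^esub> g x) (supp \<phi>)"
   unfolding mon_simps using * W g c monoid_algebra_closed(2)[OF \<phi> \<phi> c]
   by (intro free_lift_superset[of W P]) auto
  also have "\<dots> = finsum W (\<lambda>x. c \<odot>\<^bsub>W\<^esub> (\<phi> x \<odot>\<^bsub>W\<^esub> g x)) (supp \<phi>)"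
   using gA * W c by (intro fsum_cong) (auto simp: alg_smult)
  also have "\<dots> = c \<odot>\<^bsub>W\<^esub> free_lift W g \<phi>"
   unfolding free_lift_def using gA * W c by (intro fsum_smult[symmetric]) auto
  finally show ?thesis .
 qed
qed

lemma free_lift_single:
 assumes "alg W" "g x \<in> carrier W"
 shows "free_lift W g (single K x) = g x"
proof -
 have s: "supp (single K x) = {x}" by (auto simp: single_def split: if_splits)
 have "finsum W (\<lambda>y. single K x y \<odot>\<^bsub>W\<^esub> g y) {x} = single K x x \<odot>\<^bsub>W\<^esub> g x"
  by (rule fsum_delta) (use assms in \<open>simp_all add: single_def\<close>)
 then show ?thesis unfolding free_lift_def s using assms by (simp add: single_def)
qed

lemma free_lift_relations:
 assumes Ms: "algs Ms" and W: "alg W" and g: "multilin Ms W g"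
  and \<phi>: "\<phi> \<in> rels Ms"
 shows "free_lift W g \<phi> = \<zero>\<^bsub>W\<^esub>"
proof -
 let ?F = "free Ms"
 have aF: "alg ?F" by (rule algebra_free_tensor[OF Ms])
 interpret F: algebra K ?F using aF .
 have L: "lin ?F W (free_lift W g)"
  unfolding free_tensor_def using W multilin_closed[OF g] by (intro lin_free_lift) auto
 have S: "free_lift W g (single K xs) = g xs" if "xs \<in> RD Ms" for xs
  by (rule free_lift_single[where W=W and g=g and x=xs, OF W multilin_closed[OF g that]])
 let ?N = "{\<phi> \<in> carrier ?F. free_lift W g \<phi> = \<zero>\<^bsub>W\<^esub>}"
 have "submodule ?N K ?F"
 proof (rule F.submoduleI)
  show "\<ominus>\<^bsub>?F\<^esub> a \<in> ?N" if "a \<in> ?N" for a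
   using that linD(3)[OF L, of "\<ominus> \<one>" a] alg_minus(3)[OF aF, of "\<zero>\<^bsub>?F\<^esub>" a] W aF by simp
 qed (use linD[OF L] lin_zero[OF L aF W] W in auto)
 moreover have "r \<in> ?N" if r: "r \<in> multilinear_relators K Ms" for r
 proof -
  have "r \<in> carrier ?F" using r multilinear_relators_carrier[OF Ms] by blast
  moreover have "free_lift W g r = \<zero>\<^bsub>W\<^esub>"
   using r unfolding multilinear_relators_def
  proof (elim UnE CollectE exE conjE)
   fix xs l x y assume *: "r = single K (xs[l := x \<oplus>\<^bsub>Ms ! l\<^esub> y]) \<ominus>\<^bsub>?F\<^esub> (single K (xs[l := x]) \<oplus>\<^bsub>?F\<^esub> single K (xs[l := y]))"
    "xs \<in> RD Ms" "l < length Ms" "x \<in> carrier (Ms ! l)" "y \<in> carrier (Ms ! l)"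
   have "alg (Ms ! l)" using * Ms by simp
   then show ?thesis using * linD(2)[OF multilin_update[OF g *(2,3)] *(4,5)] W linD(1)[OF multilin_update[OF g *(2,3)]]
    by (simp add: lin_minus[OF L aF W] linD[OF L] single_free_tensor RD_update aF S alg_minus(2))
  next
   fix xs l c x assume *: "r = single K (xs[l := c \<odot>\<^bsub>Ms ! l\<^esub> x]) \<ominus>\<^bsub>?F\<^esub> (c \<odot>\<^bsub>?F\<^esub> single K (xs[l := x]))"
    "xs \<in> RD Ms" "l < length Ms" "c \<in> \<K>" "x \<in> carrier (Ms ! l)"
   have "alg (Ms ! l)" using * Ms by simp
   then show ?thesis using * linD(3)[OF multilin_update[OF g *(2,3)] *(4,5)] W linD(1)[OF multilin_update[OF g *(2,3)]]
    by (simp add: lin_minus[OF L aF W] linD[OF L] single_free_tensor RD_update aF S alg_minus(2))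
  qed
  ultimately show ?thesis by simp
 qed
 ultimately show ?thesis using tensor_relations_submodule(3)[OF Ms, of ?N] \<phi> by blast
qed

lemma tensor_lift_tproj:
 assumes Ms: "algs Ms" and W: "alg W" and g: "multilin Ms W g" and \<phi>: "\<phi> \<in> carrier (free Ms)"
 shows "tlift W g (tproj Ms \<phi>) = free_lift W g \<phi>"
proof -
 let ?F = "free Ms"
 have aF: "alg ?F" by (rule algebra_free_tensor[OF Ms])
 have L: "lin ?F W (free_lift W g)"
  unfolding free_tensor_def using W multilin_closed[OF g] by (intro lin_free_lift) auto
 have "free_lift W g \<chi> = free_lift W g \<phi>" if "\<chi> \<in> tproj Ms \<phi>" for \<chi>
 proof -
  have \<chi>: "\<chi> \<in> carrier ?F" "tproj Ms \<chi> = tproj Ms \<phi>" using tproj_mem(2)[OF Ms \<phi> that] by simp_all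
  then have "\<chi> \<ominus>\<^bsub>?F\<^esub> \<phi> \<in> rels Ms" using tproj_eq_iff[OF Ms] \<phi> by blast
  then have "free_lift W g \<chi> \<ominus>\<^bsub>W\<^esub> free_lift W g \<phi> = \<zero>\<^bsub>W\<^esub>"
   using free_lift_relations[OF Ms W g] lin_minus[OF L aF W \<chi>(1) \<phi>] by simp
  then show ?thesis using alg_minus(2)[OF W linD(1)[OF L \<chi>(1)] linD(1)[OF L \<phi>]] by simp
 qed
 then have "free_lift W g ` tproj Ms \<phi> = (\<lambda>_. free_lift W g \<phi>) ` tproj Ms \<phi>" by (rule image_cong[OF refl])
 then have "free_lift W g ` tproj Ms \<phi> = {free_lift W g \<phi>}"
  using tproj_mem(1)[OF Ms \<phi>] by (metis empty_iff image_constant)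
 then show ?thesis by (simp add: tensor_lift_def free_lift_def[abs_def])
qed

lemma lin_tensor_lift [simp]:
 assumes Ms: "algs Ms" and W: "alg W" and g: "multilin Ms W g"
 shows "lin (tens Ms) W (tlift W g)"
proof -
 let ?F = "free Ms"
 have aF: "alg ?F" by (rule algebra_free_tensor[OF Ms])
 have L: "lin ?F W (free_lift W g)"
  unfolding free_tensor_def using W multilin_closed[OF g] by (intro lin_free_lift) auto
 show ?thesis
 proof (rule linI)
  note s = tensor_simps[OF Ms] tensor_lift_tproj[OF assms] linD[OF L] aF
  fix x assume "x \<in> TC Ms"
  then obtain \<phi> where \<phi>: "\<phi> \<in> carrier ?F" "x = tproj Ms \<phi>" unfolding s(1) by blast
  show "tlift W g x \<in> carrier W" using \<phi> by (simp add: s)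
  show "tlift W g (c \<odot>\<^bsub>tens Ms\<^esub> x) = c \<odot>\<^bsub>W\<^esub> tlift W g x" if "c \<in> \<K>" for c
   using \<phi> that by (simp add: s)
  fix y assume "y \<in> TC Ms"
  then obtain \<chi> where \<chi>: "\<chi> \<in> carrier ?F" "y = tproj Ms \<chi>" unfolding s(1) by blast
  show "tlift W g (x \<oplus>\<^bsub>tens Ms\<^esub> y) = tlift W g x \<oplus>\<^bsub>W\<^esub> tlift W g y"
   using \<phi> \<chi> by (simp add: s)
 qed
qed

lemma tensor_lift_pure [simp]:
 assumes Ms: "algs Ms" and W: "alg W" and g: "multilin Ms W g" and xs: "xs \<in> RD Ms"
 shows "tlift W g (pur Ms xs) = g xs"
 using assms by (simp add: pure_tproj tensor_lift_tproj single_free_tensor free_lift_single multilin_closed)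

lemma tensor_lift_unique:
 assumes Ms: "algs Ms" and W: "alg W" and g: "multilin Ms W g" and h: "lin (tens Ms) W h"
  and eq: "\<And>xs. xs \<in> RD Ms \<Longrightarrow> h (pur Ms xs) = g xs" and t: "t \<in> TC Ms"
 shows "h t = tlift W g t"
proof (rule tensor_ext[OF Ms W h lin_tensor_lift[OF Ms W g] _ t])
 show "h (pur Ms xs) = tlift W g (pur Ms xs)" if "xs \<in> RD Ms" for xs
  by (simp add: eq that tensor_lift_pure[OF Ms W g])
qed

lemma ex_scalar_inverse: "a \<in> \<K> \<Longrightarrow> a \<noteq> \<zero> \<Longrightarrow> \<exists>b\<in>\<K>. b \<otimes> a = \<one>"
 using field_Units Units_l_inv_ex by auto

lemma tensor_lift_lin:
 assumes Ms: "algs Ms" and W: "alg W" "alg W'" and g: "multilin Ms W g" and L: "lin W W' L"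
  and t: "t \<in> TC Ms"
 shows "L (tlift W g t) = tlift W' (\<lambda>xs. L (g xs)) t"
proof (rule tensor_lift_unique[OF Ms W(2) lin_multilin[OF g L] lin_comp[OF lin_tensor_lift[OF Ms W(1) g] L] _ t])
 show "L (tlift W g (pur Ms xs)) = L (g xs)" if "xs \<in> RD Ms" for xs
  by (simp only: tensor_lift_pure[OF Ms W(1) g that])
qed

lemma tensor_lift_cong:
 assumes Ms: "algs Ms" and W: "alg W" and g: "multilin Ms W g"
  and eq: "\<And>xs. xs \<in> RD Ms \<Longrightarrow> f xs = g xs" and t: "t \<in> TC Ms"
 shows "tlift W f t = tlift W g t"
proof (rule tensor_lift_unique[OF Ms W g _ _ t])
 have f: "multilin Ms W f" by (rule multilin_cong[OF Ms g eq])
 show "lin (tens Ms) W (tlift W f)" by (rule lin_tensor_lift[OF Ms W f])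
 show "tlift W f (pur Ms xs) = g xs" if "xs \<in> RD Ms" for xs
  by (simp add: tensor_lift_pure[OF Ms W f that] eq[OF that])
qed

lemma tensor_lift_closed:
 assumes "algs Ms" "alg W" "multilin Ms W g" "t \<in> TC Ms"
 shows "tlift W g t \<in> carrier W"
 by (rule linD(1)[OF lin_tensor_lift[OF assms(1-3)] assms(4)])

lemma lin_tensor_lift_param:
 assumes Ns: "algs Ns" and W: "alg W" and h: "\<And>x. x \<in> carrier M \<Longrightarrow> multilin Ns W (h x)"
  and l: "\<And>ys. ys \<in> RD Ns \<Longrightarrow> lin M W (\<lambda>x. h x ys)" and M: "alg M"
  and t: "t \<in> TC Ns"
 shows "lin M W (\<lambda>x. tlift W (h x) t)"
proof (rule linI)
 fix x assume x: "x \<in> carrier M"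
 note L = lin_tensor_lift[OF Ns W h]
 show "tlift W (h x) t \<in> carrier W" by (rule tensor_lift_closed[OF Ns W h[OF x] t])
 show "tlift W (h (c \<odot>\<^bsub>M\<^esub> x)) t = c \<odot>\<^bsub>W\<^esub> tlift W (h x) t" if c: "c \<in> \<K>" for c
 proof -
  have cx: "c \<odot>\<^bsub>M\<^esub> x \<in> carrier M" using c x M by simp
  show ?thesis
  proof (rule tensor_lift_unique[OF Ns W h[OF cx] lin_smult[OF W c L[OF x]] _ t, symmetric])
   show "c \<odot>\<^bsub>W\<^esub> tlift W (h x) (pur Ns ys) = h (c \<odot>\<^bsub>M\<^esub> x) ys" if "ys \<in> RD Ns" for ys
    by (simp only: tensor_lift_pure[OF Ns W h[OF x] that] linD(3)[OF l[OF that] c x])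
  qed
 qed
 show "tlift W (h (x \<oplus>\<^bsub>M\<^esub> y)) t = tlift W (h x) t \<oplus>\<^bsub>W\<^esub> tlift W (h y) t"
  if y: "y \<in> carrier M" for y
 proof -
  have xy: "x \<oplus>\<^bsub>M\<^esub> y \<in> carrier M" using y x M by simp
  show ?thesis
  proof (rule tensor_lift_unique[OF Ns W h[OF xy] lin_add[OF W L[OF x] L[OF y]] _ t, symmetric])
   show "tlift W (h x) (pur Ns ys) \<oplus>\<^bsub>W\<^esub> tlift W (h y) (pur Ns ys) = h (x \<oplus>\<^bsub>M\<^esub> y) ys"
    if "ys \<in> RD Ns" for ys
    by (simp only: tensor_lift_pure[OF Ns W h[OF x] that] tensor_lift_pure[OF Ns W h[OF y] that] linD(2)[OF l[OF that] x y])
  qed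
 qed
qed

lemma multilin_tensor_lift_param:
 assumes Ns: "algs Ns" and W: "alg W" and t: "t \<in> TC Ns"
 shows "\<lbrakk>algs Ms; (\<And>xs. xs \<in> RD Ms \<Longrightarrow> multilin Ns W (h xs)); (\<And>ys. ys \<in> RD Ns \<Longrightarrow> multilin Ms W (\<lambda>xs. h xs ys))\<rbrakk> \<Longrightarrow>
   multilin Ms W (\<lambda>xs. tlift W (h xs) t)"
proof (induction Ms arbitrary: h)
 case Nil
 show ?case using tensor_lift_closed[OF Ns W Nil(2)[of "[]"] t] by simp
next
 case (Cons M Ms)
 have "lin M W (\<lambda>x. tlift W (h (x # xs)) t)" if xs: "xs \<in> RD Ms" for xs
 proof (rule lin_tensor_lift_param[OF Ns W _ _ _ t])
  show "multilin Ns W (h (x # xs))" if "x \<in> carrier M" for x using Cons.prems(2)[of "x # xs"] that xs by simp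
  show "lin M W (\<lambda>x. h (x # xs) ys)" if "ys \<in> RD Ns" for ys using Cons.prems(3)[OF that] xs by simp
  show "alg M" using Cons.prems(1) by simp
 qed
 moreover have "multilin Ms W (\<lambda>xs. tlift W (h (x # xs)) t)" if x: "x \<in> carrier M" for x
 proof (rule Cons.IH)
  show "algs Ms" using Cons.prems(1) by simp
  show "multilin Ns W (h (x # xs))" if "xs \<in> RD Ms" for xs using Cons.prems(2)[of "x # xs"] that x by simp
  show "multilin Ms W (\<lambda>xs. h (x # xs) ys)" if "ys \<in> RD Ns" for ys using Cons.prems(3)[OF that] x by simp
 qed
 ultimately show ?case by simp
qed

lemma multilin_expand:
 assumes M1: "algs Ms" and M: "alg M" and M2: "algs Ms'" and Ns: "algs Ns" and W: "alg W"
  and g: "multilin (Ms @ Ns @ Ms') W g" and D: "lin M (tens Ns) D" and l: "l = length Ms"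
 shows "multilin (Ms @ M # Ms') W
  (\<lambda>xs. tlift W (\<lambda>ys. g (take l xs @ ys @ drop (Suc l) xs)) (D (xs ! l)))"
proof -
 let ?f = "\<lambda>xs. tlift W (\<lambda>ys. g (take l xs @ ys @ drop (Suc l) xs)) (D (xs ! l))"
 have f: "?f (as @ x # bs) = tlift W (\<lambda>ys. g (as @ ys @ bs)) (D x)" if "as \<in> RD Ms" for as x bs
  using RD_length[OF that] l nth_append_length[of as x bs] by simp
 have g1: "multilin Ms W (\<lambda>as. g (as @ ys @ bs))" if "ys \<in> RD Ns" "bs \<in> RD Ms'" for ys bs
  using g[unfolded multilin_append] that by simp
 have g2: "multilin Ns W (\<lambda>ys. g (as @ ys @ bs))" if "as \<in> RD Ms" "bs \<in> RD Ms'" for as bs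
  using g[unfolded multilin_append] that by simp
 have g3: "multilin Ms' W (\<lambda>bs. g (as @ ys @ bs))" if "as \<in> RD Ms" "ys \<in> RD Ns" for as ys
  using g[unfolded multilin_append] that by simp
 note Dx = linD(1)[OF D]
 have "multilin Ms W (\<lambda>as. ?f (as @ x # bs))" if "x \<in> carrier M" "bs \<in> RD Ms'" for x bs
 proof (rule multilin_cong[OF M1 _ f])
  show "multilin Ms W (\<lambda>as. tlift W (\<lambda>ys. g (as @ ys @ bs)) (D x))"
   by (rule multilin_tensor_lift_param[OF Ns W Dx[OF that(1)] M1 g2[OF _ that(2)] g1[OF _ that(2)]])
 qed
 moreover have "multilin (M # Ms') W (\<lambda>ys. ?f (as @ ys))" if as: "as \<in> RD Ms" for as
 proof -
  have "lin M W (\<lambda>x. tlift W (\<lambda>ys. g (as @ ys @ bs)) (D x))" if "bs \<in> RD Ms'" for bs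
   by (rule lin_comp[OF D lin_tensor_lift[OF Ns W g2[OF as that]]])
  moreover have "multilin Ms' W (\<lambda>bs. tlift W (\<lambda>ys. g (as @ ys @ bs)) (D x))" if "x \<in> carrier M" for x
   by (rule multilin_tensor_lift_param[OF Ns W Dx[OF that] M2 g2[OF as] g3[OF as]])
  ultimately show ?thesis unfolding multilin.simps f[OF as] by blast
 qed
 ultimately show ?thesis unfolding multilin_append by (auto elim!: RD_ConsE)
qed

subsection \<open>Linear functionals separate points\<close>

definition subspace :: "('k, 'v, 'n) module_scheme \<Rightarrow> 'v set \<Rightarrow> bool" where
 "subspace M N \<longleftrightarrow> N \<subseteq> carrier M \<and> \<zero>\<^bsub>M\<^esub> \<in> N \<and> (\<forall>x\<in>N. \<forall>y\<in>N. x \<oplus>\<^bsub>M\<^esub> y \<in> N) \<and>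
   (\<forall>c\<in>\<K>. \<forall>x\<in>N. c \<odot>\<^bsub>M\<^esub> x \<in> N)"

text \<open>A subspace that is maximal among those avoiding \<open>x\<close> is a hyperplane complementary to the
  line through \<open>x\<close>; the functional is the coordinate along that line.\<close>

lemma ex_functional:
 assumes M: "alg M" and x: "x \<in> carrier M" "x \<noteq> \<zero>\<^bsub>M\<^esub>"
 shows "\<exists>\<phi>. fnl M \<phi> \<and> \<phi> x \<noteq> \<zero>"
proof -
 interpret M: algebra K M by fact
 let ?A = "{N. subspace M N \<and> x \<notin> N}"
 have "\<exists>N\<in>?A. \<forall>X\<in>?A. N \<subseteq> X \<longrightarrow> X = N"
 proof (rule subset_Zorn_nonempty)
  have "{\<zero>\<^bsub>M\<^esub>} \<in> ?A" using x M by (simp add: subspace_def)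
  then show "?A \<noteq> {}" by blast
  fix C assume C: "C \<noteq> {}" "subset.chain ?A C"
  then have CA: "subspace M X" "x \<notin> X" if "X \<in> C" for X using that by (auto simp: subset_chain_def)
  have "y \<oplus>\<^bsub>M\<^esub> z \<in> \<Union>C" if "y \<in> \<Union>C" "z \<in> \<Union>C" for y z
  proof -
   from that obtain Y Z where YZ: "y \<in> Y" "Y \<in> C" "z \<in> Z" "Z \<in> C" by blast
   then have "Y \<subseteq> Z \<or> Z \<subseteq> Y" using C(2) unfolding subset_chain_def by blast
   then obtain X where "X \<in> C" "y \<in> X" "z \<in> X" using YZ by blast
   then show ?thesis using CA(1)[OF \<open>X \<in> C\<close>] unfolding subspace_def by blast
  qed
  moreover have "\<zero>\<^bsub>M\<^esub> \<in> \<Union>C" using C(1) CA(1) unfolding subspace_def by blast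
  moreover have "\<Union>C \<subseteq> carrier M" using CA(1) unfolding subspace_def by blast
  moreover have "c \<odot>\<^bsub>M\<^esub> y \<in> \<Union>C" if "c \<in> \<K>" "y \<in> \<Union>C" for c y
  proof -
   from that obtain Y where Y: "y \<in> Y" "Y \<in> C" by blast
   then have "c \<odot>\<^bsub>M\<^esub> y \<in> Y" using CA(1)[OF Y(2)] that(1) unfolding subspace_def by blast
   then show ?thesis using Y by blast
  qed
  moreover have "x \<notin> \<Union>C" using CA(2) by blast
  ultimately show "\<Union>C \<in> ?A" unfolding subspace_def by blast
 qed
 then obtain N where N: "subspace M N" "x \<notin> N" and max: "\<And>X. \<lbrakk>subspace M X; x \<notin> X; N \<subseteq> X\<rbrakk> \<Longrightarrow> X = N"
  by auto
 have Ns: "n \<in> carrier M" if "n \<in> N" for n using N(1) that unfolding subspace_def by blast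
 have Na: "m \<oplus>\<^bsub>M\<^esub> n \<in> N" if "m \<in> N" "n \<in> N" for m n using N(1) that unfolding subspace_def by blast
 have Nm: "c \<odot>\<^bsub>M\<^esub> n \<in> N" if "c \<in> \<K>" "n \<in> N" for c n using N(1) that unfolding subspace_def by blast
 have N0: "\<zero>\<^bsub>M\<^esub> \<in> N" using N(1) unfolding subspace_def by blast
 have ex: "\<exists>c\<in>\<K>. \<exists>n\<in>N. y = n \<oplus>\<^bsub>M\<^esub> c \<odot>\<^bsub>M\<^esub> x" if y: "y \<in> carrier M" for y
 proof (cases "y \<in> N")
  case True
  have "y = y \<oplus>\<^bsub>M\<^esub> \<zero> \<odot>\<^bsub>M\<^esub> x" using x y M by simp
  then show ?thesis using True zero_closed by blast
 next
  case False
  let ?N' = "{z. \<exists>n\<in>N. \<exists>d\<in>\<K>. z = n \<oplus>\<^bsub>M\<^esub> d \<odot>\<^bsub>M\<^esub> y}"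
  have "subspace M ?N'" unfolding subspace_def
  proof (intro conjI ballI)
   show "?N' \<subseteq> carrier M" using Ns y M by auto
   have "\<zero>\<^bsub>M\<^esub> = \<zero>\<^bsub>M\<^esub> \<oplus>\<^bsub>M\<^esub> \<zero> \<odot>\<^bsub>M\<^esub> y" using y M by simp
   then show "\<zero>\<^bsub>M\<^esub> \<in> ?N'" using N0 zero_closed by blast
   fix z assume "z \<in> ?N'"
   then obtain n d where z: "n \<in> N" "d \<in> \<K>" "z = n \<oplus>\<^bsub>M\<^esub> d \<odot>\<^bsub>M\<^esub> y" by blast
   show "c \<odot>\<^bsub>M\<^esub> z \<in> ?N'" if c: "c \<in> \<K>" for c
   proof -
    have "c \<odot>\<^bsub>M\<^esub> z = c \<odot>\<^bsub>M\<^esub> n \<oplus>\<^bsub>M\<^esub> (c \<otimes> d) \<odot>\<^bsub>M\<^esub> y"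
     using z c y Ns M by (simp add: alg_distrib alg_smult)
    then show ?thesis using Nm[OF c z(1)] m_closed[OF c z(2)] by blast
   qed
   fix z' assume "z' \<in> ?N'"
   then obtain n' d' where z': "n' \<in> N" "d' \<in> \<K>" "z' = n' \<oplus>\<^bsub>M\<^esub> d' \<odot>\<^bsub>M\<^esub> y" by blast
   have "z \<oplus>\<^bsub>M\<^esub> z' = (n \<oplus>\<^bsub>M\<^esub> n') \<oplus>\<^bsub>M\<^esub> (d \<oplus> d') \<odot>\<^bsub>M\<^esub> y"
    using z z' y Ns M by (simp add: alg_distrib alg_add_ac)
   then show "z \<oplus>\<^bsub>M\<^esub> z' \<in> ?N'" using Na[OF z(1) z'(1)] a_closed[OF z(2) z'(2)] by blast
  qed
  moreover have "N \<subseteq> ?N'"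
  proof
   fix n assume n: "n \<in> N"
   then have "n = n \<oplus>\<^bsub>M\<^esub> \<zero> \<odot>\<^bsub>M\<^esub> y" using Ns y M by simp
   then show "n \<in> ?N'" using n zero_closed by blast
  qed
  moreover have "y \<in> ?N'"
  proof -
   have "y = \<zero>\<^bsub>M\<^esub> \<oplus>\<^bsub>M\<^esub> \<one> \<odot>\<^bsub>M\<^esub> y" using y M by simp
   then show ?thesis using N0 one_closed by blast
  qed
  ultimately have "x \<in> ?N'" using max[of ?N'] False by blast
  then obtain n d where z: "n \<in> N" "d \<in> \<K>" "x = n \<oplus>\<^bsub>M\<^esub> d \<odot>\<^bsub>M\<^esub> y" by blast
  have "d \<noteq> \<zero>"
  proof
   assume "d = \<zero>"
   then have "x = n" using z y Ns M by simp
   then show False using z(1) N(2) by simp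
  qed
  then obtain b where b: "b \<in> \<K>" "b \<otimes> d = \<one>" using ex_scalar_inverse z(2) by blast
  have bn: "b \<odot>\<^bsub>M\<^esub> n \<in> carrier M" using b z(1) Ns M by simp
  have bx: "b \<odot>\<^bsub>M\<^esub> x = b \<odot>\<^bsub>M\<^esub> n \<oplus>\<^bsub>M\<^esub> y"
   using z b y Ns M by (simp add: alg_distrib alg_smult)
  have "(\<ominus> \<one>) \<odot>\<^bsub>M\<^esub> (b \<odot>\<^bsub>M\<^esub> n) \<oplus>\<^bsub>M\<^esub> b \<odot>\<^bsub>M\<^esub> x = (\<ominus>\<^bsub>M\<^esub> (b \<odot>\<^bsub>M\<^esub> n) \<oplus>\<^bsub>M\<^esub> b \<odot>\<^bsub>M\<^esub> n) \<oplus>\<^bsub>M\<^esub> y"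
   unfolding bx alg_minus(3)[OF M bn bn] using bn y by (simp add: M.a_assoc)
  also have "\<dots> = y" using bn y by (simp add: M.l_neg)
  finally have "y = (\<ominus> \<one>) \<odot>\<^bsub>M\<^esub> (b \<odot>\<^bsub>M\<^esub> n) \<oplus>\<^bsub>M\<^esub> b \<odot>\<^bsub>M\<^esub> x" ..
  moreover have "(\<ominus> \<one>) \<odot>\<^bsub>M\<^esub> (b \<odot>\<^bsub>M\<^esub> n) \<in> N" using Nm b(1) z(1) by simp
  ultimately show ?thesis using b(1) by blast
 qed
 have uniq: "c = c'" if "n \<in> N" "n' \<in> N" "c \<in> \<K>" "c' \<in> \<K>"
   "n \<oplus>\<^bsub>M\<^esub> c \<odot>\<^bsub>M\<^esub> x = n' \<oplus>\<^bsub>M\<^esub> c' \<odot>\<^bsub>M\<^esub> x" for n n' c c'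
 proof (rule ccontr)
  assume ne: "c \<noteq> c'"
  let ?d = "c \<ominus> c'"
  have d: "?d \<in> \<K>" "c = ?d \<oplus> c'" using that(3,4) by (simp_all add: minus_eq a_assoc l_neg)
  have "?d \<noteq> \<zero>" using ne d(2) that by auto
  then obtain b where b: "b \<in> \<K>" "b \<otimes> ?d = \<one>" using ex_scalar_inverse d(1) by blast
  have "n \<oplus>\<^bsub>M\<^esub> c \<odot>\<^bsub>M\<^esub> x = (n \<oplus>\<^bsub>M\<^esub> ?d \<odot>\<^bsub>M\<^esub> x) \<oplus>\<^bsub>M\<^esub> c' \<odot>\<^bsub>M\<^esub> x"
   by (subst d(2)) (use d(1) that x Ns M in \<open>simp add: alg_distrib alg_add_ac\<close>)
  then have "(n \<oplus>\<^bsub>M\<^esub> ?d \<odot>\<^bsub>M\<^esub> x) \<oplus>\<^bsub>M\<^esub> c' \<odot>\<^bsub>M\<^esub> x = n' \<oplus>\<^bsub>M\<^esub> c' \<odot>\<^bsub>M\<^esub> x" using that(5) by simp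
  then have "n \<oplus>\<^bsub>M\<^esub> ?d \<odot>\<^bsub>M\<^esub> x = n'" using that x d(1) Ns M.add.right_cancel by simp
  then have "?d \<odot>\<^bsub>M\<^esub> x = (\<ominus> \<one>) \<odot>\<^bsub>M\<^esub> n \<oplus>\<^bsub>M\<^esub> n'"
   using that x d(1) Ns M by (auto simp: alg_minus(3)[OF M, of n n] M.a_assoc[symmetric] M.l_neg)
  then have "?d \<odot>\<^bsub>M\<^esub> x \<in> N" using Na Nm that by simp
  then have "b \<odot>\<^bsub>M\<^esub> (?d \<odot>\<^bsub>M\<^esub> x) \<in> N" using Nm b(1) by blast
  then have "x \<in> N" using b d(1) x M by (simp add: alg_smult)
  then show False using N(2) by simp
 qed
 define \<phi> where "\<phi> y = (THE c. c \<in> \<K> \<and> (\<exists>n\<in>N. y = n \<oplus>\<^bsub>M\<^esub> c \<odot>\<^bsub>M\<^esub> x))" for y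
 have \<phi>: "\<phi> (n \<oplus>\<^bsub>M\<^esub> c \<odot>\<^bsub>M\<^esub> x) = c" if "n \<in> N" "c \<in> \<K>" for n c
  unfolding \<phi>_def
 proof (rule the_equality)
  show "c \<in> \<K> \<and> (\<exists>n'\<in>N. n \<oplus>\<^bsub>M\<^esub> c \<odot>\<^bsub>M\<^esub> x = n' \<oplus>\<^bsub>M\<^esub> c \<odot>\<^bsub>M\<^esub> x)" using that by blast
  show "d = c" if D: "d \<in> \<K> \<and> (\<exists>n'\<in>N. n \<oplus>\<^bsub>M\<^esub> c \<odot>\<^bsub>M\<^esub> x = n' \<oplus>\<^bsub>M\<^esub> d \<odot>\<^bsub>M\<^esub> x)" for d
  proof -
   obtain n' where "n' \<in> N" "n \<oplus>\<^bsub>M\<^esub> c \<odot>\<^bsub>M\<^esub> x = n' \<oplus>\<^bsub>M\<^esub> d \<odot>\<^bsub>M\<^esub> x" using D by blast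
   then show ?thesis using uniq[of n n' c d] \<open>n \<in> N\<close> \<open>c \<in> \<K>\<close> D by simp
  qed
 qed
 have "fnl M \<phi>"
 proof (rule linI)
  fix y assume "y \<in> carrier M"
  then obtain n d where y: "n \<in> N" "d \<in> \<K>" "y = n \<oplus>\<^bsub>M\<^esub> d \<odot>\<^bsub>M\<^esub> x" using ex by blast
  show "\<phi> y \<in> carrier (Ks)" using y \<phi> by simp
  show "\<phi> (c \<odot>\<^bsub>M\<^esub> y) = c \<odot>\<^bsub>Ks\<^esub> \<phi> y" if c: "c \<in> \<K>" for c
  proof -
   have "c \<odot>\<^bsub>M\<^esub> y = c \<odot>\<^bsub>M\<^esub> n \<oplus>\<^bsub>M\<^esub> (c \<otimes> d) \<odot>\<^bsub>M\<^esub> x"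
    using y c x Ns M by (simp add: alg_distrib alg_smult)
   then show ?thesis using y c Nm \<phi> by simp
  qed
  fix z assume "z \<in> carrier M"
  then obtain n' d' where z: "n' \<in> N" "d' \<in> \<K>" "z = n' \<oplus>\<^bsub>M\<^esub> d' \<odot>\<^bsub>M\<^esub> x" using ex by blast
  have "y \<oplus>\<^bsub>M\<^esub> z = (n \<oplus>\<^bsub>M\<^esub> n') \<oplus>\<^bsub>M\<^esub> (d \<oplus> d') \<odot>\<^bsub>M\<^esub> x"
   using y z x Ns M by (simp add: alg_distrib alg_add_ac)
  then show "\<phi> (y \<oplus>\<^bsub>M\<^esub> z) = \<phi> y \<oplus>\<^bsub>Ks\<^esub> \<phi> z" using y z Na \<phi> by simp
 qed
 moreover have "\<phi> x = \<one>" using \<phi>[OF N0 one_closed] x M by simp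
 ultimately show ?thesis using one_not_zero by metis
qed

text \<open>All equations between elements are checked on a separating set. Allowing sets smaller than
  the whole dual matters for the product algebra, where functionals on one factor suffice.\<close>

definition separating :: "('k, 'v, 'n) module_scheme \<Rightarrow> ('v \<Rightarrow> 'k) set \<Rightarrow> bool" where
 "separating M E \<longleftrightarrow> (\<forall>e\<in>E. fnl M e) \<and> (\<forall>x\<in>carrier M. (\<forall>e\<in>E. e x = \<zero>) \<longrightarrow> x = \<zero>\<^bsub>M\<^esub>)"

lemma separating_functionals: "alg M \<Longrightarrow> separating M {e. fnl M e}"
 unfolding separating_def using ex_functional[of M] by blast

lemma separating_eqI:
 assumes S: "separating M E" and M: "alg M" and x: "x \<in> carrier M" and y: "y \<in> carrier M"
  and eq: "\<And>e. e \<in> E \<Longrightarrow> e x = e y"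
 shows "x = y"
proof -
 have "e (x \<ominus>\<^bsub>M\<^esub> y) = \<zero>" if e: "e \<in> E" for e
 proof -
  have fe: "fnl M e" using S e unfolding separating_def by blast
  have "e (x \<ominus>\<^bsub>M\<^esub> y) = e x \<ominus>\<^bsub>Ks\<^esub> e y"
   by (rule lin_minus[OF fe M algebra_Ks x y])
  also have "\<dots> = \<zero>"
   using alg_minus(2)[OF algebra_Ks, of "e x" "e y"] eq[OF e] fnl_closed[OF fe x] fnl_closed[OF fe y] by simp
  finally show ?thesis .
 qed
 then have "x \<ominus>\<^bsub>M\<^esub> y = \<zero>\<^bsub>M\<^esub>" using S x y M unfolding separating_def by simp
 then show ?thesis using alg_minus(2)[OF M x y] by simp
qed

subsection \<open>Evaluating tensors at tuples of functionals\<close>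

primrec pev :: "('v \<Rightarrow> 'k) list \<Rightarrow> 'v list \<Rightarrow> 'k" where
 "pev [] xs = \<one>"
| "pev (\<phi> # \<phi>s) xs = \<phi> (hd xs) \<otimes> pev \<phi>s (tl xs)"

definition tev :: "('v \<Rightarrow> 'k) list \<Rightarrow> ('k, 'v) tensor \<Rightarrow> 'k" where
 "tev \<phi>s = tlift (Ks) (pev \<phi>s)"

abbreviation fnls :: "('k, 'v, 'n) module_scheme list \<Rightarrow> ('v \<Rightarrow> 'k) list \<Rightarrow> bool" where
 "fnls \<equiv> list_all2 fnl"

lemma multilin_pev [simp]: "fnls Ms \<phi>s \<Longrightarrow> multilin Ms (Ks) (pev \<phi>s)"
proof (induction rule: list_all2_induct)
 case (Cons M Ms \<phi> \<phi>s)
 have "fnl M (\<lambda>x. \<phi> x \<otimes> pev \<phi>s ys)" if "ys \<in> RD Ms" for ys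
  using lin_smult_left[OF algebra_Ks, of "pev \<phi>s ys" M \<phi>] multilin_closed[OF Cons.IH that] Cons.hyps(1) by simp
 moreover have "multilin Ms (Ks) (\<lambda>ys. \<phi> x \<otimes> pev \<phi>s ys)" if "x \<in> carrier M" for x
  using lin_multilin[OF Cons.IH lin_smult[OF algebra_Ks _ lin_id], of "\<phi> x"] fnl_closed[OF Cons.hyps(1) that] by simp
 ultimately show ?case by simp
qed simp

lemma pev_closed: "fnls Ms \<phi>s \<Longrightarrow> xs \<in> RD Ms \<Longrightarrow> pev \<phi>s xs \<in> \<K>"
 using multilin_closed[OF multilin_pev] by fastforce

lemma pev_append:
 "\<lbrakk>fnls Ms \<phi>s; fnls Ns \<chi>s; xs \<in> RD Ms; ys \<in> RD Ns\<rbrakk> \<Longrightarrow> pev (\<phi>s @ \<chi>s) (xs @ ys) = pev \<phi>s xs \<otimes> pev \<chi>s ys"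
proof (induction arbitrary: xs rule: list_all2_induct)
 case Nil
 then show ?case using pev_closed[OF Nil(1,3)] Nil(2) by simp
next
 case (Cons M Ms \<phi> \<phi>s)
 obtain z zs where xs: "xs = z # zs" "z \<in> carrier M" "zs \<in> RD Ms" using Cons.prems(2) by (rule RD_ConsE)
 then show ?case
  using Cons fnl_closed[OF Cons.hyps(1) xs(2)] pev_closed[OF Cons.hyps(2) xs(3)] pev_closed[OF Cons.prems(1,3)]
  by (simp add: m_assoc)
qed

lemma fnl_tev [simp]: "algs Ms \<Longrightarrow> fnls Ms \<phi>s \<Longrightarrow> fnl (tens Ms) (tev \<phi>s)"
 unfolding tev_def by simp

lemma tev_closed: "\<lbrakk>algs Ms; fnls Ms \<phi>s; t \<in> TC Ms\<rbrakk> \<Longrightarrow> tev \<phi>s t \<in> \<K>"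
 using fnl_closed[OF fnl_tev] by blast

lemma tev_pure: "\<lbrakk>algs Ms; fnls Ms \<phi>s; xs \<in> RD Ms\<rbrakk> \<Longrightarrow> tev \<phi>s (pur Ms xs) = pev \<phi>s xs"
 unfolding tev_def by (rule tensor_lift_pure) simp_all

lemma tev_tensor_lift:
 assumes "algs Ms" "algs Ns" "fnls Ns \<phi>s" "multilin Ms (tens Ns) g" "t \<in> TC Ms"
 shows "tev \<phi>s (tlift (tens Ns) g t) = tlift (Ks) (\<lambda>xs. tev \<phi>s (g xs)) t"
 by (rule tensor_lift_lin[OF assms(1) alg_tens[OF assms(2)] algebra_Ks assms(4) fnl_tev[OF assms(2,3)] assms(5)])

lemma tev_eqI:
 assumes "algs Ms" "fnls Ms \<phi>s" "fnl (tens Ms) h" "\<And>xs. xs \<in> RD Ms \<Longrightarrow> h (pur Ms xs) = pev \<phi>s xs"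
  "t \<in> TC Ms"
 shows "h t = tev \<phi>s t"
 unfolding tev_def
 by (rule tensor_lift_unique[OF assms(1) algebra_Ks multilin_pev[OF assms(2)] assms(3,4,5)])

subsection \<open>Prepending a factor\<close>

definition tcons :: "('k, 'v, 'n) module_scheme list \<Rightarrow> 'v \<Rightarrow> ('k, 'v) tensor \<Rightarrow> ('k, 'v) tensor" where
 "tcons Ms x = tlift (tens Ms) (\<lambda>xs. pur Ms (x # xs))"

lemma multilin_pure_Cons:
 "algs (M # Ms) \<Longrightarrow> x \<in> carrier M \<Longrightarrow> multilin Ms (tens (M # Ms)) (\<lambda>xs. pur (M # Ms) (x # xs))"
 using multilin_pure[of "M # Ms"] by simp

lemma tcons_lin: "algs (M # Ms) \<Longrightarrow> x \<in> carrier M \<Longrightarrow> lin (tens Ms) (tens (M # Ms)) (tcons (M # Ms) x)"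
 unfolding tcons_def by (rule lin_tensor_lift[OF _ _ multilin_pure_Cons]) simp_all

lemma tcons_lin_left:
 assumes "algs (M # Ms)" "s \<in> TC Ms"
 shows "lin M (tens (M # Ms)) (\<lambda>x. tcons (M # Ms) x s)"
 unfolding tcons_def
 by (rule lin_tensor_lift_param) (use assms multilin_pure[of "M # Ms"] in simp_all)

lemma tcons_pure:
 "\<lbrakk>algs (M # Ms); x \<in> carrier M; xs \<in> RD Ms\<rbrakk> \<Longrightarrow> tcons (M # Ms) x (pur Ms xs) = pur (M # Ms) (x # xs)"
 unfolding tcons_def by (rule tensor_lift_pure[OF _ _ multilin_pure_Cons]) simp_all

lemma tcons_closed: "\<lbrakk>algs (M # Ms); x \<in> carrier M; s \<in> TC Ms\<rbrakk> \<Longrightarrow> tcons (M # Ms) x s \<in> TC (M # Ms)"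
 by (rule linD(1)[OF tcons_lin])

lemma tev_tcons:
 assumes Ms: "algs (M # Ms)" and x: "x \<in> carrier M" and s: "s \<in> TC Ms" and f: "fnl M \<phi>" "fnls Ms \<phi>s"
 shows "tev (\<phi> # \<phi>s) (tcons (M # Ms) x s) = \<phi> x \<otimes> tev \<phi>s s"
proof -
 have px: "\<phi> x \<in> \<K>" by (rule fnl_closed[OF f(1) x])
 have fs: "fnls (M # Ms) (\<phi> # \<phi>s)" using f by simp
 have Ms': "algs Ms" using Ms by simp
 have 1: "fnl (tens Ms) (\<lambda>s. tev (\<phi> # \<phi>s) (tcons (M # Ms) x s))"
  by (rule lin_comp[OF tcons_lin[OF Ms x] fnl_tev[OF Ms fs]])
 have 2: "fnl (tens Ms) (\<lambda>s. \<phi> x \<otimes> tev \<phi>s s)"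
  using lin_smult[OF algebra_Ks px fnl_tev[OF Ms' f(2)]] by simp
 show ?thesis
 proof (rule tensor_ext[OF Ms' algebra_Ks 1 2 _ s])
  show "tev (\<phi> # \<phi>s) (tcons (M # Ms) x (pur Ms xs)) = \<phi> x \<otimes> tev \<phi>s (pur Ms xs)" if xs: "xs \<in> RD Ms" for xs
   using tev_pure[OF Ms fs, of "x # xs"] tev_pure[OF Ms' f(2) xs] tcons_pure[OF Ms x xs] x xs by simp
 qed
qed

lemma tcons_mult:
 assumes Ms: "algs (M # Ms)" and x: "x \<in> carrier M" "y \<in> carrier M"
  and s: "s \<in> TC Ms" and t: "t \<in> TC Ms"
 shows "tcons (M # Ms) x s \<otimes>\<^bsub>tens (M # Ms)\<^esub> tcons (M # Ms) y t = tcons (M # Ms) (x \<otimes>\<^bsub>M\<^esub> y) (s \<otimes>\<^bsub>tens Ms\<^esub> t)"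
proof -
 let ?T = "tens (M # Ms)" and ?S = "tens Ms"
 have Ms': "algs Ms" and M: "alg M" using Ms by simp_all
 have xy: "x \<otimes>\<^bsub>M\<^esub> y \<in> carrier M" using x M by simp
 note T = alg_tens[OF Ms] and S = alg_tens[OF Ms']
 have *: "tcons (M # Ms) x s \<otimes>\<^bsub>?T\<^esub> tcons (M # Ms) y (pur Ms ys) = tcons (M # Ms) (x \<otimes>\<^bsub>M\<^esub> y) (s \<otimes>\<^bsub>?S\<^esub> pur Ms ys)"
  if ys: "ys \<in> RD Ms" for ys
 proof (rule tensor_ext[OF Ms' T _ _ _ s])
  have p: "pur Ms ys \<in> carrier ?S" by (rule pure_closed[OF Ms' ys])
  show "lin ?S ?T (\<lambda>s. tcons (M # Ms) x s \<otimes>\<^bsub>?T\<^esub> tcons (M # Ms) y (pur Ms ys))"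
   by (rule lin_mult_left[OF T tcons_closed[OF Ms x(2) p] tcons_lin[OF Ms x(1)]])
  show "lin ?S ?T (\<lambda>s. tcons (M # Ms) (x \<otimes>\<^bsub>M\<^esub> y) (s \<otimes>\<^bsub>?S\<^esub> pur Ms ys))"
   by (rule lin_comp[OF lin_mult_left[OF S p lin_id] tcons_lin[OF Ms xy]])
  show "tcons (M # Ms) x (pur Ms xs) \<otimes>\<^bsub>?T\<^esub> tcons (M # Ms) y (pur Ms ys) = tcons (M # Ms) (x \<otimes>\<^bsub>M\<^esub> y) (pur Ms xs \<otimes>\<^bsub>?S\<^esub> pur Ms ys)"
   if xs: "xs \<in> RD Ms" for xs
   using x xs ys xy Ms Ms' tcons_pure[OF Ms x(1) xs] tcons_pure[OF Ms x(2) ys]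
    tcons_pure[OF Ms xy RD_mult_closed[OF Ms' xs ys]] pure_mult[OF Ms' xs ys] pure_mult[OF Ms, of "x # xs" "y # ys"] by simp
 qed
 show ?thesis
 proof (rule tensor_ext[OF Ms' T _ _ _ t])
  show "lin ?S ?T (\<lambda>t. tcons (M # Ms) x s \<otimes>\<^bsub>?T\<^esub> tcons (M # Ms) y t)"
   by (rule lin_mult_right[OF T tcons_closed[OF Ms x(1) s] tcons_lin[OF Ms x(2)]])
  show "lin ?S ?T (\<lambda>t. tcons (M # Ms) (x \<otimes>\<^bsub>M\<^esub> y) (s \<otimes>\<^bsub>?S\<^esub> t))"
   by (rule lin_comp[OF lin_mult_right[OF S s lin_id] tcons_lin[OF Ms xy]])
 qed (rule *)
qed

lemma tcons_one: "algs (M # Ms) \<Longrightarrow> tcons (M # Ms) \<one>\<^bsub>M\<^esub> \<one>\<^bsub>tens Ms\<^esub> = \<one>\<^bsub>tens (M # Ms)\<^esub>"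
proof -
 assume Ms: "algs (M # Ms)"
 then have Ms': "algs Ms" and M: "alg M" by simp_all
 have "map one Ms \<in> RD Ms" using Ms' by (induction Ms) simp_all
 then show ?thesis
  using tcons_pure[OF Ms, of "\<one>\<^bsub>M\<^esub>" "map one Ms"] pure_one[OF Ms] pure_one[OF Ms'] M by simp
qed

subsection \<open>Representations of minimal length\<close>

definition indep :: "('k, 'v, 'n) module_scheme \<Rightarrow> 'i set \<Rightarrow> ('i \<Rightarrow> 'v) \<Rightarrow> bool" where
 "indep M J g \<longleftrightarrow> (\<forall>a. (\<forall>j\<in>J. a j \<in> \<K>) \<longrightarrow> finsum M (\<lambda>j. a j \<odot>\<^bsub>M\<^esub> g j) J = \<zero>\<^bsub>M\<^esub> \<longrightarrow> (\<forall>j\<in>J. a j = \<zero>))"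

text \<open>A linear relation between the left factors expresses one of them through the others, and
  bilinearity moves its coefficients to the right factors.\<close>

lemma shorten_representation:
 assumes U: "alg U" and V: "alg V" and W: "alg W"
  and \<beta>1: "\<And>v. v \<in> carrier V \<Longrightarrow> lin U W (\<lambda>u. \<beta> u v)" and \<beta>2: "\<And>u. u \<in> carrier U \<Longrightarrow> lin V W (\<beta> u)"
  and J: "finite J" and g: "\<And>j. j \<in> J \<Longrightarrow> g j \<in> carrier U" and h: "\<And>j. j \<in> J \<Longrightarrow> h j \<in> carrier V"
  and dep: "\<not> indep U J g"
 shows "\<exists>j0 h'. j0 \<in> J \<and> (\<forall>j\<in>J - {j0}. h' j \<in> carrier V) \<and>
   finsum W (\<lambda>j. \<beta> (g j) (h j)) J = finsum W (\<lambda>j. \<beta> (g j) (h' j)) (J - {j0})"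
proof -
 from dep obtain a j0 where a: "\<And>j. j \<in> J \<Longrightarrow> a j \<in> \<K>" "finsum U (\<lambda>j. a j \<odot>\<^bsub>U\<^esub> g j) J = \<zero>\<^bsub>U\<^esub>"
  and j0: "j0 \<in> J" "a j0 \<noteq> \<zero>" unfolding indep_def by blast
 obtain b where b: "b \<in> \<K>" "b \<otimes> a j0 = \<one>" using ex_scalar_inverse a(1) j0 by blast
 let ?J = "J - {j0}"
 define c where "c j = \<ominus> (b \<otimes> a j)" for j
 have c: "c j \<in> \<K>" if "j \<in> J" for j using a(1) b that by (simp add: c_def)
 have fJ: "finite ?J" using J by simp
 have gj: "g j \<in> carrier U" "a j \<odot>\<^bsub>U\<^esub> g j \<in> carrier U" "h j \<in> carrier V" if "j \<in> J" for j
  using g h a(1) U that by simp_all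
 interpret U: algebra K U by fact
 have s: "finsum U (\<lambda>j. c j \<odot>\<^bsub>U\<^esub> g j) ?J \<in> carrier U" using c gj U by (intro fsum_closed) simp_all
 have "\<zero>\<^bsub>U\<^esub> = (\<ominus> b) \<odot>\<^bsub>U\<^esub> finsum U (\<lambda>j. a j \<odot>\<^bsub>U\<^esub> g j) J" using a(2) b U by simp
 also have "\<dots> = finsum U (\<lambda>j. (\<ominus> b) \<odot>\<^bsub>U\<^esub> (a j \<odot>\<^bsub>U\<^esub> g j)) J"
  by (rule fsum_smult[OF U J]) (use b gj in simp_all)
 also have "\<dots> = finsum U (\<lambda>j. c j \<odot>\<^bsub>U\<^esub> g j) J"
  by (rule fsum_cong[OF U refl]) (use a(1) b gj U c in \<open>simp_all add: alg_smult c_def l_minus\<close>)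
 also have "\<dots> = c j0 \<odot>\<^bsub>U\<^esub> g j0 \<oplus>\<^bsub>U\<^esub> finsum U (\<lambda>j. c j \<odot>\<^bsub>U\<^esub> g j) ?J"
  by (rule fsum_remove[OF U J j0(1)]) (use c gj U in simp)
 also have "c j0 \<odot>\<^bsub>U\<^esub> g j0 = \<ominus>\<^bsub>U\<^esub> g j0"
  unfolding c_def b(2) by (rule alg_minus(3)[OF U gj(1)[OF j0(1)] gj(1)[OF j0(1)]])
 finally have "\<zero>\<^bsub>U\<^esub> = \<ominus>\<^bsub>U\<^esub> g j0 \<oplus>\<^bsub>U\<^esub> finsum U (\<lambda>j. c j \<odot>\<^bsub>U\<^esub> g j) ?J" .
 then have "g j0 \<oplus>\<^bsub>U\<^esub> \<zero>\<^bsub>U\<^esub> = g j0 \<oplus>\<^bsub>U\<^esub> (\<ominus>\<^bsub>U\<^esub> g j0 \<oplus>\<^bsub>U\<^esub> finsum U (\<lambda>j. c j \<odot>\<^bsub>U\<^esub> g j) ?J)" by simp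
 then have g0: "g j0 = finsum U (\<lambda>j. c j \<odot>\<^bsub>U\<^esub> g j) ?J"
  using gj(1)[OF j0(1)] s by (simp add: U.a_assoc[symmetric] U.r_neg)
 let ?h = "\<lambda>j. h j \<oplus>\<^bsub>V\<^esub> c j \<odot>\<^bsub>V\<^esub> h j0"
 have \<beta>: "\<beta> u v \<in> carrier W" if "u \<in> carrier U" "v \<in> carrier V" for u v by (rule linD(1)[OF \<beta>2[OF that(1)] that(2)])
 have h0: "h j0 \<in> carrier V" using gj(3) j0 by simp
 have "\<beta> (g j0) (h j0) = finsum W (\<lambda>j. \<beta> (c j \<odot>\<^bsub>U\<^esub> g j) (h j0)) ?J"
  by (subst g0) (rule lin_fsum[OF \<beta>1[OF h0] U W fJ], use c gj U in simp)
 also have "\<dots> = finsum W (\<lambda>j. \<beta> (g j) (c j \<odot>\<^bsub>V\<^esub> h j0)) ?J"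
  by (rule fsum_cong[OF W refl]) (use c gj h0 V W \<beta> linD(3)[OF \<beta>1[OF h0]] linD(3)[OF \<beta>2 _ h0] in simp_all)
 finally have 1: "\<beta> (g j0) (h j0) = finsum W (\<lambda>j. \<beta> (g j) (c j \<odot>\<^bsub>V\<^esub> h j0)) ?J" .
 have "finsum W (\<lambda>j. \<beta> (g j) (h j)) J = \<beta> (g j0) (h j0) \<oplus>\<^bsub>W\<^esub> finsum W (\<lambda>j. \<beta> (g j) (h j)) ?J"
  by (rule fsum_remove[OF W J j0(1)]) (use \<beta> gj in simp)
 also have "\<dots> = finsum W (\<lambda>j. \<beta> (g j) (c j \<odot>\<^bsub>V\<^esub> h j0)) ?J \<oplus>\<^bsub>W\<^esub> finsum W (\<lambda>j. \<beta> (g j) (h j)) ?J"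
  by (simp only: 1)
 also have "\<dots> = finsum W (\<lambda>j. \<beta> (g j) (c j \<odot>\<^bsub>V\<^esub> h j0) \<oplus>\<^bsub>W\<^esub> \<beta> (g j) (h j)) ?J"
  by (rule fsum_add[OF W fJ, symmetric]) (use \<beta> gj c h0 V in simp_all)
 also have "\<dots> = finsum W (\<lambda>j. \<beta> (g j) (?h j)) ?J"
 proof (rule fsum_cong[OF W refl])
  fix j assume "j \<in> ?J"
  then have j: "j \<in> J" by simp
  then have ch: "c j \<odot>\<^bsub>V\<^esub> h j0 \<in> carrier V" "h j \<in> carrier V" using c h0 V gj by simp_all
  show "\<beta> (g j) (c j \<odot>\<^bsub>V\<^esub> h j0) \<oplus>\<^bsub>W\<^esub> \<beta> (g j) (h j) = \<beta> (g j) (?h j)"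
   using linD(2)[OF \<beta>2[OF gj(1)[OF j]] ch] ch V by (simp add: alg_add_ac(2)[OF V])
  show "\<beta> (g j) (?h j) \<in> carrier W" using \<beta> gj j ch V by simp
 qed
 finally show ?thesis using j0(1) c h0 gj V by (intro exI[of _ j0] exI[of _ ?h]) simp
qed

lemma minimal_representation:
 fixes J0 :: "'i set"
 assumes U: "alg U" and V: "alg V" and W: "alg W"
  and \<beta>1: "\<And>v. v \<in> carrier V \<Longrightarrow> lin U W (\<lambda>u. \<beta> u v)" and \<beta>2: "\<And>u. u \<in> carrier U \<Longrightarrow> lin V W (\<beta> u)"
  and "finite J0" "\<And>j. j \<in> J0 \<Longrightarrow> g0 j \<in> carrier U" "\<And>j. j \<in> J0 \<Longrightarrow> h0 j \<in> carrier V"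
  and t: "t = finsum W (\<lambda>j. \<beta> (g0 j) (h0 j)) J0"
 obtains J :: "'i set" and g h where "finite J" "\<And>j. j \<in> J \<Longrightarrow> g j \<in> carrier U" "\<And>j. j \<in> J \<Longrightarrow> h j \<in> carrier V"
  "t = finsum W (\<lambda>j. \<beta> (g j) (h j)) J" "indep U J g" "indep V J h"
proof -
 define P where "P J g h \<longleftrightarrow> finite J \<and> (\<forall>j\<in>J. g j \<in> carrier U) \<and> (\<forall>j\<in>J. h j \<in> carrier V) \<and>
  t = finsum W (\<lambda>j. \<beta> (g j) (h j)) J" for J :: "'i set" and g h
 have "\<exists>n J g h. P J g h \<and> card J = n" using assms(6-9) unfolding P_def by blast
 then obtain n where n: "\<exists>J g h. P J g h \<and> card J = n" "\<And>m. m < n \<Longrightarrow> \<not> (\<exists>J g h. P J g h \<and> card J = m)"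
  using exists_least_iff[of "\<lambda>n. \<exists>J g h. P J g h \<and> card J = n"] by blast
 then obtain J g h where PJ: "P J g h" "card J = n" by blast
 then have *: "finite J" "\<And>j. j \<in> J \<Longrightarrow> g j \<in> carrier U" "\<And>j. j \<in> J \<Longrightarrow> h j \<in> carrier V"
  "t = finsum W (\<lambda>j. \<beta> (g j) (h j)) J" unfolding P_def by simp_all
 have less: "card (J - {j}) < n" if "j \<in> J" for j
  using card_Diff1_less[OF *(1) that] PJ(2) by simp
 have "indep U J g"
 proof (rule ccontr)
  assume "\<not> indep U J g"
  then have "\<exists>j0 h'. j0 \<in> J \<and> (\<forall>j\<in>J - {j0}. h' j \<in> carrier V) \<and>
   finsum W (\<lambda>j. \<beta> (g j) (h j)) J = finsum W (\<lambda>j. \<beta> (g j) (h' j)) (J - {j0})"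
   by (intro shorten_representation[where \<beta>=\<beta> and g=g and h=h, OF U V W] \<beta>1 \<beta>2 *(1,2,3))
  then obtain j0 h' where j: "j0 \<in> J" "\<forall>j\<in>J - {j0}. h' j \<in> carrier V"
   "finsum W (\<lambda>j. \<beta> (g j) (h j)) J = finsum W (\<lambda>j. \<beta> (g j) (h' j)) (J - {j0})" by blast
  then have "P (J - {j0}) g h'" unfolding P_def using * by simp
  then show False using n(2)[OF less[OF j(1)]] by blast
 qed
 moreover have "indep V J h"
 proof (rule ccontr)
  assume "\<not> indep V J h"
  then have "\<exists>j0 g'. j0 \<in> J \<and> (\<forall>j\<in>J - {j0}. g' j \<in> carrier U) \<and>
   finsum W (\<lambda>j. \<beta> (g j) (h j)) J = finsum W (\<lambda>j. \<beta> (g' j) (h j)) (J - {j0})"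
   by (intro shorten_representation[where \<beta>="\<lambda>v u. \<beta> u v" and g=h and h=g, OF V U W] \<beta>1 \<beta>2 *(1,2,3))
  then obtain j0 g' where j: "j0 \<in> J" "\<forall>j\<in>J - {j0}. g' j \<in> carrier U"
   "finsum W (\<lambda>j. \<beta> (g j) (h j)) J = finsum W (\<lambda>j. \<beta> (g' j) (h j)) (J - {j0})" by blast
  then have "P (J - {j0}) g' h" unfolding P_def using * by simp
  then show False using n(2)[OF less[OF j(1)]] by blast
 qed
 ultimately show thesis using that * by blast
qed

lemma fsum_concat:
 fixes m n :: nat
 assumes W: "alg W" and f: "\<And>i. i < m \<Longrightarrow> f i \<in> carrier W" and f': "\<And>i. i < n \<Longrightarrow> f' i \<in> carrier W"
 shows "finsum W f {..<m} \<oplus>\<^bsub>W\<^esub> finsum W f' {..<n} = finsum W (\<lambda>i. if i < m then f i else f' (i - m)) {..<m + n}"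
 using f'
proof (induction n)
 case 0
 have "finsum W f {..<m} = finsum W (\<lambda>i. if i < m then f i else f' (i - m)) {..<m}"
  by (rule fsum_cong[OF W refl]) (use f in simp_all)
 moreover have "finsum W f {..<m} \<in> carrier W" by (rule fsum_closed[OF W f]) simp
 ultimately show ?case using W by simp
next
 case (Suc n)
 have s: "finsum W f' {..<n} \<in> carrier W" by (rule fsum_closed[OF W Suc.prems]) simp
 have s': "finsum W f {..<m} \<in> carrier W" by (rule fsum_closed[OF W f]) simp
 have "finsum W f' {..<Suc n} = f' n \<oplus>\<^bsub>W\<^esub> finsum W f' {..<n}"
  using fsum_insert[of W "{..<n}" n f'] W Suc.prems by (simp add: lessThan_Suc)
 moreover have "finsum W (\<lambda>i. if i < m then f i else f' (i - m)) {..<m + Suc n} =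
   f' n \<oplus>\<^bsub>W\<^esub> finsum W (\<lambda>i. if i < m then f i else f' (i - m)) {..<m + n}"
  using fsum_insert[of W "{..<m + n}" "m + n" "\<lambda>i. if i < m then f i else f' (i - m)"] W Suc.prems f by (simp add: lessThan_Suc)
 ultimately show ?case using Suc s s' W by (simp add: alg_add_ac)
qed

lemma tensor_Cons_sum:
 assumes Ms: "algs (M # Ms)" and t: "t \<in> TC (M # Ms)"
 shows "\<exists>n::nat. \<exists>g s. (\<forall>i<n. g i \<in> carrier M) \<and> (\<forall>i<n. s i \<in> TC Ms) \<and>
  t = finsum (tens (M # Ms)) (\<lambda>i. tcons (M # Ms) (g i) (s i)) {..<n}"
 using Ms t
proof (induction rule: tensor_induct)
 case zero
 show ?case by (rule exI[of _ 0]) (simp add: Ms)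
next
 case (add s t)
 let ?T = "tens (M # Ms)"
 have T: "alg ?T" using Ms by simp
 obtain m g1 s1 where 1: "\<forall>i<m. g1 i \<in> carrier M" "\<forall>i<m. s1 i \<in> TC Ms"
  "s = finsum ?T (\<lambda>i. tcons (M # Ms) (g1 i) (s1 i)) {..<m::nat}" using add.IH(1) by blast
 obtain n g2 s2 where 2: "\<forall>i<n. g2 i \<in> carrier M" "\<forall>i<n. s2 i \<in> TC Ms"
  "t = finsum ?T (\<lambda>i. tcons (M # Ms) (g2 i) (s2 i)) {..<n::nat}" using add.IH(2) by blast
 let ?g = "\<lambda>i. if i < m then g1 i else g2 (i - m)" and ?s = "\<lambda>i. if i < m then s1 i else s2 (i - m)"
 have cl: "tcons (M # Ms) (g1 i) (s1 i) \<in> carrier ?T" if "i < m" for i using tcons_closed[OF Ms] 1 that by simp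
 have cl2: "tcons (M # Ms) (g2 i) (s2 i) \<in> carrier ?T" if "i < n" for i using tcons_closed[OF Ms] 2 that by simp
 have "s \<oplus>\<^bsub>?T\<^esub> t = finsum ?T (\<lambda>i. if i < m then tcons (M # Ms) (g1 i) (s1 i) else tcons (M # Ms) (g2 (i - m)) (s2 (i - m))) {..<m + n}"
  unfolding 1(3) 2(3) by (rule fsum_concat[OF T cl cl2])
 also have "\<dots> = finsum ?T (\<lambda>i. tcons (M # Ms) (?g i) (?s i)) {..<m + n}"
  by (rule fsum_cong[OF T refl]) (use cl cl2 in auto)
 finally show ?case using 1 2 by (intro exI[of _ "m + n"] exI[of _ ?g] exI[of _ ?s]) simp
next
 case (pure c xs)
 let ?T = "tens (M # Ms)"
 have T: "alg ?T" and M: "alg M" using Ms by simp_all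
 obtain y ys where xs: "xs = y # ys" "y \<in> carrier M" "ys \<in> RD Ms" using pure(2) by (rule RD_ConsE)
 have p: "pur Ms ys \<in> TC Ms" using pure_closed xs Ms by simp
 have "c \<odot>\<^bsub>?T\<^esub> pur (M # Ms) xs = tcons (M # Ms) (c \<odot>\<^bsub>M\<^esub> y) (pur Ms ys)"
  using linD(3)[OF tcons_lin_left[OF Ms p] pure(1) xs(2)] tcons_pure[OF Ms xs(2,3)] xs by simp
 also have "\<dots> = finsum ?T (\<lambda>i. tcons (M # Ms) (c \<odot>\<^bsub>M\<^esub> y) (pur Ms ys)) {..<1::nat}"
  using fsum_delta[of ?T "{..<1::nat}" 0 "\<lambda>i. tcons (M # Ms) (c \<odot>\<^bsub>M\<^esub> y) (pur Ms ys)"] T tcons_closed[OF Ms _ p, of "c \<odot>\<^bsub>M\<^esub> y"] pure(1) xs(2) M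
  by simp
 finally show ?case using pure(1) xs(2) M p by (intro exI[of _ 1] exI[of _ "\<lambda>_. c \<odot>\<^bsub>M\<^esub> y"] exI[of _ "\<lambda>_. pur Ms ys"]) simp
qed

lemma tensor_Nil: "t \<in> TC ([] :: ('k, 'v, 'n) module_scheme list) \<Longrightarrow>
  t = tev [] t \<odot>\<^bsub>tens ([] :: ('k, 'v, 'n) module_scheme list)\<^esub> pur ([] :: ('k, 'v, 'n) module_scheme list) []"
proof -
 let ?M = "[] :: ('k, 'v, 'n) module_scheme list"
 assume t: "t \<in> TC ?M"
 have a: "algs ?M" and T: "alg (tens ?M)" and p: "pur ?M [] \<in> TC ?M" and f: "fnls ?M []" by simp_all
 show ?thesis
 proof (rule tensor_ext[OF a T lin_id _ _ t])
  show "lin (tens ?M) (tens ?M) (\<lambda>t. tev [] t \<odot>\<^bsub>tens ?M\<^esub> pur ?M [])"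
   by (rule lin_smult_left[OF T p fnl_tev[OF a f]])
  show "pur ?M xs = tev [] (pur ?M xs) \<odot>\<^bsub>tens ?M\<^esub> pur ?M []" if "xs \<in> RD ?M" for xs
   using tev_pure[OF a f that] that T p by simp
 qed
qed

text \<open>Write \<open>t = \<Sum>\<^sub>j g\<^sub>j \<otimes> s\<^sub>j\<close> with independent \<open>g\<^sub>j\<close>. Contracting the tail gives
  \<open>\<Sum>\<^sub>j \<phi>s(s\<^sub>j) g\<^sub>j = 0\<close>, so \<open>\<phi>s(s\<^sub>j) = 0\<close> for every tuple \<open>\<phi>s\<close>, and \<open>s\<^sub>j = 0\<close> by induction.\<close>

theorem tensor_separated:
 assumes "algs Ms" "list_all2 separating Ms Es" "t \<in> TC Ms"
  "\<And>\<phi>s. list_all2 (\<in>) \<phi>s Es \<Longrightarrow> tev \<phi>s t = \<zero>"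
 shows "t = \<zero>\<^bsub>tens Ms\<^esub>"
 using assms(2,1,3,4)
proof (induction arbitrary: t rule: list_all2_induct)
 case Nil
 have "tev [] t = \<zero>" by (rule Nil(3)) simp
 then show ?case using tensor_Nil[OF Nil(2)] by simp
next
 case (Cons M Ms E Es)
 let ?T = "tens (M # Ms)"
 have M: "alg M" and Ms': "algs Ms" and S: "alg (tens Ms)" and T: "alg ?T" using Cons.prems(1) by simp_all
 have fs: "fnls Ms \<phi>s" if "list_all2 (\<in>) \<phi>s Es" for \<phi>s
  using that Cons.hyps(2) unfolding separating_def list_all2_conv_all_nth by force
 have fe: "fnl M e" if "e \<in> E" for e using Cons.hyps(1) that unfolding separating_def by blast
 obtain n g0 s0 where rep: "\<forall>i<n. g0 i \<in> carrier M" "\<forall>i<n. s0 i \<in> TC Ms"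
  "t = finsum ?T (\<lambda>i. tcons (M # Ms) (g0 i) (s0 i)) {..<n::nat}"
  using tensor_Cons_sum[OF Cons.prems(1,2)] by blast
 obtain J :: "nat set" and g s where J: "finite J" "\<And>j. j \<in> J \<Longrightarrow> g j \<in> carrier M" "\<And>j. j \<in> J \<Longrightarrow> s j \<in> TC Ms"
  "t = finsum ?T (\<lambda>j. tcons (M # Ms) (g j) (s j)) J" "indep M J g"
 proof (rule minimal_representation[OF M S T tcons_lin_left[OF Cons.prems(1)] tcons_lin[OF Cons.prems(1)] finite_lessThan _ _ rep(3)])
 qed (use rep in auto)
 have Z: "tev \<phi>s (s j) = \<zero>" if \<phi>s: "list_all2 (\<in>) \<phi>s Es" and j: "j \<in> J" for \<phi>s j
 proof -
  have ts: "tev \<phi>s (s j) \<in> \<K>" if "j \<in> J" for j by (rule tev_closed[OF Ms' fs[OF \<phi>s] J(3)[OF that]])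
  let ?x = "finsum M (\<lambda>j. tev \<phi>s (s j) \<odot>\<^bsub>M\<^esub> g j) J"
  have x: "?x \<in> carrier M" using ts J(2) M by simp
  have "e ?x = \<zero>" if e: "e \<in> E" for e
  proof -
   have "e ?x = finsum (Ks) (\<lambda>j. e (tev \<phi>s (s j) \<odot>\<^bsub>M\<^esub> g j)) J"
    by (rule lin_fsum[OF fe[OF e] M algebra_Ks J(1)]) (use ts J(2) M in simp)
   also have "\<dots> = finsum (Ks) (\<lambda>j. tev (e # \<phi>s) (tcons (M # Ms) (g j) (s j))) J"
   proof (rule fsum_cong[OF algebra_Ks refl])
    fix j assume j: "j \<in> J"
    have *: "tev (e # \<phi>s) (tcons (M # Ms) (g j) (s j)) = e (g j) \<otimes> tev \<phi>s (s j)"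
     by (rule tev_tcons[OF Cons.prems(1) J(2)[OF j] J(3)[OF j] fe[OF e] fs[OF \<phi>s]])
    then show "e (tev \<phi>s (s j) \<odot>\<^bsub>M\<^esub> g j) = tev (e # \<phi>s) (tcons (M # Ms) (g j) (s j))"
     using linD(3)[OF fe[OF e] ts[OF j] J(2)[OF j]] ts[OF j] fnl_closed[OF fe[OF e] J(2)[OF j]] by (simp add: m_comm)
    show "tev (e # \<phi>s) (tcons (M # Ms) (g j) (s j)) \<in> carrier (Ks)"
     unfolding * using ts[OF j] fnl_closed[OF fe[OF e] J(2)[OF j]] by simp
   qed
   also have "\<dots> = tev (e # \<phi>s) t"
    unfolding J(4)
    by (rule lin_fsum[OF fnl_tev[OF Cons.prems(1)] T algebra_Ks J(1), symmetric])
      (use fe[OF e] fs[OF \<phi>s] tcons_closed[OF Cons.prems(1) J(2) J(3)] in simp_all)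
   also have "\<dots> = \<zero>" by (rule Cons.prems(3)) (use e \<phi>s in simp)
   finally show ?thesis .
  qed
  then have "?x = \<zero>\<^bsub>M\<^esub>" using Cons.hyps(1) x unfolding separating_def by blast
  then show ?thesis
   using J(5)[unfolded indep_def, rule_format, of "\<lambda>j. tev \<phi>s (s j)" j] ts j by simp
 qed
 have s0: "s j = \<zero>\<^bsub>tens Ms\<^esub>" if "j \<in> J" for j
  by (rule Cons.IH[OF Ms' J(3)[OF that] Z[OF _ that]])
 show ?case unfolding J(4)
 proof (rule fsum_zero[OF T])
  show "tcons (M # Ms) (g j) (s j) = \<zero>\<^bsub>?T\<^esub>" if "j \<in> J" for j
   unfolding s0[OF that] by (rule lin_zero[OF tcons_lin[OF Cons.prems(1) J(2)[OF that]] S T])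
 qed
qed

lemma tensor_eqI:
 assumes Ms: "algs Ms" and E: "list_all2 separating Ms Es" and s: "s \<in> TC Ms" and t: "t \<in> TC Ms"
  and eq: "\<And>\<phi>s. list_all2 (\<in>) \<phi>s Es \<Longrightarrow> tev \<phi>s s = tev \<phi>s t"
 shows "s = t"
proof (rule separating_eqI[OF _ alg_tens[OF Ms] s t])
 have fs: "fnls Ms \<phi>s" if "list_all2 (\<in>) \<phi>s Es" for \<phi>s
  using that E unfolding separating_def list_all2_conv_all_nth by force
 show "separating (tens Ms) (tev ` {\<phi>s. list_all2 (\<in>) \<phi>s Es})"
  unfolding separating_def
 proof (intro conjI ballI impI)
  show "fnl (tens Ms) e" if "e \<in> tev ` {\<phi>s. list_all2 (\<in>) \<phi>s Es}" for e
   using that fnl_tev[OF Ms fs] by blast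
  show "x = \<zero>\<^bsub>tens Ms\<^esub>" if "x \<in> TC Ms" "\<forall>e\<in>tev ` {\<phi>s. list_all2 (\<in>) \<phi>s Es}. e x = \<zero>" for x
   by (rule tensor_separated[OF Ms E that(1)]) (use that(2) in blast)
 qed
 show "e s = e t" if "e \<in> tev ` {\<phi>s. list_all2 (\<in>) \<phi>s Es}" for e using that eq by blast
qed

lemma tensor_eqI_fnls:
 assumes Ms: "algs Ms" and s: "s \<in> TC Ms" and t: "t \<in> TC Ms"
  and eq: "\<And>\<phi>s. fnls Ms \<phi>s \<Longrightarrow> tev \<phi>s s = tev \<phi>s t"
 shows "s = t"
proof (rule tensor_eqI[OF Ms _ s t])
 show "list_all2 separating Ms (map (\<lambda>M. {e. fnl M e}) Ms)"
  using Ms by (auto simp: list_all2_conv_all_nth intro!: separating_functionals)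
 show "tev \<phi>s s = tev \<phi>s t" if "list_all2 (\<in>) \<phi>s (map (\<lambda>M. {e. fnl M e}) Ms)" for \<phi>s
  by (rule eq) (use that in \<open>auto simp: list_all2_conv_all_nth\<close>)
qed

lemmas ksum_cong = fsum_cong[OF algebra_Ks, simplified]
lemmas ksum_mult_left = fsum_mult_left[OF algebra_Ks, simplified]
lemmas ksum_mult_right = fsum_mult_right[OF algebra_Ks, simplified]
lemmas ksum_swap = fsum_swap[OF algebra_Ks, simplified]
lemmas ksum_closed = fsum_closed[OF algebra_Ks, simplified]
lemmas ksum_delta = fsum_delta[OF algebra_Ks, simplified]
lemmas ksum_insert = fsum_insert[OF algebra_Ks, simplified]
lemmas fnl_fsum = lin_fsum[OF _ _ algebra_Ks, simplified]

lemma fnl_lincomb: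
 assumes "fnl M e" "alg M" "finite J" "\<And>j. j \<in> J \<Longrightarrow> c j \<in> \<K>" "\<And>j. j \<in> J \<Longrightarrow> g j \<in> carrier M"
 shows "e (finsum M (\<lambda>j. c j \<odot>\<^bsub>M\<^esub> g j) J) = ksum (\<lambda>j. c j \<otimes> e (g j)) J"
proof -
 have "e (finsum M (\<lambda>j. c j \<odot>\<^bsub>M\<^esub> g j) J) = ksum (\<lambda>j. e (c j \<odot>\<^bsub>M\<^esub> g j)) J"
  by (rule fnl_fsum[OF assms(1-3)]) (use assms(2,4,5) in simp)
 also have "\<dots> = ksum (\<lambda>j. c j \<otimes> e (g j)) J"
  by (rule ksum_cong[OF refl]) (use assms(4,5) linD(3)[OF assms(1)] fnl_closed[OF assms(1)] in simp_all)
 finally show ?thesis .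
qed

lemma subspace_fsum:
 assumes M: "alg M" and N: "subspace M N" and "finite J" "\<And>j. j \<in> J \<Longrightarrow> g j \<in> N"
 shows "finsum M g J \<in> N"
 using assms(3,4)
proof (induction J)
 case empty then show ?case using M N unfolding subspace_def by simp
next
 case (insert j J)
 have "g i \<in> carrier M" if "i \<in> insert j J" for i using insert.prems[OF that] N unfolding subspace_def by blast
 then have "finsum M g (insert j J) = g j \<oplus>\<^bsub>M\<^esub> finsum M g J" by (intro fsum_insert[OF M insert.hyps]) auto
 then show ?case using insert N unfolding subspace_def by simp
qed

lemma subspace_lincomb:
 assumes M: "alg M" and N: "subspace M N" and "finite J" "\<And>j. j \<in> J \<Longrightarrow> c j \<in> \<K>" "\<And>j. j \<in> J \<Longrightarrow> g j \<in> N"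
 shows "finsum M (\<lambda>j. c j \<odot>\<^bsub>M\<^esub> g j) J \<in> N"
 by (rule subspace_fsum[OF M N assms(3)]) (use assms(4,5) N in \<open>auto simp: subspace_def\<close>)

section \<open>Matrix coefficients\<close>

lemma tensor_single:
 assumes M: "alg M" and s: "s \<in> TC [M]"
 shows "\<exists>x\<in>carrier M. s = pur [M] [x]"
proof -
 have Ms: "algs [M]" using M by simp
 have P: "lin M (tens [M]) (\<lambda>x. pur [M] [x])" using multilin_pure[OF Ms] by simp
 show ?thesis using Ms s
 proof (induction rule: tensor_induct)
  case zero
  show ?case using lin_zero[OF P M] M by (intro bexI[of _ "\<zero>\<^bsub>M\<^esub>"]) simp_all
 next
  case (add s t)
  then obtain x y where "x \<in> carrier M" "s = pur [M] [x]" "y \<in> carrier M" "t = pur [M] [y]" by blast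
  then show ?case using linD(2)[OF P] M by (intro bexI[of _ "x \<oplus>\<^bsub>M\<^esub> y"]) simp_all
 next
  case (pure c xs)
  then obtain x where "x \<in> carrier M" "xs = [x]" by (auto elim!: RD_ConsE)
  then show ?case using linD(3)[OF P] M pure by (intro bexI[of _ "c \<odot>\<^bsub>M\<^esub> x"]) simp_all
 qed
qed

lemma pure_pair_lin:
 assumes "alg U" "alg V"
 shows "v \<in> carrier V \<Longrightarrow> lin U (tens [U, V]) (\<lambda>u. pur [U, V] [u, v])"
  and "u \<in> carrier U \<Longrightarrow> lin V (tens [U, V]) (\<lambda>v. pur [U, V] [u, v])"
 using multilin_pure[of "[U, V]"] assms by simp_all

lemma tensor_pair_minimal:
 assumes U: "alg U" and V: "alg V" and t: "t \<in> TC [U, V]"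
 obtains J :: "nat set" and g h where "finite J" "\<And>j. j \<in> J \<Longrightarrow> g j \<in> carrier U" "\<And>j. j \<in> J \<Longrightarrow> h j \<in> carrier V"
  "t = finsum (tens [U, V]) (\<lambda>j. pur [U, V] [g j, h j]) J" "indep U J g" "indep V J h"
proof -
 have UV: "algs [U, V]" using U V by simp
 have T: "alg (tens [U, V])" by (rule alg_tens[OF UV])
 obtain n g0 s where rep: "\<forall>i<n. g0 i \<in> carrier U" "\<forall>i<n. s i \<in> TC [V]"
  "t = finsum (tens [U, V]) (\<lambda>i. tcons [U, V] (g0 i) (s i)) {..<n::nat}"
  using tensor_Cons_sum[OF UV t] by blast
 have "\<forall>i. \<exists>x. i < n \<longrightarrow> x \<in> carrier V \<and> s i = pur [V] [x]"
  using rep(2) tensor_single[OF V] by blast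
 then obtain h0 where h0: "\<And>i. i < n \<Longrightarrow> h0 i \<in> carrier V" "\<And>i. i < n \<Longrightarrow> s i = pur [V] [h0 i]" by metis
 have p: "pur [U, V] [a, b] \<in> TC [U, V]" if "a \<in> carrier U" "b \<in> carrier V" for a b
  using that UV by simp
 have t': "t = finsum (tens [U, V]) (\<lambda>i. pur [U, V] [g0 i, h0 i]) {..<n}"
  unfolding rep(3)
  by (rule fsum_cong[OF T refl]) (use rep(1) h0 p tcons_pure[OF UV, of _ "[_]"] in simp_all)
 show thesis
 proof (rule minimal_representation[where \<beta>="\<lambda>a b. pur [U, V] [a, b]", OF U V T pure_pair_lin[OF U V] finite_lessThan _ _ t'])
  show "g0 j \<in> carrier U" "h0 j \<in> carrier V" if "j \<in> {..<n}" for j using that rep(1) h0(1) by simp_all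
 qed (use that in blast)+
qed

lemma tev_pair:
 assumes "alg U" "alg V" "fnl U a" "fnl V b" "u \<in> carrier U" "v \<in> carrier V"
 shows "tev [a, b] (pur [U, V] [u, v]) = a u \<otimes> b v"
 using assms tev_pure[of "[U, V]" "[a, b]" "[u, v]"] fnl_closed[OF assms(4,6)] by simp

lemma tev_pair_sum:
 assumes U: "alg U" and V: "alg V" and a: "fnl U a" and b: "fnl V b" and J: "finite J"
  and g: "\<And>j. j \<in> J \<Longrightarrow> g j \<in> carrier U" and h: "\<And>j. j \<in> J \<Longrightarrow> h j \<in> carrier V"
 shows "tev [a, b] (finsum (tens [U, V]) (\<lambda>j. pur [U, V] [g j, h j]) J) = ksum (\<lambda>j. a (g j) \<otimes> b (h j)) J"
proof -
 have UV: "algs [U, V]" "fnls [U, V] [a, b]" using U V a b by simp_all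
 have "tev [a, b] (finsum (tens [U, V]) (\<lambda>j. pur [U, V] [g j, h j]) J) = ksum (\<lambda>j. tev [a, b] (pur [U, V] [g j, h j])) J"
  by (rule fnl_fsum[OF fnl_tev[OF UV] alg_tens[OF UV(1)] J]) (use g h UV in simp)
 also have "\<dots> = ksum (\<lambda>j. a (g j) \<otimes> b (h j)) J"
  by (rule ksum_cong[OF refl]) (use tev_pair[OF U V a b g h] fnl_closed[OF a g] fnl_closed[OF b h] in simp_all)
 finally show ?thesis .
qed

text \<open>Induction on \<open>J\<close>: subtract from the new vector its projection to the previous ones. The
  result is nonzero by independence, so some member of \<open>S\<close> detects it, and this member can be
  corrected to vanish on the previous vectors.\<close>

lemma dual_basis:
 fixes U :: "('k, 'u, 'n) module_scheme" and g :: "'j \<Rightarrow> 'u"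
 assumes U: "alg U" and S: "separating U S"
  and S0: "(\<lambda>_. \<zero>) \<in> S" and Sadd: "\<And>e e'. e \<in> S \<Longrightarrow> e' \<in> S \<Longrightarrow> (\<lambda>x. e x \<oplus> e' x) \<in> S"
  and Smult: "\<And>c e. c \<in> \<K> \<Longrightarrow> e \<in> S \<Longrightarrow> (\<lambda>x. c \<otimes> e x) \<in> S"
  and Sext: "\<And>e e'. e \<in> S \<Longrightarrow> (\<And>x. x \<in> carrier U \<Longrightarrow> e' x = e x) \<Longrightarrow> e' \<in> S"
 shows "\<lbrakk>finite J; (\<And>j. j \<in> J \<Longrightarrow> g j \<in> carrier U); indep U J g\<rbrakk> \<Longrightarrow>
   \<exists>\<chi>. \<forall>j\<in>J. \<chi> j \<in> S \<and> (\<forall>i\<in>J. \<chi> j (g i) = (if i = j then \<one> else \<zero>))"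
proof (induction J rule: finite_induct)
 case empty
 then show ?case by simp
next
 case (insert r J)
 have fS: "fnl U e" if "e \<in> S" for e using S that unfolding separating_def by blast
 have Ssum: "(\<lambda>x. ksum (\<lambda>i. c i \<otimes> e i x) I) \<in> S"
  if "finite I" "\<And>i. i \<in> I \<Longrightarrow> c i \<in> \<K>" "\<And>i. i \<in> I \<Longrightarrow> e i \<in> S" for I :: "'j set" and c e
  using that
 proof (induction I rule: finite_induct)
  case empty
  then show ?case using S0 by (simp add: finsum_def finprod_def)
 next
  case (insert i I)
  show ?case
  proof (rule Sext)
   show "(\<lambda>x. c i \<otimes> e i x \<oplus> ksum (\<lambda>i. c i \<otimes> e i x) I) \<in> S"
    using insert by (intro Sadd Smult) auto
   show "ksum (\<lambda>i. c i \<otimes> e i x) (insert i I) = c i \<otimes> e i x \<oplus> ksum (\<lambda>i. c i \<otimes> e i x) I"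
    if x: "x \<in> carrier U" for x
    using insert.prems fnl_closed[OF fS x] by (intro ksum_insert insert.hyps) simp_all
  qed
 qed
 have g: "g i \<in> carrier U" if "i \<in> insert r J" for i using insert.prems(1) that .
 have gJ: "g i \<in> carrier U" if "i \<in> J" for i using g that by simp
 have gr: "g r \<in> carrier U" using g by simp
 have "indep U J g" unfolding indep_def
 proof (intro allI impI ballI)
  fix a j assume a: "\<forall>j\<in>J. a j \<in> \<K>" "finsum U (\<lambda>j. a j \<odot>\<^bsub>U\<^esub> g j) J = \<zero>\<^bsub>U\<^esub>" and j: "j \<in> J"
  let ?a = "a(r := \<zero>)"
  have *: "finsum U (\<lambda>j. ?a j \<odot>\<^bsub>U\<^esub> g j) J = finsum U (\<lambda>j. a j \<odot>\<^bsub>U\<^esub> g j) J"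
   by (rule fsum_cong[OF U refl]) (use insert.hyps(2) a(1) gJ U in auto)
  have "finsum U (\<lambda>j. ?a j \<odot>\<^bsub>U\<^esub> g j) (insert r J) = ?a r \<odot>\<^bsub>U\<^esub> g r \<oplus>\<^bsub>U\<^esub> finsum U (\<lambda>j. ?a j \<odot>\<^bsub>U\<^esub> g j) J"
   by (rule fsum_insert[OF U insert.hyps]) (use a(1) gJ gr U in auto)
  then have "finsum U (\<lambda>j. ?a j \<odot>\<^bsub>U\<^esub> g j) (insert r J) = \<zero>\<^bsub>U\<^esub>" using * a(2) gr U by simp
  moreover have "\<forall>j\<in>insert r J. ?a j \<in> \<K>" using a(1) by simp
  ultimately have "\<forall>j\<in>insert r J. ?a j = \<zero>" using insert.prems(2)[unfolded indep_def, rule_format, of ?a] by blast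
  then have "?a j = \<zero>" using j by blast
  then show "a j = \<zero>" using j insert.hyps(2) by (auto split: if_splits)
 qed
 then obtain \<chi> where \<chi>: "\<And>j. j \<in> J \<Longrightarrow> \<chi> j \<in> S" "\<And>i j. j \<in> J \<Longrightarrow> i \<in> J \<Longrightarrow> \<chi> j (g i) = (if i = j then \<one> else \<zero>)"
  using insert.IH gJ by blast
 have \<chi>c: "\<chi> j x \<in> \<K>" if "j \<in> J" "x \<in> carrier U" for j x by (rule fnl_closed[OF fS[OF \<chi>(1)[OF that(1)]] that(2)])
 define a where "a i = (if i = r then \<one> else \<ominus> \<chi> i (g r))" for i
 have ac: "a i \<in> \<K>" if "i \<in> insert r J" for i using that \<chi>c gr by (auto simp: a_def)
 let ?x = "finsum U (\<lambda>j. a j \<odot>\<^bsub>U\<^esub> g j) (insert r J)"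
 have x: "?x \<in> carrier U" by (rule fsum_closed[OF U]) (use ac g U in simp)
 have "?x \<noteq> \<zero>\<^bsub>U\<^esub>"
 proof
  assume "?x = \<zero>\<^bsub>U\<^esub>"
  then have "\<forall>j\<in>insert r J. a j = \<zero>" using insert.prems(2)[unfolded indep_def, rule_format, of a] ac by blast
  then have "a r = \<zero>" by simp
  then show False by (simp add: a_def)
 qed
 then obtain e where e: "e \<in> S" "e ?x \<noteq> \<zero>" using S x unfolding separating_def by blast
 have ec: "e y \<in> \<K>" if "y \<in> carrier U" for y by (rule fnl_closed[OF fS[OF e(1)] that])
 obtain b where b: "b \<in> \<K>" "b \<otimes> e ?x = \<one>" using ex_scalar_inverse ec[OF x] e(2) by blast
 define s where "s y = ksum (\<lambda>i. e (g i) \<otimes> \<chi> i y) J" for y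
 have sS: "s \<in> S" unfolding s_def using ec gJ \<chi>(1) by (intro Ssum insert.hyps) simp_all
 have sc: "s y \<in> \<K>" if "y \<in> carrier U" for y by (rule fnl_closed[OF fS[OF sS] that])
 define \<rho> where "\<rho> y = b \<otimes> (e y \<oplus> (\<ominus> \<one>) \<otimes> s y)" for y
 have \<rho>S: "\<rho> \<in> S" unfolding \<rho>_def using b(1) e(1) sS by (intro Smult Sadd) simp_all
 have \<rho>c: "\<rho> y \<in> \<K>" if "y \<in> carrier U" for y by (rule fnl_closed[OF fS[OF \<rho>S] that])
 have \<rho>i: "\<rho> (g i) = \<zero>" if i: "i \<in> J" for i
 proof -
  have "s (g i) = e (g i) \<otimes> \<chi> i (g i)"
   unfolding s_def by (rule ksum_delta[OF insert.hyps(1) i]) (use i \<chi>(2) ec gJ in auto)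
  then have "s (g i) = e (g i)" using i \<chi>(2) ec gJ by simp
  then show ?thesis unfolding \<rho>_def using ec[OF gJ[OF i]] b(1) by (simp add: l_minus r_neg)
 qed
 have \<rho>r: "\<rho> (g r) = \<one>"
 proof -
  have "e ?x = ksum (\<lambda>j. a j \<otimes> e (g j)) (insert r J)"
   by (rule fnl_lincomb[OF fS[OF e(1)] U _ ac g]) (use insert.hyps in simp_all)
  also have "\<dots> = a r \<otimes> e (g r) \<oplus> ksum (\<lambda>j. a j \<otimes> e (g j)) J"
   by (rule ksum_insert[OF insert.hyps]) (use ac g gJ ec in simp_all)
  also have "ksum (\<lambda>j. a j \<otimes> e (g j)) J = ksum (\<lambda>j. (\<ominus> \<one>) \<otimes> (e (g j) \<otimes> \<chi> j (g r))) J"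
   by (rule ksum_cong[OF refl]) (use insert.hyps(2) ec gJ \<chi>c gr in \<open>auto simp: a_def l_minus r_minus m_comm\<close>)
  also have "\<dots> = (\<ominus> \<one>) \<otimes> s (g r)"
   unfolding s_def by (rule ksum_mult_right[symmetric]) (use insert.hyps ec gJ \<chi>c gr in simp_all)
  finally have "e ?x = e (g r) \<oplus> (\<ominus> \<one>) \<otimes> s (g r)" using ec[OF gr] by (simp add: a_def)
  then show ?thesis unfolding \<rho>_def using b(2) by simp
 qed
 define \<chi>' where "\<chi>' j = (if j = r then \<rho> else (\<lambda>y. \<chi> j y \<oplus> (\<ominus> \<chi> j (g r)) \<otimes> \<rho> y))" for j
 have "\<chi>' j \<in> S" if "j \<in> insert r J" for j
  using that \<rho>S \<chi>(1) \<chi>c gr by (auto simp: \<chi>'_def intro!: Sadd Smult)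
 moreover have "\<chi>' j (g i) = (if i = j then \<one> else \<zero>)" if j: "j \<in> insert r J" and i: "i \<in> insert r J" for i j
 proof (cases "j = r")
  case True
  then show ?thesis using i \<rho>i \<rho>r by (auto simp: \<chi>'_def)
 next
  case False
  then have j': "j \<in> J" using j by simp
  show ?thesis
  proof (cases "i = r")
   case True
   then show ?thesis using False \<chi>c[OF j' gr] by (simp add: \<chi>'_def \<rho>r r_neg)
  next
   case False
   then have "i \<in> J" using i by simp
   then show ?thesis using \<open>j \<noteq> r\<close> \<chi>c[OF j' gr] \<chi>(2)[OF j' \<open>i \<in> J\<close>] by (simp add: \<chi>'_def \<rho>i)
  qed
 qed
 ultimately show ?case by blast
qed

text \<open>The finiteness theorem for coalgebras, for functions \<open>ev w\<close> on words. A representation of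
  \<open>\<Delta> f = \<Sum>\<^sub>j g\<^sub>j \<otimes> h\<^sub>j\<close> of minimal length shows that the left and right translates of \<open>f\<close> (\<open>lc\<close>
  and \<open>rc\<close>) span finite-dimensional spaces with bases \<open>h\<close> and \<open>g\<close>. The matrix \<open>M\<close> describes
  right translation on the span of the \<open>g\<^sub>j\<close>, so translation by a concatenated word is a matrix
  product. Finally \<open>g\<^sub>j\<close> is a combination of the \<open>M\<^sub>l\<^sub>j\<close>, and \<open>f\<close> of the \<open>g\<^sub>j\<close>. The subspace \<open>N\<close>
  records a property stable under translation, such as coherence.\<close>

theorem matrix_coefficients:
 fixes U :: "('k, 'u, 'n) module_scheme" and \<Omega> :: "'w set" and ev :: "'w list \<Rightarrow> 'u \<Rightarrow> 'k"
 assumes U: "alg U" and evS: "separating U (ev ` lists \<Omega>)" and N: "subspace U N"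
  and lcN: "\<And>w f. w \<in> lists \<Omega> \<Longrightarrow> f \<in> N \<Longrightarrow> lc w f \<in> N"
  and lc: "\<And>u w f. \<lbrakk>u \<in> lists \<Omega>; w \<in> lists \<Omega>; f \<in> N\<rbrakk> \<Longrightarrow> ev u (lc w f) = ev (w @ u) f"
  and rcN: "\<And>w f. w \<in> lists \<Omega> \<Longrightarrow> f \<in> N \<Longrightarrow> rc w f \<in> N"
  and rc: "\<And>u w f. \<lbrakk>u \<in> lists \<Omega>; w \<in> lists \<Omega>; f \<in> N\<rbrakk> \<Longrightarrow> ev u (rc w f) = ev (u @ w) f"
  and f: "f \<in> N" and t: "t \<in> TC [U, U]"
  and ft: "\<And>u w. u \<in> lists \<Omega> \<Longrightarrow> w \<in> lists \<Omega> \<Longrightarrow> ev (u @ w) f = tev [ev u, ev w] t"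
 obtains J :: "nat set" and M where "finite J" "\<And>i j. i \<in> J \<Longrightarrow> j \<in> J \<Longrightarrow> M i j \<in> N"
  "\<And>u w i j. \<lbrakk>u \<in> lists \<Omega>; w \<in> lists \<Omega>; i \<in> J; j \<in> J\<rbrakk> \<Longrightarrow>
   ev (u @ w) (M i j) = ksum (\<lambda>l. ev u (M i l) \<otimes> ev w (M l j)) J"
  "\<And>i j. i \<in> J \<Longrightarrow> j \<in> J \<Longrightarrow> ev [] (M i j) = (if i = j then \<one> else \<zero>)"
  "\<And>Q. subspace U Q \<Longrightarrow> (\<And>i j. i \<in> J \<Longrightarrow> j \<in> J \<Longrightarrow> M i j \<in> Q) \<Longrightarrow> f \<in> Q"
proof -
 have NU: "x \<in> carrier U" if "x \<in> N" for x using N that unfolding subspace_def by blast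
 have fev: "fnl U (ev w)" if "w \<in> lists \<Omega>" for w using evS that unfolding separating_def by blast
 have evc: "ev w x \<in> \<K>" if "w \<in> lists \<Omega>" "x \<in> carrier U" for w x by (rule fnl_closed[OF fev[OF that(1)] that(2)])
 have eqI: "x = y" if "x \<in> carrier U" "y \<in> carrier U" "\<And>w. w \<in> lists \<Omega> \<Longrightarrow> ev w x = ev w y" for x y
  by (rule separating_eqI[OF evS U that(1,2)]) (use that(3) in blast)
 have app: "u @ w \<in> lists \<Omega>" if "u \<in> lists \<Omega>" "w \<in> lists \<Omega>" for u w using that by simp
 have nil: "[] \<in> lists \<Omega>" by simp
 obtain J :: "nat set" and g h where J: "finite J" and g: "\<And>j. j \<in> J \<Longrightarrow> g j \<in> carrier U" and h: "\<And>j. j \<in> J \<Longrightarrow> h j \<in> carrier U"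
  and tJ: "t = finsum (tens [U, U]) (\<lambda>j. pur [U, U] [g j, h j]) J" and ig: "indep U J g" and ih: "indep U J h"
  by (rule tensor_pair_minimal[OF U U t]) blast
 have F: "ev (u @ w) f = ksum (\<lambda>j. ev u (g j) \<otimes> ev w (h j)) J" if "u \<in> lists \<Omega>" "w \<in> lists \<Omega>" for u w
  unfolding ft[OF that] tJ by (rule tev_pair_sum[OF U U fev[OF that(1)] fev[OF that(2)] J g h])
 \<comment> \<open>The functionals that can be contracted with either end of an element of \<open>N\<close>.\<close>
 define S where "S = {\<chi>. fnl U \<chi> \<and> (\<forall>d\<in>{lc, rc}. \<forall>f\<in>N. \<exists>x\<in>N. \<forall>u\<in>lists \<Omega>. ev u x = \<chi> (d u f))}"
 have Sd: "\<exists>x\<in>N. \<forall>u\<in>lists \<Omega>. ev u x = e (d u f)" if "e \<in> S" "d \<in> {lc, rc}" "f \<in> N" for e d f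
  using that(1,3) bspec[OF conjunct2[OF CollectD[OF that(1)[unfolded S_def]]] that(2)] by simp
 have SI: "e \<in> S" if "fnl U e" "\<And>d f. d \<in> {lc, rc} \<Longrightarrow> f \<in> N \<Longrightarrow> \<exists>x\<in>N. \<forall>u\<in>lists \<Omega>. ev u x = e (d u f)" for e
  unfolding S_def by (intro CollectI conjI ballI that)
 have fS: "fnl U e" if "e \<in> S" for e using that unfolding S_def by simp
 have lcU: "lc u f \<in> carrier U" "rc u f \<in> carrier U" if "u \<in> lists \<Omega>" "f \<in> N" for u f
  using NU[OF lcN[OF that]] NU[OF rcN[OF that]] by simp_all
 have N0: "\<zero>\<^bsub>U\<^esub> \<in> N" using N unfolding subspace_def by blast
 have Nadd: "x \<oplus>\<^bsub>U\<^esub> y \<in> N" if "x \<in> N" "y \<in> N" for x y using N that unfolding subspace_def by blast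
 have Nmult: "c \<odot>\<^bsub>U\<^esub> y \<in> N" if "c \<in> \<K>" "y \<in> N" for c y using N that unfolding subspace_def by blast
 have evS': "ev w \<in> S" if w: "w \<in> lists \<Omega>" for w
 proof (rule SI[OF fev[OF w]])
  fix d f assume d: "d \<in> {lc, rc}" and f: "f \<in> N"
  show "\<exists>x\<in>N. \<forall>u\<in>lists \<Omega>. ev u x = ev w (d u f)"
  proof (cases "d = lc")
   case True
   then show ?thesis using rcN[OF w f] rc[OF _ w f] lc[OF w _ f] by (intro bexI[of _ "rc w f"]) simp_all
  next
   case False
   then have "d = rc" using d by simp
   then show ?thesis using lcN[OF w f] lc[OF _ w f] rc[OF w _ f] by (intro bexI[of _ "lc w f"]) simp_all
  qed
 qed
 have S: "separating U S"
  unfolding separating_def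
 proof (intro conjI ballI impI)
  show "fnl U e" if "e \<in> S" for e by (rule fS[OF that])
  show "x = \<zero>\<^bsub>U\<^esub>" if "x \<in> carrier U" "\<forall>e\<in>S. e x = \<zero>" for x
   using evS that evS' unfolding separating_def by blast
 qed
 have S0: "(\<lambda>_. \<zero>) \<in> S"
  by (rule SI[OF lin_zero_map[OF algebra_Ks, simplified]]) (use N0 lin_zero[OF fev U algebra_Ks] in \<open>auto intro!: bexI[of _ "\<zero>\<^bsub>U\<^esub>"]\<close>)
 have Sadd: "(\<lambda>x. e x \<oplus> e' x) \<in> S" if e: "e \<in> S" "e' \<in> S" for e e'
 proof (rule SI)
  show "fnl U (\<lambda>x. e x \<oplus> e' x)" using lin_add[OF algebra_Ks fS[OF e(1)] fS[OF e(2)]] by simp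
  fix d f assume d: "d \<in> {lc, rc}" "f \<in> N"
  obtain x where "x \<in> N" "\<forall>u\<in>lists \<Omega>. ev u x = e (d u f)" using Sd[OF e(1) d] by (rule bexE)
  moreover obtain y where "y \<in> N" "\<forall>u\<in>lists \<Omega>. ev u y = e' (d u f)" using Sd[OF e(2) d] by (rule bexE)
  ultimately show "\<exists>x\<in>N. \<forall>u\<in>lists \<Omega>. ev u x = e (d u f) \<oplus> e' (d u f)"
   using linD(2)[OF fev NU NU] Nadd by (intro bexI[of _ "x \<oplus>\<^bsub>U\<^esub> y"]) simp_all
 qed
 have Smult: "(\<lambda>x. c \<otimes> e x) \<in> S" if c: "c \<in> \<K>" and e: "e \<in> S" for c e
 proof (rule SI)
  show "fnl U (\<lambda>x. c \<otimes> e x)" using lin_smult[OF algebra_Ks c fS[OF e]] by simp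
  fix d f assume d: "d \<in> {lc, rc}" "f \<in> N"
  obtain x where "x \<in> N" "\<forall>u\<in>lists \<Omega>. ev u x = e (d u f)" using Sd[OF e d] by (rule bexE)
  then show "\<exists>x\<in>N. \<forall>u\<in>lists \<Omega>. ev u x = c \<otimes> e (d u f)"
   using linD(3)[OF fev c NU] Nmult[OF c] by (intro bexI[of _ "c \<odot>\<^bsub>U\<^esub> x"]) simp_all
 qed
 have Sext: "e' \<in> S" if e: "e \<in> S" and eq: "\<And>x. x \<in> carrier U \<Longrightarrow> e' x = e x" for e e'
 proof (rule SI[OF lin_cong[OF fS[OF e] U eq]])
  show "\<exists>x\<in>N. \<forall>u\<in>lists \<Omega>. ev u x = e' (d u f)" if d: "d \<in> {lc, rc}" "f \<in> N" for d f
  proof -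
   have *: "e' (d u f) = e (d u f)" if "u \<in> lists \<Omega>" for u
    using eq[OF lcU(1)[OF that \<open>f \<in> N\<close>]] eq[OF lcU(2)[OF that \<open>f \<in> N\<close>]] \<open>d \<in> {lc, rc}\<close> by auto
   obtain x where "x \<in> N" "\<forall>u\<in>lists \<Omega>. ev u x = e (d u f)" using Sd[OF e d] by (rule bexE)
   then show ?thesis by (intro bexI[of _ x]) (simp_all add: *)
  qed
 qed
 have dual: "\<exists>\<chi>. \<forall>j\<in>J. \<chi> j \<in> S \<and> (\<forall>i\<in>J. \<chi> j (x i) = (if i = j then \<one> else \<zero>))"
  if x: "\<And>j. j \<in> J \<Longrightarrow> x j \<in> carrier U" and ix: "indep U J x" for x
 proof (rule dual_basis[OF U S S0 _ _ _ J _ ix])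
  show "(\<lambda>x. e x \<oplus> e' x) \<in> S" if "e \<in> S" "e' \<in> S" for e e' by (rule Sadd[OF that])
  show "(\<lambda>x. c \<otimes> e x) \<in> S" if "c \<in> \<K>" "e \<in> S" for c e by (rule Smult[OF that])
  show "e' \<in> S" if "e \<in> S" "\<And>x. x \<in> carrier U \<Longrightarrow> e' x = e x" for e e' by (rule Sext[OF that])
 qed (rule x)
 obtain \<chi> where "\<forall>j\<in>J. \<chi> j \<in> S \<and> (\<forall>i\<in>J. \<chi> j (h i) = (if i = j then \<one> else \<zero>))"
  using dual[OF h ih] by (rule exE)
 then have \<chi>: "\<And>j. j \<in> J \<Longrightarrow> \<chi> j \<in> S" "\<And>i j. j \<in> J \<Longrightarrow> i \<in> J \<Longrightarrow> \<chi> j (h i) = (if i = j then \<one> else \<zero>)"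
  by simp_all
 obtain \<eta> where "\<forall>j\<in>J. \<eta> j \<in> S \<and> (\<forall>i\<in>J. \<eta> j (g i) = (if i = j then \<one> else \<zero>))"
  using dual[OF g ig] by (rule exE)
 then have \<eta>: "\<And>j. j \<in> J \<Longrightarrow> \<eta> j \<in> S" "\<And>i j. j \<in> J \<Longrightarrow> i \<in> J \<Longrightarrow> \<eta> j (g i) = (if i = j then \<one> else \<zero>)"
  by simp_all
 have dsum: "ksum (\<lambda>i. c i \<otimes> (if i = j then \<one> else \<zero>)) J = c j" if "j \<in> J" "\<And>i. i \<in> J \<Longrightarrow> c i \<in> \<K>" for j c
  using ksum_delta[OF J that(1), of "\<lambda>i. c i \<otimes> (if i = j then \<one> else \<zero>)"] that by simp
 have lcf: "lc u f = finsum U (\<lambda>j. ev u (g j) \<odot>\<^bsub>U\<^esub> h j) J" if u: "u \<in> lists \<Omega>" for u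
 proof (rule eqI[OF lcU(1)[OF u f]])
  show "finsum U (\<lambda>j. ev u (g j) \<odot>\<^bsub>U\<^esub> h j) J \<in> carrier U" by (rule fsum_closed[OF U]) (use evc[OF u] g h U in simp)
  show "ev w (lc u f) = ev w (finsum U (\<lambda>j. ev u (g j) \<odot>\<^bsub>U\<^esub> h j) J)" if w: "w \<in> lists \<Omega>" for w
   unfolding lc[OF w u f] F[OF u w] by (rule fnl_lincomb[OF fev[OF w] U J evc[OF u g] h, symmetric])
 qed
 have rcf: "rc w f = finsum U (\<lambda>j. ev w (h j) \<odot>\<^bsub>U\<^esub> g j) J" if w: "w \<in> lists \<Omega>" for w
 proof (rule eqI[OF lcU(2)[OF w f]])
  show "finsum U (\<lambda>j. ev w (h j) \<odot>\<^bsub>U\<^esub> g j) J \<in> carrier U" by (rule fsum_closed[OF U]) (use evc[OF w] g h U in simp)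
  show "ev u (rc w f) = ev u (finsum U (\<lambda>j. ev w (h j) \<odot>\<^bsub>U\<^esub> g j) J)" if u: "u \<in> lists \<Omega>" for u
  proof -
   have "ev u (rc w f) = ksum (\<lambda>j. ev w (h j) \<otimes> ev u (g j)) J"
    unfolding rc[OF u w f] F[OF u w] by (rule ksum_cong[OF refl]) (use evc g h u w m_comm in simp_all)
   then show ?thesis using fnl_lincomb[OF fev[OF u] U J evc[OF w h] g] by simp
  qed
 qed
 have half: "y j \<in> N" if j: "j \<in> J" and d: "d \<in> {lc, rc}" and \<xi>: "\<xi> j \<in> S" "\<And>i. i \<in> J \<Longrightarrow> \<xi> j (z i) = (if i = j then \<one> else \<zero>)"
  and y: "\<And>j. j \<in> J \<Longrightarrow> y j \<in> carrier U" and z: "\<And>j. j \<in> J \<Longrightarrow> z j \<in> carrier U"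
  and df: "\<And>u. u \<in> lists \<Omega> \<Longrightarrow> d u f = finsum U (\<lambda>j. ev u (y j) \<odot>\<^bsub>U\<^esub> z j) J" for j d \<xi> y z
 proof -
  obtain x where x: "x \<in> N" "\<And>u. u \<in> lists \<Omega> \<Longrightarrow> ev u x = \<xi> j (d u f)" using Sd[OF \<xi>(1) d f] by auto
  have "x = y j"
  proof (rule eqI[OF NU[OF x(1)] y[OF j]])
   fix u assume u: "u \<in> lists \<Omega>"
   have "ev u x = ksum (\<lambda>i. ev u (y i) \<otimes> \<xi> j (z i)) J"
    unfolding x(2)[OF u] df[OF u] by (rule fnl_lincomb[OF fS[OF \<xi>(1)] U J evc[OF u y] z])
   also have "\<dots> = ksum (\<lambda>i. ev u (y i) \<otimes> (if i = j then \<one> else \<zero>)) J"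
    by (rule ksum_cong[OF refl]) (use \<xi>(2) evc y u in auto)
   also have "\<dots> = ev u (y j)" by (rule dsum[OF j evc[OF u y]])
   finally show "ev u x = ev u (y j)" .
  qed
  then show ?thesis using x by simp
 qed
 have hN: "h j \<in> N" if j: "j \<in> J" for j
  by (rule half[of j rc \<eta> g h, OF j _ \<eta>(1)[OF j] \<eta>(2)[OF j] h g rcf]) simp_all
 \<comment> \<open>The entry \<open>M l j\<close> is the contraction of the right end of \<open>h l\<close> with the dual functional \<open>\<chi> j\<close>.\<close>
 define M where "M l j = (SOME m. m \<in> N \<and> (\<forall>v\<in>lists \<Omega>. ev v m = \<chi> j (lc v (h l))))" for l j
 have "M l j \<in> N \<and> (\<forall>v\<in>lists \<Omega>. ev v (M l j) = \<chi> j (lc v (h l)))" if "l \<in> J" "j \<in> J" for l j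
  unfolding M_def by (rule someI_ex) (use Sd[OF \<chi>(1)[OF that(2)] _ hN[OF that(1)], of lc] in auto)
 then have M: "\<And>l j. l \<in> J \<Longrightarrow> j \<in> J \<Longrightarrow> M l j \<in> N"
  "\<And>l j v. \<lbrakk>l \<in> J; j \<in> J; v \<in> lists \<Omega>\<rbrakk> \<Longrightarrow> ev v (M l j) = \<chi> j (lc v (h l))" by simp_all
 have MU: "M l j \<in> carrier U" if "l \<in> J" "j \<in> J" for l j by (rule NU[OF M(1)[OF that]])
 have A: "ev (u @ v) (g j) = ksum (\<lambda>l. ev u (g l) \<otimes> ev v (M l j)) J"
  if u: "u \<in> lists \<Omega>" and v: "v \<in> lists \<Omega>" and j: "j \<in> J" for u v j
 proof -
  have 1: "lc (u @ v) f = finsum U (\<lambda>l. ev u (g l) \<odot>\<^bsub>U\<^esub> lc v (h l)) J"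
  proof (rule eqI[OF lcU(1)[OF app[OF u v] f]])
   show "finsum U (\<lambda>l. ev u (g l) \<odot>\<^bsub>U\<^esub> lc v (h l)) J \<in> carrier U"
    by (rule fsum_closed[OF U]) (use evc[OF u] g lcU(1)[OF v hN] U in simp)
   fix w assume w: "w \<in> lists \<Omega>"
   have "ev w (lc (u @ v) f) = ksum (\<lambda>l. ev u (g l) \<otimes> ev (v @ w) (h l)) J"
    using lc[OF w app[OF u v] f] F[OF u app[OF v w]] by simp
   also have "\<dots> = ksum (\<lambda>l. ev u (g l) \<otimes> ev w (lc v (h l))) J"
    by (rule ksum_cong[OF refl]) (use lc[OF w v hN] evc[OF u g] evc[OF w lcU(1)[OF v hN]] in simp_all)
   also have "\<dots> = ev w (finsum U (\<lambda>l. ev u (g l) \<odot>\<^bsub>U\<^esub> lc v (h l)) J)"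
    by (rule fnl_lincomb[OF fev[OF w] U J evc[OF u g] lcU(1)[OF v hN], symmetric])
   finally show "ev w (lc (u @ v) f) = ev w (finsum U (\<lambda>l. ev u (g l) \<odot>\<^bsub>U\<^esub> lc v (h l)) J)" .
  qed
  have f\<chi>: "fnl U (\<chi> j)" by (rule fS[OF \<chi>(1)[OF j]])
  have "\<chi> j (lc (u @ v) f) = ksum (\<lambda>i. ev (u @ v) (g i) \<otimes> \<chi> j (h i)) J"
   unfolding lcf[OF app[OF u v]] by (rule fnl_lincomb[OF f\<chi> U J evc[OF app[OF u v] g] h])
  also have "\<dots> = ksum (\<lambda>i. ev (u @ v) (g i) \<otimes> (if i = j then \<one> else \<zero>)) J"
   by (rule ksum_cong[OF refl]) (use \<chi>(2) j evc[OF app[OF u v] g] in auto)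
  also have "\<dots> = ev (u @ v) (g j)" by (rule dsum[OF j evc[OF app[OF u v] g]])
  finally have 2: "\<chi> j (lc (u @ v) f) = ev (u @ v) (g j)" .
  have "\<chi> j (lc (u @ v) f) = ksum (\<lambda>l. ev u (g l) \<otimes> \<chi> j (lc v (h l))) J"
   unfolding 1 by (rule fnl_lincomb[OF f\<chi> U J evc[OF u g] lcU(1)[OF v hN]])
  also have "\<dots> = ksum (\<lambda>l. ev u (g l) \<otimes> ev v (M l j)) J"
   by (rule ksum_cong[OF refl]) (use M(2)[OF _ j v] evc[OF u g] evc[OF v MU[OF _ j]] in simp_all)
  finally show ?thesis using 2 by simp
 qed
 have coeff: "a l = b l"
  if a: "\<And>l. l \<in> J \<Longrightarrow> a l \<in> \<K>" and b: "\<And>l. l \<in> J \<Longrightarrow> b l \<in> \<K>" and l: "l \<in> J"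
   and eq: "\<And>u. u \<in> lists \<Omega> \<Longrightarrow> ksum (\<lambda>l. ev u (g l) \<otimes> a l) J = ksum (\<lambda>l. ev u (g l) \<otimes> b l) J" for a b l
 proof -
  have cl: "finsum U (\<lambda>l. a l \<odot>\<^bsub>U\<^esub> g l) J \<in> carrier U" if "\<And>l. l \<in> J \<Longrightarrow> a l \<in> \<K>" for a
   by (rule fsum_closed[OF U]) (use that g U in simp)
  have ee: "ev u (finsum U (\<lambda>l. a l \<odot>\<^bsub>U\<^esub> g l) J) = ksum (\<lambda>l. ev u (g l) \<otimes> a l) J"
   if u: "u \<in> lists \<Omega>" and a: "\<And>l. l \<in> J \<Longrightarrow> a l \<in> \<K>" for u a
  proof -
   have "ev u (finsum U (\<lambda>l. a l \<odot>\<^bsub>U\<^esub> g l) J) = ksum (\<lambda>l. a l \<otimes> ev u (g l)) J"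
    by (rule fnl_lincomb[OF fev[OF u] U J a g])
   also have "\<dots> = ksum (\<lambda>l. ev u (g l) \<otimes> a l) J"
    by (rule ksum_cong[OF refl]) (use a evc[OF u g] m_comm in simp_all)
   finally show ?thesis .
  qed
  have "finsum U (\<lambda>l. a l \<odot>\<^bsub>U\<^esub> g l) J = finsum U (\<lambda>l. b l \<odot>\<^bsub>U\<^esub> g l) J"
   by (rule eqI[OF cl[OF a] cl[OF b]]) (simp_all add: ee a b eq)
  moreover have "\<eta> l (finsum U (\<lambda>l. a l \<odot>\<^bsub>U\<^esub> g l) J) = a l" if a: "\<And>l. l \<in> J \<Longrightarrow> a l \<in> \<K>" for a
  proof -
   have "\<eta> l (finsum U (\<lambda>l. a l \<odot>\<^bsub>U\<^esub> g l) J) = ksum (\<lambda>i. a i \<otimes> \<eta> l (g i)) J"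
    by (rule fnl_lincomb[OF fS[OF \<eta>(1)[OF l]] U J a g])
   also have "\<dots> = ksum (\<lambda>i. a i \<otimes> (if i = l then \<one> else \<zero>)) J"
    by (rule ksum_cong[OF refl]) (use \<eta>(2)[OF l] a in auto)
   finally show ?thesis using dsum[OF l a] by simp
  qed
  ultimately show ?thesis using a b by metis
 qed
 have B: "ev (v @ w) (M i j) = ksum (\<lambda>l. ev v (M i l) \<otimes> ev w (M l j)) J"
  if v: "v \<in> lists \<Omega>" and w: "w \<in> lists \<Omega>" and i: "i \<in> J" and j: "j \<in> J" for v w i j
 proof (rule coeff[OF _ _ i])
  let ?b = "\<lambda>i. ksum (\<lambda>l. ev v (M i l) \<otimes> ev w (M l j)) J"
  show a: "ev (v @ w) (M l j) \<in> \<K>" if "l \<in> J" for l using evc[OF app[OF v w] MU[OF that j]] .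
  show "?b l \<in> \<K>" if "l \<in> J" for l
   by (rule ksum_closed) (use evc[OF v MU[OF that]] evc[OF w MU[OF _ j]] in simp)
  fix u assume u: "u \<in> lists \<Omega>"
  have "ksum (\<lambda>l. ev u (g l) \<otimes> ev (v @ w) (M l j)) J = ev ((u @ v) @ w) (g j)"
   using A[OF u app[OF v w] j] by simp
  also have "\<dots> = ksum (\<lambda>i. ev (u @ v) (g i) \<otimes> ev w (M i j)) J" by (rule A[OF app[OF u v] w j])
  also have "\<dots> = ksum (\<lambda>i. ksum (\<lambda>l. ev u (g l) \<otimes> ev v (M l i) \<otimes> ev w (M i j)) J) J"
  proof (rule ksum_cong[OF refl])
   fix i assume i: "i \<in> J"
   show "ev (u @ v) (g i) \<otimes> ev w (M i j) = ksum (\<lambda>l. ev u (g l) \<otimes> ev v (M l i) \<otimes> ev w (M i j)) J"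
    unfolding A[OF u v i]
    by (rule ksum_mult_left[OF J]) (use evc[OF u g] evc[OF v MU[OF _ i]] evc[OF w MU[OF i j]] in simp_all)
   show "ksum (\<lambda>l. ev u (g l) \<otimes> ev v (M l i) \<otimes> ev w (M i j)) J \<in> \<K>"
    by (rule ksum_closed) (use evc[OF u g] evc[OF v MU[OF _ i]] evc[OF w MU[OF i j]] in simp)
  qed
  also have "\<dots> = ksum (\<lambda>l. ksum (\<lambda>i. ev u (g l) \<otimes> ev v (M l i) \<otimes> ev w (M i j)) J) J"
   by (rule ksum_swap[OF J J]) (use evc[OF u g] evc[OF v MU] evc[OF w MU[OF _ j]] in simp)
  also have "\<dots> = ksum (\<lambda>l. ev u (g l) \<otimes> ?b l) J"
  proof (rule ksum_cong[OF refl])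
   fix l assume l: "l \<in> J"
   have "ev u (g l) \<otimes> ?b l = ksum (\<lambda>i. ev u (g l) \<otimes> (ev v (M l i) \<otimes> ev w (M i j))) J"
    by (rule ksum_mult_right[OF J]) (use evc[OF u g[OF l]] evc[OF v MU[OF l]] evc[OF w MU[OF _ j]] in simp_all)
   also have "\<dots> = ksum (\<lambda>i. ev u (g l) \<otimes> ev v (M l i) \<otimes> ev w (M i j)) J"
    by (rule ksum_cong[OF refl]) (use evc[OF u g[OF l]] evc[OF v MU[OF l]] evc[OF w MU[OF _ j]] in \<open>simp_all add: m_assoc\<close>)
   finally show "ksum (\<lambda>i. ev u (g l) \<otimes> ev v (M l i) \<otimes> ev w (M i j)) J = ev u (g l) \<otimes> ?b l" ..
   have "?b l \<in> \<K>" by (rule ksum_closed) (use evc[OF v MU[OF l]] evc[OF w MU[OF _ j]] in simp)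
   then show "ev u (g l) \<otimes> ?b l \<in> \<K>" using evc[OF u g[OF l]] by simp
  qed
  finally show "ksum (\<lambda>l. ev u (g l) \<otimes> ev (v @ w) (M l j)) J = ksum (\<lambda>l. ev u (g l) \<otimes> ?b l) J" .
 qed
 have C: "ev [] (M i j) = (if i = j then \<one> else \<zero>)" if i: "i \<in> J" and j: "j \<in> J" for i j
 proof (rule coeff[OF _ _ i])
  show "ev [] (M l j) \<in> \<K>" if "l \<in> J" for l by (rule evc[OF nil MU[OF that j]])
  show "ksum (\<lambda>l. ev u (g l) \<otimes> ev [] (M l j)) J = ksum (\<lambda>l. ev u (g l) \<otimes> (if l = j then \<one> else \<zero>)) J"
   if u: "u \<in> lists \<Omega>" for u
  proof -
   have "ksum (\<lambda>l. ev u (g l) \<otimes> (if l = j then \<one> else \<zero>)) J = ev u (g j)" by (rule dsum[OF j evc[OF u g]])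
   then show ?thesis using A[OF u nil j] by simp
  qed
 qed simp
 have D: "f \<in> Q" if Q: "subspace U Q" and MQ: "\<And>i j. i \<in> J \<Longrightarrow> j \<in> J \<Longrightarrow> M i j \<in> Q" for Q
 proof -
  have gQ: "g j \<in> Q" if j: "j \<in> J" for j
  proof -
   have "g j = finsum U (\<lambda>l. ev [] (g l) \<odot>\<^bsub>U\<^esub> M l j) J"
   proof (rule eqI[OF g[OF j]])
    show "finsum U (\<lambda>l. ev [] (g l) \<odot>\<^bsub>U\<^esub> M l j) J \<in> carrier U"
     by (rule fsum_closed[OF U]) (use evc[OF nil g] MU[OF _ j] U in simp)
    show "ev w (g j) = ev w (finsum U (\<lambda>l. ev [] (g l) \<odot>\<^bsub>U\<^esub> M l j) J)" if w: "w \<in> lists \<Omega>" for w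
     using A[OF nil w j] fnl_lincomb[OF fev[OF w] U J evc[OF nil g] MU[OF _ j]] by simp
   qed
   then show ?thesis using subspace_lincomb[OF U Q J evc[OF nil g] MQ[OF _ j]] by simp
  qed
  have "f = finsum U (\<lambda>j. ev [] (h j) \<odot>\<^bsub>U\<^esub> g j) J"
  proof (rule eqI[OF NU[OF f]])
   show "finsum U (\<lambda>j. ev [] (h j) \<odot>\<^bsub>U\<^esub> g j) J \<in> carrier U"
    by (rule fsum_closed[OF U]) (use evc[OF nil h] g U in simp)
   show "ev w f = ev w (finsum U (\<lambda>j. ev [] (h j) \<odot>\<^bsub>U\<^esub> g j) J)" if w: "w \<in> lists \<Omega>" for w
   proof -
    have "ev w f = ev w (rc [] f)" using rc[OF w nil f] by simp
    then show ?thesis by (simp only: rcf[OF nil])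
   qed
  qed
  then show ?thesis using subspace_lincomb[OF U Q J evc[OF nil h] gQ] by simp
 qed
 show thesis by (rule that[OF J M(1) B C D])
qed

section \<open>Hopf algebras and their matrix coefficients\<close>

lemma tev_expand_at:
 assumes Ms: "algs Ms" and M: "alg M" and Ms': "algs Ms'" and Ns: "algs Ns"
  and D: "lin M (tens Ns) D" and l: "l = length Ms"
 shows "lin (tens (Ms @ M # Ms')) (tens (Ms @ Ns @ Ms')) (expand_at K (Ms @ Ns @ Ms') D l)"
  and "\<lbrakk>fnls Ms as; fnls Ns bs; fnls Ms' cs; t \<in> TC (Ms @ M # Ms')\<rbrakk> \<Longrightarrow>
   tev (as @ bs @ cs) (expand_at K (Ms @ Ns @ Ms') D l t) = tev (as @ (\<lambda>x. tev bs (D x)) # cs) t"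
proof -
 let ?W = "Ms @ Ns @ Ms'" and ?V = "Ms @ M # Ms'"
 have W: "algs ?W" and V: "algs ?V" using Ms M Ms' Ns by auto
 note TW = alg_tens[OF W]
 let ?G = "\<lambda>xs. tlift (tens ?W) (\<lambda>ys. pur ?W (take l xs @ ys @ drop (Suc l) xs)) (D (xs ! l))"
 have G: "multilin ?V (tens ?W) ?G"
  by (rule multilin_expand[OF Ms M Ms' Ns TW multilin_pure[OF W] D l])
 show lin: "lin (tens ?V) (tens ?W) (expand_at K ?W D l)"
  unfolding expand_at_def by (rule lin_tensor_lift[OF V TW G])
 assume as: "fnls Ms as" and bs: "fnls Ns bs" and cs: "fnls Ms' cs" and t: "t \<in> TC ?V"
 have fW: "fnls ?W (as @ bs @ cs)" using as bs cs by (intro list_all2_appendI)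
 have Db: "fnl M (\<lambda>x. tev bs (D x))" by (rule lin_comp[OF D fnl_tev[OF Ns bs]])
 have fV: "fnls ?V (as @ (\<lambda>x. tev bs (D x)) # cs)" using as Db cs by (intro list_all2_appendI) simp_all
 show "tev (as @ bs @ cs) (expand_at K ?W D l t) = tev (as @ (\<lambda>x. tev bs (D x)) # cs) t"
 proof (rule tev_eqI[OF V fV lin_comp[OF lin fnl_tev[OF W fW]] _ t])
  fix xs assume xs: "xs \<in> RD ?V"
  obtain u xv where xs1: "xs = u @ xv" "length u = length Ms" "u \<in> RD Ms" "xv \<in> RD (M # Ms')" using xs by (rule RD_appendE)
  obtain x v where xv: "xv = x # v" "x \<in> carrier M" "v \<in> RD Ms'" using xs1(4) by (rule RD_ConsE)
  have eq: "xs = u @ x # v" using xs1 xv by simp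
  have tk: "take l xs = u" "drop (Suc l) xs = v" "xs ! l = x" using eq xs1(2) l nth_append_length[of u x v] by simp_all
  have Dx: "D x \<in> TC Ns" by (rule linD(1)[OF D xv(2)])
  have g: "multilin Ns (tens ?W) (\<lambda>ys. pur ?W (u @ ys @ v))"
   using multilin_pure[OF W, unfolded multilin_append] xs1(3) xv(3) by simp
  have pu: "pev as u \<in> \<K>" and pv: "pev cs v \<in> \<K>" using pev_closed[OF as xs1(3)] pev_closed[OF cs xv(3)] by simp_all
  have "expand_at K ?W D l (pur ?V xs) = tlift (tens ?W) (\<lambda>ys. pur ?W (u @ ys @ v)) (D x)"
   unfolding expand_at_def tensor_lift_pure[OF V TW G xs] tk ..
  then have "tev (as @ bs @ cs) (expand_at K ?W D l (pur ?V xs))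
   = tlift (Ks) (\<lambda>ys. tev (as @ bs @ cs) (pur ?W (u @ ys @ v))) (D x)"
   using tev_tensor_lift[OF Ns W fW g Dx] by simp
  also have "\<dots> = pev as u \<otimes> (tev bs (D x) \<otimes> pev cs v)"
  proof (rule tensor_lift_unique[OF Ns algebra_Ks lin_multilin[OF g fnl_tev[OF W fW]] _ _ Dx, symmetric])
   show "fnl (tens Ns) (\<lambda>s. pev as u \<otimes> (tev bs s \<otimes> pev cs v))"
    using lin_smult[OF algebra_Ks pu lin_smult_left[OF algebra_Ks _ fnl_tev[OF Ns bs], of "pev cs v"]] pv by simp
   fix ys assume ys: "ys \<in> RD Ns"
   have "u @ ys @ v \<in> RD ?W" using xs1(3) ys xv(3) by simp
   then show "pev as u \<otimes> (tev bs (pur Ns ys) \<otimes> pev cs v) = tev (as @ bs @ cs) (pur ?W (u @ ys @ v))"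
    using tev_pure[OF W fW] tev_pure[OF Ns bs ys] pev_append[OF as list_all2_appendI[OF bs cs] xs1(3) RD_append'[OF ys xv(3)]]
     pev_append[OF bs cs ys xv(3)] by simp
  qed
  also have "\<dots> = pev (as @ (\<lambda>x. tev bs (D x)) # cs) xs"
  proof -
   have "fnls (M # Ms') ((\<lambda>x. tev bs (D x)) # cs)" using Db cs by simp
   moreover have "x # v \<in> RD (M # Ms')" using xv by simp
   ultimately have "pev (as @ (\<lambda>x. tev bs (D x)) # cs) (u @ x # v) = pev as u \<otimes> pev ((\<lambda>x. tev bs (D x)) # cs) (x # v)"
    by (rule pev_append[OF as _ xs1(3)])
   then show ?thesis unfolding eq by simp
  qed
  finally show "tev (as @ bs @ cs) (expand_at K ?W D l (pur ?V xs)) = pev (as @ (\<lambda>x. tev bs (D x)) # cs) xs" .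
 qed
qed

lemma tev_pair_cong:
 assumes M: "alg M" and N: "alg N" and a: "fnl M a" and b: "fnl N b"
  and eq: "\<And>x. x \<in> carrier M \<Longrightarrow> a' x = a x" "\<And>x. x \<in> carrier N \<Longrightarrow> b' x = b x" and t: "t \<in> TC [M, N]"
 shows "tev [a', b'] t = tev [a, b] t"
 unfolding tev_def
proof (rule tensor_lift_cong[OF _ algebra_Ks _ _ t])
 show "multilin [M, N] (Ks) (pev [a, b])" using a b by (intro multilin_pev) simp
 show "pev [a', b'] xs = pev [a, b] xs" if "xs \<in> RD [M, N]" for xs
  using that eq by (auto elim!: RD_ConsE)
qed (use M N in simp)

subsection \<open>The axioms in terms of functionals\<close>

lemma hopfD:
 assumes h: "hopf B"
 shows "alg B" and "lin B (tens [B, B]) (comult B)" and "fnl B (counit B)" and "lin B B (antipode B)"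
  and "x \<in> carrier B \<Longrightarrow> y \<in> carrier B \<Longrightarrow> comult B (x \<otimes>\<^bsub>B\<^esub> y) = comult B x \<otimes>\<^bsub>tens [B, B]\<^esub> comult B y"
  and "comult B \<one>\<^bsub>B\<^esub> = \<one>\<^bsub>tens [B, B]\<^esub>"
  and "x \<in> carrier B \<Longrightarrow> y \<in> carrier B \<Longrightarrow> counit B (x \<otimes>\<^bsub>B\<^esub> y) = counit B x \<otimes> counit B y"
  and "counit B \<one>\<^bsub>B\<^esub> = \<one>"
proof -
 show "alg B" using h by (simp add: hopf_algebra_def)
 note c = hopf_algebra.comult_hom[OF h] and e = hopf_algebra.counit_hom[OF h]
 show "lin B (tens [B, B]) (comult B)" using c by (simp add: lin_def alg_hom_def ring_hom_def Pi_iff)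
 show "fnl B (counit B)" using e by (simp add: lin_def alg_hom_def ring_hom_def Pi_iff)
 show "lin B B (antipode B)"
  using hopf_algebra.antipode_closed[OF h] hopf_algebra.antipode_add[OF h] hopf_algebra.antipode_smult[OF h]
  by (simp add: lin_def)
 show "comult B (x \<otimes>\<^bsub>B\<^esub> y) = comult B x \<otimes>\<^bsub>tens [B, B]\<^esub> comult B y" if "x \<in> carrier B" "y \<in> carrier B"
  using c that by (simp add: alg_hom_def ring_hom_def)
 show "comult B \<one>\<^bsub>B\<^esub> = \<one>\<^bsub>tens [B, B]\<^esub>" using c by (simp add: alg_hom_def ring_hom_def)
 show "counit B (x \<otimes>\<^bsub>B\<^esub> y) = counit B x \<otimes> counit B y" if "x \<in> carrier B" "y \<in> carrier B"
  using e that by (simp add: alg_hom_def ring_hom_def)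
 show "counit B \<one>\<^bsub>B\<^esub> = \<one>" using e by (simp add: alg_hom_def ring_hom_def)
qed

lemma fnl_pair_lift:
 assumes B: "alg B" and a: "fnl B a" and b: "fnl B b" and t: "t \<in> TC [B, B]"
 shows "tlift B (\<lambda>xs. a (xs ! 0) \<odot>\<^bsub>B\<^esub> xs ! 1) t \<in> carrier B"
  and "b (tlift B (\<lambda>xs. a (xs ! 0) \<odot>\<^bsub>B\<^esub> xs ! 1) t) = tev [a, b] t"
  and "tlift B (\<lambda>xs. a (xs ! 1) \<odot>\<^bsub>B\<^esub> xs ! 0) t \<in> carrier B"
  and "b (tlift B (\<lambda>xs. a (xs ! 1) \<odot>\<^bsub>B\<^esub> xs ! 0) t) = tev [b, a] t"
proof -
 have BB: "algs [B, B]" using B by simp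
 have ac: "a x \<in> \<K>" "b x \<in> \<K>" if "x \<in> carrier B" for x using fnl_closed[OF a that] fnl_closed[OF b that] by simp_all
 have g: "multilin [B, B] B (\<lambda>xs. a (xs ! 0) \<odot>\<^bsub>B\<^esub> xs ! 1)"
  using lin_smult_left[OF B _ a] lin_smult[OF B ac(1) lin_id] ac B by (auto elim!: RD_ConsE)
 have g': "multilin [B, B] B (\<lambda>xs. a (xs ! 1) \<odot>\<^bsub>B\<^esub> xs ! 0)"
  using lin_smult_left[OF B _ a] lin_smult[OF B ac(1) lin_id] ac B by (auto elim!: RD_ConsE)
 show "tlift B (\<lambda>xs. a (xs ! 0) \<odot>\<^bsub>B\<^esub> xs ! 1) t \<in> carrier B"
  "tlift B (\<lambda>xs. a (xs ! 1) \<odot>\<^bsub>B\<^esub> xs ! 0) t \<in> carrier B"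
  using tensor_lift_closed[OF BB B g t] tensor_lift_closed[OF BB B g' t] by simp_all
 have f: "fnls [B, B] [a, b]" "fnls [B, B] [b, a]" using a b by simp_all
 show "b (tlift B (\<lambda>xs. a (xs ! 0) \<odot>\<^bsub>B\<^esub> xs ! 1) t) = tev [a, b] t"
 proof (rule tev_eqI[OF BB f(1) lin_comp[OF lin_tensor_lift[OF BB B g] b] _ t])
  fix xs assume xs: "xs \<in> RD [B, B]"
  then obtain x y where xy: "xs = [x, y]" "x \<in> carrier B" "y \<in> carrier B" by (auto elim!: RD_ConsE)
  show "b (tlift B (\<lambda>xs. a (xs ! 0) \<odot>\<^bsub>B\<^esub> xs ! 1) (pur [B, B] xs)) = pev [a, b] xs"
   unfolding tensor_lift_pure[OF BB B g xs] using xy linD(3)[OF b ac(1) xy(3)] ac by simp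
 qed
 show "b (tlift B (\<lambda>xs. a (xs ! 1) \<odot>\<^bsub>B\<^esub> xs ! 0) t) = tev [b, a] t"
 proof (rule tev_eqI[OF BB f(2) lin_comp[OF lin_tensor_lift[OF BB B g'] b] _ t])
  fix xs assume xs: "xs \<in> RD [B, B]"
  then obtain x y where xy: "xs = [x, y]" "x \<in> carrier B" "y \<in> carrier B" by (auto elim!: RD_ConsE)
  show "b (tlift B (\<lambda>xs. a (xs ! 1) \<odot>\<^bsub>B\<^esub> xs ! 0) (pur [B, B] xs)) = pev [b, a] xs"
   unfolding tensor_lift_pure[OF BB B g' xs] using xy linD(3)[OF b ac(1) xy(2)] ac m_comm by simp
 qed
qed

lemma tev_counit:
 assumes h: "hopf B" and b: "fnl B b" and x: "x \<in> carrier B"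
 shows "tev [counit B, b] (comult B x) = b x" and "tev [b, counit B] (comult B x) = b x"
 using fnl_pair_lift(2,4)[OF hopfD(1)[OF h] hopfD(3)[OF h] b linD(1)[OF hopfD(2)[OF h] x]]
  hopf_algebra.counit_left[OF h x] hopf_algebra.counit_right[OF h x] by simp_all

lemma tev_coassoc:
 assumes h: "hopf B" and f: "fnl B a" "fnl B b" "fnl B c" and x: "x \<in> carrier B"
 shows "tev [\<lambda>y. tev [a, b] (comult B y), c] (comult B x) = tev [a, \<lambda>y. tev [b, c] (comult B y)] (comult B x)"
proof -
 note B = hopfD(1)[OF h] and D = hopfD(2)[OF h]
 note t = linD(1)[OF D x]
 have "tev [a, b, c] (expand_at K [B, B, B] (comult B) 0 (comult B x)) = tev [\<lambda>y. tev [a, b] (comult B y), c] (comult B x)"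
  using tev_expand_at(2)[of "[]" B "[B]" "[B, B]" "comult B" 0 "[]" "[a, b]" "[c]" "comult B x"] B D f t by simp
 moreover have "tev [a, b, c] (expand_at K [B, B, B] (comult B) 1 (comult B x)) = tev [a, \<lambda>y. tev [b, c] (comult B y)] (comult B x)"
  using tev_expand_at(2)[of "[B]" B "[]" "[B, B]" "comult B" 1 "[a]" "[b, c]" "[]" "comult B x"] B D f t by simp
 ultimately show ?thesis using hopf_algebra.coassoc[OF h x] by simp
qed

subsection \<open>Convolution of functionals\<close>

text \<open>The value at \<open>x\<close> of a product of functionals in the dual algebra: the word is evaluated on
  the iterated coproduct of \<open>x\<close>.\<close>

primrec conv :: "('k, 'v, 'n) hopf_scheme \<Rightarrow> ('v \<Rightarrow> 'k) list \<Rightarrow> 'v \<Rightarrow> 'k" where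
 "conv B [] = counit B"
| "conv B (\<phi> # w) = (\<lambda>x. tev [\<phi>, conv B w] (comult B x))"

lemma fnl_tev_comult:
 assumes h: "hopf B" and "fnl B a" "fnl B b"
 shows "fnl B (\<lambda>x. tev [a, b] (comult B x))"
 by (rule lin_comp[OF hopfD(2)[OF h] fnl_tev]) (use hopfD(1)[OF h] assms in simp_all)

lemma fnl_conv: "hopf B \<Longrightarrow> w \<in> lists {\<phi>. fnl B \<phi>} \<Longrightarrow> fnl B (conv B w)"
proof (induction w)
 case Nil
 then show ?case using hopfD(3) by simp
next
 case (Cons \<phi> w)
 then show ?case using fnl_tev_comult[of B \<phi> "conv B w"] by simp
qed

lemma conv_single: "\<lbrakk>hopf B; fnl B \<phi>; x \<in> carrier B\<rbrakk> \<Longrightarrow> conv B [\<phi>] x = \<phi> x"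
 using tev_counit(2) by simp

lemma conv_append:
 assumes h: "hopf B" and w: "w \<in> lists {\<phi>. fnl B \<phi>}"
 shows "u \<in> lists {\<phi>. fnl B \<phi>} \<Longrightarrow> x \<in> carrier B \<Longrightarrow> conv B (u @ w) x = tev [conv B u, conv B w] (comult B x)"
proof (induction u arbitrary: x)
 case Nil
 then show ?case using tev_counit(1)[OF h fnl_conv[OF h w]] by simp
next
 case (Cons \<phi> u)
 note B = hopfD(1)[OF h]
 have f: "fnl B \<phi>" and u: "u \<in> lists {\<phi>. fnl B \<phi>}" using Cons.prems(1) by simp_all
 note cu = fnl_conv[OF h u] and cw = fnl_conv[OF h w]
 have "conv B ((\<phi> # u) @ w) x = tev [\<phi>, conv B (u @ w)] (comult B x)" by simp
 also have "\<dots> = tev [\<phi>, \<lambda>y. tev [conv B u, conv B w] (comult B y)] (comult B x)"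
  by (rule tev_pair_cong[OF B B f fnl_tev_comult[OF h cu cw] refl Cons.IH[OF u] linD(1)[OF hopfD(2)[OF h] Cons.prems(2)]])
 also have "\<dots> = tev [conv B (\<phi> # u), conv B w] (comult B x)"
  using tev_coassoc[OF h f cu cw Cons.prems(2)] by simp
 finally show ?case .
qed

lemma separating_conv:
 assumes h: "hopf B"
 shows "separating B (conv B ` lists {\<phi>. fnl B \<phi>})"
 unfolding separating_def
proof (intro conjI ballI impI)
 show "fnl B e" if "e \<in> conv B ` lists {\<phi>. fnl B \<phi>}" for e using that fnl_conv[OF h] by blast
 fix x assume x: "x \<in> carrier B" and z: "\<forall>e\<in>conv B ` lists {\<phi>. fnl B \<phi>}. e x = \<zero>"
 have "\<phi> x = \<zero>" if "fnl B \<phi>" for \<phi>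
 proof -
  have "[\<phi>] \<in> lists {\<phi>. fnl B \<phi>}" using that by simp
  then have "conv B [\<phi>] x = \<zero>" using z by blast
  then show ?thesis using conv_single[OF h that x] by simp
 qed
 then show "x = \<zero>\<^bsub>B\<^esub>" using ex_functional[OF hopfD(1)[OF h] x] by blast
qed

subsection \<open>Comultiplicative matrices\<close>

text \<open>A finite-dimensional comodule in matrix form, that is, a representation of the group scheme
  on a space with basis \<open>I\<close>.\<close>

definition comat :: "('k, 'v, 'n) hopf_scheme \<Rightarrow> 'i set \<Rightarrow> ('i \<Rightarrow> 'i \<Rightarrow> 'v) \<Rightarrow> bool" where
 "comat B I Z \<longleftrightarrow> finite I \<and> (\<forall>a\<in>I. \<forall>b\<in>I. Z a b \<in> carrier B \<and>
   comult B (Z a b) = finsum (tens [B, B]) (\<lambda>c. pur [B, B] [Z a c, Z c b]) I \<and>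
   counit B (Z a b) = (if a = b then \<one> else \<zero>))"

lemma comatD:
 assumes "comat B I Z"
 shows "finite I" and "a \<in> I \<Longrightarrow> b \<in> I \<Longrightarrow> Z a b \<in> carrier B"
  and "a \<in> I \<Longrightarrow> b \<in> I \<Longrightarrow> comult B (Z a b) = finsum (tens [B, B]) (\<lambda>c. pur [B, B] [Z a c, Z c b]) I"
  and "a \<in> I \<Longrightarrow> b \<in> I \<Longrightarrow> counit B (Z a b) = (if a = b then \<one> else \<zero>)"
 using assms by (simp_all add: comat_def)

lemma tev_comat:
 assumes h: "hopf B" and Z: "comat B I Z" and f: "fnl B \<phi>" "fnl B \<chi>" and ab: "a \<in> I" "b \<in> I"
 shows "tev [\<phi>, \<chi>] (comult B (Z a b)) = ksum (\<lambda>c. \<phi> (Z a c) \<otimes> \<chi> (Z c b)) I"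
 unfolding comatD(3)[OF Z ab]
 by (rule tev_pair_sum[OF hopfD(1)[OF h] hopfD(1)[OF h] f comatD(1)[OF Z]]) (use comatD(2)[OF Z] ab in simp_all)

lemma comatI:
 assumes h: "hopf B" and I: "finite I" and Z: "\<And>a b. a \<in> I \<Longrightarrow> b \<in> I \<Longrightarrow> Z a b \<in> carrier B"
  and D: "\<And>a b \<phi> \<chi>. \<lbrakk>a \<in> I; b \<in> I; fnl B \<phi>; fnl B \<chi>\<rbrakk> \<Longrightarrow>
   tev [\<phi>, \<chi>] (comult B (Z a b)) = ksum (\<lambda>c. \<phi> (Z a c) \<otimes> \<chi> (Z c b)) I"
  and e: "\<And>a b. a \<in> I \<Longrightarrow> b \<in> I \<Longrightarrow> counit B (Z a b) = (if a = b then \<one> else \<zero>)"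
 shows "comat B I Z"
 unfolding comat_def
proof (intro conjI ballI I)
 fix a b assume ab: "a \<in> I" "b \<in> I"
 show "Z a b \<in> carrier B" "counit B (Z a b) = (if a = b then \<one> else \<zero>)" using Z e ab by simp_all
 note B = hopfD(1)[OF h]
 have BB: "algs [B, B]" using B by simp
 show "comult B (Z a b) = finsum (tens [B, B]) (\<lambda>c. pur [B, B] [Z a c, Z c b]) I"
 proof (rule tensor_eqI_fnls[OF BB linD(1)[OF hopfD(2)[OF h] Z[OF ab]]])
  show "finsum (tens [B, B]) (\<lambda>c. pur [B, B] [Z a c, Z c b]) I \<in> TC [B, B]"
   by (rule fsum_closed[OF alg_tens[OF BB] pure_closed[OF BB]]) (use Z ab in simp)
  fix \<phi>s assume "fnls [B, B] \<phi>s"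
  then obtain \<phi> \<chi> where p: "\<phi>s = [\<phi>, \<chi>]" "fnl B \<phi>" "fnl B \<chi>" by (auto simp: list_all2_Cons1)
  show "tev \<phi>s (comult B (Z a b)) = tev \<phi>s (finsum (tens [B, B]) (\<lambda>c. pur [B, B] [Z a c, Z c b]) I)"
   unfolding p(1) D[OF ab p(2,3)] by (rule tev_pair_sum[OF B B p(2,3) I, symmetric]) (use Z ab in simp_all)
 qed
qed

text \<open>Here the words of \<open>matrix_coefficients\<close> are evaluated by convolution, and translation is
  contraction of one end of the coproduct.\<close>

theorem comat_span:
 assumes h: "hopf B" and x: "x \<in> carrier B" and Q: "subspace B Q"
  and ent: "\<And>(I :: nat set) Z a b. \<lbrakk>comat B I Z; a \<in> I; b \<in> I\<rbrakk> \<Longrightarrow> Z a b \<in> Q"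
 shows "x \<in> Q"
proof -
 let ?\<Omega> = "{\<phi>. fnl B \<phi>}"
 note B = hopfD(1)[OF h] and D = hopfD(2)[OF h]
 have N: "subspace B (carrier B)" using B by (simp add: subspace_def)
 note cf = fnl_conv[OF h]
 note pl = fnl_pair_lift[OF B cf _ linD(1)[OF D]]
 obtain J :: "nat set" and M where J: "finite J" and MB: "\<And>i j. i \<in> J \<Longrightarrow> j \<in> J \<Longrightarrow> M i j \<in> carrier B"
  and Mm: "\<And>u w i j. \<lbrakk>u \<in> lists ?\<Omega>; w \<in> lists ?\<Omega>; i \<in> J; j \<in> J\<rbrakk> \<Longrightarrow>
   conv B (u @ w) (M i j) = ksum (\<lambda>l. conv B u (M i l) \<otimes> conv B w (M l j)) J"
  and M1: "\<And>i j. i \<in> J \<Longrightarrow> j \<in> J \<Longrightarrow> conv B [] (M i j) = (if i = j then \<one> else \<zero>)"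
  and MQ: "\<And>Q. subspace B Q \<Longrightarrow> (\<And>i j. i \<in> J \<Longrightarrow> j \<in> J \<Longrightarrow> M i j \<in> Q) \<Longrightarrow> x \<in> Q"
 proof (rule matrix_coefficients[OF B separating_conv[OF h] N,
   where lc="\<lambda>w x. tlift B (\<lambda>xs. conv B w (xs ! 0) \<odot>\<^bsub>B\<^esub> xs ! 1) (comult B x)"
    and rc="\<lambda>w x. tlift B (\<lambda>xs. conv B w (xs ! 1) \<odot>\<^bsub>B\<^esub> xs ! 0) (comult B x)"
    and f=x and t="comult B x"])
  fix u w y assume w: "w \<in> lists ?\<Omega>" and y: "y \<in> carrier B"
  show "tlift B (\<lambda>xs. conv B w (xs ! 0) \<odot>\<^bsub>B\<^esub> xs ! 1) (comult B y) \<in> carrier B"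
   "tlift B (\<lambda>xs. conv B w (xs ! 1) \<odot>\<^bsub>B\<^esub> xs ! 0) (comult B y) \<in> carrier B"
   using pl(1)[OF w cf[OF w] y] pl(3)[OF w cf[OF w] y] by simp_all
  assume u: "u \<in> lists ?\<Omega>"
  show "conv B u (tlift B (\<lambda>xs. conv B w (xs ! 0) \<odot>\<^bsub>B\<^esub> xs ! 1) (comult B y)) = conv B (w @ u) y"
   unfolding pl(2)[OF w cf[OF u] y] conv_append[OF h u w y] ..
  show "conv B u (tlift B (\<lambda>xs. conv B w (xs ! 1) \<odot>\<^bsub>B\<^esub> xs ! 0) (comult B y)) = conv B (u @ w) y"
   unfolding pl(4)[OF w cf[OF u] y] conv_append[OF h w u y] ..
 next
  show "comult B x \<in> TC [B, B]" by (rule linD(1)[OF D x])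
  show "conv B (u @ w) x = tev [conv B u, conv B w] (comult B x)" if "u \<in> lists ?\<Omega>" "w \<in> lists ?\<Omega>" for u w
   by (rule conv_append[OF h that(2,1) x])
 qed (use x in blast)+
 have "comat B J M"
 proof (rule comatI[OF h J MB])
  fix i j \<phi> \<chi> assume ij: "i \<in> J" "j \<in> J" and \<phi>s: "fnl B \<phi>" "fnl B \<chi>"
  have w: "[\<phi>] \<in> lists ?\<Omega>" "[\<chi>] \<in> lists ?\<Omega>" using \<phi>s by simp_all
  note Mij = MB[OF ij]
  have "tev [\<phi>, \<chi>] (comult B (M i j)) = tev [conv B [\<phi>], conv B [\<chi>]] (comult B (M i j))"
   by (rule tev_pair_cong[OF B B cf[OF w(1)] cf[OF w(2)] _ _ linD(1)[OF D Mij]])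
    (use conv_single[OF h] \<phi>s in simp_all)
  also have "\<dots> = conv B ([\<phi>] @ [\<chi>]) (M i j)" by (rule conv_append[OF h w(2,1) Mij, symmetric])
  also have "\<dots> = ksum (\<lambda>l. conv B [\<phi>] (M i l) \<otimes> conv B [\<chi>] (M l j)) J" by (rule Mm[OF w ij])
  also have "\<dots> = ksum (\<lambda>l. \<phi> (M i l) \<otimes> \<chi> (M l j)) J"
   by (rule ksum_cong[OF refl]) (use conv_single[OF h] \<phi>s MB ij fnl_closed[OF \<phi>s(1)] fnl_closed[OF \<phi>s(2)] in simp_all)
  finally show "tev [\<phi>, \<chi>] (comult B (M i j)) = ksum (\<lambda>c. \<phi> (M i c) \<otimes> \<chi> (M c j)) J" .
 next
  show "counit B (M i j) = (if i = j then \<one> else \<zero>)" if "i \<in> J" "j \<in> J" for i j using M1[OF that] by simp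
 qed
 then show ?thesis using MQ[OF Q] ent by blast
qed

subsection \<open>Matrices over an algebra\<close>

definition mm :: "('k, 'v, 'n) module_scheme \<Rightarrow> 'i set \<Rightarrow> ('i \<Rightarrow> 'i \<Rightarrow> 'v) \<Rightarrow> ('i \<Rightarrow> 'i \<Rightarrow> 'v) \<Rightarrow> 'i \<Rightarrow> 'i \<Rightarrow> 'v" where
 "mm M I X Y a b = finsum M (\<lambda>c. X a c \<otimes>\<^bsub>M\<^esub> Y c b) I"

definition mat_in :: "('k, 'v, 'n) module_scheme \<Rightarrow> 'i set \<Rightarrow> ('i \<Rightarrow> 'i \<Rightarrow> 'v) \<Rightarrow> bool" where
 "mat_in M I X \<longleftrightarrow> (\<forall>a\<in>I. \<forall>b\<in>I. X a b \<in> carrier M)"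

definition delta :: "('k, 'v, 'n) module_scheme \<Rightarrow> 'i \<Rightarrow> 'i \<Rightarrow> 'v" where
 "delta M a b = (if a = b then \<one>\<^bsub>M\<^esub> else \<zero>\<^bsub>M\<^esub>)"

lemma mat_inD: "\<lbrakk>mat_in M I X; a \<in> I; b \<in> I\<rbrakk> \<Longrightarrow> X a b \<in> carrier M"
 by (simp add: mat_in_def)

lemma mm_closed: "\<lbrakk>alg M; mat_in M I X; mat_in M I Y\<rbrakk> \<Longrightarrow> mat_in M I (mm M I X Y)"
 by (auto simp: mat_in_def mm_def)

lemma delta_closed: "alg M \<Longrightarrow> delta M a b \<in> carrier M"
 by (simp add: delta_def)

lemma mm_cong:
 assumes "alg M" "\<And>c. c \<in> I \<Longrightarrow> X a c = X' a c" "\<And>c. c \<in> I \<Longrightarrow> Y c b = Y' c b" "mat_in M I X'" "mat_in M I Y'" "a \<in> I" "b \<in> I"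
 shows "mm M I X Y a b = mm M I X' Y' a b"
 unfolding mm_def by (rule fsum_cong[OF assms(1) refl]) (use assms in \<open>simp_all add: mat_in_def\<close>)

lemma mm_delta:
 assumes "alg M" "finite I" "mat_in M I X" "a \<in> I" "b \<in> I"
 shows "mm M I (delta M) X a b = X a b" and "mm M I X (delta M) a b = X a b"
proof -
 note c = mat_inD[OF assms(3)]
 have "mm M I (delta M) X a b = delta M a a \<otimes>\<^bsub>M\<^esub> X a b"
  unfolding mm_def by (rule fsum_delta[OF assms(1,2,4)]) (use assms c in \<open>simp_all add: delta_def\<close>)
 then show "mm M I (delta M) X a b = X a b" using assms c by (simp add: delta_def)
 have "mm M I X (delta M) a b = X a b \<otimes>\<^bsub>M\<^esub> delta M b b"
  unfolding mm_def by (rule fsum_delta[OF assms(1,2,5)]) (use assms c in \<open>simp_all add: delta_def\<close>)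
 then show "mm M I X (delta M) a b = X a b" using assms c by (simp add: delta_def)
qed

lemma mm_assoc:
 assumes M: "alg M" and I: "finite I" and X: "mat_in M I X" and Y: "mat_in M I Y" and Z: "mat_in M I Z" and ab: "a \<in> I" "b \<in> I"
 shows "mm M I (mm M I X Y) Z a b = mm M I X (mm M I Y Z) a b"
proof -
 note c = mat_inD[OF X] mat_inD[OF Y] mat_inD[OF Z]
 have "mm M I (mm M I X Y) Z a b = finsum M (\<lambda>d. finsum M (\<lambda>c. (X a c \<otimes>\<^bsub>M\<^esub> Y c d) \<otimes>\<^bsub>M\<^esub> Z d b) I) I"
  unfolding mm_def[of M I "mm M I X Y"]
 proof (rule fsum_cong[OF M refl])
  fix d assume d: "d \<in> I"
  show "mm M I X Y a d \<otimes>\<^bsub>M\<^esub> Z d b = finsum M (\<lambda>c. (X a c \<otimes>\<^bsub>M\<^esub> Y c d) \<otimes>\<^bsub>M\<^esub> Z d b) I"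
   unfolding mm_def by (rule fsum_mult_left[OF M I]) (use c ab d M in simp_all)
  show "finsum M (\<lambda>c. (X a c \<otimes>\<^bsub>M\<^esub> Y c d) \<otimes>\<^bsub>M\<^esub> Z d b) I \<in> carrier M"
   by (rule fsum_closed[OF M]) (use c ab d M in simp)
 qed
 also have "\<dots> = finsum M (\<lambda>c. finsum M (\<lambda>d. (X a c \<otimes>\<^bsub>M\<^esub> Y c d) \<otimes>\<^bsub>M\<^esub> Z d b) I) I"
  by (rule fsum_swap[OF M I I]) (use c ab M in simp)
 also have "\<dots> = mm M I X (mm M I Y Z) a b"
  unfolding mm_def[of M I X]
 proof (rule fsum_cong[OF M refl])
  fix e assume e: "e \<in> I"
  have "X a e \<otimes>\<^bsub>M\<^esub> mm M I Y Z e b = finsum M (\<lambda>d. X a e \<otimes>\<^bsub>M\<^esub> (Y e d \<otimes>\<^bsub>M\<^esub> Z d b)) I"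
   unfolding mm_def by (rule fsum_mult_right[OF M I]) (use c ab e M in simp_all)
  also have "\<dots> = finsum M (\<lambda>d. (X a e \<otimes>\<^bsub>M\<^esub> Y e d) \<otimes>\<^bsub>M\<^esub> Z d b) I"
   by (rule fsum_cong[OF M refl]) (use c ab e M in \<open>simp_all add: alg_mult_ac(1)\<close>)
  finally show "finsum M (\<lambda>d. (X a e \<otimes>\<^bsub>M\<^esub> Y e d) \<otimes>\<^bsub>M\<^esub> Z d b) I = X a e \<otimes>\<^bsub>M\<^esub> mm M I Y Z e b" ..
  show "X a e \<otimes>\<^bsub>M\<^esub> mm M I Y Z e b \<in> carrier M" using mat_inD[OF mm_closed[OF M Y Z]] c ab e M by simp
 qed
 finally show ?thesis .
qed

lemma left_inverse_eq_right_inverse: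
 assumes M: "alg M" and I: "finite I" and L: "mat_in M I L" and D: "mat_in M I D" and R: "mat_in M I R"
  and LD: "\<And>a b. a \<in> I \<Longrightarrow> b \<in> I \<Longrightarrow> mm M I L D a b = delta M a b"
  and DR: "\<And>a b. a \<in> I \<Longrightarrow> b \<in> I \<Longrightarrow> mm M I D R a b = delta M a b" and ab: "a \<in> I" "b \<in> I"
 shows "L a b = R a b"
proof -
 have d: "mat_in M I (delta M)" using M by (simp add: mat_in_def delta_closed)
 have "L a b = mm M I L (delta M) a b" by (rule mm_delta(2)[OF M I L ab, symmetric])
 also have "\<dots> = mm M I L (mm M I D R) a b"
  by (rule mm_cong[OF M]) (use DR ab L mm_closed[OF M D R] in simp_all)
 also have "\<dots> = mm M I (mm M I L D) R a b" by (rule mm_assoc[OF M I L D R ab, symmetric])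
 also have "\<dots> = mm M I (delta M) R a b"
  by (rule mm_cong[OF M]) (use LD ab d R in simp_all)
 also have "\<dots> = R a b" by (rule mm_delta(1)[OF M I R ab])
 finally show ?thesis .
qed

lemma mm_hom:
 assumes M: "alg M" and N: "alg N" and h: "lin M N h"
  and mult: "\<And>x y. x \<in> carrier M \<Longrightarrow> y \<in> carrier M \<Longrightarrow> h (x \<otimes>\<^bsub>M\<^esub> y) = h x \<otimes>\<^bsub>N\<^esub> h y"
  and I: "finite I" and X: "mat_in M I X" and Y: "mat_in M I Y" and ab: "a \<in> I" "b \<in> I"
 shows "h (mm M I X Y a b) = mm N I (\<lambda>a b. h (X a b)) (\<lambda>a b. h (Y a b)) a b"
proof -
 have "h (mm M I X Y a b) = finsum N (\<lambda>c. h (X a c \<otimes>\<^bsub>M\<^esub> Y c b)) I"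
  unfolding mm_def by (rule lin_fsum[OF h M N I]) (use mat_inD[OF X] mat_inD[OF Y] ab M in simp)
 also have "\<dots> = mm N I (\<lambda>a b. h (X a b)) (\<lambda>a b. h (Y a b)) a b"
  unfolding mm_def by (rule fsum_cong[OF N refl]) (use mult mat_inD[OF X] mat_inD[OF Y] ab N linD(1)[OF h] in simp_all)
 finally show ?thesis .
qed

lemma pair_mult:
 assumes B: "alg B" and "x \<in> carrier B" "y \<in> carrier B" "x' \<in> carrier B" "y' \<in> carrier B"
 shows "pur [B, B] [x, y] \<otimes>\<^bsub>tens [B, B]\<^esub> pur [B, B] [x', y'] = pur [B, B] [x \<otimes>\<^bsub>B\<^esub> x', y \<otimes>\<^bsub>B\<^esub> y']"
 using pure_mult[of "[B, B]" "[x, y]" "[x', y']"] assms by (simp add: monoid.defs)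

lemma pair_sum_mult:
 assumes B: "alg B" and I: "finite I" and J: "finite J"
  and x: "\<And>c. c \<in> I \<Longrightarrow> x c \<in> carrier B" "\<And>c. c \<in> I \<Longrightarrow> y c \<in> carrier B"
  and x': "\<And>d. d \<in> J \<Longrightarrow> x' d \<in> carrier B" "\<And>d. d \<in> J \<Longrightarrow> y' d \<in> carrier B"
 defines "T \<equiv> tens [B, B]"
 shows "finsum T (\<lambda>c. pur [B, B] [x c, y c]) I \<otimes>\<^bsub>T\<^esub> finsum T (\<lambda>d. pur [B, B] [x' d, y' d]) J =
  finsum T (\<lambda>r. pur [B, B] [x (fst r) \<otimes>\<^bsub>B\<^esub> x' (snd r), y (fst r) \<otimes>\<^bsub>B\<^esub> y' (snd r)]) (I \<times> J)"
proof -
 have BB: "algs [B, B]" using B by simp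
 note T = alg_tens[OF BB, folded T_def]
 have p: "pur [B, B] [x, y] \<in> carrier T" if "x \<in> carrier B" "y \<in> carrier B" for x y
  using pure_closed[OF BB] that unfolding T_def by simp
 note pm = pair_mult[OF B, folded T_def]
 have "finsum T (\<lambda>c. pur [B, B] [x c, y c]) I \<otimes>\<^bsub>T\<^esub> finsum T (\<lambda>d. pur [B, B] [x' d, y' d]) J
  = finsum T (\<lambda>c. pur [B, B] [x c, y c] \<otimes>\<^bsub>T\<^esub> finsum T (\<lambda>d. pur [B, B] [x' d, y' d]) J) I"
  by (rule fsum_mult_left[OF T I]) (use p x x' T in simp_all)
 also have "\<dots> = finsum T (\<lambda>c. finsum T (\<lambda>d. pur [B, B] [x c \<otimes>\<^bsub>B\<^esub> x' d, y c \<otimes>\<^bsub>B\<^esub> y' d]) J) I"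
 proof (rule fsum_cong[OF T refl])
  fix c assume c: "c \<in> I"
  have "pur [B, B] [x c, y c] \<otimes>\<^bsub>T\<^esub> finsum T (\<lambda>d. pur [B, B] [x' d, y' d]) J
    = finsum T (\<lambda>d. pur [B, B] [x c, y c] \<otimes>\<^bsub>T\<^esub> pur [B, B] [x' d, y' d]) J"
   by (rule fsum_mult_right[OF T J]) (use p x x' c in simp_all)
  also have "\<dots> = finsum T (\<lambda>d. pur [B, B] [x c \<otimes>\<^bsub>B\<^esub> x' d, y c \<otimes>\<^bsub>B\<^esub> y' d]) J"
   by (rule fsum_cong[OF T refl]) (use pm p x x' c B in simp_all)
  finally show "pur [B, B] [x c, y c] \<otimes>\<^bsub>T\<^esub> finsum T (\<lambda>d. pur [B, B] [x' d, y' d]) J = \<dots>" .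
  show "finsum T (\<lambda>d. pur [B, B] [x c \<otimes>\<^bsub>B\<^esub> x' d, y c \<otimes>\<^bsub>B\<^esub> y' d]) J \<in> carrier T"
   by (rule fsum_closed[OF T]) (use p x x' c B in simp)
 qed
 also have "\<dots> = finsum T (\<lambda>r. pur [B, B] [x (fst r) \<otimes>\<^bsub>B\<^esub> x' (snd r), y (fst r) \<otimes>\<^bsub>B\<^esub> y' (snd r)]) (I \<times> J)"
  by (rule fsum_product[OF T I J]) (use p x x' B in simp)
 finally show ?thesis .
qed

subsection \<open>Operations on comultiplicative matrices\<close>

lemma comat_one:
 assumes h: "hopf B"
 shows "comat B {i} (\<lambda>_ _. \<one>\<^bsub>B\<^esub>)"
proof -
 note B = hopfD(1)[OF h]
 have BB: "algs [B, B]" using B by simp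
 have "finsum (tens [B, B]) (\<lambda>c. pur [B, B] [\<one>\<^bsub>B\<^esub>, \<one>\<^bsub>B\<^esub>]) {i} = pur [B, B] [\<one>\<^bsub>B\<^esub>, \<one>\<^bsub>B\<^esub>]"
  by (rule fsum_delta[OF alg_tens[OF BB]]) (use pure_closed[OF BB, of "[\<one>\<^bsub>B\<^esub>, \<one>\<^bsub>B\<^esub>]"] B in auto)
 then show ?thesis unfolding comat_def using hopfD(6,8)[OF h] B pure_one[OF BB] by simp
qed

lemma comat_mult:
 assumes h: "hopf B" and Z: "comat B I Z" and Y: "comat B J Y"
 shows "comat B (I \<times> J) (\<lambda>p q. Z (fst p) (fst q) \<otimes>\<^bsub>B\<^esub> Y (snd p) (snd q))"
 unfolding comat_def
proof (intro conjI ballI)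
 note B = hopfD(1)[OF h]
 let ?T = "tens [B, B]"
 show "finite (I \<times> J)" using comatD(1)[OF Z] comatD(1)[OF Y] by simp
 fix p q assume "p \<in> I \<times> J" "q \<in> I \<times> J"
 then obtain a a' b b' where pq: "p = (a, a')" "q = (b, b')" "a \<in> I" "a' \<in> J" "b \<in> I" "b' \<in> J" by auto
 note Zc = comatD(2)[OF Z] and Yc = comatD(2)[OF Y]
 show "Z (fst p) (fst q) \<otimes>\<^bsub>B\<^esub> Y (snd p) (snd q) \<in> carrier B" using pq Zc Yc B by simp
 show "counit B (Z (fst p) (fst q) \<otimes>\<^bsub>B\<^esub> Y (snd p) (snd q)) = (if p = q then \<one> else \<zero>)"
  using pq hopfD(7)[OF h Zc Yc] comatD(4)[OF Z] comatD(4)[OF Y] by simp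
 have "comult B (Z a b \<otimes>\<^bsub>B\<^esub> Y a' b') = finsum ?T (\<lambda>c. pur [B, B] [Z a c, Z c b]) I \<otimes>\<^bsub>?T\<^esub> finsum ?T (\<lambda>d. pur [B, B] [Y a' d, Y d b']) J"
  using hopfD(5)[OF h Zc Yc] comatD(3)[OF Z] comatD(3)[OF Y] pq by simp
 also have "\<dots> = finsum ?T (\<lambda>r. pur [B, B] [Z a (fst r) \<otimes>\<^bsub>B\<^esub> Y a' (snd r), Z (fst r) b \<otimes>\<^bsub>B\<^esub> Y (snd r) b']) (I \<times> J)"
  by (rule pair_sum_mult[OF B comatD(1)[OF Z] comatD(1)[OF Y]]) (use pq Zc Yc in simp_all)
 finally show "comult B (Z (fst p) (fst q) \<otimes>\<^bsub>B\<^esub> Y (snd p) (snd q)) = finsum ?T (\<lambda>r. pur [B, B] [Z (fst p) (fst r) \<otimes>\<^bsub>B\<^esub> Y (snd p) (snd r), Z (fst r) (fst q) \<otimes>\<^bsub>B\<^esub> Y (snd r) (snd q)]) (I \<times> J)"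
  using pq by simp
qed

lemma pair_lift:
 assumes B: "alg B" and W: "alg W" and g: "multilin [B, B] W g" and I: "finite I"
  and xy: "\<And>c. c \<in> I \<Longrightarrow> x c \<in> carrier B" "\<And>c. c \<in> I \<Longrightarrow> y c \<in> carrier B"
 shows "tlift W g (finsum (tens [B, B]) (\<lambda>c. pur [B, B] [x c, y c]) I) = finsum W (\<lambda>c. g [x c, y c]) I"
proof -
 have BB: "algs [B, B]" using B by simp
 have "tlift W g (finsum (tens [B, B]) (\<lambda>c. pur [B, B] [x c, y c]) I) =
  finsum W (\<lambda>c. tlift W g (pur [B, B] [x c, y c])) I"
  by (rule lin_fsum[OF lin_tensor_lift[OF BB W g] alg_tens[OF BB] W I pure_closed[OF BB]]) (use xy in simp)
 also have "\<dots> = finsum W (\<lambda>c. g [x c, y c]) I"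
  by (rule fsum_cong[OF W refl]) (use tensor_lift_pure[OF BB W g] multilin_closed[OF g] xy in simp_all)
 finally show ?thesis .
qed

lemma comat_antipode_inverse:
 assumes h: "hopf B" and Z: "comat B I Z" and ab: "a \<in> I" "b \<in> I"
 shows "mm B I (\<lambda>a b. antipode B (Z a b)) Z a b = delta B a b"
  and "mm B I Z (\<lambda>a b. antipode B (Z a b)) a b = delta B a b"
proof -
 note B = hopfD(1)[OF h] and S = hopfD(4)[OF h] and Zc = comatD(2)[OF Z]
 note Sc = linD(1)[OF S]
 have g: "multilin [B, B] B (\<lambda>xs. antipode B (xs ! 0) \<otimes>\<^bsub>B\<^esub> xs ! 1)"
  using lin_mult_left[OF B _ S] lin_mult_right[OF B Sc lin_id] Sc B by (auto elim!: RD_ConsE)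
 have g': "multilin [B, B] B (\<lambda>xs. xs ! 0 \<otimes>\<^bsub>B\<^esub> antipode B (xs ! 1))"
  using lin_mult_left[OF B Sc lin_id] lin_mult_right[OF B _ S] Sc B by (auto elim!: RD_ConsE)
 have e: "counit B (Z a b) \<odot>\<^bsub>B\<^esub> \<one>\<^bsub>B\<^esub> = delta B a b" using comatD(4)[OF Z ab] B by (simp add: delta_def)
 show "mm B I (\<lambda>a b. antipode B (Z a b)) Z a b = delta B a b"
  using hopf_algebra.antipode_left[OF h Zc[OF ab]] pair_lift[OF B B g comatD(1)[OF Z] Zc[OF ab(1)] Zc[OF _ ab(2)]] e
  unfolding comatD(3)[OF Z ab] by (simp add: mm_def)
 show "mm B I Z (\<lambda>a b. antipode B (Z a b)) a b = delta B a b"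
  using hopf_algebra.antipode_right[OF h Zc[OF ab]] pair_lift[OF B B g' comatD(1)[OF Z] Zc[OF ab(1)] Zc[OF _ ab(2)]] e
  unfolding comatD(3)[OF Z ab] by (simp add: mm_def)
qed

text \<open>This is the contragredient representation. The matrix \<open>\<Delta>(S Z)\<close> is a left inverse of
  \<open>\<Delta> Z = (Z \<otimes> 1)(1 \<otimes> Z)\<close>, hence equal to the right inverse \<open>(1 \<otimes> S Z)(S Z \<otimes> 1)\<close>; the order of
  these factors is the reason for the transposition.\<close>

lemma comat_antipode:
 assumes h: "hopf B" and Z: "comat B I Z"
 shows "comat B I (\<lambda>a b. antipode B (Z b a))"
proof -
 note B = hopfD(1)[OF h] and S = hopfD(4)[OF h] and Zc = comatD(2)[OF Z] and D = hopfD(2)[OF h] and I = comatD(1)[OF Z]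
 let ?T = "tens [B, B]" and ?W = "\<lambda>a b. antipode B (Z a b)"
 have BB: "algs [B, B]" using B by simp
 note T = alg_tens[OF BB]
 have Wc: "antipode B (Z a b) \<in> carrier B" if "a \<in> I" "b \<in> I" for a b by (rule linD(1)[OF S Zc[OF that]])
 have mZ: "mat_in B I Z" and mW: "mat_in B I ?W" using Zc Wc by (simp_all add: mat_in_def)
 note inv = comat_antipode_inverse[OF h Z]
 let ?i = "\<lambda>x. pur [B, B] [x, \<one>\<^bsub>B\<^esub>]" and ?j = "\<lambda>x. pur [B, B] [\<one>\<^bsub>B\<^esub>, x]"
 have i: "lin B ?T ?i" and j: "lin B ?T ?j" using pure_pair_lin[OF B B] B by simp_all
 have im: "?i (x \<otimes>\<^bsub>B\<^esub> y) = ?i x \<otimes>\<^bsub>?T\<^esub> ?i y" "?j (x \<otimes>\<^bsub>B\<^esub> y) = ?j x \<otimes>\<^bsub>?T\<^esub> ?j y"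
  if "x \<in> carrier B" "y \<in> carrier B" for x y using pair_mult[OF B] that B by simp_all
 have i1: "?i \<one>\<^bsub>B\<^esub> = \<one>\<^bsub>?T\<^esub>" using pure_one[OF BB] by simp
 have id: "?i (delta B a b) = delta ?T a b" "?j (delta B a b) = delta ?T a b" for a b
  using i1 lin_zero[OF i B T] lin_zero[OF j B T] by (simp_all add: delta_def)
 have ij: "?i x \<otimes>\<^bsub>?T\<^esub> ?j y = pur [B, B] [x, y]" "?j y \<otimes>\<^bsub>?T\<^esub> ?i x = pur [B, B] [x, y]"
  if "x \<in> carrier B" "y \<in> carrier B" for x y using pair_mult[OF B] that B by simp_all
 have mi: "mat_in ?T I (\<lambda>a b. ?i (X a b))" "mat_in ?T I (\<lambda>a b. ?j (X a b))" if "mat_in B I X" for X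
  using linD(1)[OF i] linD(1)[OF j] that unfolding mat_in_def by simp_all
 let ?L = "\<lambda>a b. comult B (?W a b)" and ?D = "mm ?T I (\<lambda>a b. ?i (Z a b)) (\<lambda>a b. ?j (Z a b))"
  and ?R = "mm ?T I (\<lambda>a b. ?j (?W a b)) (\<lambda>a b. ?i (?W a b))"
 have mL: "mat_in ?T I ?L" using linD(1)[OF D Wc] unfolding mat_in_def by simp
 have mD: "mat_in ?T I ?D" by (rule mm_closed[OF T mi(1)[OF mZ] mi(2)[OF mZ]])
 have mR: "mat_in ?T I ?R" by (rule mm_closed[OF T mi(2)[OF mW] mi(1)[OF mW]])
 have p: "pur [B, B] [x, y] \<in> carrier ?T" if "x \<in> carrier B" "y \<in> carrier B" for x y using pure_closed[OF BB] that by simp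
 have Deq: "?D a b = comult B (Z a b)" if "a \<in> I" "b \<in> I" for a b
  unfolding mm_def comatD(3)[OF Z that] by (rule fsum_cong[OF T refl]) (use ij p Zc that in simp_all)
 have Req: "?R a b = finsum ?T (\<lambda>c. pur [B, B] [?W c b, ?W a c]) I" if "a \<in> I" "b \<in> I" for a b
  unfolding mm_def by (rule fsum_cong[OF T refl]) (use ij p Wc that in simp_all)
 have LD: "mm ?T I ?L ?D a b = delta ?T a b" if ab: "a \<in> I" "b \<in> I" for a b
 proof -
  have mc: "mat_in ?T I (\<lambda>a b. comult B (Z a b))" using linD(1)[OF D Zc] unfolding mat_in_def by simp
  have "mm ?T I ?L ?D a b = mm ?T I ?L (\<lambda>a b. comult B (Z a b)) a b"
   by (rule mm_cong[OF T]) (use Deq mL mc ab in simp_all)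
  also have "\<dots> = comult B (mm B I ?W Z a b)"
   by (rule mm_hom[OF B T D hopfD(5)[OF h] I mW mZ ab, symmetric])
  also have "\<dots> = delta ?T a b"
   unfolding inv(1)[OF ab] using hopfD(6)[OF h] lin_zero[OF D B T] by (simp add: delta_def)
  finally show ?thesis .
 qed
 have DR: "mm ?T I ?D ?R a b = delta ?T a b" if ab: "a \<in> I" "b \<in> I" for a b
 proof -
  let ?iZ = "\<lambda>a b. ?i (Z a b)" and ?jZ = "\<lambda>a b. ?j (Z a b)" and ?jW = "\<lambda>a b. ?j (?W a b)" and ?iW = "\<lambda>a b. ?i (?W a b)"
  note m = mi(1)[OF mZ] mi(2)[OF mZ] mi(2)[OF mW] mi(1)[OF mW]
  have d: "mat_in ?T I (delta ?T)" using T by (simp add: mat_in_def delta_closed)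
  have jj: "mm ?T I ?jZ ?jW a b = delta ?T a b" if "a \<in> I" "b \<in> I" for a b
   using trans[OF mm_hom[OF B T j im(2) I mZ mW that, symmetric] arg_cong[OF inv(2)[OF that], of ?j]] by (simp only: id(2))
  have ii: "mm ?T I ?iZ ?iW a b = delta ?T a b"
   using trans[OF mm_hom[OF B T i im(1) I mZ mW ab, symmetric] arg_cong[OF inv(2)[OF ab], of ?i]] by (simp only: id(1))
  have k: "mm ?T I ?jZ ?R c b = ?iW c b" if c: "c \<in> I" for c
  proof -
   have "mm ?T I ?jZ ?R c b = mm ?T I (mm ?T I ?jZ ?jW) ?iW c b"
    by (rule mm_assoc[OF T I m(2,3,4) c ab(2), symmetric])
   also have "\<dots> = mm ?T I (delta ?T) ?iW c b"
    by (rule mm_cong[OF T]) (use jj d m(4) c ab(2) in simp_all)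
   also have "\<dots> = ?iW c b" by (rule mm_delta(1)[OF T I m(4) c ab(2)])
   finally show ?thesis .
  qed
  have "mm ?T I ?D ?R a b = mm ?T I ?iZ (mm ?T I ?jZ ?R) a b" by (rule mm_assoc[OF T I m(1,2) mR ab])
  also have "\<dots> = mm ?T I ?iZ ?iW a b" by (rule mm_cong[OF T]) (use k m(1,4) ab in simp_all)
  finally show ?thesis using ii by simp
 qed
 have main: "comult B (?W a b) = finsum ?T (\<lambda>c. pur [B, B] [?W c b, ?W a c]) I" if "a \<in> I" "b \<in> I" for a b
  using left_inverse_eq_right_inverse[OF T I mL mD mR LD DR that] Req[OF that] by simp
 have eps: "counit B (?W a b) = (if a = b then \<one> else \<zero>)" if ab: "a \<in> I" "b \<in> I" for a b
 proof -
  note E = hopfD(3)[OF h]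
  have ec: "counit B x \<in> \<K>" if "x \<in> carrier B" for x by (rule fnl_closed[OF E that])
  have "(if a = b then \<one> else \<zero>) = counit B (mm B I ?W Z a b)"
   unfolding inv(1)[OF ab] using hopfD(8)[OF h] lin_zero[OF E B algebra_Ks] by (simp add: delta_def)
  also have "\<dots> = ksum (\<lambda>c. counit B (?W a c \<otimes>\<^bsub>B\<^esub> Z c b)) I"
   unfolding mm_def by (rule fnl_fsum[OF E B I]) (use Wc Zc ab B in simp)
  also have "\<dots> = counit B (?W a b \<otimes>\<^bsub>B\<^esub> Z b b)"
   by (rule ksum_delta[OF I ab(2)]) (use hopfD(7)[OF h Wc Zc] ab comatD(4)[OF Z] ec Wc in simp_all)
  also have "\<dots> = counit B (?W a b)" using hopfD(7)[OF h Wc Zc] ab comatD(4)[OF Z] ec Wc by simp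
  finally show ?thesis ..
 qed
 show ?thesis unfolding comat_def using I Wc main eps by auto
qed

lemma comat_hom:
 assumes h: "hopf B" and h': "hopf B'" and q: "q \<in> homs B B'" and Z: "comat B I Z"
 shows "comat B' I (\<lambda>a b. q (Z a b))"
 unfolding comat_def
proof (intro conjI ballI)
 note B = hopfD(1)[OF h] and B' = hopfD(1)[OF h'] and Zc = comatD(2)[OF Z] and I = comatD(1)[OF Z]
 show "finite I" by (rule I)
 have ql: "lin B B' q" using q by (simp add: hopf_hom_def lin_def alg_hom_def ring_hom_def Pi_iff)
 fix a b assume ab: "a \<in> I" "b \<in> I"
 show "q (Z a b) \<in> carrier B'" by (rule linD(1)[OF ql Zc[OF ab]])
 show "counit B' (q (Z a b)) = (if a = b then \<one> else \<zero>)"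
  using q Zc[OF ab] comatD(4)[OF Z ab] by (simp add: hopf_hom_def)
 let ?T = "tens [B', B']"
 have BB: "algs [B', B']" using B' by simp
 note T = alg_tens[OF BB]
 have g: "multilin [B, B] ?T (\<lambda>xs. pur [B', B'] (map q xs))"
  using lin_comp[OF ql pure_pair_lin(1)[OF B' B']] lin_comp[OF ql pure_pair_lin(2)[OF B' B']] pure_closed[OF BB] linD(1)[OF ql]
  by (auto elim!: RD_ConsE)
 have "comult B' (q (Z a b)) = tlift ?T (\<lambda>xs. pur [B', B'] (map q xs)) (comult B (Z a b))"
  using q Zc[OF ab] by (simp add: hopf_hom_def)
 also have "\<dots> = finsum ?T (\<lambda>c. pur [B', B'] (map q [Z a c, Z c b])) I"
  unfolding comatD(3)[OF Z ab] by (rule pair_lift[OF B T g I]) (use Zc ab in simp_all)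
 finally show "comult B' (q (Z a b)) = finsum ?T (\<lambda>c. pur [B', B'] [q (Z a c), q (Z c b)]) I" by simp
qed

lemma separatingD:
 assumes "separating M E" "x \<in> carrier M" "\<And>e. e \<in> E \<Longrightarrow> e x = \<zero>"
 shows "x = \<zero>\<^bsub>M\<^esub>"
 using assms unfolding separating_def by simp

section \<open>Contracting and splitting tensors\<close>

lemma multilin_pev_smult:
 assumes Ms: "algs Ms" and Ns: "algs Ns" and W: "alg W"
 shows "fnls Ms as \<Longrightarrow> multilin Ns W g \<Longrightarrow> multilin (Ms @ Ns) W (\<lambda>xs. pev as (take (length Ms) xs) \<odot>\<^bsub>W\<^esub> g (drop (length Ms) xs))"
  and "multilin Ms W g' \<Longrightarrow> fnls Ns bs \<Longrightarrow> multilin (Ms @ Ns) W (\<lambda>xs. pev bs (drop (length Ms) xs) \<odot>\<^bsub>W\<^esub> g' (take (length Ms) xs))"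
proof -
 assume as: "fnls Ms as" and g: "multilin Ns W g"
 have "multilin Ms W (\<lambda>xs. pev as xs \<odot>\<^bsub>W\<^esub> g ys)" if "ys \<in> RD Ns" for ys
  by (rule lin_multilin[OF multilin_pev[OF as] lin_smult_left[OF W multilin_closed[OF g that] lin_id]])
 then have "multilin Ms W (\<lambda>xs. pev as (take (length Ms) (xs @ ys)) \<odot>\<^bsub>W\<^esub> g (drop (length Ms) (xs @ ys)))" if "ys \<in> RD Ns" for ys
  by (rule multilin_cong[OF Ms]) (use that in \<open>simp_all add: RD_length\<close>)
 moreover have "multilin Ns W (\<lambda>ys. pev as (take (length Ms) (xs @ ys)) \<odot>\<^bsub>W\<^esub> g (drop (length Ms) (xs @ ys)))" if "xs \<in> RD Ms" for xs
  using lin_multilin[OF g lin_smult[OF W pev_closed[OF as that] lin_id]] that by (simp add: RD_length)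
 ultimately show "multilin (Ms @ Ns) W (\<lambda>xs. pev as (take (length Ms) xs) \<odot>\<^bsub>W\<^esub> g (drop (length Ms) xs))"
  unfolding multilin_append by blast
next
 assume g: "multilin Ms W g'" and bs: "fnls Ns bs"
 have "multilin Ms W (\<lambda>xs. pev bs ys \<odot>\<^bsub>W\<^esub> g' xs)" if "ys \<in> RD Ns" for ys
  by (rule lin_multilin[OF g lin_smult[OF W pev_closed[OF bs that] lin_id]])
 then have "multilin Ms W (\<lambda>xs. pev bs (drop (length Ms) (xs @ ys)) \<odot>\<^bsub>W\<^esub> g' (take (length Ms) (xs @ ys)))" if "ys \<in> RD Ns" for ys
  by (rule multilin_cong[OF Ms]) (use that in \<open>simp_all add: RD_length\<close>)
 moreover have "multilin Ns W (\<lambda>ys. pev bs (drop (length Ms) (xs @ ys)) \<odot>\<^bsub>W\<^esub> g' (take (length Ms) (xs @ ys)))" if "xs \<in> RD Ms" for xs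
  using lin_multilin[OF multilin_pev[OF bs] lin_smult_left[OF W multilin_closed[OF g that] lin_id]] that by (simp add: RD_length)
 ultimately show "multilin (Ms @ Ns) W (\<lambda>xs. pev bs (drop (length Ms) xs) \<odot>\<^bsub>W\<^esub> g' (take (length Ms) xs))"
  unfolding multilin_append by blast
qed

lemma tev_contract:
 assumes Ms: "algs Ms" and Ns: "algs Ns" and as: "fnls Ms as" and bs: "fnls Ns bs" and t: "t \<in> TC (Ms @ Ns)"
 shows "tev bs (tlift (tens Ns) (\<lambda>xs. pev as (take (length Ms) xs) \<odot>\<^bsub>tens Ns\<^esub> pur Ns (drop (length Ms) xs)) t) = tev (as @ bs) t"
  and "tev as (tlift (tens Ms) (\<lambda>xs. pev bs (drop (length Ms) xs) \<odot>\<^bsub>tens Ms\<^esub> pur Ms (take (length Ms) xs)) t) = tev (as @ bs) t"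
proof -
 have MN: "algs (Ms @ Ns)" using Ms Ns by auto
 have f: "fnls (Ms @ Ns) (as @ bs)" by (rule list_all2_appendI[OF as bs])
 note TM = alg_tens[OF Ms] and TN = alg_tens[OF Ns]
 note g = multilin_pev_smult(1)[OF Ms Ns TN as multilin_pure[OF Ns]] and g' = multilin_pev_smult(2)[OF Ms Ns TM multilin_pure[OF Ms] bs]
 show "tev bs (tlift (tens Ns) (\<lambda>xs. pev as (take (length Ms) xs) \<odot>\<^bsub>tens Ns\<^esub> pur Ns (drop (length Ms) xs)) t) = tev (as @ bs) t"
 proof (rule tev_eqI[OF MN f lin_comp[OF lin_tensor_lift[OF MN TN g] fnl_tev[OF Ns bs]] _ t])
  fix zs assume zs: "zs \<in> RD (Ms @ Ns)"
  then obtain xs ys where xy: "zs = xs @ ys" "length xs = length Ms" "xs \<in> RD Ms" "ys \<in> RD Ns" by (rule RD_appendE)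
  show "tev bs (tlift (tens Ns) (\<lambda>xs. pev as (take (length Ms) xs) \<odot>\<^bsub>tens Ns\<^esub> pur Ns (drop (length Ms) xs)) (pur (Ms @ Ns) zs)) = pev (as @ bs) zs"
   unfolding tensor_lift_pure[OF MN TN g zs]
   using xy linD(3)[OF fnl_tev[OF Ns bs] pev_closed[OF as xy(3)] pure_closed[OF Ns xy(4)]] tev_pure[OF Ns bs xy(4)] pev_append[OF as bs xy(3,4)] by simp
 qed
 show "tev as (tlift (tens Ms) (\<lambda>xs. pev bs (drop (length Ms) xs) \<odot>\<^bsub>tens Ms\<^esub> pur Ms (take (length Ms) xs)) t) = tev (as @ bs) t"
 proof (rule tev_eqI[OF MN f lin_comp[OF lin_tensor_lift[OF MN TM g'] fnl_tev[OF Ms as]] _ t])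
  fix zs assume zs: "zs \<in> RD (Ms @ Ns)"
  then obtain xs ys where xy: "zs = xs @ ys" "length xs = length Ms" "xs \<in> RD Ms" "ys \<in> RD Ns" by (rule RD_appendE)
  show "tev as (tlift (tens Ms) (\<lambda>xs. pev bs (drop (length Ms) xs) \<odot>\<^bsub>tens Ms\<^esub> pur Ms (take (length Ms) xs)) (pur (Ms @ Ns) zs)) = pev (as @ bs) zs"
   unfolding tensor_lift_pure[OF MN TM g' zs]
   using xy linD(3)[OF fnl_tev[OF Ms as] pev_closed[OF bs xy(4)] pure_closed[OF Ms xy(3)]] tev_pure[OF Ms as xy(3)] pev_append[OF as bs xy(3,4)]
    pev_closed[OF as xy(3)] pev_closed[OF bs xy(4)] by (simp add: m_comm)
 qed
qed

lemma multilin_split: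
 assumes Ms: "algs Ms" and Ns: "algs Ns"
 shows "multilin (Ms @ Ns) (tens [tens Ms, tens Ns])
  (\<lambda>xs. pur [tens Ms, tens Ns] [pur Ms (take (length Ms) xs), pur Ns (drop (length Ms) xs)])"
proof -
 note TM = alg_tens[OF Ms] and TN = alg_tens[OF Ns]
 note l = pure_pair_lin[OF TM TN]
 let ?W = "tens [tens Ms, tens Ns]"
 let ?g = "\<lambda>xs. pur [tens Ms, tens Ns] [pur Ms (take (length Ms) xs), pur Ns (drop (length Ms) xs)]"
 have "multilin Ms ?W (\<lambda>xs. ?g (xs @ ys))" if ys: "ys \<in> RD Ns" for ys
  by (rule multilin_cong[OF Ms lin_multilin[OF multilin_pure[OF Ms] l(1)[OF pure_closed[OF Ns ys]]]]) (simp add: RD_length)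
 moreover have "multilin Ns ?W (\<lambda>ys. ?g (xs @ ys))" if xs: "xs \<in> RD Ms" for xs
  using lin_multilin[OF multilin_pure[OF Ns] l(2)[OF pure_closed[OF Ms xs]]] xs by (simp add: RD_length)
 ultimately show ?thesis unfolding multilin_append by blast
qed

lemma tev_split:
 assumes Ms: "algs Ms" and Ns: "algs Ns" and as: "fnls Ms as" and bs: "fnls Ns bs" and t: "t \<in> TC (Ms @ Ns)"
 shows "tev [tev as, tev bs] (tlift (tens [tens Ms, tens Ns])
  (\<lambda>xs. pur [tens Ms, tens Ns] [pur Ms (take (length Ms) xs), pur Ns (drop (length Ms) xs)]) t) = tev (as @ bs) t"
proof -
 have MN: "algs (Ms @ Ns)" using Ms Ns by auto
 have f: "fnls (Ms @ Ns) (as @ bs)" by (rule list_all2_appendI[OF as bs])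
 note TM = alg_tens[OF Ms] and TN = alg_tens[OF Ns] and g = multilin_split[OF Ms Ns]
 have TT: "algs [tens Ms, tens Ns]" using TM TN by simp
 have ft: "fnls [tens Ms, tens Ns] [tev as, tev bs]" using fnl_tev[OF Ms as] fnl_tev[OF Ns bs] by simp
 show ?thesis
 proof (rule tev_eqI[OF MN f lin_comp[OF lin_tensor_lift[OF MN alg_tens[OF TT] g] fnl_tev[OF TT ft]] _ t])
  fix zs assume zs: "zs \<in> RD (Ms @ Ns)"
  then obtain xs ys where xy: "zs = xs @ ys" "length xs = length Ms" "xs \<in> RD Ms" "ys \<in> RD Ns" by (rule RD_appendE)
  show "tev [tev as, tev bs] (tlift (tens [tens Ms, tens Ns])
   (\<lambda>xs. pur [tens Ms, tens Ns] [pur Ms (take (length Ms) xs), pur Ns (drop (length Ms) xs)]) (pur (Ms @ Ns) zs)) = pev (as @ bs) zs"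
   unfolding tensor_lift_pure[OF MN alg_tens[OF TT] g zs]
   using xy tev_pair[OF TM TN fnl_tev[OF Ms as] fnl_tev[OF Ns bs] pure_closed[OF Ms xy(3)] pure_closed[OF Ns xy(4)]]
    tev_pure[OF Ms as xy(3)] tev_pure[OF Ns bs xy(4)] pev_append[OF as bs xy(3,4)] by simp
 qed
qed

end

section \<open>The completed tensor algebra\<close>

text \<open>The set \<open>\<Omega>\<close> is a parameter because for a product algebra only letters that factor through
  one projection behave well under coherence.\<close>

locale letters = ground_field K for K :: "('k, 'm) ring_scheme" (structure) +
 fixes A :: "('k, 'v, 'n) module_scheme" and \<Omega> :: "('v \<Rightarrow> 'k) set"
 assumes algebra_A [simp]: "alg A" and separating_A: "separating A \<Omega>"
begin

abbreviation "TT \<equiv> completed_tensor K A"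
abbreviation "tp \<equiv> tensor_power K A"

lemma algs_replicate [simp]: "algs (replicate n A)"
 by simp

lemma algebra_power [simp]: "alg (tp n)"
 by (rule alg_tens) simp

lemma TT_simps:
 "f \<in> carrier TT \<longleftrightarrow> (\<forall>n. f n \<in> carrier (tp n))"
 "f \<otimes>\<^bsub>TT\<^esub> g = (\<lambda>n. f n \<otimes>\<^bsub>tp n\<^esub> g n)"
 "\<one>\<^bsub>TT\<^esub> = (\<lambda>n. \<one>\<^bsub>tp n\<^esub>)"
 "\<zero>\<^bsub>TT\<^esub> = (\<lambda>n. \<zero>\<^bsub>tp n\<^esub>)"
 "f \<oplus>\<^bsub>TT\<^esub> g = (\<lambda>n. f n \<oplus>\<^bsub>tp n\<^esub> g n)"
 "c \<odot>\<^bsub>TT\<^esub> f = (\<lambda>n. c \<odot>\<^bsub>tp n\<^esub> f n)"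
 by (simp_all add: completed_tensor_def)

lemma algebra_TT [simp]: "alg TT"
proof -
 have "cring TT"
 proof (intro cringI abelian_groupI comm_monoidI)
  show "\<exists>y\<in>carrier TT. y \<oplus>\<^bsub>TT\<^esub> x = \<zero>\<^bsub>TT\<^esub>" if "x \<in> carrier TT" for x
  proof (rule bexI)
   have x: "x n \<in> carrier (tp n)" for n using that by (simp add: TT_simps)
   show "(\<lambda>n. \<ominus>\<^bsub>tp n\<^esub> x n) \<in> carrier TT" using x by (simp add: TT_simps)
   have "\<ominus>\<^bsub>tp n\<^esub> x n \<oplus>\<^bsub>tp n\<^esub> x n = \<zero>\<^bsub>tp n\<^esub>" for n
   proof -
    interpret P: algebra K "tensor_power K A n" by simp
    show ?thesis using x by (simp add: P.l_neg)
   qed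
   then show "(\<lambda>n. \<ominus>\<^bsub>tp n\<^esub> x n) \<oplus>\<^bsub>TT\<^esub> x = \<zero>\<^bsub>TT\<^esub>" by (simp add: TT_simps)
  qed
 qed (simp_all add: TT_simps alg_add_ac alg_mult_ac alg_distrib)
 then show ?thesis
  by (rule algebraI[OF is_cring]) (simp_all add: TT_simps alg_distrib alg_smult)
qed

lemma lin_component: "lin TT (tp n) (\<lambda>f. f n)"
 by (rule linI) (simp_all add: TT_simps)

definition fev :: "('v \<Rightarrow> 'k) list \<Rightarrow> (nat \<Rightarrow> ('k, 'v) tensor) \<Rightarrow> 'k" where
 "fev w f = tev w (f (length w))"

abbreviation words :: "('v \<Rightarrow> 'k) list set" where "words \<equiv> lists {\<phi>. fnl A \<phi>}"

abbreviation "LW \<equiv> lists \<Omega>"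

lemma \<Omega>_fnl: "\<phi> \<in> \<Omega> \<Longrightarrow> fnl A \<phi>"
 using separating_A by (simp add: separating_def)

lemma LW_words: "w \<in> LW \<Longrightarrow> w \<in> words"
 using \<Omega>_fnl by auto

lemma words_fnls: "w \<in> words \<Longrightarrow> fnls (replicate (length w) A) w"
 by (induction w) auto

lemma words_fnls': "w \<in> words \<Longrightarrow> length w = n \<Longrightarrow> fnls (replicate n A) w"
 using words_fnls by blast

lemma fnl_fev: "w \<in> words \<Longrightarrow> fnl TT (fev w)"
 unfolding fev_def by (rule lin_comp[OF lin_component fnl_tev]) (simp_all add: words_fnls)

lemma fev_closed: "w \<in> words \<Longrightarrow> f \<in> carrier TT \<Longrightarrow> fev w f \<in> \<K>"
 by (rule fnl_closed[OF fnl_fev])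

lemma list_all2_replicate: "list_all2 (\<in>) w (replicate n S) \<longleftrightarrow> length w = n \<and> w \<in> lists S"
proof (induction n arbitrary: w)
 case (Suc n)
 then show ?case by (cases w) auto
qed auto

lemma separating_power: "separating (tp n) (tev ` {w \<in> LW. length w = n})"
 unfolding separating_def
proof (intro conjI ballI impI)
 show "fnl (tp n) e" if e: "e \<in> tev ` {w \<in> LW. length w = n}" for e
 proof -
  obtain w where w': "e = tev w" "w \<in> {w \<in> LW. length w = n}" using e by (rule imageE)
  then have w: "w \<in> LW" "length w = n" "e = tev w" by simp_all
  show ?thesis unfolding w(3) by (rule fnl_tev[OF algs_replicate words_fnls'[OF LW_words[OF w(1)] w(2)]])
 qed
 fix t assume t: "t \<in> carrier (tp n)" "\<forall>e\<in>tev ` {w \<in> LW. length w = n}. e t = \<zero>"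
 show "t = \<zero>\<^bsub>tp n\<^esub>"
 proof (rule tensor_separated[OF algs_replicate _ t(1)])
  show "list_all2 separating (replicate n A) (replicate n \<Omega>)" using separating_A by (simp add: list_all2_conv_all_nth)
  show "tev \<phi>s t = \<zero>" if "list_all2 (\<in>) \<phi>s (replicate n \<Omega>)" for \<phi>s
  proof -
   have "\<phi>s \<in> {w \<in> LW. length w = n}" using that unfolding list_all2_replicate by simp
   then show ?thesis by (rule bspec[OF t(2) imageI])
  qed
 qed
qed

lemma separating_TT: "separating TT (fev ` LW)"
 unfolding separating_def
proof (intro conjI ballI impI)
 show "fnl TT e" if e: "e \<in> fev ` LW" for e
 proof -
  obtain w where w: "e = fev w" "w \<in> LW" using e by (rule imageE)
  show ?thesis unfolding w(1) by (rule fnl_fev[OF LW_words[OF w(2)]])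
 qed
 fix f assume f: "f \<in> carrier TT" "\<forall>e\<in>fev ` LW. e f = \<zero>"
 have "f n = \<zero>\<^bsub>tp n\<^esub>" for n
 proof -
  have "e (f n) = \<zero>" if e: "e \<in> tev ` {w \<in> LW. length w = n}" for e
  proof -
   obtain w where w': "e = tev w" "w \<in> {w \<in> LW. length w = n}" using e by (rule imageE)
   then have w: "w \<in> LW" "length w = n" "e = tev w" by simp_all
   have "fev w f = \<zero>" by (rule bspec[OF f(2) imageI[OF w(1)]])
   then show ?thesis using w by (simp add: fev_def)
  qed
  moreover have "f n \<in> carrier (tp n)" using f(1) by (simp add: TT_simps)
  ultimately show ?thesis by (intro separatingD[OF separating_power])
 qed
 then show "f = \<zero>\<^bsub>TT\<^esub>" by (simp add: TT_simps fun_eq_iff)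
qed

lemma TT_eqI: "\<lbrakk>f \<in> carrier TT; g \<in> carrier TT; (\<And>w. w \<in> LW \<Longrightarrow> fev w f = fev w g)\<rbrakk> \<Longrightarrow> f = g"
 by (rule separating_eqI[OF separating_TT algebra_TT], assumption, assumption) (erule imageE, simp)

lemma TT_at: "f \<in> carrier TT \<Longrightarrow> f n \<in> carrier (tp n)"
 by (simp add: TT_simps)

definition lcon :: "('v \<Rightarrow> 'k) list \<Rightarrow> (nat \<Rightarrow> ('k, 'v) tensor) \<Rightarrow> nat \<Rightarrow> ('k, 'v) tensor" where
 "lcon w f n = tlift (tp n)
   (\<lambda>xs. pev w (take (length w) xs) \<odot>\<^bsub>tp n\<^esub> pur (replicate n A) (drop (length w) xs)) (f (length w + n))"

definition rcon :: "('v \<Rightarrow> 'k) list \<Rightarrow> (nat \<Rightarrow> ('k, 'v) tensor) \<Rightarrow> nat \<Rightarrow> ('k, 'v) tensor" where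
 "rcon w f n = tlift (tp n)
   (\<lambda>xs. pev w (drop n xs) \<odot>\<^bsub>tp n\<^esub> pur (replicate n A) (take n xs)) (f (n + length w))"

lemma con_closed:
 assumes w: "w \<in> words" and f: "f \<in> carrier TT"
 shows "lcon w f \<in> carrier TT" and "rcon w f \<in> carrier TT"
proof -
 note fw = words_fnls[OF w]
 have al: "algs (replicate m A @ replicate n A)" for m n by auto
 have t: "f (m + n) \<in> TC (replicate m A @ replicate n A)" for m n
  using TT_at[OF f] by (simp add: replicate_add[symmetric])
 note g = multilin_pev_smult[OF algs_replicate algs_replicate algebra_power]
 show "lcon w f \<in> carrier TT" unfolding TT_simps(1) lcon_def
  using tensor_lift_closed[OF al algebra_power g(1)[OF fw multilin_pure[OF algs_replicate]] t] by simp
 show "rcon w f \<in> carrier TT" unfolding TT_simps(1) rcon_def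
  using tensor_lift_closed[OF al algebra_power g(2)[OF multilin_pure[OF algs_replicate] fw] t] by simp
qed

lemma fev_con:
 assumes w: "w \<in> words" and f: "f \<in> carrier TT" and u: "u \<in> words"
 shows "fev u (lcon w f) = fev (w @ u) f" and "fev u (rcon w f) = fev (u @ w) f"
proof -
 note fw = words_fnls[OF w] and fu = words_fnls[OF u]
 have t: "f (length w + length u) \<in> TC (replicate (length w) A @ replicate (length u) A)"
  "f (length u + length w) \<in> TC (replicate (length u) A @ replicate (length w) A)"
  using TT_at[OF f] by (simp_all add: replicate_add[symmetric])
 show "fev u (lcon w f) = fev (w @ u) f"
  using tev_contract(1)[OF algs_replicate algs_replicate fw fu t(1)] unfolding fev_def lcon_def by simp
 show "fev u (rcon w f) = fev (u @ w) f"
  using tev_contract(2)[OF algs_replicate algs_replicate fu fw t(2)] unfolding fev_def rcon_def by simp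
qed

subsection \<open>The comultiplication in terms of words\<close>

lemma tev_represents:
 assumes U: "alg U" and incl: "lin U TT (\<lambda>x. x)" and t: "t \<in> TC [U, U]"
  and u: "u \<in> words" "length u = i" and w: "w \<in> words" "length w = j"
 shows "tlift (tens [tp i, tp j])
   (\<lambda>gs. pur [tp i, tp j] [(gs ! 0) i, (gs ! 1) j]) t \<in> TC [tp i, tp j]"
  and "tev [tev u, tev w] (tlift (tens [tp i, tp j])
   (\<lambda>gs. pur [tp i, tp j] [(gs ! 0) i, (gs ! 1) j]) t) = tev [fev u, fev w] t"
proof -
 let ?P = "tp i" and ?Q = "tp j"
 have UU: "algs [U, U]" and PQ: "algs [?P, ?Q]" using U by simp_all
 note T = alg_tens[OF PQ]
 have at: "lin U (tp n) (\<lambda>x. x n)" for n by (rule lin_comp[OF incl lin_component])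
 have pl: "lin ?P (tens [?P, ?Q]) (\<lambda>x. pur [?P, ?Q] [x, y])" if "y \<in> carrier ?Q" for y
  by (rule pure_pair_lin(1)[OF algebra_power algebra_power that])
 have pr: "lin ?Q (tens [?P, ?Q]) (\<lambda>y. pur [?P, ?Q] [x, y])" if "x \<in> carrier ?P" for x
  by (rule pure_pair_lin(2)[OF algebra_power algebra_power that])
 have g: "multilin [U, U] (tens [?P, ?Q]) (\<lambda>gs. pur [?P, ?Q] [(gs ! 0) i, (gs ! 1) j])"
  using lin_comp[OF at pl] lin_comp[OF at pr] linD(1)[OF at] pure_closed[OF PQ] by (auto elim!: RD_ConsE)
 show "tlift (tens [?P, ?Q]) (\<lambda>gs. pur [?P, ?Q] [(gs ! 0) i, (gs ! 1) j]) t \<in> TC [?P, ?Q]"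
  by (rule tensor_lift_closed[OF UU T g t])
 have fu: "fnl ?P (tev u)" "fnl ?Q (tev w)" using fnl_tev[OF algs_replicate words_fnls'[OF u]] fnl_tev[OF algs_replicate words_fnls'[OF w]] by simp_all
 then have f: "fnls [?P, ?Q] [tev u, tev w]" by simp
 have ff: "fnls [U, U] [fev u, fev w]" using lin_comp[OF incl fnl_fev[OF u(1)]] lin_comp[OF incl fnl_fev[OF w(1)]] by simp
 show "tev [tev u, tev w] (tlift (tens [?P, ?Q]) (\<lambda>gs. pur [?P, ?Q] [(gs ! 0) i, (gs ! 1) j]) t) = tev [fev u, fev w] t"
 proof (rule tev_eqI[OF UU ff lin_comp[OF lin_tensor_lift[OF UU T g] fnl_tev[OF PQ f]] _ t])
  fix xs assume xs: "xs \<in> RD [U, U]"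
  then obtain x y where xy: "xs = [x, y]" "x \<in> carrier U" "y \<in> carrier U" by (auto elim!: RD_ConsE)
  have "fev w y \<in> \<K>" by (rule fev_closed[OF w(1) linD(1)[OF incl xy(3)]])
  then show "tev [tev u, tev w] (tlift (tens [?P, ?Q]) (\<lambda>gs. pur [?P, ?Q] [(gs ! 0) i, (gs ! 1) j]) (pur [U, U] xs)) = pev [fev u, fev w] xs"
   unfolding tensor_lift_pure[OF UU T g xs]
   using xy tev_pair[OF algebra_power algebra_power fu linD(1)[OF at xy(2)] linD(1)[OF at xy(3)]] u(2) w(2) by (simp add: fev_def)
 qed
qed

lemma tev_split_tensor:
 assumes f: "f \<in> carrier TT" and u: "u \<in> words" "length u = i" and w: "w \<in> words" "length w = j"
 shows "split_tensor K A i j (f (i + j)) \<in> TC [tp i, tp j]"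
  and "tev [tev u, tev w] (split_tensor K A i j (f (i + j))) = fev (u @ w) f"
proof -
 have t: "f (i + j) \<in> TC (replicate i A @ replicate j A)"
  using TT_at[OF f] by (simp add: replicate_add[symmetric])
 have PQ: "algs [tp i, tp j]" by simp
 have al: "algs (replicate i A @ replicate j A)" by auto
 show "split_tensor K A i j (f (i + j)) \<in> TC [tp i, tp j]"
  unfolding split_tensor_def
  using tensor_lift_closed[OF al alg_tens[OF PQ] _ t] multilin_split[OF algs_replicate algs_replicate, of i j] by simp
 show "tev [tev u, tev w] (split_tensor K A i j (f (i + j))) = fev (u @ w) f"
  unfolding split_tensor_def fev_def
  using tev_split[OF algs_replicate algs_replicate words_fnls'[OF u] words_fnls'[OF w] t] u w by simp
qed

text \<open>Both sides of the condition on \<open>\<Delta>(f)\<^sub>i\<^sub>,\<^sub>j\<close> are elements of \<open>A\<^sup>i \<otimes> A\<^sup>j\<close> (tensor powers), on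
  which pairs of words of lengths \<open>i\<close> and \<open>j\<close> separate points.\<close>

lemma represents_iff:
 assumes U: "alg U" and incl: "lin U TT (\<lambda>x. x)" and t: "t \<in> TC [U, U]" and f: "f \<in> carrier TT"
 shows "represents_comult K A f t \<longleftrightarrow> (\<forall>u\<in>LW. \<forall>w\<in>LW. fev (u @ w) f = tev [fev u, fev w] t)"
proof
 assume r: "represents_comult K A f t"
 show "\<forall>u\<in>LW. \<forall>w\<in>LW. fev (u @ w) f = tev [fev u, fev w] t"
 proof (intro ballI)
  fix u w assume uw: "u \<in> LW" "w \<in> LW"
  note u = LW_words[OF uw(1)] and w = LW_words[OF uw(2)]
  show "fev (u @ w) f = tev [fev u, fev w] t"
   using tev_split_tensor(2)[OF f u refl w refl] tev_represents(2)[OF U incl t u refl w refl] r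
   unfolding represents_comult_def by simp
 qed
next
 assume *: "\<forall>u\<in>LW. \<forall>w\<in>LW. fev (u @ w) f = tev [fev u, fev w] t"
 show "represents_comult K A f t" unfolding represents_comult_def
 proof (intro allI)
  fix i j
  let ?P = "tp i" and ?Q = "tp j"
  have PQ: "algs [?P, ?Q]" by simp
  let ?z = "\<lambda>n. replicate n (\<lambda>_::'v. \<zero>)"
  have zw: "?z n \<in> words" "length (?z n) = n" for n
   using lin_zero_map[OF algebra_Ks, of A] by auto
  show "tlift (tens [?P, ?Q]) (\<lambda>gs. pur [?P, ?Q] [(gs ! 0) i, (gs ! 1) j]) t = split_tensor K A i j (f (i + j))"
  proof (rule tensor_eqI[OF PQ, of "[tev ` {w \<in> LW. length w = i}, tev ` {w \<in> LW. length w = j}]"])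
   show "tlift (tens [?P, ?Q]) (\<lambda>gs. pur [?P, ?Q] [(gs ! 0) i, (gs ! 1) j]) t \<in> TC [?P, ?Q]"
    by (rule tev_represents(1)[OF U incl t zw zw])
   show "split_tensor K A i j (f (i + j)) \<in> TC [?P, ?Q]"
    by (rule tev_split_tensor(1)[OF f zw zw])
   show "list_all2 separating [?P, ?Q] [tev ` {w \<in> LW. length w = i}, tev ` {w \<in> LW. length w = j}]"
    using separating_power by simp
   fix \<phi>s assume "list_all2 (\<in>) \<phi>s [tev ` {w \<in> LW. length w = i}, tev ` {w \<in> LW. length w = j}]"
   then obtain u w where uw: "\<phi>s = [tev u, tev w]" "u \<in> LW" "length u = i" "w \<in> LW" "length w = j"
    by (auto simp: list_all2_Cons2)
   show "tev \<phi>s (tlift (tens [?P, ?Q]) (\<lambda>gs. pur [?P, ?Q] [(gs ! 0) i, (gs ! 1) j]) t) = tev \<phi>s (split_tensor K A i j (f (i + j)))"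
    using tev_split_tensor(2)[OF f LW_words[OF uw(2)] uw(3) LW_words[OF uw(4)] uw(5)]
     tev_represents(2)[OF U incl t LW_words[OF uw(2)] uw(3) LW_words[OF uw(4)] uw(5)] * uw by simp
  qed
 qed
qed

lemma separating_sub:
 assumes U: "alg U" and incl: "lin U TT (\<lambda>x. x)"
 shows "separating U (fev ` LW)"
 unfolding separating_def
proof (intro conjI ballI impI)
 show "fnl U e" if e: "e \<in> fev ` LW" for e
 proof -
  obtain w where w: "e = fev w" "w \<in> LW" using e by (rule imageE)
  show ?thesis unfolding w(1) by (rule lin_comp[OF incl fnl_fev[OF LW_words[OF w(2)]]])
 qed
 show "x = \<zero>\<^bsub>U\<^esub>" if "x \<in> carrier U" "\<forall>e\<in>fev ` LW. e x = \<zero>" for x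
  using separatingD[OF separating_TT linD(1)[OF incl that(1)]] that(2) lin_zero[OF incl U algebra_TT] by simp
qed

lemma tensor_sub_eqI:
 assumes U: "alg U" and incl: "lin U TT (\<lambda>x. x)" and s: "s \<in> TC [U, U]" and t: "t \<in> TC [U, U]"
  and eq: "\<And>u w. u \<in> LW \<Longrightarrow> w \<in> LW \<Longrightarrow> tev [fev u, fev w] s = tev [fev u, fev w] t"
 shows "s = t"
proof (rule tensor_eqI[OF _ _ s t, of "[fev ` LW, fev ` LW]"])
 show "list_all2 separating [U, U] [fev ` LW, fev ` LW]" using separating_sub[OF U incl] by simp
 fix \<phi>s assume "list_all2 (\<in>) \<phi>s [fev ` LW, fev ` LW]"
 then obtain u w where "\<phi>s = [fev u, fev w]" "u \<in> LW" "w \<in> LW" by (auto simp: list_all2_Cons2)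
 then show "tev \<phi>s s = tev \<phi>s t" using eq by simp
qed (use U in simp)

lemma cofree_comult_eq:
 assumes U: "alg U" and incl: "lin U TT (\<lambda>x. x)" and t: "t \<in> TC [U, U]" and f: "f \<in> carrier TT"
  and eq: "\<And>u w. u \<in> LW \<Longrightarrow> w \<in> LW \<Longrightarrow> fev (u @ w) f = tev [fev u, fev w] t"
 shows "cofree_comult K A U f = t"
 unfolding cofree_comult_def
proof (rule the_equality)
 show "t \<in> TC [U, U] \<and> represents_comult K A f t" using t eq represents_iff[OF U incl t f] by blast
 fix s assume s: "s \<in> TC [U, U] \<and> represents_comult K A f s"
 then have "fev (u @ w) f = tev [fev u, fev w] s" if "u \<in> LW" "w \<in> LW" for u w
  using represents_iff[OF U incl _ f, of s] that by blast
 then show "s = t" using s by (intro tensor_sub_eqI[OF U incl _ t]) (simp_all add: eq[symmetric])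
qed

lemma cofree_carrier:
 "f \<in> carrier (cofree K A) \<longleftrightarrow> f \<in> carrier TT \<and>
   (\<exists>t\<in>TC [TT, TT]. \<forall>u\<in>LW. \<forall>w\<in>LW. fev (u @ w) f = tev [fev u, fev w] t)"
proof -
 have "f \<in> carrier (cofree K A) \<longleftrightarrow> f \<in> carrier TT \<and> (\<exists>t\<in>TC [TT, TT]. represents_comult K A f t)"
  by (simp add: cofree_def)
 then show ?thesis using represents_iff[OF algebra_TT lin_id] by blast
qed

lemma cofree_counit_eq: "cofree_counit K f = fev [] f"
proof -
 have "pev [] = (\<lambda>_::'v list. \<one>)" by (simp add: fun_eq_iff)
 then show ?thesis by (simp add: cofree_counit_def fev_def tev_def)
qed

lemma lin_cofree_proj: "lin TT A (cofree_proj K A)"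
 and fnl_cofree_proj: "f \<in> carrier TT \<Longrightarrow> fnl A \<phi> \<Longrightarrow> \<phi> (cofree_proj K A f) = fev [\<phi>] f"
proof -
 have AA: "algs [A]" by simp
 have g: "multilin [A] A (\<lambda>xs. xs ! 0)" by simp
 have at: "lin TT (tens [A]) (\<lambda>f. f 1)" using lin_component[of 1] by simp
 show "lin TT A (cofree_proj K A)"
  unfolding cofree_proj_def by (rule lin_comp[OF at lin_tensor_lift[OF AA algebra_A g]])
 assume f: "f \<in> carrier TT" and \<phi>: "fnl A \<phi>"
 show "\<phi> (cofree_proj K A f) = fev [\<phi>] f"
  unfolding cofree_proj_def fev_def
 proof (simp, rule tev_eqI[OF AA _ lin_comp[OF lin_tensor_lift[OF AA algebra_A g] \<phi>, simplified]])
  show "fnls [A] [\<phi>]" using \<phi> by simp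
  show "f (Suc 0) \<in> TC [A]" using linD(1)[OF at f] by simp
  fix xs assume xs: "xs \<in> RD [A]"
  then obtain x where "xs = [x]" "x \<in> carrier A" by (auto elim!: RD_ConsE)
  then show "\<phi> (tlift A (\<lambda>xs. xs ! 0) (pur [A] xs)) = pev [\<phi>] xs"
   using tensor_lift_pure[OF AA algebra_A g xs] fnl_closed[OF \<phi>] by simp
 qed
qed

subsection \<open>Tensor powers of a matrix\<close>

primrec tpow :: "'i set \<Rightarrow> ('i \<Rightarrow> 'i \<Rightarrow> 'v) \<Rightarrow> nat \<Rightarrow> 'i \<Rightarrow> 'i \<Rightarrow> ('k, 'v) tensor" where
 "tpow I X 0 = delta (tp 0)"
| "tpow I X (Suc n) = (\<lambda>a b. finsum (tp (Suc n)) (\<lambda>c. tcons (replicate (Suc n) A) (X a c) (tpow I X n c b)) I)"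

text \<open>If \<open>X\<close> is a representation over a coalgebra structure on \<open>A\<close>, this matrix consists of the
  iterated coproducts of its entries; it is defined for every matrix over \<open>A\<close>.\<close>

definition Emat :: "'i set \<Rightarrow> ('i \<Rightarrow> 'i \<Rightarrow> 'v) \<Rightarrow> 'i \<Rightarrow> 'i \<Rightarrow> nat \<Rightarrow> ('k, 'v) tensor" where
 "Emat I X a b n = tpow I X n a b"

lemma algs_Suc: "algs (A # replicate n A)"
 by simp

lemma tcons_power_closed: "x \<in> carrier A \<Longrightarrow> s \<in> carrier (tp n) \<Longrightarrow>
  tcons (replicate (Suc n) A) x s \<in> carrier (tp (Suc n))"
 using tcons_closed[OF algs_Suc] by simp

lemma tpow_closed: "\<lbrakk>mat_in A I X; a \<in> I; b \<in> I\<rbrakk> \<Longrightarrow> tpow I X n a b \<in> carrier (tp n)"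
proof (induction n arbitrary: a)
 case 0
 then show ?case using delta_closed[OF algebra_power, of 0] by simp
next
 case (Suc n)
 show ?case unfolding tpow.simps
  by (rule fsum_closed[OF algebra_power tcons_power_closed[OF mat_inD[OF Suc.prems(1,2)] Suc.IH[OF Suc.prems(1) _ Suc.prems(3)]]])
qed

lemma Emat_closed: "\<lbrakk>mat_in A I X; a \<in> I; b \<in> I\<rbrakk> \<Longrightarrow> Emat I X a b \<in> carrier TT"
 by (simp add: TT_simps Emat_def tpow_closed)

lemma fev_Emat_Nil: "fev [] (Emat I X a b) = (if a = b then \<one> else \<zero>)"
proof -
 have a: "algs ([] :: ('k, 'v, 'n) module_scheme list)" and f: "fnls ([] :: ('k, 'v, 'n) module_scheme list) []" by simp_all
 have "tev [] (pur ([] :: ('k, 'v, 'n) module_scheme list) []) = \<one>" using tev_pure[OF a f, of "[]"] by simp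
 then show ?thesis using pure_one[OF a] lin_zero[OF fnl_tev[OF a f] alg_tens[OF a] algebra_Ks]
  by (simp add: fev_def Emat_def delta_def)
qed

lemma fev_Emat_Cons:
 assumes I: "finite I" and X: "mat_in A I X" and ab: "a \<in> I" "b \<in> I" and \<phi>: "fnl A \<phi>" and w: "w \<in> words"
 shows "fev (\<phi> # w) (Emat I X a b) = ksum (\<lambda>c. \<phi> (X a c) \<otimes> fev w (Emat I X c b)) I"
proof -
 let ?n = "length w"
 note fw = words_fnls[OF w]
 have f: "fnls (A # replicate ?n A) (\<phi> # w)" using \<phi> fw by simp
 have Xc: "X a c \<in> carrier A" if "c \<in> I" for c by (rule mat_inD[OF X ab(1) that])
 have tc: "tpow I X ?n c b \<in> carrier (tp ?n)" if "c \<in> I" for c by (rule tpow_closed[OF X that ab(2)])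
 have cl: "tcons (A # replicate ?n A) (X a c) (tpow I X ?n c b) \<in> TC (A # replicate ?n A)" if "c \<in> I" for c
  by (rule tcons_closed[OF algs_Suc Xc[OF that] tc[OF that]])
 have "fev (\<phi> # w) (Emat I X a b) = tev (\<phi> # w) (finsum (tens (A # replicate ?n A)) (\<lambda>c. tcons (A # replicate ?n A) (X a c) (tpow I X ?n c b)) I)"
  by (simp add: fev_def Emat_def)
 also have "\<dots> = ksum (\<lambda>c. tev (\<phi> # w) (tcons (A # replicate ?n A) (X a c) (tpow I X ?n c b))) I"
  by (rule fnl_fsum[OF fnl_tev[OF algs_Suc f] alg_tens[OF algs_Suc] I cl])
 also have "\<dots> = ksum (\<lambda>c. \<phi> (X a c) \<otimes> fev w (Emat I X c b)) I"
 proof (rule ksum_cong[OF refl])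
  fix c assume c: "c \<in> I"
  show "tev (\<phi> # w) (tcons (A # replicate ?n A) (X a c) (tpow I X ?n c b)) = \<phi> (X a c) \<otimes> fev w (Emat I X c b)"
   using tev_tcons[OF algs_Suc Xc[OF c] tc[OF c] \<phi> fw] by (simp add: fev_def Emat_def)
  show "\<phi> (X a c) \<otimes> fev w (Emat I X c b) \<in> \<K>"
   using fnl_closed[OF \<phi> Xc[OF c]] fev_closed[OF w Emat_closed[OF X c ab(2)]] by simp
 qed
 finally show ?thesis .
qed

lemma fev_append_eqI:
 assumes I: "finite I" and M: "mat_in TT I M"
  and one: "\<And>a b. a \<in> I \<Longrightarrow> b \<in> I \<Longrightarrow> fev [] (M a b) = (if a = b then \<one> else \<zero>)"
  and step: "\<And>a b \<phi> w. \<lbrakk>a \<in> I; b \<in> I; fnl A \<phi>; w \<in> words\<rbrakk> \<Longrightarrow>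
   fev (\<phi> # w) (M a b) = ksum (\<lambda>c. x \<phi> a c \<otimes> fev w (M c b)) I"
  and x: "\<And>a b \<phi>. \<lbrakk>a \<in> I; b \<in> I; fnl A \<phi>\<rbrakk> \<Longrightarrow> x \<phi> a b \<in> \<K>" and w: "w \<in> words"
 shows "\<lbrakk>u \<in> words; a \<in> I; b \<in> I\<rbrakk> \<Longrightarrow> fev (u @ w) (M a b) = ksum (\<lambda>c. fev u (M a c) \<otimes> fev w (M c b)) I"
proof (induction u arbitrary: a)
 case Nil
 have cl: "fev w (M c b) \<in> \<K>" if "c \<in> I" for c by (rule fev_closed[OF w mat_inD[OF M that Nil(3)]])
 have "ksum (\<lambda>c. fev [] (M a c) \<otimes> fev w (M c b)) I = fev [] (M a a) \<otimes> fev w (M a b)"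
  by (rule ksum_delta[OF I Nil(2)]) (use one Nil cl in auto)
 then show ?case using one[OF Nil(2,2)] cl[OF Nil(2)] by simp
next
 case (Cons \<phi> u)
 have \<phi>: "fnl A \<phi>" and u: "u \<in> words" using Cons.prems(1) by simp_all
 have uw: "u @ w \<in> words" using u w by simp
 have cl: "fev v (M c d) \<in> \<K>" if "v \<in> words" "c \<in> I" "d \<in> I" for v c d by (rule fev_closed[OF that(1) mat_inD[OF M that(2,3)]])
 have "fev ((\<phi> # u) @ w) (M a b) = ksum (\<lambda>c. x \<phi> a c \<otimes> fev (u @ w) (M c b)) I"
  using step[OF Cons.prems(2,3) \<phi> uw] by simp
 also have "\<dots> = ksum (\<lambda>c. ksum (\<lambda>d. x \<phi> a c \<otimes> (fev u (M c d) \<otimes> fev w (M d b))) I) I"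
 proof (rule ksum_cong[OF refl])
  fix c assume c: "c \<in> I"
  show "x \<phi> a c \<otimes> fev (u @ w) (M c b) = ksum (\<lambda>d. x \<phi> a c \<otimes> (fev u (M c d) \<otimes> fev w (M d b))) I"
   unfolding Cons.IH[OF u c Cons.prems(3)]
   by (rule ksum_mult_right[OF I x[OF Cons.prems(2) c \<phi>]]) (use cl[OF u c] cl[OF w _ Cons.prems(3)] in simp)
  show "ksum (\<lambda>d. x \<phi> a c \<otimes> (fev u (M c d) \<otimes> fev w (M d b))) I \<in> \<K>"
   by (rule ksum_closed) (use cl[OF u c] cl[OF w _ Cons.prems(3)] x[OF Cons.prems(2) c \<phi>] in simp)
 qed
 also have "\<dots> = ksum (\<lambda>d. ksum (\<lambda>c. x \<phi> a c \<otimes> (fev u (M c d) \<otimes> fev w (M d b))) I) I"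
  by (rule ksum_swap[OF I I]) (use cl[OF u] cl[OF w _ Cons.prems(3)] x[OF Cons.prems(2) _ \<phi>] in simp)
 also have "\<dots> = ksum (\<lambda>d. fev (\<phi> # u) (M a d) \<otimes> fev w (M d b)) I"
 proof (rule ksum_cong[OF refl])
  fix d assume d: "d \<in> I"
  have "fev (\<phi> # u) (M a d) \<otimes> fev w (M d b) = ksum (\<lambda>c. x \<phi> a c \<otimes> fev u (M c d) \<otimes> fev w (M d b)) I"
   unfolding step[OF Cons.prems(2) d \<phi> u]
   by (rule ksum_mult_left[OF I cl[OF w d Cons.prems(3)]]) (use cl[OF u _ d] x[OF Cons.prems(2) _ \<phi>] in simp)
  also have "\<dots> = ksum (\<lambda>c. x \<phi> a c \<otimes> (fev u (M c d) \<otimes> fev w (M d b))) I"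
   by (rule ksum_cong[OF refl]) (use cl[OF u _ d] cl[OF w d Cons.prems(3)] x[OF Cons.prems(2) _ \<phi>] in \<open>simp_all add: m_assoc\<close>)
  finally show "ksum (\<lambda>c. x \<phi> a c \<otimes> (fev u (M c d) \<otimes> fev w (M d b))) I = fev (\<phi> # u) (M a d) \<otimes> fev w (M d b)" ..
  show "fev (\<phi> # u) (M a d) \<otimes> fev w (M d b) \<in> \<K>" using cl[OF Cons.prems(1,2) d] cl[OF w d Cons.prems(3)] by simp
 qed
 finally show ?case .
qed

lemma fev_Emat_append:
 assumes I: "finite I" and X: "mat_in A I X" and u: "u \<in> words" and w: "w \<in> words" and ab: "a \<in> I" "b \<in> I"
 shows "fev (u @ w) (Emat I X a b) = ksum (\<lambda>c. fev u (Emat I X a c) \<otimes> fev w (Emat I X c b)) I"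
proof (rule fev_append_eqI[OF I _ _ _ _ w u ab, where x="\<lambda>\<phi> a c. \<phi> (X a c)"])
 show "mat_in TT I (Emat I X)" using Emat_closed[OF X] by (simp add: mat_in_def)
 show "\<phi> (X a b) \<in> \<K>" if "a \<in> I" "b \<in> I" "fnl A \<phi>" for a b \<phi> by (rule fnl_closed[OF that(3) mat_inD[OF X that(1,2)]])
qed (simp_all add: fev_Emat_Nil fev_Emat_Cons[OF I X])

text \<open>A word is a product of its letters, so a matrix that turns concatenation into matrix
  multiplication is known once it is known on single letters.\<close>

lemma Emat_unique:
 assumes I: "finite I" and X: "mat_in A I X" and M: "mat_in TT I M"
  and one: "\<And>a b. a \<in> I \<Longrightarrow> b \<in> I \<Longrightarrow> fev [] (M a b) = (if a = b then \<one> else \<zero>)"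
  and app: "\<And>u w a b. \<lbrakk>u \<in> LW; w \<in> LW; a \<in> I; b \<in> I\<rbrakk> \<Longrightarrow>
   fev (u @ w) (M a b) = ksum (\<lambda>c. fev u (M a c) \<otimes> fev w (M c b)) I"
  and MX: "\<And>a b. a \<in> I \<Longrightarrow> b \<in> I \<Longrightarrow> cofree_proj K A (M a b) = X a b" and ab: "a \<in> I" "b \<in> I"
 shows "M a b = Emat I X a b"
proof -
 have "fev w (M a b) = fev w (Emat I X a b)" if "w \<in> LW" "a \<in> I" "b \<in> I" for w a b
  using that
 proof (induction w arbitrary: a rule: list.induct)
  case Nil
  then show ?case using one by (simp add: fev_Emat_Nil)
 next
  case (Cons \<phi> w)
  have \<phi>: "fnl A \<phi>" "[\<phi>] \<in> LW" and w: "w \<in> LW" using Cons.prems(1) \<Omega>_fnl by simp_all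
  have "fev ([\<phi>] @ w) (M a b) = ksum (\<lambda>c. fev [\<phi>] (M a c) \<otimes> fev w (M c b)) I" by (rule app[OF \<phi>(2) w Cons.prems(2,3)])
  also have "\<dots> = ksum (\<lambda>c. \<phi> (X a c) \<otimes> fev w (Emat I X c b)) I"
  proof (rule ksum_cong[OF refl])
   fix c assume c: "c \<in> I"
   show "fev [\<phi>] (M a c) \<otimes> fev w (M c b) = \<phi> (X a c) \<otimes> fev w (Emat I X c b)"
    using fnl_cofree_proj[OF mat_inD[OF M Cons.prems(2) c] \<phi>(1)] MX[OF Cons.prems(2) c] Cons.IH[OF w c Cons.prems(3)] by simp
   show "\<phi> (X a c) \<otimes> fev w (Emat I X c b) \<in> \<K>"
    using fnl_closed[OF \<phi>(1) mat_inD[OF X Cons.prems(2) c]] fev_closed[OF LW_words[OF w] Emat_closed[OF X c Cons.prems(3)]] by simp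
  qed
  also have "\<dots> = fev (\<phi> # w) (Emat I X a b)" by (rule fev_Emat_Cons[OF I X Cons.prems(2,3) \<phi>(1) LW_words[OF w], symmetric])
  finally show ?case by simp
 qed
 then show ?thesis by (intro TT_eqI[OF mat_inD[OF M ab] Emat_closed[OF X ab]]) (simp add: ab)
qed

lemma cofree_proj_Emat:
 assumes I: "finite I" and X: "mat_in A I X" and ab: "a \<in> I" "b \<in> I"
 shows "cofree_proj K A (Emat I X a b) = X a b"
proof (rule separating_eqI[OF separating_A algebra_A linD(1)[OF lin_cofree_proj Emat_closed[OF X ab]] mat_inD[OF X ab]])
 fix \<phi> assume "\<phi> \<in> \<Omega>"
 then have \<phi>: "fnl A \<phi>" by (rule \<Omega>_fnl)
 have "\<phi> (cofree_proj K A (Emat I X a b)) = ksum (\<lambda>c. \<phi> (X a c) \<otimes> fev [] (Emat I X c b)) I"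
  unfolding fnl_cofree_proj[OF Emat_closed[OF X ab] \<phi>] by (rule fev_Emat_Cons[OF I X ab \<phi>]) simp
 also have "\<dots> = \<phi> (X a b) \<otimes> fev [] (Emat I X b b)"
  by (rule ksum_delta[OF I ab(2)]) (use fnl_closed[OF \<phi> mat_inD[OF X ab(1)]] ab in \<open>auto simp: fev_Emat_Nil\<close>)
 finally show "\<phi> (cofree_proj K A (Emat I X a b)) = \<phi> (X a b)"
  using fnl_closed[OF \<phi> mat_inD[OF X ab]] by (simp add: fev_Emat_Nil)
qed

text \<open>Multiplication in a tensor power is done factor by factor, so tensor powers of matrices
  multiply like the matrices themselves, by Kronecker products.\<close>

lemma tpow_mult:
 assumes I: "finite I" and J: "finite J" and X: "mat_in A I X" and Y: "mat_in A J Y"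
 shows "\<lbrakk>a \<in> I; b \<in> I; a' \<in> J; b' \<in> J\<rbrakk> \<Longrightarrow>
   tpow I X n a b \<otimes>\<^bsub>tp n\<^esub> tpow J Y n a' b' =
  tpow (I \<times> J) (\<lambda>p q. X (fst p) (fst q) \<otimes>\<^bsub>A\<^esub> Y (snd p) (snd q)) n (a, a') (b, b')"
proof (induction n arbitrary: a a')
 case 0
 have T0: "alg (tp 0)" by (rule algebra_power)
 show ?case using T0 by (simp add: delta_def)
next
 case (Suc n)
 let ?T = "tp (Suc n)" and ?S = "tp n" and ?As = "replicate (Suc n) A"
 let ?Z = "\<lambda>p q. X (fst p) (fst q) \<otimes>\<^bsub>A\<^esub> Y (snd p) (snd q)"
 note T = algebra_power[of "Suc n"]
 have x: "tcons ?As (X a c) (tpow I X n c b) \<in> carrier ?T" if "c \<in> I" for c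
  by (rule tcons_power_closed[OF mat_inD[OF X Suc.prems(1) that] tpow_closed[OF X that Suc.prems(2)]])
 have y: "tcons ?As (Y a' c) (tpow J Y n c b') \<in> carrier ?T" if "c \<in> J" for c
  by (rule tcons_power_closed[OF mat_inD[OF Y Suc.prems(3) that] tpow_closed[OF Y that Suc.prems(4)]])
 have ys: "finsum ?T (\<lambda>d. tcons ?As (Y a' d) (tpow J Y n d b')) J \<in> carrier ?T" by (rule fsum_closed[OF T y])
 have xy: "tcons ?As (X a c) (tpow I X n c b) \<otimes>\<^bsub>?T\<^esub> tcons ?As (Y a' d) (tpow J Y n d b')
   = tcons ?As (X a c \<otimes>\<^bsub>A\<^esub> Y a' d) (tpow (I \<times> J) ?Z n (c, d) (b, b'))" if "c \<in> I" "d \<in> J" for c d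
  using tcons_mult[OF algs_Suc mat_inD[OF X Suc.prems(1) that(1)] mat_inD[OF Y Suc.prems(3) that(2)]
   tpow_closed[OF X that(1) Suc.prems(2)] tpow_closed[OF Y that(2) Suc.prems(4)]] Suc.IH[OF that(1) Suc.prems(2) that(2) Suc.prems(4)]
  by simp
 have cl: "tcons ?As (X a c \<otimes>\<^bsub>A\<^esub> Y a' d) (tpow (I \<times> J) ?Z n (c, d) (b, b')) \<in> carrier ?T" if "c \<in> I" "d \<in> J" for c d
  unfolding xy[OF that, symmetric] using x[OF that(1)] y[OF that(2)] T by simp
 have "tpow I X (Suc n) a b \<otimes>\<^bsub>?T\<^esub> tpow J Y (Suc n) a' b'
   = finsum ?T (\<lambda>c. tcons ?As (X a c) (tpow I X n c b) \<otimes>\<^bsub>?T\<^esub> finsum ?T (\<lambda>d. tcons ?As (Y a' d) (tpow J Y n d b')) J) I"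
  unfolding tpow.simps by (rule fsum_mult_left[OF T I ys x])
 also have "\<dots> = finsum ?T (\<lambda>c. finsum ?T (\<lambda>d. tcons ?As (X a c \<otimes>\<^bsub>A\<^esub> Y a' d) (tpow (I \<times> J) ?Z n (c, d) (b, b'))) J) I"
 proof (rule fsum_cong[OF T refl])
  fix c assume c: "c \<in> I"
  have "tcons ?As (X a c) (tpow I X n c b) \<otimes>\<^bsub>?T\<^esub> finsum ?T (\<lambda>d. tcons ?As (Y a' d) (tpow J Y n d b')) J
    = finsum ?T (\<lambda>d. tcons ?As (X a c) (tpow I X n c b) \<otimes>\<^bsub>?T\<^esub> tcons ?As (Y a' d) (tpow J Y n d b')) J"
   by (rule fsum_mult_right[OF T J x[OF c] y])
  also have "\<dots> = finsum ?T (\<lambda>d. tcons ?As (X a c \<otimes>\<^bsub>A\<^esub> Y a' d) (tpow (I \<times> J) ?Z n (c, d) (b, b'))) J"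
   by (rule fsum_cong[OF T refl xy[OF c] cl[OF c]])
  finally show "tcons ?As (X a c) (tpow I X n c b) \<otimes>\<^bsub>?T\<^esub> finsum ?T (\<lambda>d. tcons ?As (Y a' d) (tpow J Y n d b')) J = \<dots>" .
  show "finsum ?T (\<lambda>d. tcons ?As (X a c \<otimes>\<^bsub>A\<^esub> Y a' d) (tpow (I \<times> J) ?Z n (c, d) (b, b'))) J \<in> carrier ?T"
   by (rule fsum_closed[OF T cl[OF c]])
 qed
 also have "\<dots> = finsum ?T (\<lambda>p. tcons ?As (X a (fst p) \<otimes>\<^bsub>A\<^esub> Y a' (snd p)) (tpow (I \<times> J) ?Z n (fst p, snd p) (b, b'))) (I \<times> J)"
  by (rule fsum_product[OF T I J cl])
 finally show ?case by simp
qed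

lemma Emat_mult:
 assumes "finite I" "finite J" "mat_in A I X" "mat_in A J Y" "a \<in> I" "b \<in> I" "a' \<in> J" "b' \<in> J"
 shows "Emat I X a b \<otimes>\<^bsub>TT\<^esub> Emat J Y a' b' =
  Emat (I \<times> J) (\<lambda>p q. X (fst p) (fst q) \<otimes>\<^bsub>A\<^esub> Y (snd p) (snd q)) (a, a') (b, b')"
 using tpow_mult[OF assms] by (simp add: TT_simps Emat_def fun_eq_iff)

lemma Emat_one: "Emat {i} (\<lambda>_ _. \<one>\<^bsub>A\<^esub>) i i = \<one>\<^bsub>TT\<^esub>"
proof -
 have "tpow {i} (\<lambda>_ _. \<one>\<^bsub>A\<^esub>) n i i = \<one>\<^bsub>tp n\<^esub>" for n
 proof (induction n)
  case (Suc n)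
  have "finsum (tp (Suc n)) (\<lambda>c. tcons (replicate (Suc n) A) \<one>\<^bsub>A\<^esub> (tpow {i} (\<lambda>_ _. \<one>\<^bsub>A\<^esub>) n c i)) {i}
   = tcons (replicate (Suc n) A) \<one>\<^bsub>A\<^esub> (tpow {i} (\<lambda>_ _. \<one>\<^bsub>A\<^esub>) n i i)"
   by (rule fsum_delta[OF algebra_power]) (use Suc tcons_power_closed[of "\<one>\<^bsub>A\<^esub>" "\<one>\<^bsub>tp n\<^esub>" n] in auto)
  then show ?case using Suc tcons_one[OF algs_Suc] by simp
 qed (simp add: delta_def)
 then show ?thesis by (simp add: TT_simps Emat_def fun_eq_iff)
qed

end

context ground_field
begin

section \<open>Products and copies of algebras\<close>

lemma prod_algebra_simps [simp]:
 "carrier (prod_algebra M N) = carrier M \<times> carrier N"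
 "(x, y) \<oplus>\<^bsub>prod_algebra M N\<^esub> (x', y') = (x \<oplus>\<^bsub>M\<^esub> x', y \<oplus>\<^bsub>N\<^esub> y')"
 "(x, y) \<otimes>\<^bsub>prod_algebra M N\<^esub> (x', y') = (x \<otimes>\<^bsub>M\<^esub> x', y \<otimes>\<^bsub>N\<^esub> y')"
 "\<zero>\<^bsub>prod_algebra M N\<^esub> = (\<zero>\<^bsub>M\<^esub>, \<zero>\<^bsub>N\<^esub>)" "\<one>\<^bsub>prod_algebra M N\<^esub> = (\<one>\<^bsub>M\<^esub>, \<one>\<^bsub>N\<^esub>)"
 "c \<odot>\<^bsub>prod_algebra M N\<^esub> (x, y) = (c \<odot>\<^bsub>M\<^esub> x, c \<odot>\<^bsub>N\<^esub> y)"
 by (simp_all add: prod_algebra_def RDirProd_def DirProd_def ring.defs monoid.defs)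

lemma algebra_prod_algebra:
 assumes M: "alg M" and N: "alg N"
 shows "alg (prod_algebra M N)"
proof -
 have "cring (prod_algebra M N)"
 proof (intro cringI abelian_groupI comm_monoidI)
  interpret M: algebra K M by fact
  interpret N: algebra K N by fact
  fix z assume "z \<in> carrier (prod_algebra M N)"
  then obtain x y where z: "z = (x, y)" "x \<in> carrier M" "y \<in> carrier N" by auto
  show "\<exists>y\<in>carrier (prod_algebra M N). y \<oplus>\<^bsub>prod_algebra M N\<^esub> z = \<zero>\<^bsub>prod_algebra M N\<^esub>"
   using z by (intro bexI[of _ "(\<ominus>\<^bsub>M\<^esub> x, \<ominus>\<^bsub>N\<^esub> y)"]) (simp_all add: M.l_neg N.l_neg)
 qed (use M N in \<open>auto simp: alg_add_ac alg_mult_ac alg_distrib\<close>)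
 then show ?thesis
  by (rule algebraI[OF is_cring]) (use M N in \<open>auto simp: alg_distrib alg_smult\<close>)
qed

lemma image_module_simps:
 assumes "inj \<iota>"
 shows "carrier (img \<iota> M) = \<iota> ` carrier M"
  and "x \<in> carrier M \<Longrightarrow> y \<in> carrier M \<Longrightarrow> \<iota> x \<oplus>\<^bsub>img \<iota> M\<^esub> \<iota> y = \<iota> (x \<oplus>\<^bsub>M\<^esub> y)"
  and "x \<in> carrier M \<Longrightarrow> y \<in> carrier M \<Longrightarrow> \<iota> x \<otimes>\<^bsub>img \<iota> M\<^esub> \<iota> y = \<iota> (x \<otimes>\<^bsub>M\<^esub> y)"
  and "\<zero>\<^bsub>img \<iota> M\<^esub> = \<iota> \<zero>\<^bsub>M\<^esub>" and "\<one>\<^bsub>img \<iota> M\<^esub> = \<iota> \<one>\<^bsub>M\<^esub>"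
  and "x \<in> carrier M \<Longrightarrow> c \<odot>\<^bsub>img \<iota> M\<^esub> \<iota> x = \<iota> (c \<odot>\<^bsub>M\<^esub> x)"
proof -
 have i: "inv_into (carrier M) \<iota> (\<iota> x) = x" if "x \<in> carrier M" for x
  using inv_into_f_f[OF inj_on_subset[OF assms subset_UNIV] that] .
 note d = image_module_def image_ring_def image_group_def ring.defs monoid.defs
 show "carrier (img \<iota> M) = \<iota> ` carrier M" "\<zero>\<^bsub>img \<iota> M\<^esub> = \<iota> \<zero>\<^bsub>M\<^esub>" "\<one>\<^bsub>img \<iota> M\<^esub> = \<iota> \<one>\<^bsub>M\<^esub>"
  by (simp_all add: d)
 show "\<iota> x \<oplus>\<^bsub>img \<iota> M\<^esub> \<iota> y = \<iota> (x \<oplus>\<^bsub>M\<^esub> y)" "\<iota> x \<otimes>\<^bsub>img \<iota> M\<^esub> \<iota> y = \<iota> (x \<otimes>\<^bsub>M\<^esub> y)"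
  if "x \<in> carrier M" "y \<in> carrier M" using i that by (simp_all add: d)
 show "c \<odot>\<^bsub>img \<iota> M\<^esub> \<iota> x = \<iota> (c \<odot>\<^bsub>M\<^esub> x)" if "x \<in> carrier M" using i that by (simp add: d)
qed

lemma algebra_image_module:
 assumes i: "inj \<iota>" and M: "alg M"
 shows "alg (img \<iota> M)"
proof -
 note s = image_module_simps[OF i]
 have "cring (img \<iota> M)"
 proof (intro cringI abelian_groupI comm_monoidI)
  interpret M: algebra K M by fact
  fix z assume "z \<in> carrier (img \<iota> M)"
  then obtain x where z: "z = \<iota> x" "x \<in> carrier M" unfolding s(1) by blast
  show "\<exists>y\<in>carrier (img \<iota> M). y \<oplus>\<^bsub>img \<iota> M\<^esub> z = \<zero>\<^bsub>img \<iota> M\<^esub>"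
   using z by (intro bexI[of _ "\<iota> (\<ominus>\<^bsub>M\<^esub> x)"]) (simp_all add: s M.l_neg)
 qed (use M in \<open>auto simp: s alg_add_ac alg_mult_ac alg_distrib\<close>)
 then show ?thesis
  by (rule algebraI[OF is_cring]) (use M in \<open>auto simp: s alg_distrib alg_smult\<close>)
qed

lemma lin_image_module: "inj \<iota> \<Longrightarrow> lin M (img \<iota> M) \<iota>"
 by (rule linI) (simp_all add: image_module_simps)

lemma lin_from_image_module:
 assumes i: "inj \<iota>" and h: "lin M N (\<lambda>x. h (\<iota> x))"
 shows "lin (img \<iota> M) N h"
proof (rule linI)
 note s = image_module_simps[OF i] and l = linD[OF h]
 fix z assume "z \<in> carrier (img \<iota> M)"
 then obtain x where z: "z = \<iota> x" "x \<in> carrier M" unfolding s(1) by blast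
 show "h z \<in> carrier N" using z l(1) by simp
 show "h (c \<odot>\<^bsub>img \<iota> M\<^esub> z) = c \<odot>\<^bsub>N\<^esub> h z" if "c \<in> \<K>" for c using z l(3) that by (simp add: s)
 fix z' assume "z' \<in> carrier (img \<iota> M)"
 then obtain x' where z': "z' = \<iota> x'" "x' \<in> carrier M" unfolding s(1) by blast
 show "h (z \<oplus>\<^bsub>img \<iota> M\<^esub> z') = h z \<oplus>\<^bsub>N\<^esub> h z'" using z z' l(2) by (simp add: s)
qed

subsection \<open>Applying linear maps to all factors\<close>

fun lins :: "('k, 'v, 'n) module_scheme list \<Rightarrow> ('k, 'w, 'p) module_scheme list \<Rightarrow> ('v \<Rightarrow> 'w) list \<Rightarrow> bool" where
 "lins [] [] [] = True"
| "lins (M # Ms) (N # Ns) (h # hs) = (lin M N h \<and> lins Ms Ns hs)"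
| "lins _ _ _ = False"

abbreviation app :: "('v \<Rightarrow> 'w) list \<Rightarrow> 'v list \<Rightarrow> 'w list" where
 "app \<equiv> map2 (\<lambda>h x. h x)"

lemma app_RD: "lins Ms Ns hs \<Longrightarrow> xs \<in> RD Ms \<Longrightarrow> app hs xs \<in> RD Ns"
proof (induction Ms Ns hs arbitrary: xs rule: lins.induct)
 case (2 M Ms N Ns h hs)
 obtain y ys where xs: "xs = y # ys" "y \<in> carrier M" "ys \<in> RD Ms" using 2(3) by (rule RD_ConsE)
 have h: "lin M N h" using 2(2) by simp
 show ?case using 2(1)[OF _ xs(3)] 2(2) xs linD(1)[OF h xs(2)] by simp
qed auto

lemma multilin_app: "lins Ms Ns hs \<Longrightarrow> multilin Ns W g \<Longrightarrow> multilin Ms W (\<lambda>xs. g (app hs xs))"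
proof (induction Ms Ns hs arbitrary: g rule: lins.induct)
 case (2 M Ms N Ns h hs)
 have h: "lin M N h" and hs: "lins Ms Ns hs" using 2(2) by simp_all
 have "lin M W (\<lambda>x. g (h x # app hs ys))" if "ys \<in> RD Ms" for ys
  using 2(3) app_RD[OF hs that] by (intro lin_comp[OF h, where g="\<lambda>x. g (x # app hs ys)"]) simp
 moreover have "multilin Ms W (\<lambda>ys. g (h x # app hs ys))" if "x \<in> carrier M" for x
  using 2(1)[OF hs, of "\<lambda>ys. g (h x # ys)"] 2(3) linD(1)[OF h that] by simp
 ultimately show ?case by simp
qed simp_all

lemma pev_app: "\<lbrakk>lins Ms Ns hs; length xs = length hs; length \<phi>s = length hs\<rbrakk> \<Longrightarrow>
   pev \<phi>s (app hs xs) = pev (map2 (\<lambda>h \<phi> x. \<phi> (h x)) hs \<phi>s) xs"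
proof (induction Ms Ns hs arbitrary: xs \<phi>s rule: lins.induct)
 case (2 M Ms N Ns h hs)
 then show ?case by (cases xs; cases \<phi>s) simp_all
qed simp_all

lemma lins_length: "lins Ms Ns hs \<Longrightarrow> length Ms = length hs \<and> length Ns = length hs"
 by (induction Ms Ns hs rule: lins.induct) auto

lemma fnls_app: "lins Ms Ns hs \<Longrightarrow> fnls Ns \<phi>s \<Longrightarrow> fnls Ms (map2 (\<lambda>h \<phi> x. \<phi> (h x)) hs \<phi>s)"
proof (induction Ms Ns hs arbitrary: \<phi>s rule: lins.induct)
 case (2 M Ms N Ns h hs)
 then obtain \<phi> \<phi>s' where p: "\<phi>s = \<phi> # \<phi>s'" "fnl N \<phi>" "fnls Ns \<phi>s'" by (auto simp: list_all2_Cons1)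
 have h: "lin M N h" using 2(2) by simp
 show ?case using 2(1)[of \<phi>s'] 2(2) p lin_comp[OF h p(2)] by simp
qed simp_all

lemma tev_app:
 assumes Ms: "algs Ms" and Ns: "algs Ns" and hs: "lins Ms Ns hs" and t: "t \<in> TC Ms"
  and f: "\<And>xs. xs \<in> RD Ms \<Longrightarrow> f xs = pur Ns (app hs xs)"
 shows "tlift (tens Ns) f t \<in> TC Ns"
  and "fnls Ns \<phi>s \<Longrightarrow> tev \<phi>s (tlift (tens Ns) f t) = tev (map2 (\<lambda>h \<phi> x. \<phi> (h x)) hs \<phi>s) t"
proof -
 note T = alg_tens[OF Ns]
 have g: "multilin Ms (tens Ns) f" by (rule multilin_cong[OF Ms multilin_app[OF hs multilin_pure[OF Ns]] f])
 show "tlift (tens Ns) f t \<in> TC Ns" by (rule tensor_lift_closed[OF Ms T g t])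
 assume \<phi>s: "fnls Ns \<phi>s"
 show "tev \<phi>s (tlift (tens Ns) f t) = tev (map2 (\<lambda>h \<phi> x. \<phi> (h x)) hs \<phi>s) t"
 proof (rule tev_eqI[OF Ms fnls_app[OF hs \<phi>s] lin_comp[OF lin_tensor_lift[OF Ms T g] fnl_tev[OF Ns \<phi>s]] _ t])
  fix xs assume xs: "xs \<in> RD Ms"
  have "tev \<phi>s (tlift (tens Ns) f (pur Ms xs)) = pev \<phi>s (app hs xs)"
   unfolding tensor_lift_pure[OF Ms T g xs] f[OF xs] by (rule tev_pure[OF Ns \<phi>s app_RD[OF hs xs]])
  also have "\<dots> = pev (map2 (\<lambda>h \<phi> x. \<phi> (h x)) hs \<phi>s) xs"
   using lins_length[OF hs] RD_length[OF xs] list_all2_lengthD[OF \<phi>s] by (intro pev_app[OF hs]) simp_all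
  finally show "tev \<phi>s (tlift (tens Ns) f (pur Ms xs)) = pev (map2 (\<lambda>h \<phi> x. \<phi> (h x)) hs \<phi>s) xs" .
 qed
qed

lemma lins_append: "length Ms = length hs \<Longrightarrow> length Ns = length hs \<Longrightarrow> lins (Ms @ Ms') (Ns @ Ns') (hs @ hs') \<longleftrightarrow> lins Ms Ns hs \<and> lins Ms' Ns' hs'"
proof (induction hs arbitrary: Ms Ns)
 case (Cons h hs)
 then show ?case by (cases Ms; cases Ns) auto
qed simp

lemma RD_rev: "xs \<in> RD Ms \<Longrightarrow> rev xs \<in> RD (rev Ms)"
 by (induction Ms arbitrary: xs) (auto elim!: RD_ConsE)

lemma multilin_rev: "multilin (rev Ms) W g \<Longrightarrow> multilin Ms W (\<lambda>xs. g (rev xs))"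
proof (induction Ms arbitrary: g)
 case (Cons M Ms)
 have 1: "multilin (rev Ms) W (\<lambda>xs. g (xs @ ys))" if "ys \<in> RD [M]" for ys
  using Cons.prems that unfolding rev.simps multilin_append by simp
 have 2: "multilin [M] W (\<lambda>ys. g (xs @ ys))" if "xs \<in> RD (rev Ms)" for xs
  using Cons.prems that unfolding rev.simps multilin_append by simp
 have "lin M W (\<lambda>x. g (rev ys @ [x]))" if "ys \<in> RD Ms" for ys
  using 2[OF RD_rev[OF that]] by simp
 moreover have "multilin Ms W (\<lambda>ys. g (rev ys @ [x]))" if "x \<in> carrier M" for x
  using Cons.IH[OF 1[of "[x]"]] that by simp
 ultimately show ?case by simp
qed simp

lemma pev_rev: "fnls Ms \<phi>s \<Longrightarrow> xs \<in> RD Ms \<Longrightarrow> pev (rev \<phi>s) (rev xs) = pev \<phi>s xs"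
proof (induction arbitrary: xs rule: list_all2_induct)
 case (Cons M Ms \<phi> \<phi>s)
 obtain y ys where xs: "xs = y # ys" "y \<in> carrier M" "ys \<in> RD Ms" using Cons.prems by (rule RD_ConsE)
 have f: "fnls (rev Ms) (rev \<phi>s)" "fnls [M] [\<phi>]" using Cons.hyps by simp_all
 have y: "[y] \<in> RD [M]" using xs by simp
 show ?case
  using pev_append[OF f RD_rev[OF xs(3)] y] Cons.IH[OF xs(3)] xs fnl_closed[OF Cons.hyps(1) xs(2)] pev_closed[OF Cons.hyps(2) xs(3)]
  by (simp add: m_comm)
qed simp

lemma image_comult:
 assumes h: "hopf G" and i: "inj \<iota>"
 defines "D \<equiv> (\<lambda>a. tlift (tens [img \<iota> G, img \<iota> G])
   (\<lambda>xs. pur [img \<iota> G, img \<iota> G] (map \<iota> xs)) (comult G a))"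
 shows "lin G (tens [img \<iota> G, img \<iota> G]) D"
  and "\<lbrakk>fnl (img \<iota> G) \<phi>; fnl (img \<iota> G) \<chi>; a \<in> carrier G\<rbrakk> \<Longrightarrow>
   tev [\<phi>, \<chi>] (D a) = tev [\<lambda>x. \<phi> (\<iota> x), \<lambda>x. \<chi> (\<iota> x)] (comult G a)"
proof -
 let ?I = "img \<iota> G"
 note G = hopfD(1)[OF h]
 have GG: "algs [G, G]" and II: "algs [?I, ?I]" using G algebra_image_module[OF i G] by simp_all
 have hs: "lins [G, G] [?I, ?I] [\<iota>, \<iota>]" using lin_image_module[OF i, of G] by simp
 have f: "pur [?I, ?I] (map \<iota> xs) = pur [?I, ?I] (app [\<iota>, \<iota>] xs)" if "xs \<in> RD [G, G]" for xs
  using that by (auto elim!: RD_ConsE)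
 have g: "multilin [G, G] (tens [?I, ?I]) (\<lambda>xs. pur [?I, ?I] (map \<iota> xs))"
  by (rule multilin_cong[OF GG multilin_app[OF hs multilin_pure[OF II]] f])
 show "lin G (tens [?I, ?I]) D"
  unfolding D_def by (rule lin_comp[OF hopfD(2)[OF h] lin_tensor_lift[OF GG alg_tens[OF II] g]])
 assume p: "fnl ?I \<phi>" "fnl ?I \<chi>" and a: "a \<in> carrier G"
 show "tev [\<phi>, \<chi>] (D a) = tev [\<lambda>x. \<phi> (\<iota> x), \<lambda>x. \<chi> (\<iota> x)] (comult G a)"
  unfolding D_def using tev_app(2)[OF GG II hs linD(1)[OF hopfD(2)[OF h] a] f, of "[\<phi>, \<chi>]"] p by simp
qed

lemma hopf_homD:
 assumes "q \<in> homs B B'"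
 shows "lin B B' q" and "x \<in> carrier B \<Longrightarrow> y \<in> carrier B \<Longrightarrow> q (x \<otimes>\<^bsub>B\<^esub> y) = q x \<otimes>\<^bsub>B'\<^esub> q y" and "q \<one>\<^bsub>B\<^esub> = \<one>\<^bsub>B'\<^esub>"
  and "x \<in> carrier B \<Longrightarrow> counit B' (q x) = counit B x" and "x \<in> carrier B \<Longrightarrow> antipode B' (q x) = q (antipode B x)"
 using assms by (simp_all add: hopf_hom_def lin_def alg_hom_def ring_hom_def Pi_iff)

end

section \<open>Coherence in terms of words\<close>

locale amalgam = ground_field K for K :: "('k, 'm) ring_scheme" (structure) +
 fixes G\<^sub>1 :: "('k, 'a) hopf" and G\<^sub>2 :: "('k, 'b) hopf" and H :: "('k, 'h) hopf"
  and \<alpha>\<^sub>1 :: "'a \<Rightarrow> 'h" and \<alpha>\<^sub>2 :: "'b \<Rightarrow> 'h"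
 assumes G1: "hopf G\<^sub>1" and G2: "hopf G\<^sub>2" and HH: "hopf H"
  and \<alpha>1: "\<alpha>\<^sub>1 \<in> homs G\<^sub>1 H" and \<alpha>2: "\<alpha>\<^sub>2 \<in> homs G\<^sub>2 H"
begin

abbreviation "A \<equiv> prod_algebra G\<^sub>1 G\<^sub>2"
abbreviation "F \<equiv> factor G\<^sub>1 G\<^sub>2"
abbreviation "fc \<equiv> factor_comult K G\<^sub>1 G\<^sub>2"
abbreviation "fe \<equiv> factor_counit G\<^sub>1 G\<^sub>2"
abbreviation "cmp \<equiv> component K G\<^sub>1 G\<^sub>2"
abbreviation "psi \<equiv> psi_at K G\<^sub>1 G\<^sub>2"
abbreviation "del \<equiv> delta_at K G\<^sub>1 G\<^sub>2"
abbreviation "theta \<equiv> theta_at K G\<^sub>1 G\<^sub>2 H \<alpha>\<^sub>1 \<alpha>\<^sub>2"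

definition letter :: "side \<Rightarrow> ('a + 'b \<Rightarrow> 'k) \<Rightarrow> 'a \<times> 'b \<Rightarrow> 'k" where
 "letter i \<phi> = (\<lambda>x. \<phi> (select i x))"

definition \<Omega> :: "('a \<times> 'b \<Rightarrow> 'k) set" where
 "\<Omega> = {letter i \<phi> | i \<phi>. fnl (F i) \<phi>}"

lemma alg1: "alg G\<^sub>1" and alg2: "alg G\<^sub>2" and algH: "alg H"
 using hopfD(1) G1 G2 HH by blast+

lemma algebra_F [simp]: "alg (F i)"
 using algebra_image_module[OF _ alg1, of Inl] algebra_image_module[OF _ alg2, of Inr] by (cases i) simp_all

lemma algs_F [simp]: "algs (map F is)"
 by simp

lemma algebra_AA: "alg A"
 by (rule algebra_prod_algebra[OF alg1 alg2])

lemma lin_select: "lin A (F i) (select i)"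
proof -
 have 1: "lin A G\<^sub>1 fst" and 2: "lin A G\<^sub>2 snd" by (auto simp: lin_def)
 have "select One = (\<lambda>x. Inl (fst x) :: 'a + 'b)" "select Two = (\<lambda>x. Inr (snd x) :: 'a + 'b)" by (simp_all add: fun_eq_iff)
 then show ?thesis
  using lin_comp[OF 1 lin_image_module[of Inl]] lin_comp[OF 2 lin_image_module[of Inr]] by (cases i) simp_all
qed

lemma fnl_letter: "fnl (F i) \<phi> \<Longrightarrow> fnl A (letter i \<phi>)"
 unfolding letter_def by (rule lin_comp[OF lin_select])

lemma separating_AA: "separating A \<Omega>"
 unfolding separating_def
proof (intro conjI ballI impI)
 show "fnl A e" if e: "e \<in> \<Omega>" for e
 proof -
  obtain i \<phi> where "e = letter i \<phi>" "fnl (F i) \<phi>" using e unfolding \<Omega>_def by blast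
  then show ?thesis using fnl_letter by simp
 qed
 fix x assume x: "x \<in> carrier A" and z: "\<forall>e\<in>\<Omega>. e x = \<zero>"
 have "select i x = \<zero>\<^bsub>F i\<^esub>" for i
 proof (rule separatingD[OF separating_functionals[OF algebra_F] linD(1)[OF lin_select x]])
  fix e assume "e \<in> {e. fnl (F i) e}"
  then have "letter i e \<in> \<Omega>" by (auto simp: \<Omega>_def)
  then have "letter i e x = \<zero>" by (rule bspec[OF z])
  then show "e (select i x) = \<zero>" by (simp add: letter_def)
 qed
 from this[of One] this[of Two] have "fst x = \<zero>\<^bsub>G\<^sub>1\<^esub>" "snd x = \<zero>\<^bsub>G\<^sub>2\<^esub>"
  by (simp_all add: image_module_simps(4))
 then show "x = \<zero>\<^bsub>A\<^esub>" by (cases x) simp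
qed

sublocale letters K A \<Omega>
 by (rule letters.intro[OF ground_field_axioms letters_axioms.intro[OF algebra_AA separating_AA]])

lemma letter_\<Omega>: "fnl (F i) \<phi> \<Longrightarrow> letter i \<phi> \<in> \<Omega>"
 by (auto simp: \<Omega>_def)

lemma \<Omega>_wordE:
 assumes "w \<in> LW"
 obtains "is" \<phi>s where "fnls (map F is) \<phi>s" "w = map2 letter is \<phi>s"
proof -
 have "\<exists>is \<phi>s. fnls (map F is) \<phi>s \<and> w = map2 letter is \<phi>s"
  using assms
 proof (induction w rule: list.induct)
  case Nil
  show ?case by (intro exI[of _ "[]"]) simp
 next
  case (Cons l w)
  then obtain "is" \<phi>s where i: "fnls (map F is) \<phi>s" "w = map2 letter is \<phi>s" by auto
  obtain i \<phi> where l: "l = letter i \<phi>" "fnl (F i) \<phi>" using Cons.prems by (auto simp: \<Omega>_def)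
  show ?case using i l by (intro exI[of _ "i # is"] exI[of _ "\<phi> # \<phi>s"]) simp
 qed
 then show thesis by (elim exE conjE) (rule that)
qed

lemma word_\<Omega>: "fnls (map F is) \<phi>s \<Longrightarrow> map2 letter is \<phi>s \<in> LW"
proof (induction "is" arbitrary: \<phi>s)
 case (Cons i "is")
 obtain \<phi> \<phi>s' where p: "\<phi>s = \<phi> # \<phi>s'" "fnl (F i) \<phi>" "fnls (map F is) \<phi>s'"
  using Cons.prems by (cases \<phi>s) simp_all
 show ?case unfolding p(1) zip_Cons_Cons list.map prod.case
  by (rule lists.Cons[OF letter_\<Omega>[OF p(2)] Cons.IH[OF p(3)]])
qed simp

lemma lins_select: "lins (replicate (length is) A) (map F is) (map select is)"
 by (induction "is") (simp_all add: lin_select)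

lemma component_eval:
 assumes f: "f \<in> carrier TT"
 shows "cmp is f \<in> TC (map F is)"
  and "fnls (map F is) \<phi>s \<Longrightarrow> tev \<phi>s (cmp is f) = fev (map2 letter is \<phi>s) f"
proof -
 have m: "map2 select is xs = app (map select is) xs" for xs :: "('a \<times> 'b) list"
  by (simp add: zip_map1 case_prod_unfold comp_def)
 have l: "map2 letter is \<phi>s = map2 (\<lambda>h \<phi> x. \<phi> (h x)) (map select is) \<phi>s" for \<phi>s :: "('a + 'b \<Rightarrow> 'k) list"
  by (simp add: zip_map1 case_prod_unfold comp_def letter_def)
 note t = tev_app[OF algs_replicate algs_F lins_select TT_at[OF f], where f="\<lambda>xs. pur (map F is) (map2 select is xs)"]
 show "cmp is f \<in> TC (map F is)"
  unfolding component_def Let_def by (rule t(1)) (simp only: m)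
 assume p: "fnls (map F is) \<phi>s"
 have len: "length \<phi>s = length is" using list_all2_lengthD[OF p] by simp
 show "tev \<phi>s (cmp is f) = fev (map2 letter is \<phi>s) f"
  unfolding component_def Let_def fev_def using t(2)[OF _ p] len by (simp add: m l)
qed

lemma lin_fc: "lin (F i) (tens [F i, F i]) fc"
proof (cases i)
 case One
 have "lin G\<^sub>1 (tens [F One, F One]) (\<lambda>x. fc (Inl x))"
  using image_comult(1)[OF G1, of Inl] by (simp add: Let_def)
 then show ?thesis unfolding One factor.simps by (intro lin_from_image_module) simp_all
next
 case Two
 have "lin G\<^sub>2 (tens [F Two, F Two]) (\<lambda>x. fc (Inr x))"
  using image_comult(1)[OF G2, of Inr] by (simp add: Let_def)
 then show ?thesis unfolding Two factor.simps by (intro lin_from_image_module) simp_all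
qed

lemma tev_fc1:
 "\<lbrakk>fnl (F One) \<phi>; fnl (F One) \<chi>; a \<in> carrier G\<^sub>1\<rbrakk> \<Longrightarrow>
   tev [\<phi>, \<chi>] (fc (Inl a)) = tev [\<lambda>x. \<phi> (Inl x), \<lambda>x. \<chi> (Inl x)] (comult G\<^sub>1 a)"
 using image_comult(2)[OF G1, of Inl] by (simp add: Let_def)

lemma tev_fc2:
 "\<lbrakk>fnl (F Two) \<phi>; fnl (F Two) \<chi>; a \<in> carrier G\<^sub>2\<rbrakk> \<Longrightarrow>
   tev [\<phi>, \<chi>] (fc (Inr a)) = tev [\<lambda>x. \<phi> (Inr x), \<lambda>x. \<chi> (Inr x)] (comult G\<^sub>2 a)"
 using image_comult(2)[OF G2, of Inr] by (simp add: Let_def)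

lemma fnl_fe: "fnl (F i) fe"
 using lin_from_image_module[of Inl G\<^sub>1 "Ks" fe] lin_from_image_module[of Inr G\<^sub>2 "Ks" fe]
  hopfD(3)[OF G1] hopfD(3)[OF G2] by (cases i) (simp_all add: factor_counit_def)

abbreviation "star \<phi> \<chi> \<equiv> \<lambda>x. tev [\<phi>, \<chi>] (fc x)"

lemma fnl_tev_fc: "fnl (F i) \<phi> \<Longrightarrow> fnl (F i) \<chi> \<Longrightarrow> fnl (F i) (star \<phi> \<chi>)"
 by (rule lin_comp[OF lin_fc fnl_tev]) simp_all

text \<open>Composing with a tuple of functionals turns \<open>\<psi>\<close>, \<open>\<delta>\<close> and \<open>\<theta>\<close> into operations on one letter of
  the tuple: a convolution product, the counit, and a pullback along \<open>\<alpha>\<close>. For \<open>\<delta>\<close> the letter is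
  expanded into the empty tensor product, so \<open>\<psi>\<close> and \<open>\<delta>\<close> are treated alike.\<close>

lemma psi_eval:
 assumes t: "t \<in> TC (map F (us @ i # ws))"
 shows "psi (us @ i # ws) (length us) t \<in> TC (map F (us @ [i, i] @ ws))"
  and "\<lbrakk>fnls (map F us) as; fnl (F i) \<phi>; fnl (F i) \<chi>; fnls (map F ws) cs\<rbrakk> \<Longrightarrow>
   tev (as @ \<phi> # \<chi> # cs) (psi (us @ i # ws) (length us) t) = tev (as @ (star \<phi> \<chi>) # cs) t"
proof -
 have FF: "algs [F i, F i]" by simp
 have l: "length us = length (map F us)" by simp
 note e = tev_expand_at[OF algs_F algebra_F algs_F[of ws] FF lin_fc l]
 have p: "psi (us @ i # ws) (length us) t = expand_at K (map F us @ [F i, F i] @ map F ws) fc (length us) t"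
  by (simp add: psi_at_def)
 have t': "t \<in> TC (map F us @ F i # map F ws)" using t by simp
 show "psi (us @ i # ws) (length us) t \<in> TC (map F (us @ [i, i] @ ws))"
  unfolding p using linD(1)[OF e(1) t'] by simp
 show "tev (as @ \<phi> # \<chi> # cs) (psi (us @ i # ws) (length us) t) = tev (as @ (star \<phi> \<chi>) # cs) t"
  if "fnls (map F us) as" "fnl (F i) \<phi>" "fnl (F i) \<chi>" "fnls (map F ws) cs"
  unfolding p using e(2)[OF that(1) _ that(4) t', of "[\<phi>, \<chi>]"] that(2,3) by simp
qed

lemma delta_eval:
 assumes t: "t \<in> TC (map F (us @ i # ws))"
 shows "del (us @ i # ws) (length us) t \<in> TC (map F (us @ ws))"
  and "fnls (map F us) as \<Longrightarrow> fnls (map F ws) cs \<Longrightarrow>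
   tev (as @ cs) (del (us @ i # ws) (length us) t) = tev (as @ fe # cs) t"
proof -
 let ?N = "[] :: ('k, 'a + 'b) module list"
 let ?W = "map F (us @ ws)" and ?V = "map F us @ F i # map F ws"
 have N: "algs ?N" and W: "algs ?W" and V: "algs ?V" by auto
 note TN = alg_tens[OF N] and TW = alg_tens[OF W]
 have pN: "pur ?N [] \<in> TC ?N" using pure_closed[OF N] by simp
 have D: "lin (F i) (tens ?N) (\<lambda>x. fe x \<odot>\<^bsub>tens ?N\<^esub> pur ?N [])"
  by (rule lin_smult_left[OF TN pN fnl_fe])
 have l: "length us = length (map F us)" by simp
 note e = tev_expand_at[OF algs_F algebra_F algs_F[of ws] N D l]
 have t': "t \<in> TC ?V" using t by simp
 have g: "multilin ?V (tens ?W) (\<lambda>xs. tlift (tens ?W)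
   (\<lambda>ys. pur ?W (take (length us) xs @ ys @ drop (Suc (length us)) xs)) (fe (xs ! length us) \<odot>\<^bsub>tens ?N\<^esub> pur ?N []))"
  using multilin_expand[OF algs_F algebra_F algs_F[of ws] N TW _ D l, of "pur ?W"] multilin_pure[OF W] by simp
 have p: "del (us @ i # ws) (length us) t = expand_at K (map F us @ ?N @ map F ws) (\<lambda>x. fe x \<odot>\<^bsub>tens ?N\<^esub> pur ?N []) (length us) t"
  unfolding delta_at_def expand_at_def Let_def
 proof (simp, rule tensor_lift_cong[OF V _ g[simplified] _ t'])
  show "alg (tens (map F us @ map F ws))" using TW by simp
  fix xs assume xs: "xs \<in> RD ?V"
  obtain u xv where xs1: "xs = u @ xv" "length u = length (map F us)" "u \<in> RD (map F us)" "xv \<in> RD (F i # map F ws)" using xs by (rule RD_appendE)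
  obtain x v where xv: "xv = x # v" "x \<in> carrier (F i)" "v \<in> RD (map F ws)" using xs1(4) by (rule RD_ConsE)
  have k: "take (length us) xs = u" "drop (Suc (length us)) xs = v" "xs ! length us = x"
   using xs1 xv nth_append_length[of u x v] by simp_all
  have c: "fe x \<in> \<K>" by (rule fnl_closed[OF fnl_fe xv(2)])
  have uv: "u @ v \<in> RD (map F us @ map F ws)" using xs1(3) xv(3) by simp
  have m: "multilin ?N (tens (map F us @ map F ws)) (\<lambda>ys. pur (map F us @ map F ws) (u @ ys @ v))"
   using pure_closed[OF _ uv] by (auto simp: ball_Un)
  show "fe (xs ! length us) \<odot>\<^bsub>tens (map F us @ map F ws)\<^esub> pur (map F us @ map F ws) (take (length us) xs @ drop (Suc (length us)) xs)
   = tlift (tens (map F us @ map F ws)) (\<lambda>ys. pur (map F us @ map F ws) (take (length us) xs @ ys @ drop (Suc (length us)) xs))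
     (fe (xs ! length us) \<odot>\<^bsub>tens ?N\<^esub> pur ?N [])"
   unfolding k using linD(3)[OF lin_tensor_lift[OF N _ m] c pN] tensor_lift_pure[OF N _ m, of "[]"] TW by simp
 qed
 show "del (us @ i # ws) (length us) t \<in> TC ?W"
  unfolding p using linD(1)[OF e(1) t'] by simp
 have fN: "fnls ?N []" by simp
 have fx: "tev [] (fe x \<odot>\<^bsub>tens ?N\<^esub> pur ?N []) = fe x" if "x \<in> carrier (F i)" for x
  using linD(3)[OF fnl_tev[OF N fN] fnl_closed[OF fnl_fe that] pN] tev_pure[OF N fN, of "[]"] fnl_closed[OF fnl_fe that] by simp
 assume as: "fnls (map F us) as" and cs: "fnls (map F ws) cs"
 have "tev (as @ cs) (del (us @ i # ws) (length us) t) = tev (as @ (\<lambda>x. tev [] (fe x \<odot>\<^bsub>tens ?N\<^esub> pur ?N [])) # cs) t"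
  unfolding p using e(2)[OF as fN cs t'] by simp
 also have "\<dots> = tev (as @ fe # cs) t"
  unfolding tev_def
 proof (rule tensor_lift_cong[OF V algebra_Ks _ _ t'])
  have ff: "fnls ?V (as @ fe # cs)" using as cs fnl_fe by (intro list_all2_appendI) simp_all
  show "multilin ?V (Ks) (pev (as @ fe # cs))" by (rule multilin_pev[OF ff])
  fix xs assume xs: "xs \<in> RD ?V"
  obtain u xv where xs1: "xs = u @ xv" "length u = length (map F us)" "u \<in> RD (map F us)" "xv \<in> RD (F i # map F ws)" using xs by (rule RD_appendE)
  obtain x v where xv: "xv = x # v" "x \<in> carrier (F i)" "v \<in> RD (map F ws)" using xs1(4) by (rule RD_ConsE)
  have 1: "fnls (F i # map F ws) (fe # cs)" using cs fnl_fe by simp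
  have 2: "fnls (F i # map F ws) ((\<lambda>x. tev [] (fe x \<odot>\<^bsub>tens ?N\<^esub> pur ?N [])) # cs)"
   using cs lin_comp[OF D fnl_tev[OF N fN]] by simp
  show "pev (as @ (\<lambda>x. tlift (Ks) (pev []) (fe x \<odot>\<^bsub>tens ?N\<^esub> pur ?N [])) # cs) xs = pev (as @ fe # cs) xs"
   using pev_append[OF as 1 xs1(3,4)] pev_append[OF as 2 xs1(3,4)] fx[OF xv(2)] xs1(1) xv(1) by (simp add: tev_def)
 qed
 finally show "tev (as @ cs) (del (us @ i # ws) (length us) t) = tev (as @ fe # cs) t" .
qed

definition \<alpha> :: "'a + 'b \<Rightarrow> 'h" where "\<alpha> = case_sum \<alpha>\<^sub>1 \<alpha>\<^sub>2"

lemma lin_\<alpha>: "lin (F i) H \<alpha>"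
 using lin_from_image_module[of Inl G\<^sub>1 H \<alpha>] lin_from_image_module[of Inr G\<^sub>2 H \<alpha>] hopf_homD(1)[OF \<alpha>1] hopf_homD(1)[OF \<alpha>2]
 by (cases i) (simp_all add: \<alpha>_def)

abbreviation theta_mods :: "side list \<Rightarrow> side list \<Rightarrow> ('k, ('a + 'b) + 'h) module list" where
 "theta_mods us ws \<equiv> map (\<lambda>i. img Inl (F i)) us @ img Inr H # map (\<lambda>i. img Inl (F i)) ws"

lemma algs_theta [simp]: "algs (theta_mods us ws)"
 using algebra_image_module[OF _ algebra_F, of Inl] algebra_image_module[OF _ algH, of Inr] by auto

lemma theta_eval:
 assumes t: "t \<in> TC (map F (us @ i # ws))"
 shows "theta (us @ i # ws) (length us) t \<in> TC (theta_mods us ws)"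
  and "fnls (theta_mods us ws) (as @ \<chi> # cs) \<Longrightarrow> length as = length us \<Longrightarrow>
   tev (as @ \<chi> # cs) (theta (us @ i # ws) (length us) t) =
   tev (map (\<lambda>\<phi> x. \<phi> (Inl x)) as @ (\<lambda>x. \<chi> (Inr (\<alpha> x))) # map (\<lambda>\<phi> x. \<phi> (Inl x)) cs) t"
proof -
 let ?hs = "replicate (length us) Inl @ (\<lambda>x. Inr (\<alpha> x)) # replicate (length ws) Inl"
 let ?V = "map F us @ F i # map F ws"
 have V: "algs ?V" by auto
 have t': "t \<in> TC ?V" using t by simp
 have "lins (map F us) (map (\<lambda>i. img Inl (F i)) us :: ('k, ('a + 'b) + 'h) module list) (replicate (length us) Inl)" for us
  by (induction us) (simp_all add: lin_image_module)
 then have hs: "lins ?V (theta_mods us ws) ?hs"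
  using lin_comp[OF lin_\<alpha> lin_image_module[of Inr]] by (simp add: lins_append)
 have th: "theta (us @ i # ws) (length us) t = tlift (tens (theta_mods us ws))
   (\<lambda>xs. pur (theta_mods us ws) ((map Inl xs)[length us := Inr (\<alpha> (xs ! length us))])) t"
  by (simp add: theta_at_def Let_def \<alpha>_def list_update_append comp_def)
 have eq: "pur (theta_mods us ws) ((map Inl xs)[length us := Inr (\<alpha> (xs ! length us))]) = pur (theta_mods us ws) (app ?hs xs)"
  if xs: "xs \<in> RD ?V" for xs
 proof -
  obtain u xv where xs1: "xs = u @ xv" "length u = length (map F us)" "u \<in> RD (map F us)" "xv \<in> RD (F i # map F ws)" using xs by (rule RD_appendE)
  obtain x v where xv: "xv = x # v" "x \<in> carrier (F i)" "v \<in> RD (map F ws)" using xs1(4) by (rule RD_ConsE)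
  have r: "(map Inl w :: (('a + 'b) + 'h) list) = app (replicate (length w) Inl) w" for w :: "('a + 'b) list" by (induction w) simp_all
  have "length v = length ws" using RD_length[OF xv(3)] by simp
  then show ?thesis using xs1(1,2) xv(1) r[of u] r[of v] nth_append_length[of u x v] by (simp add: list_update_append)
 qed
 show "theta (us @ i # ws) (length us) t \<in> TC (theta_mods us ws)"
  unfolding th by (rule tev_app(1)[OF V algs_theta hs t' eq])
 assume f: "fnls (theta_mods us ws) (as @ \<chi> # cs)" and l: "length as = length us"
 have l': "length cs = length ws" using list_all2_lengthD[OF f] l by simp
 have m: "map2 (\<lambda>h \<phi> x. \<phi> (h x)) (replicate (length \<phi>s) Inl) \<phi>s = map (\<lambda>\<phi> x. \<phi> (Inl x)) \<phi>s" for \<phi>s :: "(('a + 'b) + 'h \<Rightarrow> 'k) list"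
  by (induction \<phi>s) simp_all
 show "tev (as @ \<chi> # cs) (theta (us @ i # ws) (length us) t) =
   tev (map (\<lambda>\<phi> x. \<phi> (Inl x)) as @ (\<lambda>x. \<chi> (Inr (\<alpha> x))) # map (\<lambda>\<phi> x. \<phi> (Inl x)) cs) t"
  unfolding th by (rule trans[OF tev_app(2)[OF V algs_theta hs t' eq f]]) (use m[of as] m[of cs] l l' in simp_all)
qed

definition coh :: "(nat \<Rightarrow> ('k, 'a \<times> 'b) tensor) \<Rightarrow> bool" where
 "coh f \<longleftrightarrow> (\<forall>u\<in>LW. \<forall>w\<in>LW.
   (\<forall>i \<phi> \<chi>. fnl (F i) \<phi> \<longrightarrow> fnl (F i) \<chi> \<longrightarrow>
    fev (u @ letter i (star \<phi> \<chi>) # w) f = fev (u @ letter i \<phi> # letter i \<chi> # w) f) \<and>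
   (\<forall>i. fev (u @ letter i fe # w) f = fev (u @ w) f) \<and>
   (\<forall>\<chi>. fnl H \<chi> \<longrightarrow> fev (u @ letter One (\<lambda>x. \<chi> (\<alpha> x)) # w) f = fev (u @ letter Two (\<lambda>x. \<chi> (\<alpha> x)) # w) f))"

lemma cohD:
 assumes "coh f" "u \<in> LW" "w \<in> LW"
 shows "fnl (F i) \<phi> \<Longrightarrow> fnl (F i) \<chi> \<Longrightarrow> fev (u @ letter i (star \<phi> \<chi>) # w) f = fev (u @ letter i \<phi> # letter i \<chi> # w) f"
  and "fev (u @ letter i fe # w) f = fev (u @ w) f"
  and "fnl H \<psi> \<Longrightarrow> fev (u @ letter One (\<lambda>x. \<psi> (\<alpha> x)) # w) f = fev (u @ letter Two (\<lambda>x. \<psi> (\<alpha> x)) # w) f"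
 using assms unfolding coh_def by simp_all

lemma cohI:
 assumes "\<And>u w i \<phi> \<chi>. \<lbrakk>u \<in> LW; w \<in> LW; fnl (F i) \<phi>; fnl (F i) \<chi>\<rbrakk> \<Longrightarrow>
   fev (u @ letter i (star \<phi> \<chi>) # w) f = fev (u @ letter i \<phi> # letter i \<chi> # w) f"
  and "\<And>u w i. u \<in> LW \<Longrightarrow> w \<in> LW \<Longrightarrow> fev (u @ letter i fe # w) f = fev (u @ w) f"
  and "\<And>u w \<psi>. \<lbrakk>u \<in> LW; w \<in> LW; fnl H \<psi>\<rbrakk> \<Longrightarrow>
   fev (u @ letter One (\<lambda>x. \<psi> (\<alpha> x)) # w) f = fev (u @ letter Two (\<lambda>x. \<psi> (\<alpha> x)) # w) f"
 shows "coh f"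
 unfolding coh_def using assms by simp

theorem coherent_iff:
 assumes f: "f \<in> carrier TT"
 shows "coherent K G\<^sub>1 G\<^sub>2 H \<alpha>\<^sub>1 \<alpha>\<^sub>2 f \<longleftrightarrow> coh f"
proof
 note c = component_eval[OF f]
 assume C: "coherent K G\<^sub>1 G\<^sub>2 H \<alpha>\<^sub>1 \<alpha>\<^sub>2 f"
 have C1: "psi (us @ i # ws) (length us) (cmp (us @ i # ws) f) = cmp (us @ [i, i] @ ws) f"
  and C2: "del (us @ i # ws) (length us) (cmp (us @ i # ws) f) = cmp (us @ ws) f"
  and C3: "theta (us @ One # ws) (length us) (cmp (us @ One # ws) f) =
   theta (us @ Two # ws) (length us) (cmp (us @ Two # ws) f)" for us i ws
  using C[unfolded coherent_def, rule_format, of "length us" "us @ i # ws"] by (simp_all add: list_update_append)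
 show "coh f"
 proof (rule cohI)
  fix u w assume u: "u \<in> LW" and w: "w \<in> LW"
  obtain us as where us: "fnls (map F us) as" "u = map2 letter us as" using u by (rule \<Omega>_wordE)
  obtain ws cs where ws: "fnls (map F ws) cs" "w = map2 letter ws cs" using w by (rule \<Omega>_wordE)
  have lus: "length us = length as" using list_all2_lengthD[OF us(1)] by simp
  have cl: "cmp (us @ i # ws) f \<in> TC (map F (us @ i # ws))" for i by (rule c(1))
  have ff: "fnls (map F (us @ i # ws)) (as @ \<phi> # cs)" if "fnl (F i) \<phi>" for i \<phi>
   using us(1) ws(1) that by (simp add: list_all2_appendI)
  have ev: "tev (as @ \<phi> # cs) (cmp (us @ i # ws) f) = fev (u @ letter i \<phi> # w) f" if "fnl (F i) \<phi>" for i \<phi>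
   using c(2)[OF ff[OF that]] us(2) ws(2) lus by simp
  show "fev (u @ letter i (star \<phi> \<chi>) # w) f = fev (u @ letter i \<phi> # letter i \<chi> # w) f"
   if p: "fnl (F i) \<phi>" "fnl (F i) \<chi>" for i \<phi> \<chi>
  proof -
   have "fnls (map F (us @ [i, i] @ ws)) (as @ \<phi> # \<chi> # cs)" using us(1) ws(1) p by (simp add: list_all2_appendI)
   then have "tev (as @ \<phi> # \<chi> # cs) (cmp (us @ [i, i] @ ws) f) = fev (u @ letter i \<phi> # letter i \<chi> # w) f"
    using c(2)[of "us @ [i, i] @ ws" "as @ \<phi> # \<chi> # cs"] us(2) ws(2) lus by simp
   then show ?thesis
    using psi_eval(2)[OF cl us(1) p ws(1)] C1[of us i ws] ev[OF fnl_tev_fc[OF p]] by simp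
  qed
  show "fev (u @ letter i fe # w) f = fev (u @ w) f" for i
  proof -
   have "fnls (map F (us @ ws)) (as @ cs)" using us(1) ws(1) by (simp add: list_all2_appendI)
   then have "tev (as @ cs) (cmp (us @ ws) f) = fev (u @ w) f"
    using c(2)[of "us @ ws" "as @ cs"] us(2) ws(2) lus by simp
   then show ?thesis using delta_eval(2)[OF cl[of i] us(1) ws(1)] C2[of us i ws] ev[OF fnl_fe[of i]] by simp
  qed
  show "fev (u @ letter One (\<lambda>x. \<psi> (\<alpha> x)) # w) f = fev (u @ letter Two (\<lambda>x. \<psi> (\<alpha> x)) # w) f" if p: "fnl H \<psi>" for \<psi>
  proof -
   let ?e = "\<lambda>\<phi>. case_sum \<phi> (\<lambda>_::'h. \<zero>)" and ?\<psi> = "case_sum (\<lambda>_::'a + 'b. \<zero>) \<psi>"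
   have e: "fnl (img Inl (F i)) (?e \<phi>)" if "fnl (F i) \<phi>" for i \<phi>
    using lin_from_image_module[of Inl "F i" "Ks" "?e \<phi>"] that by simp
   have ee: "fnls (map (\<lambda>i. img Inl (F i)) us) (map ?e as)" if "fnls (map F us) as" for us :: "side list" and as
    using that e by (simp add: list_all2_conv_all_nth)
   have "fnl (img Inr H) ?\<psi>"
    using lin_from_image_module[of Inr H "Ks" ?\<psi>] p by simp
   then have f: "fnls (theta_mods us ws) (map ?e as @ ?\<psi> # map ?e cs)"
    using ee[OF us(1)] ee[OF ws(1)] by (intro list_all2_appendI) simp_all
   have m: "map ((\<lambda>\<phi> x. \<phi> (Inl x)) \<circ> ?e) as = as" for as :: "('a + 'b \<Rightarrow> 'k) list"
    by (induction as) simp_all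
   have "tev (map ?e as @ ?\<psi> # map ?e cs) (theta (us @ i # ws) (length us) (cmp (us @ i # ws) f))
     = fev (u @ letter i (\<lambda>x. \<psi> (\<alpha> x)) # w) f" for i
    using theta_eval(2)[OF cl f] lus ev[OF lin_comp[OF lin_\<alpha> p]] m by simp
   from this[of One] this[of Two] show ?thesis using C3[of us ws] by simp
  qed
 qed
next
 note c = component_eval[OF f]
 assume C: "coh f"
 show "coherent K G\<^sub>1 G\<^sub>2 H \<alpha>\<^sub>1 \<alpha>\<^sub>2 f" unfolding coherent_def
 proof (intro allI impI)
  fix "is" :: "side list" and l assume l: "l < length is"
  define us i ws where d: "us = take l is" "i = is ! l" "ws = drop (Suc l) is"
  have "is": "is = us @ i # ws" using id_take_nth_drop[OF l] unfolding d .
  have lu: "l = length us" using l unfolding d by simp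
  have ev: "tev (as @ \<phi> # cs) (cmp (us @ i # ws) f) = fev (map2 letter us as @ letter i \<phi> # map2 letter ws cs) f"
   if "fnls (map F us) as" "fnl (F i) \<phi>" "fnls (map F ws) cs" for i \<phi> as cs
  proof -
   have "fnls (map F (us @ i # ws)) (as @ \<phi> # cs)" using that by (simp add: list_all2_appendI)
   then show ?thesis using c(2)[of "us @ i # ws" "as @ \<phi> # cs"] list_all2_lengthD[OF that(1)] by simp
  qed
  have 1: "psi (us @ i # ws) (length us) (cmp (us @ i # ws) f) = cmp (us @ [i, i] @ ws) f"
  proof (rule tensor_eqI_fnls[OF algs_F psi_eval(1)[OF c(1)] c(1)])
   fix \<phi>s assume fs: "fnls (map F (us @ [i, i] @ ws)) \<phi>s"
   obtain as \<phi> \<chi> cs where p: "\<phi>s = as @ \<phi> # \<chi> # cs" "fnls (map F us) as" "fnl (F i) \<phi>" "fnl (F i) \<chi>" "fnls (map F ws) cs"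
    using fs by (auto simp: list_all2_append1 list_all2_Cons1)
   have "tev \<phi>s (cmp (us @ [i, i] @ ws) f) = fev (map2 letter us as @ letter i \<phi> # letter i \<chi> # map2 letter ws cs) f"
    using c(2)[OF fs] p(1) list_all2_lengthD[OF p(2)] by simp
   then show "tev \<phi>s (psi (us @ i # ws) (length us) (cmp (us @ i # ws) f)) = tev \<phi>s (cmp (us @ [i, i] @ ws) f)"
    using psi_eval(2)[OF c(1) p(2-5)] ev[OF p(2) fnl_tev_fc[OF p(3,4)] p(5)] cohD(1)[OF C word_\<Omega>[OF p(2)] word_\<Omega>[OF p(5)] p(3,4)] p(1) by simp
  qed
  have 2: "del (us @ i # ws) (length us) (cmp (us @ i # ws) f) = cmp (us @ ws) f"
  proof (rule tensor_eqI_fnls[OF algs_F delta_eval(1)[OF c(1)] c(1)])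
   fix \<phi>s assume fs: "fnls (map F (us @ ws)) \<phi>s"
   obtain as cs where p: "\<phi>s = as @ cs" "fnls (map F us) as" "fnls (map F ws) cs"
    using fs by (auto simp: list_all2_append1)
   have "tev \<phi>s (cmp (us @ ws) f) = fev (map2 letter us as @ map2 letter ws cs) f"
    using c(2)[OF fs] p(1) list_all2_lengthD[OF p(2)] by simp
   then show "tev \<phi>s (del (us @ i # ws) (length us) (cmp (us @ i # ws) f)) = tev \<phi>s (cmp (us @ ws) f)"
    using delta_eval(2)[OF c(1) p(2,3)] ev[OF p(2) fnl_fe p(3)] cohD(2)[OF C word_\<Omega>[OF p(2)] word_\<Omega>[OF p(3)]] p(1) by simp
  qed
  have 3: "theta (us @ One # ws) (length us) (cmp (us @ One # ws) f) =
   theta (us @ Two # ws) (length us) (cmp (us @ Two # ws) f)"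
  proof (rule tensor_eqI_fnls[OF algs_theta theta_eval(1)[OF c(1)] theta_eval(1)[OF c(1)]])
   fix \<phi>s assume fs: "fnls (theta_mods us ws) \<phi>s"
   obtain as \<chi> cs where p: "\<phi>s = as @ \<chi> # cs" "fnls (map (\<lambda>i. img Inl (F i)) us) as" "fnl (img Inr H) \<chi>" "fnls (map (\<lambda>i. img Inl (F i)) ws) cs"
    using fs by (auto simp: list_all2_append1 list_all2_Cons1)
   have la: "length as = length us" using list_all2_lengthD[OF p(2)] by simp
   have q: "fnls (map F us) (map (\<lambda>\<phi> x. \<phi> (Inl x)) as)" if "fnls (map (\<lambda>i. img Inl (F i)) us) as"
    for us :: "side list" and as :: "(('a + 'b) + 'h \<Rightarrow> 'k) list"
    unfolding list_all2_conv_all_nth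
   proof (intro conjI allI impI)
    show "length (map F us) = length (map (\<lambda>\<phi> x. \<phi> (Inl x)) as)" using list_all2_lengthD[OF that] by simp
    fix j assume j: "j < length (map F us)"
    have "fnl (img Inl (F (us ! j))) (as ! j)" using list_all2_nthD[OF that, of j] j by simp
    then show "fnl (map F us ! j) (map (\<lambda>\<phi> x. \<phi> (Inl x)) as ! j)"
     using lin_comp[OF lin_image_module[of Inl "F (us ! j)"]] j list_all2_lengthD[OF that] by simp
   qed
   have x: "fnl H (\<lambda>x. \<chi> (Inr x))" using lin_comp[OF lin_image_module[of Inr H] p(3)] by simp
   have e: "tev \<phi>s (theta (us @ i # ws) (length us) (cmp (us @ i # ws) f)) =
    fev (map2 letter us (map (\<lambda>\<phi> x. \<phi> (Inl x)) as) @ letter i (\<lambda>x. \<chi> (Inr (\<alpha> x))) # map2 letter ws (map (\<lambda>\<phi> x. \<phi> (Inl x)) cs)) f" for i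
    using theta_eval(2)[OF c(1) fs[unfolded p(1)] la] ev[OF q[OF p(2)] lin_comp[OF lin_\<alpha> x] q[OF p(4)]] p(1) by simp
   show "tev \<phi>s (theta (us @ One # ws) (length us) (cmp (us @ One # ws) f)) =
    tev \<phi>s (theta (us @ Two # ws) (length us) (cmp (us @ Two # ws) f))"
    unfolding e by (rule cohD(3)[OF C word_\<Omega>[OF q[OF p(2)]] word_\<Omega>[OF q[OF p(4)]] x])
  qed
  show "psi is l (cmp is f) = cmp (take l is @ [is ! l, is ! l] @ drop (Suc l) is) f \<and>
    del is l (cmp is f) = cmp (take l is @ drop (Suc l) is) f \<and>
    theta (is[l := One]) l (cmp (is[l := One]) f)
     = theta (is[l := Two]) l (cmp (is[l := Two]) f)"
   using 1 2 3 unfolding "is" lu by (simp add: list_update_append)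
 qed
qed

section \<open>Coherent matrices\<close>

text \<open>A representation of \<open>G\<^sub>1\<close> and a representation of \<open>G\<^sub>2\<close> on the same space with the same
  restriction to \<open>H\<close>.\<close>

definition cohmat :: "'i set \<Rightarrow> ('i \<Rightarrow> 'i \<Rightarrow> 'a \<times> 'b) \<Rightarrow> bool" where
 "cohmat I X \<longleftrightarrow> comat G\<^sub>1 I (\<lambda>a b. fst (X a b)) \<and> comat G\<^sub>2 I (\<lambda>a b. snd (X a b)) \<and>
   (\<forall>a\<in>I. \<forall>b\<in>I. \<alpha>\<^sub>1 (fst (X a b)) = \<alpha>\<^sub>2 (snd (X a b)))"

lemma cohmatD:
 assumes "cohmat I X"
 shows "comat G\<^sub>1 I (\<lambda>a b. fst (X a b))" and "comat G\<^sub>2 I (\<lambda>a b. snd (X a b))"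
  and "a \<in> I \<Longrightarrow> b \<in> I \<Longrightarrow> \<alpha>\<^sub>1 (fst (X a b)) = \<alpha>\<^sub>2 (snd (X a b))" and "finite I" and "mat_in A I X"
 using assms by (auto simp: cohmat_def comat_def mat_in_def mem_Times_iff)

lemma fev_single: "\<lbrakk>finite I; mat_in A I X; a \<in> I; b \<in> I; fnl A \<phi>\<rbrakk> \<Longrightarrow> fev [\<phi>] (Emat I X a b) = \<phi> (X a b)"
 using fnl_cofree_proj[OF Emat_closed, of I X a b \<phi>] cofree_proj_Emat[of I X a b] by simp

lemma fev_Emat_middle:
 assumes I: "finite I" and X: "mat_in A I X" and ab: "a \<in> I" "b \<in> I"
  and u: "u \<in> words" and w: "w \<in> words" and v: "v \<in> words" and v': "v' \<in> words"
  and eq: "\<And>c d. c \<in> I \<Longrightarrow> d \<in> I \<Longrightarrow> fev v (Emat I X c d) = fev v' (Emat I X c d)"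
 shows "fev (u @ v @ w) (Emat I X a b) = fev (u @ v' @ w) (Emat I X a b)"
proof -
 have cl: "fev w (Emat I X c d) \<in> \<K>" if "w \<in> words" "c \<in> I" "d \<in> I" for w c d
  by (rule fev_closed[OF that(1) Emat_closed[OF X that(2,3)]])
 have vw: "v @ w \<in> words" "v' @ w \<in> words" using v v' w by simp_all
 have "fev (v @ w) (Emat I X c b) = fev (v' @ w) (Emat I X c b)" if c: "c \<in> I" for c
  unfolding fev_Emat_append[OF I X v w c ab(2)] fev_Emat_append[OF I X v' w c ab(2)]
  by (rule ksum_cong[OF refl]) (use eq c cl[OF v'] cl[OF w] ab in simp_all)
 then show ?thesis
  unfolding fev_Emat_append[OF I X u vw(1) ab] fev_Emat_append[OF I X u vw(2) ab]
  by (intro ksum_cong[OF refl]) (use cl[OF u] cl[OF vw(2)] ab in simp_all)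
qed

text \<open>Each coherence relation replaces a subword by another on which \<open>Emat I X\<close> has the same
  values, and these may be replaced inside any word because concatenation becomes matrix
  multiplication.\<close>

lemma coh_Emat:
 assumes X: "cohmat I X" and ab: "a \<in> I" "b \<in> I"
 shows "coh (Emat I X a b)"
proof (rule cohI)
 note I = cohmatD(4)[OF X] and Xm = cohmatD(5)[OF X]
 note fs = fev_single[OF I Xm]
 have Xc: "fst (X c d) \<in> carrier G\<^sub>1" "snd (X c d) \<in> carrier G\<^sub>2" if "c \<in> I" "d \<in> I" for c d
  using mat_inD[OF Xm that] by (auto simp: mem_Times_iff)
 fix u w assume uw: "u \<in> LW" "w \<in> LW"
 note u = LW_words[OF uw(1)] and w = LW_words[OF uw(2)]
 show "fev (u @ letter i (star \<phi> \<chi>) # w) (Emat I X a b) = fev (u @ letter i \<phi> # letter i \<chi> # w) (Emat I X a b)"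
  if p: "fnl (F i) \<phi>" "fnl (F i) \<chi>" for i \<phi> \<chi>
 proof -
  note l = fnl_letter[OF p(1)] fnl_letter[OF p(2)] fnl_letter[OF fnl_tev_fc[OF p]]
  have "fev [letter i (star \<phi> \<chi>)] (Emat I X c d) = fev [letter i \<phi>, letter i \<chi>] (Emat I X c d)" if cd: "c \<in> I" "d \<in> I" for c d
  proof -
   have "fev [letter i \<phi>, letter i \<chi>] (Emat I X c d) = ksum (\<lambda>e. letter i \<phi> (X c e) \<otimes> fev [letter i \<chi>] (Emat I X e d)) I"
    by (rule fev_Emat_Cons[OF I Xm cd l(1)]) (use l(2) in simp)
   also have "\<dots> = ksum (\<lambda>e. letter i \<phi> (X c e) \<otimes> letter i \<chi> (X e d)) I"
    by (rule ksum_cong[OF refl]) (use fs[OF _ cd(2) l(2)] fnl_closed[OF l(1) mat_inD[OF Xm cd(1)]] fnl_closed[OF l(2) mat_inD[OF Xm _ cd(2)]] in simp_all)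
   also have "\<dots> = letter i (star \<phi> \<chi>) (X c d)"
   proof (cases i)
    case One
    have "fnl G\<^sub>1 (\<lambda>x. \<phi> (Inl x))" "fnl G\<^sub>1 (\<lambda>x. \<chi> (Inl x))"
     using lin_comp[OF lin_image_module[of Inl G\<^sub>1]] p One by simp_all
    then show ?thesis
     using tev_comat[OF G1 cohmatD(1)[OF X] _ _ cd] tev_fc1[OF _ _ Xc(1)[OF cd]] p One by (simp add: letter_def)
   next
    case Two
    have "fnl G\<^sub>2 (\<lambda>x. \<phi> (Inr x))" "fnl G\<^sub>2 (\<lambda>x. \<chi> (Inr x))"
     using lin_comp[OF lin_image_module[of Inr G\<^sub>2]] p Two by simp_all
    then show ?thesis
     using tev_comat[OF G2 cohmatD(2)[OF X] _ _ cd] tev_fc2[OF _ _ Xc(2)[OF cd]] p Two by (simp add: letter_def)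
   qed
   finally show ?thesis using fs[OF cd l(3)] by simp
  qed
  then show ?thesis
   using fev_Emat_middle[OF I Xm ab u w, of "[letter i (star \<phi> \<chi>)]" "[letter i \<phi>, letter i \<chi>]"] l by simp
 qed
 show "fev (u @ letter i fe # w) (Emat I X a b) = fev (u @ w) (Emat I X a b)" for i
 proof -
  note l = fnl_letter[OF fnl_fe]
  have "fev [letter i fe] (Emat I X c d) = fev [] (Emat I X c d)" if cd: "c \<in> I" "d \<in> I" for c d
   using fs[OF cd l[of i]] comatD(4)[OF cohmatD(1)[OF X] cd] comatD(4)[OF cohmatD(2)[OF X] cd]
   by (cases i) (simp_all add: letter_def factor_counit_def fev_Emat_Nil)
  then show ?thesis using fev_Emat_middle[OF I Xm ab u w, of "[letter i fe]" "[]"] l by simp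
 qed
 show "fev (u @ letter One (\<lambda>x. \<psi> (\<alpha> x)) # w) (Emat I X a b) = fev (u @ letter Two (\<lambda>x. \<psi> (\<alpha> x)) # w) (Emat I X a b)"
  if p: "fnl H \<psi>" for \<psi>
 proof -
  note l = fnl_letter[OF lin_comp[OF lin_\<alpha> p]]
  have "fev [letter One (\<lambda>x. \<psi> (\<alpha> x))] (Emat I X c d) = fev [letter Two (\<lambda>x. \<psi> (\<alpha> x))] (Emat I X c d)" if cd: "c \<in> I" "d \<in> I" for c d
   using fs[OF cd l[of One]] fs[OF cd l[of Two]] cohmatD(3)[OF X cd] by (simp add: letter_def \<alpha>_def)
  then show ?thesis
   using fev_Emat_middle[OF I Xm ab u w, of "[letter One (\<lambda>x. \<psi> (\<alpha> x))]" "[letter Two (\<lambda>x. \<psi> (\<alpha> x))]"] l[of One] l[of Two] by simp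
 qed
qed

lemma fev_lin:
 assumes "w \<in> LW"
 shows "f \<in> carrier TT \<Longrightarrow> g \<in> carrier TT \<Longrightarrow> fev w (f \<oplus>\<^bsub>TT\<^esub> g) = fev w f \<oplus> fev w g"
  and "f \<in> carrier TT \<Longrightarrow> c \<in> \<K> \<Longrightarrow> fev w (c \<odot>\<^bsub>TT\<^esub> f) = c \<otimes> fev w f"
  and "fev w \<zero>\<^bsub>TT\<^esub> = \<zero>"
 using linD(2,3)[OF fnl_fev[OF LW_words[OF assms(1)]]] lin_zero[OF fnl_fev[OF LW_words[OF assms(1)]] algebra_TT algebra_Ks]
 by simp_all

lemma subspace_coh: "subspace TT {f \<in> carrier TT. coh f}"
proof -
 note l = letter_\<Omega>[OF fnl_fe] letter_\<Omega>[OF lin_comp[OF lin_\<alpha>]]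
 have "coh \<zero>\<^bsub>TT\<^esub>" by (rule cohI) (simp_all add: fev_lin letter_\<Omega> fnl_tev_fc l)
 moreover have "coh (f \<oplus>\<^bsub>TT\<^esub> g)" if "f \<in> carrier TT" "coh f" "g \<in> carrier TT" "coh g" for f g
  by (rule cohI) (use cohD[OF that(2)] cohD[OF that(4)] in \<open>simp_all add: fev_lin letter_\<Omega> fnl_tev_fc l that(1,3)\<close>)
 moreover have "coh (c \<odot>\<^bsub>TT\<^esub> f)" if "c \<in> \<K>" "f \<in> carrier TT" "coh f" for c f
  by (rule cohI) (use cohD[OF that(3)] in \<open>simp_all add: fev_lin letter_\<Omega> fnl_tev_fc l that(1,2)\<close>)
 ultimately show ?thesis unfolding subspace_def by auto
qed

lemma coh_con:
 assumes f: "f \<in> carrier TT" "coh f" and v: "v \<in> LW"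
 shows "coh (lcon v f)" and "coh (rcon v f)"
proof -
 note c = fev_con[OF LW_words[OF v] f(1) LW_words]
 note l = letter_\<Omega>[OF fnl_fe] letter_\<Omega>[OF lin_comp[OF lin_\<alpha>]]
 show "coh (lcon v f)"
 proof (rule cohI)
  fix u w assume uw: "u \<in> LW" "w \<in> LW"
  have vu: "v @ u \<in> LW" using uw v by simp
  note d = cohD[OF f(2) vu uw(2)]
  show "fev (u @ letter i (star \<phi> \<chi>) # w) (lcon v f) = fev (u @ letter i \<phi> # letter i \<chi> # w) (lcon v f)"
   if "fnl (F i) \<phi>" "fnl (F i) \<chi>" for i \<phi> \<chi> using d(1)[OF that] uw that by (simp add: c letter_\<Omega> fnl_tev_fc)
  show "fev (u @ letter i fe # w) (lcon v f) = fev (u @ w) (lcon v f)" for i using d(2)[of i] uw by (simp add: c l)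
  show "fev (u @ letter One (\<lambda>x. \<psi> (\<alpha> x)) # w) (lcon v f) = fev (u @ letter Two (\<lambda>x. \<psi> (\<alpha> x)) # w) (lcon v f)"
   if "fnl H \<psi>" for \<psi> using d(3)[OF that] uw that by (simp add: c l)
 qed
 show "coh (rcon v f)"
 proof (rule cohI)
  fix u w assume uw: "u \<in> LW" "w \<in> LW"
  have vw: "w @ v \<in> LW" using uw v by simp
  note d = cohD[OF f(2) uw(1) vw]
  show "fev (u @ letter i (star \<phi> \<chi>) # w) (rcon v f) = fev (u @ letter i \<phi> # letter i \<chi> # w) (rcon v f)"
   if "fnl (F i) \<phi>" "fnl (F i) \<chi>" for i \<phi> \<chi> using d(1)[OF that] uw that by (simp add: c letter_\<Omega> fnl_tev_fc)
  show "fev (u @ letter i fe # w) (rcon v f) = fev (u @ w) (rcon v f)" for i using d(2)[of i] uw by (simp add: c l)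
  show "fev (u @ letter One (\<lambda>x. \<psi> (\<alpha> x)) # w) (rcon v f) = fev (u @ letter Two (\<lambda>x. \<psi> (\<alpha> x)) # w) (rcon v f)"
   if "fnl H \<psi>" for \<psi> using d(3)[OF that] uw that by (simp add: c l)
 qed
qed

text \<open>Coherence is stable under translation, so the matrix \<open>M\<close> from \<open>matrix_coefficients\<close> has
  coherent entries. Coherence on words of length at most two makes its degree one part \<open>X\<close> a
  compatible pair of representations, and \<open>M = Emat J X\<close> by uniqueness.\<close>

theorem coherent_span:
 assumes f: "f \<in> carrier (cofree K A)" and coh: "coh f" and Q: "subspace TT Q"
  and ent: "\<And>(I :: nat set) X a b. \<lbrakk>cohmat I X; a \<in> I; b \<in> I\<rbrakk> \<Longrightarrow> Emat I X a b \<in> Q"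
 shows "f \<in> Q"
proof -
 let ?N = "{f \<in> carrier TT. coh f}"
 obtain t where fT: "f \<in> carrier TT" and t: "t \<in> TC [TT, TT]"
  and ft: "\<And>u w. u \<in> LW \<Longrightarrow> w \<in> LW \<Longrightarrow> fev (u @ w) f = tev [fev u, fev w] t"
  using f unfolding cofree_carrier by auto
 obtain J :: "nat set" and M where J: "finite J" and MN: "\<And>i j. i \<in> J \<Longrightarrow> j \<in> J \<Longrightarrow> M i j \<in> ?N"
  and Mm: "\<And>u w i j. \<lbrakk>u \<in> LW; w \<in> LW; i \<in> J; j \<in> J\<rbrakk> \<Longrightarrow>
   fev (u @ w) (M i j) = ksum (\<lambda>l. fev u (M i l) \<otimes> fev w (M l j)) J"
  and M1: "\<And>i j. i \<in> J \<Longrightarrow> j \<in> J \<Longrightarrow> fev [] (M i j) = (if i = j then \<one> else \<zero>)"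
  and MQ: "\<And>Q. subspace TT Q \<Longrightarrow> (\<And>i j. i \<in> J \<Longrightarrow> j \<in> J \<Longrightarrow> M i j \<in> Q) \<Longrightarrow> f \<in> Q"
 proof (rule matrix_coefficients[OF algebra_TT separating_TT subspace_coh, where lc=lcon and rc=rcon and f=f and t=t])
  show "lcon w f \<in> ?N" "rcon w f \<in> ?N" if "w \<in> LW" "f \<in> ?N" for w f
   using coh_con[of f w] con_closed[OF LW_words[OF that(1)], of f] that by simp_all
  show "fev u (lcon w f) = fev (w @ u) f" "fev u (rcon w f) = fev (u @ w) f" if "u \<in> LW" "w \<in> LW" "f \<in> ?N" for u w f
   using fev_con[OF LW_words[OF that(2)] _ LW_words[OF that(1)], of f] that(3) by simp_all
  show "f \<in> ?N" using fT coh by simp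
  show "t \<in> TC [TT, TT]" by (rule t)
  show "fev (u @ w) f = tev [fev u, fev w] t" if "u \<in> LW" "w \<in> LW" for u w by (rule ft[OF that])
 qed blast
 have MT: "M i j \<in> carrier TT" and Mc: "coh (M i j)" if "i \<in> J" "j \<in> J" for i j using MN[OF that] by simp_all
 define X where "X i j = cofree_proj K A (M i j)" for i j
 have Xm: "mat_in A J X" unfolding mat_in_def X_def using linD(1)[OF lin_cofree_proj MT] by simp
 have Xc: "fst (X c d) \<in> carrier G\<^sub>1" "snd (X c d) \<in> carrier G\<^sub>2" if "c \<in> J" "d \<in> J" for c d
  using mat_inD[OF Xm that] by (auto simp: mem_Times_iff)
 have l: "fev [letter i \<phi>] (M a b) = letter i \<phi> (X a b)" if "a \<in> J" "b \<in> J" "fnl (F i) \<phi>" for i \<phi> a b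
  using fnl_cofree_proj[OF MT[OF that(1,2)] fnl_letter[OF that(3)]] by (simp add: X_def)
 have nil: "[] \<in> LW" by simp
 have l2: "letter i (star \<phi> \<chi>) (X a b) = ksum (\<lambda>c. letter i \<phi> (X a c) \<otimes> letter i \<chi> (X c b)) J"
  if ab: "a \<in> J" "b \<in> J" and p: "fnl (F i) \<phi>" "fnl (F i) \<chi>" for i \<phi> \<chi> a b
 proof -
  have w: "[letter i \<phi>] \<in> LW" "[letter i \<chi>] \<in> LW" using letter_\<Omega> p by simp_all
  have "letter i (star \<phi> \<chi>) (X a b) = fev ([letter i \<phi>] @ [letter i \<chi>]) (M a b)"
   using cohD(1)[OF Mc[OF ab] nil nil p] l[OF ab fnl_tev_fc[OF p]] by simp
  also have "\<dots> = ksum (\<lambda>c. fev [letter i \<phi>] (M a c) \<otimes> fev [letter i \<chi>] (M c b)) J" by (rule Mm[OF w ab])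
  also have "\<dots> = ksum (\<lambda>c. letter i \<phi> (X a c) \<otimes> letter i \<chi> (X c b)) J"
   by (rule ksum_cong[OF refl]) (use l[OF ab(1) _ p(1)] l[OF _ ab(2) p(2)] fnl_closed[OF fnl_letter[OF p(1)] mat_inD[OF Xm ab(1)]] fnl_closed[OF fnl_letter[OF p(2)] mat_inD[OF Xm _ ab(2)]] in simp_all)
  finally show ?thesis .
 qed
 have e: "letter i fe (X a b) = (if a = b then \<one> else \<zero>)" if ab: "a \<in> J" "b \<in> J" for i a b
  using cohD(2)[OF Mc[OF ab] nil nil, of i] l[OF ab fnl_fe] M1[OF ab] by simp
 have "cohmat J X" unfolding cohmat_def
 proof (intro conjI ballI)
  show "comat G\<^sub>1 J (\<lambda>a b. fst (X a b))"
  proof (rule comatI[OF G1 J Xc(1)])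
   show "counit G\<^sub>1 (fst (X a b)) = (if a = b then \<one> else \<zero>)" if "a \<in> J" "b \<in> J" for a b
    using e[OF that, of One] by (simp add: letter_def factor_counit_def)
  next
   fix a b \<phi> \<chi> assume ab: "a \<in> J" "b \<in> J" and p: "fnl G\<^sub>1 \<phi>" "fnl G\<^sub>1 \<chi>"
   let ?e = "\<lambda>\<phi>. case_sum \<phi> (\<lambda>_::'b. \<zero>)"
   have p': "fnl (F One) (?e \<phi>)" "fnl (F One) (?e \<chi>)"
    using lin_from_image_module[of Inl G\<^sub>1 "Ks" "?e \<phi>"] lin_from_image_module[of Inl G\<^sub>1 "Ks" "?e \<chi>"] p by simp_all
   show "tev [\<phi>, \<chi>] (comult G\<^sub>1 (fst (X a b))) = ksum (\<lambda>c. \<phi> (fst (X a c)) \<otimes> \<chi> (fst (X c b))) J"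
    using l2[OF ab p'] tev_fc1[OF p' Xc(1)[OF ab]] by (simp add: letter_def)
  qed
  show "comat G\<^sub>2 J (\<lambda>a b. snd (X a b))"
  proof (rule comatI[OF G2 J Xc(2)])
   show "counit G\<^sub>2 (snd (X a b)) = (if a = b then \<one> else \<zero>)" if "a \<in> J" "b \<in> J" for a b
    using e[OF that, of Two] by (simp add: letter_def factor_counit_def)
  next
   fix a b \<phi> \<chi> assume ab: "a \<in> J" "b \<in> J" and p: "fnl G\<^sub>2 \<phi>" "fnl G\<^sub>2 \<chi>"
   let ?e = "\<lambda>\<phi>. case_sum (\<lambda>_::'a. \<zero>) \<phi>"
   have p': "fnl (F Two) (?e \<phi>)" "fnl (F Two) (?e \<chi>)"
    using lin_from_image_module[of Inr G\<^sub>2 "Ks" "?e \<phi>"] lin_from_image_module[of Inr G\<^sub>2 "Ks" "?e \<chi>"] p by simp_all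
   show "tev [\<phi>, \<chi>] (comult G\<^sub>2 (snd (X a b))) = ksum (\<lambda>c. \<phi> (snd (X a c)) \<otimes> \<chi> (snd (X c b))) J"
    using l2[OF ab p'] tev_fc2[OF p' Xc(2)[OF ab]] by (simp add: letter_def)
  qed
  fix a b assume ab: "a \<in> J" "b \<in> J"
  show "\<alpha>\<^sub>1 (fst (X a b)) = \<alpha>\<^sub>2 (snd (X a b))"
  proof (rule separating_eqI[OF separating_functionals[OF algH] algH])
   show "\<alpha>\<^sub>1 (fst (X a b)) \<in> carrier H" "\<alpha>\<^sub>2 (snd (X a b)) \<in> carrier H"
    using linD(1)[OF hopf_homD(1)[OF \<alpha>1] Xc(1)[OF ab]] linD(1)[OF hopf_homD(1)[OF \<alpha>2] Xc(2)[OF ab]] .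
   fix \<psi> assume "\<psi> \<in> {e. fnl H e}"
   then have p: "fnl H \<psi>" by simp
   show "\<psi> (\<alpha>\<^sub>1 (fst (X a b))) = \<psi> (\<alpha>\<^sub>2 (snd (X a b)))"
    using cohD(3)[OF Mc[OF ab] nil nil p] l[OF ab lin_comp[OF lin_\<alpha> p], of One] l[OF ab lin_comp[OF lin_\<alpha> p], of Two] by (simp add: letter_def \<alpha>_def)
  qed
 qed
 moreover have "M a b = Emat J X a b" if "a \<in> J" "b \<in> J" for a b
 proof (rule Emat_unique[OF J Xm _ M1 Mm _ that])
  show "mat_in TT J M" using MT by (simp add: mat_in_def)
 qed (simp_all add: X_def)
 ultimately show ?thesis using ent by (intro MQ[OF Q]) simp
qed

end

context ground_field
begin

section \<open>Hopf algebras spanned by comultiplicative matrices\<close>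

lemma algebra_restrict:
 assumes M: "alg M" and C: "subspace M (carrier N)" and one: "\<one>\<^bsub>M\<^esub> \<in> carrier N"
  and mult: "\<And>x y. x \<in> carrier N \<Longrightarrow> y \<in> carrier N \<Longrightarrow> x \<otimes>\<^bsub>M\<^esub> y \<in> carrier N"
  and N: "mult N = mult M" "\<one>\<^bsub>N\<^esub> = \<one>\<^bsub>M\<^esub>" "add N = add M" "\<zero>\<^bsub>N\<^esub> = \<zero>\<^bsub>M\<^esub>" "smult N = smult M"
 shows "alg N" and "lin N M (\<lambda>x. x)"
proof -
 interpret M: algebra K M by fact
 have cl: "x \<in> carrier M" if "x \<in> carrier N" for x using C that unfolding subspace_def by blast
 have C': "\<zero>\<^bsub>M\<^esub> \<in> carrier N" "\<And>x y. x \<in> carrier N \<Longrightarrow> y \<in> carrier N \<Longrightarrow> x \<oplus>\<^bsub>M\<^esub> y \<in> carrier N"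
  "\<And>c x. c \<in> \<K> \<Longrightarrow> x \<in> carrier N \<Longrightarrow> c \<odot>\<^bsub>M\<^esub> x \<in> carrier N"
  using C unfolding subspace_def by blast+
 have "cring N"
 proof (intro cringI abelian_groupI comm_monoidI)
  fix x assume x: "x \<in> carrier N"
  have "(\<ominus> \<one>) \<odot>\<^bsub>M\<^esub> x \<oplus>\<^bsub>M\<^esub> x = \<zero>\<^bsub>M\<^esub>" using alg_minus(3)[OF M cl[OF x] cl[OF x]] cl[OF x] by (simp add: M.l_neg)
  then show "\<exists>y\<in>carrier N. y \<oplus>\<^bsub>N\<^esub> x = \<zero>\<^bsub>N\<^esub>" using C'(3)[OF _ x, of "\<ominus> \<one>"] unfolding N by (intro bexI) simp_all
 qed (use M in \<open>simp_all add: N C' mult one cl alg_add_ac alg_mult_ac alg_distrib\<close>)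
 then show "alg N" by (rule algebraI[OF is_cring]) (use M in \<open>simp_all add: N C' cl alg_distrib alg_smult\<close>)
 show "lin N M (\<lambda>x. x)" by (rule linI) (simp_all add: N cl)
qed

text \<open>The algebra and the Hopf algebra of coherent elements are different records with the same
  operations; their tensor squares are equal on the nose.\<close>

lemma tensor_pair_same:
 fixes U :: "('k, 'v, 'n) module_scheme" and P :: "('k, 'v, 'p) module_scheme"
 assumes eq: "carrier P = carrier U" "mult P = mult U" "\<one>\<^bsub>P\<^esub> = \<one>\<^bsub>U\<^esub>" "add P = add U" "\<zero>\<^bsub>P\<^esub> = \<zero>\<^bsub>U\<^esub>" "smult P = smult U"
 shows "tens [P, P] = tens [U, U]" and "pur [P, P] = pur [U, U]"
proof -
 have r: "RDirProd_list [P, P] = RDirProd_list [U, U]"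
  by (simp add: RDirProd_list_def RDirProd_def DirProd_def image_ring_def image_group_def eq monoid.defs ring.defs)
 then have f: "free [P, P] = free [U, U]" by (simp add: free_tensor_def)
 have n: "[P, P] ! l = P" "[U, U] ! l = U" if "l < Suc (Suc 0)" for l using that by (auto simp: less_Suc_eq)
 have "multilinear_relators K [P, P] = multilinear_relators K [U, U]"
  unfolding multilinear_relators_def f r
  by (rule arg_cong2[where f="(\<union>)"]; rule Collect_cong; safe; (intro exI conjI)?; simp add: n eq)
   (simp_all add: n eq)
 then have N: "rels [P, P] = rels [U, U]" by (simp add: tensor_relations_def f)
 show "tens [P, P] = tens [U, U]" unfolding tensor_def f N ..
 show "pur [P, P] = pur [U, U]" unfolding pure_def f N fun_eq_iff by simp
qed

definition spans :: "('k, 'v, 'n) module_scheme \<Rightarrow> 'v set \<Rightarrow> bool" where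
 "spans B E \<longleftrightarrow> E \<subseteq> carrier B \<and> (\<forall>Q. subspace B Q \<longrightarrow> E \<subseteq> Q \<longrightarrow> carrier B \<subseteq> Q)"

lemma spansD: "\<lbrakk>spans B E; subspace B Q; (\<And>x. x \<in> E \<Longrightarrow> x \<in> Q); x \<in> carrier B\<rbrakk> \<Longrightarrow> x \<in> Q"
 and spans_closed: "spans B E \<Longrightarrow> x \<in> E \<Longrightarrow> x \<in> carrier B"
 unfolding spans_def by blast+

lemma spans_ext:
 assumes E: "spans B E" and B: "alg B" and W: "alg W" and f: "lin B W f" and g: "lin B W g"
  and eq: "\<And>x. x \<in> E \<Longrightarrow> f x = g x" and x: "x \<in> carrier B"
 shows "f x = g x"
proof -
 have "subspace B {x \<in> carrier B. f x = g x}"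
  using linD[OF f] linD[OF g] lin_zero[OF f B W] lin_zero[OF g B W] B unfolding subspace_def by auto
 then have "x \<in> {x \<in> carrier B. f x = g x}" by (rule spansD[OF E]) (use eq spans_closed[OF E] x in auto)
 then show ?thesis by simp
qed

lemma spans_mult:
 assumes E: "spans B E" and B: "alg B" and W: "alg W" and h: "lin B W h"
  and eq: "\<And>x y. x \<in> E \<Longrightarrow> y \<in> E \<Longrightarrow> h (x \<otimes>\<^bsub>B\<^esub> y) = h x \<otimes>\<^bsub>W\<^esub> h y" and x: "x \<in> carrier B" and y: "y \<in> carrier B"
 shows "h (x \<otimes>\<^bsub>B\<^esub> y) = h x \<otimes>\<^bsub>W\<^esub> h y"
proof (rule spans_ext[OF E B W _ _ _ x, where f="\<lambda>x. h (x \<otimes>\<^bsub>B\<^esub> y)" and g="\<lambda>x. h x \<otimes>\<^bsub>W\<^esub> h y"])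
 note hc = linD(1)[OF h]
 show "lin B W (\<lambda>x. h (x \<otimes>\<^bsub>B\<^esub> y))" by (rule lin_comp[OF lin_mult_left[OF B y lin_id] h])
 show "lin B W (\<lambda>x. h x \<otimes>\<^bsub>W\<^esub> h y)" by (rule lin_mult_left[OF W hc[OF y] h])
 fix x assume xE: "x \<in> E"
 note x = spans_closed[OF E xE]
 show "h (x \<otimes>\<^bsub>B\<^esub> y) = h x \<otimes>\<^bsub>W\<^esub> h y"
  by (rule spans_ext[OF E B W lin_comp[OF lin_mult_right[OF B x lin_id] h] lin_mult_right[OF W hc[OF x] h] eq[OF xE] y])
qed

definition entries :: "(('i \<Rightarrow> 'i \<Rightarrow> 'v) \<Rightarrow> 'i set \<Rightarrow> bool) \<Rightarrow> 'v set" where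
 "entries R = {Z a b | Z I a b. R Z I \<and> a \<in> I \<and> b \<in> I}"

lemma entriesI: "\<lbrakk>R Z I; a \<in> I; b \<in> I\<rbrakk> \<Longrightarrow> Z a b \<in> entries R"
 unfolding entries_def by blast

lemma entriesE:
 assumes "x \<in> entries R" obtains Z I a b where "x = Z a b" "R Z I" "a \<in> I" "b \<in> I"
 using assms unfolding entries_def by blast

lemma spans_comat:
 assumes h: "hopf B"
 shows "spans B (entries (\<lambda>Z (I :: nat set). comat B I Z))"
 unfolding spans_def
proof (intro conjI allI impI subsetI)
 show "x \<in> carrier B" if "x \<in> entries (\<lambda>Z I. comat B I Z)" for x using that by (rule entriesE) (simp add: comatD(2))
 fix Q x assume Q: "subspace B Q" "entries (\<lambda>Z (I :: nat set). comat B I Z) \<subseteq> Q" and x: "x \<in> carrier B"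
 show "x \<in> Q" by (rule comat_span[OF h x Q(1)], rule subsetD[OF Q(2)], rule entriesI)
qed

lemma tev_map_pair:
 assumes B: "alg B" and W: "alg W" and u: "lin B W u"
 shows "multilin [B, B] (tens [W, W]) (\<lambda>xs. pur [W, W] (map u xs))"
 using lin_comp[OF u pure_pair_lin(1)[OF W W]] lin_comp[OF u pure_pair_lin(2)[OF W W]] pure_closed[of "[W, W]"] W linD(1)[OF u]
 by (auto elim!: RD_ConsE)

text \<open>It suffices to test on matrix entries. Compatibility with the antipode follows, because
  inverse matrices are unique.\<close>

lemma hopf_homI:
 assumes h: "hopf B" and h': "hopf B'" and E: "spans B (entries R)" and u: "lin B B' u"
  and mult: "\<And>x y. x \<in> entries R \<Longrightarrow> y \<in> entries R \<Longrightarrow> u (x \<otimes>\<^bsub>B\<^esub> y) = u x \<otimes>\<^bsub>B'\<^esub> u y" and one: "u \<one>\<^bsub>B\<^esub> = \<one>\<^bsub>B'\<^esub>"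
  and R: "\<And>Z I. R Z I \<Longrightarrow> comat B I Z \<and> comat B' I (\<lambda>a b. u (Z a b))"
 shows "u \<in> homs B B'"
proof -
 note B = hopfD(1)[OF h] and B' = hopfD(1)[OF h'] and S = hopfD(4)[OF h] and S' = hopfD(4)[OF h']
 note D = hopfD(2)[OF h] and D' = hopfD(2)[OF h'] and g = tev_map_pair[OF B B' u]
 have BB: "algs [B, B]" and BB': "algs [B', B']" using B B' by simp_all
 note T' = alg_tens[OF BB']
 have um: "u (x \<otimes>\<^bsub>B\<^esub> y) = u x \<otimes>\<^bsub>B'\<^esub> u y" if "x \<in> carrier B" "y \<in> carrier B" for x y
  by (rule spans_mult[OF E B B' u mult that])
 have "tlift (tens [B', B']) (\<lambda>xs. pur [B', B'] (map u xs)) (comult B x) = comult B' (u x)" if x: "x \<in> carrier B" for x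
 proof (rule spans_ext[OF E B T' lin_comp[OF D lin_tensor_lift[OF BB T' g]] lin_comp[OF u D'] _ x])
  fix x assume "x \<in> entries R"
  then obtain Z I a b where Z: "x = Z a b" "R Z I" "a \<in> I" "b \<in> I" by (rule entriesE)
  note c = R[OF Z(2), THEN conjunct1] and c' = R[OF Z(2), THEN conjunct2]
  show "tlift (tens [B', B']) (\<lambda>xs. pur [B', B'] (map u xs)) (comult B x) = comult B' (u x)"
   unfolding Z(1) comatD(3)[OF c Z(3,4)] comatD(3)[OF c' Z(3,4)]
   using pair_lift[OF B T' g comatD(1)[OF c], of "Z a" "\<lambda>c. Z c b"] comatD(2)[OF c] Z(3,4) by simp
 qed
 moreover have "counit B' (u x) = counit B x" if x: "x \<in> carrier B" for x
 proof (rule spans_ext[OF E B algebra_Ks lin_comp[OF u hopfD(3)[OF h']] hopfD(3)[OF h] _ x])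
  fix x assume "x \<in> entries R"
  then obtain Z I a b where Z: "x = Z a b" "R Z I" "a \<in> I" "b \<in> I" by (rule entriesE)
  then show "counit B' (u x) = counit B x" using R[OF Z(2)] comatD(4)[of B I Z a b] comatD(4)[of B' I "\<lambda>a b. u (Z a b)" a b] by simp
 qed
 moreover have "antipode B' (u x) = u (antipode B x)" if x: "x \<in> carrier B" for x
 proof (rule spans_ext[OF E B B' lin_comp[OF u S'] lin_comp[OF S u] _ x])
  fix x assume "x \<in> entries R"
  then obtain Z I a b where Z: "x = Z a b" "R Z I" "a \<in> I" "b \<in> I" by (rule entriesE)
  note c = R[OF Z(2), THEN conjunct1] and c' = R[OF Z(2), THEN conjunct2]
  note I = comatD(1)[OF c] and Zc = comatD(2)[OF c]
  have mZ: "mat_in B I Z" "mat_in B I (\<lambda>a b. antipode B (Z a b))" "mat_in B' I (\<lambda>a b. u (Z a b))"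
   "mat_in B' I (\<lambda>a b. u (antipode B (Z a b)))" "mat_in B' I (\<lambda>a b. antipode B' (u (Z a b)))"
   using Zc linD(1)[OF S] linD(1)[OF S'] linD(1)[OF u] unfolding mat_in_def by simp_all
  \<comment> \<open>Both sides are inverse to the matrix with entries \<open>u (Z a b)\<close>.\<close>
  have "antipode B' (u (Z a b)) = u (antipode B (Z a b))"
  proof (rule left_inverse_eq_right_inverse[OF B' I mZ(5,3,4) comat_antipode_inverse(1)[OF h' c'] _ Z(3,4)])
   fix a b assume ab: "a \<in> I" "b \<in> I"
   have "mm B' I (\<lambda>a b. u (Z a b)) (\<lambda>a b. u (antipode B (Z a b))) a b = u (mm B I Z (\<lambda>a b. antipode B (Z a b)) a b)"
    by (rule mm_hom[OF B B' u um I mZ(1,2) ab, symmetric])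
   then show "mm B' I (\<lambda>a b. u (Z a b)) (\<lambda>a b. u (antipode B (Z a b))) a b = delta B' a b"
    unfolding comat_antipode_inverse(2)[OF h c ab] using one lin_zero[OF u B B'] by (simp add: delta_def)
  qed
  then show "antipode B' (u x) = u (antipode B x)" unfolding Z(1) .
 qed
 ultimately show ?thesis using linD[OF u] um one by (simp add: hopf_hom_def alg_hom_def ring_hom_def)
qed

lemma subspace_domain:
 assumes M: "alg M" and Q: "subspace N Q" and "R \<zero>\<^bsub>M\<^esub> \<zero>\<^bsub>N\<^esub>"
  and "\<And>x y f g. \<lbrakk>x \<in> carrier M; f \<in> Q; R x f; y \<in> carrier M; g \<in> Q; R y g\<rbrakk> \<Longrightarrow> R (x \<oplus>\<^bsub>M\<^esub> y) (f \<oplus>\<^bsub>N\<^esub> g)"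
  and "\<And>c x f. \<lbrakk>c \<in> \<K>; x \<in> carrier M; f \<in> Q; R x f\<rbrakk> \<Longrightarrow> R (c \<odot>\<^bsub>M\<^esub> x) (c \<odot>\<^bsub>N\<^esub> f)"
 shows "subspace M {x \<in> carrier M. \<exists>f\<in>Q. R x f}"
 unfolding subspace_def
proof (intro conjI ballI)
 note Q' = Q[unfolded subspace_def]
 show "\<zero>\<^bsub>M\<^esub> \<in> {x \<in> carrier M. \<exists>f\<in>Q. R x f}" using assms(3) Q' M by auto
 fix x assume "x \<in> {x \<in> carrier M. \<exists>f\<in>Q. R x f}"
 then obtain f where x: "x \<in> carrier M" "f \<in> Q" "R x f" by blast
 show "c \<odot>\<^bsub>M\<^esub> x \<in> {x \<in> carrier M. \<exists>f\<in>Q. R x f}" if "c \<in> \<K>" for c using assms(5)[OF that x] x that Q' M by auto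
 fix y assume "y \<in> {x \<in> carrier M. \<exists>f\<in>Q. R x f}"
 then obtain g where y: "y \<in> carrier M" "g \<in> Q" "R y g" by blast
 show "x \<oplus>\<^bsub>M\<^esub> y \<in> {x \<in> carrier M. \<exists>f\<in>Q. R x f}" using assms(4)[OF x y] x y Q' M by auto
qed auto

lemma subspace_vimage:
 assumes h: "lin M N h" and M: "alg M" and N: "alg N" and Q: "subspace N Q"
 shows "subspace M {x \<in> carrier M. h x \<in> Q}"
 using Q linD[OF h] lin_zero[OF h M N] M unfolding subspace_def by auto

end

context amalgam
begin

section \<open>The bialgebra of coherent elements\<close>

abbreviation "U \<equiv> coherent_algebra K G\<^sub>1 G\<^sub>2 H \<alpha>\<^sub>1 \<alpha>\<^sub>2"
abbreviation "P \<equiv> coherent_hopf K G\<^sub>1 G\<^sub>2 H \<alpha>\<^sub>1 \<alpha>\<^sub>2"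

lemma U_simps: "mult U = mult TT" "\<one>\<^bsub>U\<^esub> = \<one>\<^bsub>TT\<^esub>" "add U = add TT" "\<zero>\<^bsub>U\<^esub> = \<zero>\<^bsub>TT\<^esub>" "smult U = smult TT"
 by (simp_all add: coherent_algebra_def Let_def cofree_def)

lemma P_simps: "carrier P = carrier U" "mult P = mult U" "\<one>\<^bsub>P\<^esub> = \<one>\<^bsub>U\<^esub>" "add P = add U" "\<zero>\<^bsub>P\<^esub> = \<zero>\<^bsub>U\<^esub>" "smult P = smult U"
 "comult P = cofree_comult K A U" "counit P = cofree_counit K" "antipode P = coherent_antipode K G\<^sub>1 G\<^sub>2"
 by (simp_all add: coherent_hopf_def module.defs)

definition rep :: "('k, nat \<Rightarrow> ('k, 'a \<times> 'b) tensor, 'x) module_scheme \<Rightarrow> (nat \<Rightarrow> ('k, 'a \<times> 'b) tensor) \<Rightarrow> ('k, nat \<Rightarrow> ('k, 'a \<times> 'b) tensor) tensor \<Rightarrow> bool" where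
 "rep V f t \<longleftrightarrow> t \<in> TC [V, V] \<and> (\<forall>u\<in>LW. \<forall>w\<in>LW. fev (u @ w) f = tev [fev u, fev w] t)"

lemma carrier_P: "f \<in> carrier P \<longleftrightarrow> f \<in> carrier TT \<and> coh f \<and> (\<exists>t. rep TT f t)"
 using cofree_carrier[of f] coherent_iff[of f] unfolding P_simps rep_def by (auto simp: coherent_algebra_def Let_def)

lemma P_TT: "f \<in> carrier P \<Longrightarrow> f \<in> carrier TT"
 by (simp add: carrier_P)

lemma rep_lin:
 assumes V: "alg V" and i: "lin V TT (\<lambda>x. x)" and f: "f \<in> carrier TT" "rep V f s" and g: "g \<in> carrier TT" "rep V g t"
 shows "rep V (f \<oplus>\<^bsub>TT\<^esub> g) (s \<oplus>\<^bsub>tens [V, V]\<^esub> t)" and "c \<in> \<K> \<Longrightarrow> rep V (c \<odot>\<^bsub>TT\<^esub> f) (c \<odot>\<^bsub>tens [V, V]\<^esub> s)"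
  and "rep V \<zero>\<^bsub>TT\<^esub> \<zero>\<^bsub>tens [V, V]\<^esub>"
proof -
 have VV: "algs [V, V]" using V by simp
 note T = alg_tens[OF VV]
 have l: "fnl (tens [V, V]) (tev [fev u, fev w])" if "u \<in> LW" "w \<in> LW" for u w
  using lin_comp[OF i fnl_fev[OF LW_words]] that by (intro fnl_tev[OF VV]) simp
 show "rep V (f \<oplus>\<^bsub>TT\<^esub> g) (s \<oplus>\<^bsub>tens [V, V]\<^esub> t)"
  using f g T linD(2)[OF l] unfolding rep_def by (simp add: fev_lin)
 show "rep V (c \<odot>\<^bsub>TT\<^esub> f) (c \<odot>\<^bsub>tens [V, V]\<^esub> s)" if "c \<in> \<K>"
  using f T linD(3)[OF l] that unfolding rep_def by (simp add: fev_lin)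
 show "rep V \<zero>\<^bsub>TT\<^esub> \<zero>\<^bsub>tens [V, V]\<^esub>"
  using T lin_zero[OF l T algebra_Ks] unfolding rep_def by (simp add: fev_lin)
qed

lemma subspace_rep:
 assumes V: "alg V" and i: "lin V TT (\<lambda>x. x)"
 shows "subspace TT {f \<in> carrier TT. \<exists>t. rep V f t}"
proof -
 have z: "rep V \<zero>\<^bsub>TT\<^esub> \<zero>\<^bsub>tens [V, V]\<^esub>"
  using rep_lin(3)[OF V i, of "\<zero>\<^bsub>TT\<^esub>" _ "\<zero>\<^bsub>TT\<^esub>"] lin_zero[OF fnl_fev[OF LW_words] algebra_TT algebra_Ks]
   V lin_zero[OF fnl_tev alg_tens algebra_Ks, of "[V, V]"] lin_comp[OF i fnl_fev[OF LW_words]]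
  unfolding rep_def by simp
 show ?thesis unfolding subspace_def
 proof (intro conjI ballI)
  show "\<zero>\<^bsub>TT\<^esub> \<in> {f \<in> carrier TT. \<exists>t. rep V f t}" using z by auto
  fix f assume "f \<in> {f \<in> carrier TT. \<exists>t. rep V f t}"
  then obtain s where f: "f \<in> carrier TT" "rep V f s" by blast
  show "c \<odot>\<^bsub>TT\<^esub> f \<in> {f \<in> carrier TT. \<exists>t. rep V f t}" if "c \<in> \<K>" for c
   using rep_lin(2)[OF V i f f that] f(1) that by auto
  fix g assume "g \<in> {f \<in> carrier TT. \<exists>t. rep V f t}"
  then obtain t where g: "g \<in> carrier TT" "rep V g t" by blast
  show "f \<oplus>\<^bsub>TT\<^esub> g \<in> {f \<in> carrier TT. \<exists>t. rep V f t}" using rep_lin(1)[OF V i f g] f(1) g(1) by auto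
 qed blast
qed

lemma rep_Emat:
 assumes V: "alg V" and i: "lin V TT (\<lambda>x. x)" and X: "cohmat I X" and ab: "a \<in> I" "b \<in> I"
  and E: "\<And>a b. a \<in> I \<Longrightarrow> b \<in> I \<Longrightarrow> Emat I X a b \<in> carrier V"
 shows "rep V (Emat I X a b) (finsum (tens [V, V]) (\<lambda>c. pur [V, V] [Emat I X a c, Emat I X c b]) I)"
 unfolding rep_def
proof (intro conjI ballI)
 note I = cohmatD(4)[OF X]
 show "finsum (tens [V, V]) (\<lambda>c. pur [V, V] [Emat I X a c, Emat I X c b]) I \<in> TC [V, V]"
  by (rule fsum_closed) (use V E ab in simp_all)
 fix u w assume "u \<in> LW" "w \<in> LW"
 note uw = this[THEN LW_words]
 show "fev (u @ w) (Emat I X a b) = tev [fev u, fev w] (finsum (tens [V, V]) (\<lambda>c. pur [V, V] [Emat I X a c, Emat I X c b]) I)"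
  unfolding fev_Emat_append[OF I cohmatD(5)[OF X] uw ab]
  by (rule tev_pair_sum[OF V V lin_comp[OF i fnl_fev[OF uw(1)]] lin_comp[OF i fnl_fev[OF uw(2)]] I, symmetric]) (use E ab in simp_all)
qed

lemma Emat_TT: "\<lbrakk>cohmat I X; a \<in> I; b \<in> I\<rbrakk> \<Longrightarrow> Emat I X a b \<in> carrier TT"
 by (rule Emat_closed[OF cohmatD(5)])

lemma Emat_P:
 assumes "cohmat I X" "a \<in> I" "b \<in> I"
 shows "Emat I X a b \<in> carrier P"
 using rep_Emat[OF algebra_TT lin_id assms Emat_TT[OF assms(1)]] coh_Emat[OF assms] Emat_TT[OF assms] by (auto simp: carrier_P)

lemma subspace_P: "subspace TT (carrier P)"
proof -
 have "carrier P = {f \<in> carrier TT. coh f} \<inter> {f \<in> carrier TT. \<exists>t. rep TT f t}" using carrier_P by blast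
 then show ?thesis using subspace_coh subspace_rep[OF algebra_TT lin_id] unfolding subspace_def by auto
qed

lemma P_span:
 assumes f: "f \<in> carrier P" and Q: "subspace TT Q"
  and ent: "\<And>(I :: nat set) X a b. \<lbrakk>cohmat I X; a \<in> I; b \<in> I\<rbrakk> \<Longrightarrow> Emat I X a b \<in> Q"
 shows "f \<in> Q"
proof (rule coherent_span[OF _ _ Q ent])
 show "f \<in> carrier (cofree K A)" "coh f" using f cofree_carrier[of f] unfolding carrier_P rep_def by auto
qed

abbreviation "kron X Y \<equiv> \<lambda>p q. X (fst p) (fst q) \<otimes>\<^bsub>A\<^esub> Y (snd p) (snd q)"

lemma cohmat_kron:
 assumes X: "cohmat I X" and Y: "cohmat J Y"
 shows "cohmat (I \<times> J) (kron X Y)"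
proof -
 have f: "fst (x \<otimes>\<^bsub>A\<^esub> y) = fst x \<otimes>\<^bsub>G\<^sub>1\<^esub> fst y" "snd (x \<otimes>\<^bsub>A\<^esub> y) = snd x \<otimes>\<^bsub>G\<^sub>2\<^esub> snd y" for x y
  by (cases x; cases y; simp)+
 note m = hopf_homD(2)[OF \<alpha>1] hopf_homD(2)[OF \<alpha>2]
 show ?thesis
  unfolding cohmat_def f using comat_mult[OF G1 cohmatD(1)[OF X] cohmatD(1)[OF Y]] comat_mult[OF G2 cohmatD(2)[OF X] cohmatD(2)[OF Y]]
   cohmatD(3)[OF X] cohmatD(3)[OF Y] comatD(2)[OF cohmatD(1)[OF X]] comatD(2)[OF cohmatD(2)[OF X]]
   comatD(2)[OF cohmatD(1)[OF Y]] comatD(2)[OF cohmatD(2)[OF Y]] by (auto simp: m)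
qed

lemma cohmat_one: "cohmat {i} (\<lambda>_ _. \<one>\<^bsub>A\<^esub>)"
 using comat_one[OF G1, of i] comat_one[OF G2, of i] hopf_homD(3)[OF \<alpha>1] hopf_homD(3)[OF \<alpha>2] by (simp add: cohmat_def)

lemma Emat_kron: "\<lbrakk>cohmat I X; cohmat J Y; a \<in> I; b \<in> I; a' \<in> J; b' \<in> J\<rbrakk> \<Longrightarrow>
   Emat I X a b \<otimes>\<^bsub>TT\<^esub> Emat J Y a' b' = Emat (I \<times> J) (kron X Y) (a, a') (b, b')"
 by (rule Emat_mult[OF cohmatD(4) cohmatD(4) cohmatD(5) cohmatD(5)])

lemma one_P: "\<one>\<^bsub>TT\<^esub> \<in> carrier P"
 using Emat_P[OF cohmat_one[of "0 :: nat"], of 0 0] unfolding Emat_one by simp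

text \<open>Coherence of a product cannot be read off from values on words, which are not multiplicative
  in \<open>f\<close>. On entries the product is an entry for the Kronecker product, and bilinearity does
  the rest.\<close>

lemma mult_P:
 assumes f: "f \<in> carrier P" and g: "g \<in> carrier P"
 shows "f \<otimes>\<^bsub>TT\<^esub> g \<in> carrier P"
proof -
 have s: "subspace TT {g \<in> carrier TT. f \<otimes>\<^bsub>TT\<^esub> g \<in> carrier P}" if "f \<in> carrier TT" for f
  by (rule subspace_vimage[OF lin_mult_right[OF algebra_TT that lin_id] algebra_TT algebra_TT subspace_P])
 have E: "g \<otimes>\<^bsub>TT\<^esub> Emat I X a b \<in> carrier P" if X: "cohmat I X" "a \<in> I" "b \<in> I" and g: "g \<in> carrier P" for I :: "nat set" and X a b g
 proof -
  have "g \<in> {g \<in> carrier TT. Emat I X a b \<otimes>\<^bsub>TT\<^esub> g \<in> carrier P}"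
  proof (rule P_span[OF g s[OF Emat_TT[OF X]]])
   show "Emat J Y c d \<in> {g \<in> carrier TT. Emat I X a b \<otimes>\<^bsub>TT\<^esub> g \<in> carrier P}" if Y: "cohmat J Y" "c \<in> J" "d \<in> J" for J :: "nat set" and Y c d
    using Emat_TT[OF Y] Emat_P[OF cohmat_kron[OF X(1) Y(1)], of "(a, c)" "(b, d)"] X Y by (simp add: Emat_kron[OF X(1) Y(1) X(2,3) Y(2,3)])
  qed
  then show ?thesis using alg_mult_ac(2)[OF algebra_TT P_TT[OF g] Emat_TT[OF X]] by simp
 qed
 have "g \<in> {g \<in> carrier TT. f \<otimes>\<^bsub>TT\<^esub> g \<in> carrier P}"
  by (rule P_span[OF g s[OF P_TT[OF f]]]) (use E f Emat_TT in simp)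
 then show ?thesis by simp
qed

lemma algebra_U: "alg U" and incl_U: "lin U TT (\<lambda>x. x)" and algebra_P: "alg P" and incl_P: "lin P TT (\<lambda>x. x)"
 using algebra_restrict[OF algebra_TT subspace_P[unfolded P_simps] one_P[unfolded P_simps] mult_P[unfolded P_simps] U_simps]
  algebra_restrict[OF algebra_TT subspace_P one_P mult_P] by (simp_all add: P_simps U_simps)

abbreviation "PE \<equiv> \<lambda>Z (I :: nat set). \<exists>X. cohmat I X \<and> Z = Emat I X"

lemma spans_P: "spans P (entries PE)"
 unfolding spans_def
proof (intro conjI allI impI subsetI)
 show "x \<in> carrier P" if "x \<in> entries PE" for x
  using that by (elim entriesE exE conjE) (simp add: Emat_P)
 fix Q f assume Q: "subspace P Q" "entries PE \<subseteq> Q" and f: "f \<in> carrier P"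
 show "f \<in> Q"
 proof (rule P_span[OF f])
  show "subspace TT Q" using Q(1) P_TT unfolding subspace_def P_simps(2-) U_simps by blast
  show "Emat I X a b \<in> Q" if "cohmat I X" "a \<in> I" "b \<in> I" for I :: "nat set" and X a b
   by (rule subsetD[OF Q(2)], rule entriesI[OF _ that(2,3)], intro exI conjI, rule that(1), rule refl)
 qed
qed

lemma P_entryE:
 assumes "x \<in> entries PE"
 obtains I :: "nat set" and X a b where "x = Emat I X a b" "cohmat I X" "a \<in> I" "b \<in> I"
proof -
 obtain Z and I :: "nat set" and a b where Z: "x = Z a b" "\<exists>X. cohmat I X \<and> Z = Emat I X" "a \<in> I" "b \<in> I" using assms by (rule entriesE)
 obtain X where "cohmat I X" "Z = Emat I X" using Z(2) by (elim exE conjE)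
 then show thesis using that[of I X a b] Z by simp
qed

lemma comult_P_eq:
 assumes f: "f \<in> carrier TT" and t: "rep P f t"
 shows "comult P f = t"
 using t unfolding P_simps rep_def tensor_pair_same(1)[OF P_simps(1-6)] by (intro cofree_comult_eq[OF algebra_U incl_U _ f]) simp_all

lemma rep_comult: assumes f: "f \<in> carrier P" shows "rep P f (comult P f)"
proof -
 have "f \<in> {f \<in> carrier TT. \<exists>t. rep P f t}"
 proof (rule P_span[OF f subspace_rep[OF algebra_P incl_P]])
  show "Emat I X a b \<in> {f \<in> carrier TT. \<exists>t. rep P f t}" if X: "cohmat I X" "a \<in> I" "b \<in> I" for I :: "nat set" and X a b
   using rep_Emat[OF algebra_P incl_P X Emat_P[OF X(1)]] Emat_TT[OF X] by auto
 qed
 then obtain t where "rep P f t" by auto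
 then show ?thesis using comult_P_eq[OF P_TT[OF f]] by simp
qed

lemma comult_Emat:
 "\<lbrakk>cohmat I X; a \<in> I; b \<in> I\<rbrakk> \<Longrightarrow>
   comult P (Emat I X a b) = finsum (tens [P, P]) (\<lambda>c. pur [P, P] [Emat I X a c, Emat I X c b]) I"
 by (rule comult_P_eq[OF Emat_TT rep_Emat[OF algebra_P incl_P]]) (simp_all add: Emat_P)

lemma lin_comult: "lin P (tens [P, P]) (comult P)"
proof (rule linI)
 fix f assume f: "f \<in> carrier P"
 note rf = P_TT[OF f] rep_comult[OF f]
 show "comult P f \<in> TC [P, P]" using rf by (simp add: rep_def)
 show "comult P (c \<odot>\<^bsub>P\<^esub> f) = c \<odot>\<^bsub>tens [P, P]\<^esub> comult P f" if "c \<in> \<K>" for c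
  unfolding P_simps(6) U_simps by (rule comult_P_eq[OF _ rep_lin(2)[OF algebra_P incl_P rf rf that]]) (use rf that in simp)
 fix g assume g: "g \<in> carrier P"
 note rg = P_TT[OF g] rep_comult[OF g]
 show "comult P (f \<oplus>\<^bsub>P\<^esub> g) = comult P f \<oplus>\<^bsub>tens [P, P]\<^esub> comult P g"
  unfolding P_simps(4) U_simps by (rule comult_P_eq[OF _ rep_lin(1)[OF algebra_P incl_P rf rg]]) (use rf rg in simp)
qed

lemma tev_comult: "\<lbrakk>f \<in> carrier P; u \<in> LW; w \<in> LW\<rbrakk> \<Longrightarrow> tev [fev u, fev w] (comult P f) = fev (u @ w) f"
 using rep_comult unfolding rep_def by simp

lemma counit_P: "counit P = fev []"
 unfolding P_simps by (simp add: fun_eq_iff cofree_counit_eq)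

lemma fnl_P: "w \<in> LW \<Longrightarrow> fnl P (fev w)"
 by (rule lin_comp[OF incl_P fnl_fev[OF LW_words]])

lemma one_P_eq: "\<one>\<^bsub>P\<^esub> = Emat {0 :: nat} (\<lambda>_ _. \<one>\<^bsub>A\<^esub>) 0 0"
 unfolding P_simps U_simps Emat_one ..

lemma mult_Emat_P: "\<lbrakk>cohmat I X; cohmat J Y; a \<in> I; b \<in> I; a' \<in> J; b' \<in> J\<rbrakk> \<Longrightarrow>
   Emat I X a b \<otimes>\<^bsub>P\<^esub> Emat J Y a' b' = Emat (I \<times> J) (kron X Y) (a, a') (b, b')"
 unfolding P_simps U_simps by (rule Emat_kron)

lemma alg_hom_comult: "comult P \<in> alg_hom K P (tens [P, P])"
proof -
 have PP: "algs [P, P]" using algebra_P by simp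
 note T = alg_tens[OF PP]
 have E: "Emat {0 :: nat} (\<lambda>_ _. \<one>\<^bsub>A\<^esub>) 0 0 \<in> carrier P" by (rule Emat_P[OF cohmat_one]) simp_all
 have "comult P \<one>\<^bsub>P\<^esub> = finsum (tens [P, P]) (\<lambda>c. pur [P, P] [Emat {0 :: nat} (\<lambda>_ _. \<one>\<^bsub>A\<^esub>) 0 c, Emat {0 :: nat} (\<lambda>_ _. \<one>\<^bsub>A\<^esub>) c 0]) {0}"
  unfolding one_P_eq by (rule comult_Emat[OF cohmat_one]) simp_all
 also have "\<dots> = pur [P, P] [Emat {0 :: nat} (\<lambda>_ _. \<one>\<^bsub>A\<^esub>) 0 0, Emat {0 :: nat} (\<lambda>_ _. \<one>\<^bsub>A\<^esub>) 0 0]"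
  by (rule fsum_delta[OF T]) (use pure_closed[OF PP] E in simp_all)
 also have "\<dots> = \<one>\<^bsub>tens [P, P]\<^esub>"
  using pure_one[OF PP] unfolding one_P_eq[symmetric] by simp
 finally have 1: "comult P \<one>\<^bsub>P\<^esub> = \<one>\<^bsub>tens [P, P]\<^esub>" .
 have "comult P (x \<otimes>\<^bsub>P\<^esub> y) = comult P x \<otimes>\<^bsub>tens [P, P]\<^esub> comult P y" if xy: "x \<in> carrier P" "y \<in> carrier P" for x y
 proof (rule spans_mult[OF spans_P algebra_P T lin_comult _ xy], elim P_entryE)
  fix x y I X a b J Y c d
  assume x: "x = Emat I X a b" "cohmat I X" "a \<in> I" "b \<in> I" and y: "y = Emat J Y c d" "cohmat J Y" "c \<in> J" "d \<in> J"
  note m = mult_Emat_P[OF x(2) y(2)]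
  have "comult P (x \<otimes>\<^bsub>P\<^esub> y) = finsum (tens [P, P]) (\<lambda>r. pur [P, P] [Emat (I \<times> J) (kron X Y) (a, c) r, Emat (I \<times> J) (kron X Y) r (b, d)]) (I \<times> J)"
   unfolding x(1) y(1) m[OF x(3,4) y(3,4)] by (rule comult_Emat[OF cohmat_kron[OF x(2) y(2)]]) (use x y in simp_all)
  also have "\<dots> = finsum (tens [P, P]) (\<lambda>r. pur [P, P] [Emat I X a (fst r) \<otimes>\<^bsub>P\<^esub> Emat J Y c (snd r), Emat I X (fst r) b \<otimes>\<^bsub>P\<^esub> Emat J Y (snd r) d]) (I \<times> J)"
   by (rule fsum_cong[OF T refl]) (use m x y Emat_P[OF cohmat_kron[OF x(2) y(2)]] algebra_P pure_closed[OF PP] in auto)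
  also have "\<dots> = comult P x \<otimes>\<^bsub>tens [P, P]\<^esub> comult P y"
   unfolding x(1) y(1) comult_Emat[OF x(2-4)] comult_Emat[OF y(2-4)]
   by (rule pair_sum_mult[OF algebra_P cohmatD(4)[OF x(2)] cohmatD(4)[OF y(2)], symmetric]) (use Emat_P[OF x(2)] Emat_P[OF y(2)] x y in simp_all)
  finally show "comult P (x \<otimes>\<^bsub>P\<^esub> y) = comult P x \<otimes>\<^bsub>tens [P, P]\<^esub> comult P y" .
 qed
 then show ?thesis using linD[OF lin_comult] 1 by (simp add: alg_hom_def ring_hom_def)
qed

lemma alg_hom_counit: "counit P \<in> alg_hom K P (Ks)"
proof -
 have l: "fnl P (counit P)" unfolding counit_P by (rule fnl_P) simp
 have "counit P (x \<otimes>\<^bsub>P\<^esub> y) = counit P x \<otimes>\<^bsub>Ks\<^esub> counit P y" if xy: "x \<in> carrier P" "y \<in> carrier P" for x y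
 proof (rule spans_mult[OF spans_P algebra_P algebra_Ks l _ xy], elim P_entryE)
  fix x y I X a b J Y c d
  assume x: "x = Emat I X a b" "cohmat I X" "a \<in> I" "b \<in> I" and y: "y = Emat J Y c d" "cohmat J Y" "c \<in> J" "d \<in> J"
  show "counit P (x \<otimes>\<^bsub>P\<^esub> y) = counit P x \<otimes>\<^bsub>Ks\<^esub> counit P y"
   unfolding x(1) y(1) counit_P mult_Emat_P[OF x(2) y(2) x(3,4) y(3,4)] fev_Emat_Nil by simp
 qed
 moreover have "counit P \<one>\<^bsub>P\<^esub> = \<one>" unfolding counit_P one_P_eq by (simp add: fev_Emat_Nil)
 ultimately show ?thesis using linD[OF l] by (simp add: alg_hom_def ring_hom_def)
qed

text \<open>Both sides take the value \<open>fev (u @ v @ w) f\<close> on a triple of words.\<close>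

lemma coassoc_P:
 assumes f: "f \<in> carrier P"
 shows "expand_at K [P, P, P] (comult P) 0 (comult P f) = expand_at K [P, P, P] (comult P) 1 (comult P f)"
proof (rule tensor_eqI[of "[P, P, P]" "replicate 3 (fev ` LW)"])
 note B = algebra_P and D = lin_comult
 note t = linD(1)[OF D f]
 show "algs [P, P, P]" using B by simp
 show "list_all2 separating [P, P, P] (replicate 3 (fev ` LW))"
  using separating_sub[OF B incl_P] by (simp add: numeral_3_eq_3)
 show "expand_at K [P, P, P] (comult P) 0 (comult P f) \<in> TC [P, P, P]"
  using linD(1)[OF tev_expand_at(1)[of "[]" P "[P]" "[P, P]" "comult P" 0], of "comult P f"] B D t by simp
 show "expand_at K [P, P, P] (comult P) 1 (comult P f) \<in> TC [P, P, P]"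
  using linD(1)[OF tev_expand_at(1)[of "[P]" P "[]" "[P, P]" "comult P" 1], of "comult P f"] B D t by simp
 fix \<phi>s assume "list_all2 (\<in>) \<phi>s (replicate 3 (fev ` LW))"
 then obtain u v w where p: "\<phi>s = [fev u, fev v, fev w]" "u \<in> LW" "v \<in> LW" "w \<in> LW"
  by (auto simp: numeral_3_eq_3 list_all2_Cons2)
 have uv: "u @ v \<in> LW" "v @ w \<in> LW" using p by simp_all
 note l = fnl_P[OF p(2)] fnl_P[OF p(3)] fnl_P[OF p(4)]
 have "tev \<phi>s (expand_at K [P, P, P] (comult P) 0 (comult P f)) = tev [\<lambda>y. tev [fev u, fev v] (comult P y), fev w] (comult P f)"
  using tev_expand_at(2)[of "[]" P "[P]" "[P, P]" "comult P" 0 "[]" "[fev u, fev v]" "[fev w]" "comult P f"] B D l t p(1) by simp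
 also have "\<dots> = tev [fev (u @ v), fev w] (comult P f)"
  by (rule tev_pair_cong[OF B B fnl_P[OF uv(1)] l(3) tev_comult[OF _ p(2,3)] refl t])
 also have "\<dots> = tev [fev u, fev (v @ w)] (comult P f)"
  using tev_comult[OF f uv(1) p(4)] tev_comult[OF f p(2) uv(2)] by simp
 also have "\<dots> = tev [fev u, \<lambda>y. tev [fev v, fev w] (comult P y)] (comult P f)"
  by (rule tev_pair_cong[OF B B l(1) fnl_P[OF uv(2)] refl tev_comult[OF _ p(3,4)] t, symmetric])
 also have "\<dots> = tev \<phi>s (expand_at K [P, P, P] (comult P) 1 (comult P f))"
  using tev_expand_at(2)[of "[P]" P "[]" "[P, P]" "comult P" 1 "[fev u]" "[fev v, fev w]" "[]" "comult P f"] B D l t p(1) by simp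
 finally show "tev \<phi>s (expand_at K [P, P, P] (comult P) 0 (comult P f)) = tev \<phi>s (expand_at K [P, P, P] (comult P) 1 (comult P f))" .
qed

lemma counit_axioms_P:
 assumes f: "f \<in> carrier P"
 shows "tlift P (\<lambda>xs. counit P (xs ! 0) \<odot>\<^bsub>P\<^esub> xs ! 1) (comult P f) = f"
  and "tlift P (\<lambda>xs. counit P (xs ! 1) \<odot>\<^bsub>P\<^esub> xs ! 0) (comult P f) = f"
proof -
 have nil: "[] \<in> LW" by simp
 note p = fnl_pair_lift[OF algebra_P fnl_P[OF nil] fnl_P linD(1)[OF lin_comult f], folded counit_P]
 note e = tev_comult[OF f, folded counit_P]
 show "tlift P (\<lambda>xs. counit P (xs ! 0) \<odot>\<^bsub>P\<^esub> xs ! 1) (comult P f) = f"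
  by (rule TT_eqI[OF P_TT[OF p(1)[OF nil]] P_TT[OF f]]) (use p(2) e(1)[OF nil] in \<open>simp add: counit_P\<close>)
 show "tlift P (\<lambda>xs. counit P (xs ! 1) \<odot>\<^bsub>P\<^esub> xs ! 0) (comult P f) = f"
  by (rule TT_eqI[OF P_TT[OF p(3)[OF nil]] P_TT[OF f]]) (use p(4) e(1)[OF _ nil] in \<open>simp add: counit_P\<close>)
qed

section \<open>The antipode\<close>

abbreviation "fa \<equiv> factor_antipode G\<^sub>1 G\<^sub>2"

lemma lin_fa: "lin (F i) (F i) fa"
proof (cases i)
 case One
 have "lin G\<^sub>1 (img Inl G\<^sub>1) (\<lambda>x. fa (Inl x))"
  using lin_comp[OF hopfD(4)[OF G1] lin_image_module[of Inl G\<^sub>1]] by (simp add: factor_antipode_def)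
 then show ?thesis unfolding One factor.simps by (intro lin_from_image_module) simp_all
next
 case Two
 have "lin G\<^sub>2 (img Inr G\<^sub>2) (\<lambda>x. fa (Inr x))"
  using lin_comp[OF hopfD(4)[OF G2] lin_image_module[of Inr G\<^sub>2]] by (simp add: factor_antipode_def)
 then show ?thesis unfolding Two factor.simps by (intro lin_from_image_module) simp_all
qed

lemma lins_fa: "lins (map F is) (map F is) (replicate (length is) fa)"
 by (induction "is") (simp_all add: lin_fa)

abbreviation "pull \<phi>s \<equiv> map (\<lambda>\<phi> x. \<phi> (fa x)) \<phi>s"

lemma fnls_pull: "fnls (map F is) \<phi>s \<Longrightarrow> fnls (map F is) (pull \<phi>s)"
 by (simp add: list_all2_conv_all_nth lin_comp[OF lin_fa])

text \<open>On words the antipode reverses the order and precomposes every letter with the antipode of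
  its factor. As a relation it can be handled before existence of the antipode is known.\<close>

definition anti :: "(nat \<Rightarrow> ('k, 'a \<times> 'b) tensor) \<Rightarrow> (nat \<Rightarrow> ('k, 'a \<times> 'b) tensor) \<Rightarrow> bool" where
 "anti f g \<longleftrightarrow> (\<forall>is \<phi>s. fnls (map F is) \<phi>s \<longrightarrow> fev (map2 letter is \<phi>s) g = fev (rev (map2 letter is (pull \<phi>s))) f)"

lemma antipode_component:
 assumes f: "f \<in> carrier TT"
 defines "S \<equiv> \<lambda>is. tlift (tens (map F (rev is))) (\<lambda>xs. pur (map F (rev is)) (rev (map fa xs))) (cmp is f)"
 shows "S is \<in> TC (map F (rev is))"
  and "fnls (map F (rev is)) \<phi>s \<Longrightarrow> tev \<phi>s (S is) = fev (rev (map2 letter (rev is) (pull \<phi>s))) f"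
proof -
 let ?M = "map F is" and ?N = "map F (rev is)" and ?t = "cmp is f"
 note T = alg_tens[OF algs_F, of "rev is"] and c = component_eval[OF f, of "is"]
 have m: "app (replicate (length is) fa) xs = map fa xs" if "xs \<in> RD ?M" for xs
  using RD_length[OF that] by (simp add: map2_map_map[symmetric] list_eq_iff_nth_eq)
 have g: "multilin ?M (tens ?N) (\<lambda>xs. pur ?N (rev (map fa xs)))"
 proof (rule multilin_cong[OF algs_F multilin_app[OF lins_fa]])
  show "multilin ?M (tens ?N) (\<lambda>xs. pur ?N (rev xs))"
   by (rule multilin_rev) (use multilin_pure[OF algs_F, of "rev is"] in \<open>simp add: rev_map\<close>)
 qed (simp add: m)
 show "S is \<in> TC ?N" unfolding S_def by (rule tensor_lift_closed[OF algs_F T g c(1)])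
 assume p: "fnls ?N \<phi>s"
 then have p': "fnls ?M (rev \<phi>s)" using list_all2_rev[of _ "map F (rev is)" \<phi>s] by (simp add: rev_map)
 note q = fnls_pull[OF p']
 have "tev \<phi>s (S is) = tev (pull (rev \<phi>s)) ?t"
  unfolding S_def
 proof (rule tev_eqI[OF algs_F q lin_comp[OF lin_tensor_lift[OF algs_F T g] fnl_tev[OF algs_F p]] _ c(1)])
  fix xs assume xs: "xs \<in> RD ?M"
  have fx: "map fa xs \<in> RD ?M" using app_RD[OF lins_fa xs] m[OF xs] by simp
  have rx: "rev (map fa xs) \<in> RD ?N" using RD_rev[OF fx] by (simp add: rev_map)
  have l: "pev (pull as) ys = pev as (map fa ys)" if "length as = length ys" for as and ys
   using that by (induction as ys rule: list_induct2) simp_all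
  have "tev \<phi>s (tlift (tens ?N) (\<lambda>xs. pur ?N (rev (map fa xs))) (pur ?M xs)) = pev \<phi>s (rev (map fa xs))"
   unfolding tensor_lift_pure[OF algs_F T g xs] by (rule tev_pure[OF algs_F p rx])
  also have "\<dots> = pev (rev \<phi>s) (map fa xs)" using pev_rev[OF p' fx] by simp
  also have "\<dots> = pev (pull (rev \<phi>s)) xs" using l[of "rev \<phi>s" xs] list_all2_lengthD[OF p'] RD_length[OF xs] by simp
  finally show "tev \<phi>s (tlift (tens ?N) (\<lambda>xs. pur ?N (rev (map fa xs))) (pur ?M xs)) = pev (pull (rev \<phi>s)) xs" .
 qed
 also have "\<dots> = fev (map2 letter is (pull (rev \<phi>s))) f" by (rule c(2)[OF q])
 also have "map2 letter is (pull (rev \<phi>s)) = rev (map2 letter (rev is) (pull \<phi>s))"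
  using zip_rev[of "rev is" "pull \<phi>s"] list_all2_lengthD[OF p] by (simp add: rev_map)
 finally show "tev \<phi>s (S is) = fev (rev (map2 letter (rev is) (pull \<phi>s))) f" .
qed

lemma coherent_antipode_eq:
 assumes f: "f \<in> carrier TT" and g: "g \<in> carrier TT" and a: "anti f g"
 shows "antipode P f = g"
 unfolding P_simps coherent_antipode_def Let_def
proof (rule the_equality)
 let ?S = "\<lambda>is. tlift (tens (map F (rev is))) (\<lambda>xs. pur (map F (rev is)) (rev (map fa xs))) (cmp is f)"
 have "cmp (rev is) g = ?S is" for "is"
  by (rule tensor_eqI_fnls[OF algs_F component_eval(1)[OF g] antipode_component(1)[OF f]])
   (use component_eval(2)[OF g, of "rev is"] antipode_component(2)[OF f, of "is"] a in \<open>simp add: anti_def\<close>)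
 then show "g \<in> carrier TT \<and> (\<forall>is. cmp (rev is) g = ?S is)" using g by simp
 then have S: "cmp is g = ?S (rev is)" for "is" by (metis rev_rev_ident)
 fix h assume h: "h \<in> carrier TT \<and> (\<forall>is. cmp (rev is) h = ?S is)"
 then have hT: "h \<in> carrier TT" and c: "cmp is h = cmp is g" for "is"
  using S[of "is"] by (simp, metis rev_rev_ident)
 show "h = g"
 proof (rule TT_eqI[OF hT g])
  fix w assume "w \<in> LW"
  then obtain "is" \<phi>s where w: "fnls (map F is) \<phi>s" "w = map2 letter is \<phi>s" by (rule \<Omega>_wordE)
  show "fev w h = fev w g" using component_eval(2)[OF hT w(1)] component_eval(2)[OF g w(1)] c w(2) by simp
 qed
qed

lemma rev_word: assumes "fnls (map F is) \<phi>s" shows "rev (map2 letter is (pull \<phi>s)) \<in> LW"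
 using word_\<Omega>[OF fnls_pull[OF assms]] by (simp only: in_lists_conv_set set_rev)

lemma anti_lin:
 assumes f: "f \<in> carrier TT" "g \<in> carrier TT" "anti f g"
 shows "\<lbrakk>f' \<in> carrier TT; g' \<in> carrier TT; anti f' g'\<rbrakk> \<Longrightarrow> anti (f \<oplus>\<^bsub>TT\<^esub> f') (g \<oplus>\<^bsub>TT\<^esub> g')"
  and "c \<in> \<K> \<Longrightarrow> anti (c \<odot>\<^bsub>TT\<^esub> f) (c \<odot>\<^bsub>TT\<^esub> g)"
 using f unfolding anti_def by (simp_all add: fev_lin word_\<Omega> rev_word del: in_lists_conv_set)

definition inv_mat :: "('i \<Rightarrow> 'i \<Rightarrow> 'a \<times> 'b) \<Rightarrow> 'i \<Rightarrow> 'i \<Rightarrow> 'a \<times> 'b" where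
 "inv_mat X a b = (antipode G\<^sub>1 (fst (X b a)), antipode G\<^sub>2 (snd (X b a)))"

lemma cohmat_inv:
 assumes X: "cohmat I X"
 shows "cohmat I (inv_mat X)"
 using comat_antipode[OF G1 cohmatD(1)[OF X]] comat_antipode[OF G2 cohmatD(2)[OF X]] cohmatD(3)[OF X]
  hopf_homD(5)[OF \<alpha>1 comatD(2)[OF cohmatD(1)[OF X]]] hopf_homD(5)[OF \<alpha>2 comatD(2)[OF cohmatD(2)[OF X]]]
 unfolding cohmat_def inv_mat_def by simp

lemma anti_Emat:
 assumes X: "cohmat I X" and ab: "a \<in> I" "b \<in> I"
 shows "anti (Emat I X a b) (Emat I (inv_mat X) b a)"
 unfolding anti_def
proof (intro allI impI)
 note I = cohmatD(4)[OF X] and Xm = cohmatD(5)[OF X] and Ym = cohmatD(5)[OF cohmat_inv[OF X]]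
 fix "is" \<phi>s assume "fnls (map F is) \<phi>s"
 then show "fev (map2 letter is \<phi>s) (Emat I (inv_mat X) b a) = fev (rev (map2 letter is (pull \<phi>s))) (Emat I X a b)"
  using ab(2)
 proof (induction "is" arbitrary: \<phi>s b)
  case Nil
  then show ?case by (simp add: fev_Emat_Nil)
 next
  case (Cons i "is")
  obtain \<phi> \<phi>s' where p: "\<phi>s = \<phi> # \<phi>s'" "fnl (F i) \<phi>" "fnls (map F is) \<phi>s'" using Cons.prems(1) by (cases \<phi>s) simp_all
  have p': "fnl (F i) (\<lambda>x. \<phi> (fa x))" by (rule lin_comp[OF lin_fa p(2)])
  let ?w = "map2 letter is \<phi>s'" and ?v = "rev (map2 letter is (pull \<phi>s'))"
  note w = LW_words[OF word_\<Omega>[OF p(3)]] and v = LW_words[OF rev_word[OF p(3)]]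
  have l: "[letter i (\<lambda>x. \<phi> (fa x))] \<in> words" using fnl_letter[OF p'] by simp
  have "fev (map2 letter (i # is) \<phi>s) (Emat I (inv_mat X) b a) = ksum (\<lambda>c. letter i \<phi> (inv_mat X b c) \<otimes> fev ?w (Emat I (inv_mat X) c a)) I"
   unfolding p(1) using fev_Emat_Cons[OF I Ym Cons.prems(2) ab(1) fnl_letter[OF p(2)] w] by simp
  also have "\<dots> = ksum (\<lambda>c. fev ?v (Emat I X a c) \<otimes> fev [letter i (\<lambda>x. \<phi> (fa x))] (Emat I X c b)) I"
  proof (rule ksum_cong[OF refl])
   fix c assume c: "c \<in> I"
   have "letter i \<phi> (inv_mat X b c) = letter i (\<lambda>x. \<phi> (fa x)) (X c b)"
    by (cases i) (simp_all add: letter_def inv_mat_def factor_antipode_def)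
   also have "\<dots> = fev [letter i (\<lambda>x. \<phi> (fa x))] (Emat I X c b)"
    by (rule fev_single[OF I Xm c Cons.prems(2) fnl_letter[OF p'], symmetric])
   finally show "letter i \<phi> (inv_mat X b c) \<otimes> fev ?w (Emat I (inv_mat X) c a) = fev ?v (Emat I X a c) \<otimes> fev [letter i (\<lambda>x. \<phi> (fa x))] (Emat I X c b)"
    using Cons.IH[OF p(3) c] fev_closed[OF v Emat_closed[OF Xm ab(1) c]] fev_closed[OF l Emat_closed[OF Xm c Cons.prems(2)]] by (simp add: m_comm)
   show "fev ?v (Emat I X a c) \<otimes> fev [letter i (\<lambda>x. \<phi> (fa x))] (Emat I X c b) \<in> \<K>"
    using fev_closed[OF v Emat_closed[OF Xm ab(1) c]] fev_closed[OF l Emat_closed[OF Xm c Cons.prems(2)]] by simp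
  qed
  also have "\<dots> = fev (rev (map2 letter (i # is) (pull \<phi>s))) (Emat I X a b)"
   unfolding p(1) using fev_Emat_append[OF I Xm v l ab(1) Cons.prems(2)] by simp
  finally show ?case .
 qed
qed

lemma antipode_Emat: "\<lbrakk>cohmat I X; a \<in> I; b \<in> I\<rbrakk> \<Longrightarrow> antipode P (Emat I X a b) = Emat I (inv_mat X) b a"
 by (rule coherent_antipode_eq[OF Emat_TT Emat_TT[OF cohmat_inv] anti_Emat])

lemma antipode_P: assumes f: "f \<in> carrier P" shows "antipode P f \<in> carrier P" and "anti f (antipode P f)"
proof -
 have nil: "anti \<zero>\<^bsub>TT\<^esub> \<zero>\<^bsub>TT\<^esub>" unfolding anti_def by (simp add: fev_lin word_\<Omega> rev_word del: in_lists_conv_set)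
 let ?Q = "{f \<in> carrier TT. \<exists>g\<in>carrier P. anti f g}"
 have "f \<in> ?Q"
 proof (rule P_span[OF f])
  show "Emat I X a b \<in> ?Q" if "cohmat I X" "a \<in> I" "b \<in> I" for I :: "nat set" and X a b
   using Emat_TT[OF that] Emat_P[OF cohmat_inv[OF that(1)] that(3,2)] anti_Emat[OF that] by blast
  show "subspace TT ?Q"
   by (rule subspace_domain[where R=anti, OF algebra_TT subspace_P nil]) (use anti_lin P_TT in simp_all)
 qed
 then obtain g where g: "g \<in> carrier P" "anti f g" by blast
 then have "antipode P f = g" by (intro coherent_antipode_eq P_TT f)
 then show "antipode P f \<in> carrier P" "anti f (antipode P f)" using g by simp_all
qed

lemma lin_antipode: "lin P P (antipode P)"
proof (rule linI)
 fix f assume f: "f \<in> carrier P"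
 note a = P_TT[OF f] P_TT[OF antipode_P(1)[OF f]] antipode_P(2)[OF f]
 show "antipode P f \<in> carrier P" by (rule antipode_P(1)[OF f])
 show "antipode P (c \<odot>\<^bsub>P\<^esub> f) = c \<odot>\<^bsub>P\<^esub> antipode P f" if "c \<in> \<K>" for c
  unfolding P_simps(6) U_simps by (rule coherent_antipode_eq[OF _ _ anti_lin(2)[OF a that]]) (use a that in simp_all)
 fix g assume g: "g \<in> carrier P"
 note b = P_TT[OF g] P_TT[OF antipode_P(1)[OF g]] antipode_P(2)[OF g]
 show "antipode P (f \<oplus>\<^bsub>P\<^esub> g) = antipode P f \<oplus>\<^bsub>P\<^esub> antipode P g"
  unfolding P_simps(4) U_simps by (rule coherent_antipode_eq[OF _ _ anti_lin(1)[OF a b]]) (use a b in simp_all)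
qed

text \<open>The form of the sum in \<open>diagonal_sum\<close>: summing \<open>m\<close> over the diagonal yields a multiple of the
  identity matrix, which contracts the remaining pair of indices.\<close>

lemma ksum_contract:
 assumes I: "finite I" and m: "\<And>c p. c \<in> I \<Longrightarrow> p \<in> I \<times> I \<Longrightarrow> m c p \<in> \<K>" and g: "\<And>p. p \<in> I \<times> I \<Longrightarrow> g p \<in> \<K>"
  and k: "k \<in> \<K>" and mk: "\<And>d e. d \<in> I \<Longrightarrow> e \<in> I \<Longrightarrow> ksum (\<lambda>c. m c (d, e)) I = (if d = e then k else \<zero>)"
 shows "ksum (\<lambda>c. ksum (\<lambda>p. m c p \<otimes> g p) (I \<times> I)) I = k \<otimes> ksum (\<lambda>d. g (d, d)) I"
proof -
 let ?h = "\<lambda>d e. (if d = e then k else \<zero>) \<otimes> g (d, e)"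
 have II: "finite (I \<times> I)" using I by simp
 have h: "?h d e \<in> \<K>" if "d \<in> I" "e \<in> I" for d e using k g that by simp
 have "ksum (\<lambda>c. ksum (\<lambda>p. m c p \<otimes> g p) (I \<times> I)) I = ksum (\<lambda>p. ksum (\<lambda>c. m c p \<otimes> g p) I) (I \<times> I)"
  by (rule ksum_swap[OF I II]) (use m g in simp)
 also have "\<dots> = ksum (\<lambda>p. ?h (fst p) (snd p)) (I \<times> I)"
 proof (rule ksum_cong[OF refl])
  fix p assume p: "p \<in> I \<times> I"
  then have "ksum (\<lambda>c. m c p) I = (if fst p = snd p then k else \<zero>)" using mk[of "fst p" "snd p"] by auto
  then show "ksum (\<lambda>c. m c p \<otimes> g p) I = ?h (fst p) (snd p)"
   using ksum_mult_left[OF I g[OF p], of "\<lambda>c. m c p"] m p by auto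
  show "?h (fst p) (snd p) \<in> \<K>" by (rule h) (use p in auto)
 qed
 also have "\<dots> = ksum (\<lambda>d. ksum (?h d) I) I"
  using fsum_product[OF algebra_Ks I I, of ?h] h by simp
 also have "\<dots> = ksum (\<lambda>d. k \<otimes> g (d, d)) I"
 proof (rule ksum_cong[OF refl])
  fix d assume d: "d \<in> I"
  show "ksum (?h d) I = k \<otimes> g (d, d)" using ksum_delta[OF I d, of "?h d"] g d k by simp
  show "k \<otimes> g (d, d) \<in> \<K>" using g d k by simp
 qed
 also have "\<dots> = k \<otimes> ksum (\<lambda>d. g (d, d)) I"
  by (rule ksum_mult_right[OF I k, symmetric]) (use g in simp)
 finally show ?thesis .
qed

text \<open>Stripping off the letters of a word one at a time, the diagonal of the Kronecker product
  contributes the value of the letter at \<open>1\<close>, as it does for the unit. The function \<open>rv\<close> is the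
  identity or reversal: letters are removed from the left or from the right according to the
  side on which the inverse stands.\<close>

lemma diagonal_sum:
 fixes E :: "'i \<times> 'i \<Rightarrow> nat \<Rightarrow> ('k, 'a \<times> 'b) tensor"
 assumes I: "finite I" and ab: "a \<in> I" "b \<in> I" and nil: "rv [] = []"
  and cl: "\<And>w p. w \<in> words \<Longrightarrow> p \<in> I \<times> I \<Longrightarrow> fev (rv w) (E p) \<in> \<K>"
  and E0: "\<And>c. c \<in> I \<Longrightarrow> fev [] (E (c, c)) = (if c = a \<and> c = b then \<one> else \<zero>)"
  and z: "\<And>\<phi> p r. \<lbrakk>fnl A \<phi>; p \<in> I \<times> I; r \<in> I \<times> I\<rbrakk> \<Longrightarrow> \<phi> (Z p r) \<in> \<K>"
  and zs: "\<And>\<phi> d e. \<lbrakk>fnl A \<phi>; d \<in> I; e \<in> I\<rbrakk> \<Longrightarrow> ksum (\<lambda>c. \<phi> (Z (c, c) (d, e))) I = (if d = e then \<phi> \<one>\<^bsub>A\<^esub> else \<zero>)"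
  and step: "\<And>\<phi> w p. \<lbrakk>fnl A \<phi>; w \<in> words; p \<in> I \<times> I\<rbrakk> \<Longrightarrow>
   fev (rv (\<phi> # w)) (E p) = ksum (\<lambda>r. \<phi> (Z p r) \<otimes> fev (rv w) (E r)) (I \<times> I)"
  and one: "\<And>\<phi> w. fnl A \<phi> \<Longrightarrow> w \<in> words \<Longrightarrow> fev (rv (\<phi> # w)) \<one>\<^bsub>TT\<^esub> = \<phi> \<one>\<^bsub>A\<^esub> \<otimes> fev (rv w) \<one>\<^bsub>TT\<^esub>"
  and o: "\<And>w. w \<in> words \<Longrightarrow> fev (rv w) \<one>\<^bsub>TT\<^esub> \<in> \<K>"
 shows "w \<in> words \<Longrightarrow> ksum (\<lambda>c. fev (rv w) (E (c, c))) I = fev (rv w) \<one>\<^bsub>TT\<^esub> \<otimes> (if a = b then \<one> else \<zero>)"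
proof (induction w rule: list.induct)
 case Nil
 have o0: "fev [] \<one>\<^bsub>TT\<^esub> = \<one>" unfolding Emat_one[symmetric, of "0 :: nat"] by (simp add: fev_Emat_Nil)
 have "ksum (\<lambda>c. fev [] (E (c, c))) I = (if a = b then \<one> else \<zero>)"
  by (rule trans[OF ksum_delta[OF I ab(1)]]) (auto simp: E0 ab(1))
 then show ?case unfolding nil o0 by simp
next
 case (Cons \<phi> w)
 have \<phi>: "fnl A \<phi>" and w: "w \<in> words" using Cons.prems by simp_all
 have oA: "\<phi> \<one>\<^bsub>A\<^esub> \<in> \<K>" by (rule fnl_closed[OF \<phi> alg_simps(4)[OF algebra_AA]])
 have "ksum (\<lambda>c. fev (rv (\<phi> # w)) (E (c, c))) I = ksum (\<lambda>c. ksum (\<lambda>r. \<phi> (Z (c, c) r) \<otimes> fev (rv w) (E r)) (I \<times> I)) I"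
  by (rule ksum_cong[OF refl]) (use step[OF \<phi> w] z[OF \<phi>] cl[OF w] in \<open>simp_all add: ksum_closed\<close>)
 also have "\<dots> = \<phi> \<one>\<^bsub>A\<^esub> \<otimes> ksum (\<lambda>d. fev (rv w) (E (d, d))) I"
  by (rule ksum_contract[OF I _ cl[OF w] oA zs[OF \<phi>]]) (use z[OF \<phi>] in simp_all)
 also have "\<dots> = fev (rv (\<phi> # w)) \<one>\<^bsub>TT\<^esub> \<otimes> (if a = b then \<one> else \<zero>)"
  unfolding Cons.IH[OF w] one[OF \<phi> w] using oA o[OF w] by (simp add: m_assoc)
 finally show ?case .
qed

lemma Emat_inverse:
 assumes I: "finite I" and X: "mat_in A I X" and Y: "mat_in A I Y" and ab: "a \<in> I" "b \<in> I"
 shows "(\<And>d e. d \<in> I \<Longrightarrow> e \<in> I \<Longrightarrow> finsum A (\<lambda>c. Y c d \<otimes>\<^bsub>A\<^esub> X c e) I = delta A d e) \<Longrightarrow>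
   finsum TT (\<lambda>c. Emat I Y c a \<otimes>\<^bsub>TT\<^esub> Emat I X c b) I = delta TT a b"
  and "(\<And>d e. d \<in> I \<Longrightarrow> e \<in> I \<Longrightarrow> finsum A (\<lambda>c. X d c \<otimes>\<^bsub>A\<^esub> Y e c) I = delta A d e) \<Longrightarrow>
   finsum TT (\<lambda>c. Emat I X a c \<otimes>\<^bsub>TT\<^esub> Emat I Y b c) I = delta TT a b"
proof -
 let ?I = "I \<times> I" and ?o = "\<lambda>_ _ :: nat. \<one>\<^bsub>A\<^esub>"
 have II: "finite ?I" using I by simp
 have one: "mat_in A {0 :: nat} ?o" using alg1 alg2 by (simp add: mat_in_def)
 have oA: "\<one>\<^bsub>A\<^esub> \<in> carrier A" using algebra_AA by (rule alg_simps)
 have km: "mat_in A ?I (kron X' Y')" if "mat_in A I X'" "mat_in A I Y'" for X' Y'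
  unfolding mat_in_def by (intro ballI alg_simps(2)[OF algebra_AA] mat_inD[OF that(1)] mat_inD[OF that(2)]) auto
 have o: "fev w \<one>\<^bsub>TT\<^esub> \<in> \<K>" if "w \<in> words" for w by (rule fev_closed[OF that]) simp
 have fin: "finsum TT E I = delta TT a b"
  if E: "\<And>c. c \<in> I \<Longrightarrow> E c \<in> carrier TT" and w: "\<And>w. w \<in> words \<Longrightarrow> ksum (\<lambda>c. fev w (E c)) I = fev w \<one>\<^bsub>TT\<^esub> \<otimes> (if a = b then \<one> else \<zero>)" for E
 proof (rule TT_eqI)
  show "finsum TT E I \<in> carrier TT" by (rule fsum_closed[OF algebra_TT E])
  show "delta TT a b \<in> carrier TT" by (rule delta_closed[OF algebra_TT])
  fix v assume "v \<in> LW"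
  note v = LW_words[OF this]
  show "fev v (finsum TT E I) = fev v (delta TT a b)"
   using fnl_fsum[OF fnl_fev[OF v] algebra_TT I E] w[OF v] o[OF v] lin_zero[OF fnl_fev[OF v] algebra_TT algebra_Ks]
   by (simp add: delta_def)
 qed
 have sum: "ksum (\<lambda>c. \<phi> (Z c)) I = (if d = e then \<phi> \<one>\<^bsub>A\<^esub> else \<zero>)"
  if "fnl A \<phi>" "\<And>c. c \<in> I \<Longrightarrow> Z c \<in> carrier A" "finsum A Z I = delta A d e" for \<phi> Z d e
  using fnl_fsum[OF that(1) algebra_AA I, of Z] that(2,3) lin_zero[OF that(1) algebra_AA algebra_Ks] unfolding delta_def by (cases "d = e") simp_all
 show "finsum TT (\<lambda>c. Emat I Y c a \<otimes>\<^bsub>TT\<^esub> Emat I X c b) I = delta TT a b"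
  if inv: "\<And>d e. d \<in> I \<Longrightarrow> e \<in> I \<Longrightarrow> finsum A (\<lambda>c. Y c d \<otimes>\<^bsub>A\<^esub> X c e) I = delta A d e"
 proof (rule fin)
  note Z = km[OF Y X]
  have p: "(a, b) \<in> ?I" using ab by simp
  have fc: "fev w (Emat ?I (kron Y X) r (a, b)) \<in> \<K>" if "w \<in> words" "r \<in> ?I" for w r
   by (rule fev_closed[OF that(1) Emat_closed[OF Z that(2) p]])
  show "Emat I Y c a \<otimes>\<^bsub>TT\<^esub> Emat I X c b \<in> carrier TT" if "c \<in> I" for c
   using Emat_closed[OF Y that ab(1)] Emat_closed[OF X that ab(2)] by (rule alg_simps(2)[OF algebra_TT])
  fix w assume w: "w \<in> words"
  have "ksum (\<lambda>c. fev w (Emat ?I (kron Y X) (c, c) (a, b))) I = fev w \<one>\<^bsub>TT\<^esub> \<otimes> (if a = b then \<one> else \<zero>)"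
  proof (rule diagonal_sum[where rv="\<lambda>w. w" and Z="kron Y X" and E="\<lambda>r. Emat ?I (kron Y X) r (a, b)", OF I ab _ fc _ _ _ fev_Emat_Cons[OF II Z _ p] _ o w])
   show "\<phi> (kron Y X r s) \<in> \<K>" if "fnl A \<phi>" "r \<in> ?I" "s \<in> ?I" for \<phi> r s by (rule fnl_closed[OF that(1) mat_inD[OF Z that(2,3)]])
   show "ksum (\<lambda>c. \<phi> (kron Y X (c, c) (d, e))) I = (if d = e then \<phi> \<one>\<^bsub>A\<^esub> else \<zero>)" if "fnl A \<phi>" "d \<in> I" "e \<in> I" for \<phi> d e
    by (rule sum[OF that(1) mat_inD[OF Z]]) (use inv that in simp_all)
   show "fev (\<phi> # w) \<one>\<^bsub>TT\<^esub> = \<phi> \<one>\<^bsub>A\<^esub> \<otimes> fev w \<one>\<^bsub>TT\<^esub>" if \<phi>: "fnl A \<phi>" and w: "w \<in> words" for \<phi> w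
    unfolding Emat_one[of "0 :: nat", symmetric]
    by (rule trans[OF fev_Emat_Cons[OF _ one _ _ \<phi> w] ksum_delta]) (use fnl_closed[OF \<phi> oA] o[OF w] Emat_one[of "0 :: nat"] in simp_all)
  qed (simp_all add: fev_Emat_Nil)
  then show "ksum (\<lambda>c. fev w (Emat I Y c a \<otimes>\<^bsub>TT\<^esub> Emat I X c b)) I = fev w \<one>\<^bsub>TT\<^esub> \<otimes> (if a = b then \<one> else \<zero>)"
   using fc[OF w] by (subst ksum_cong[OF refl]) (simp_all add: Emat_mult[OF I I Y X _ ab(1) _ ab(2)])
 qed
 show "finsum TT (\<lambda>c. Emat I X a c \<otimes>\<^bsub>TT\<^esub> Emat I Y b c) I = delta TT a b"
  if inv: "\<And>d e. d \<in> I \<Longrightarrow> e \<in> I \<Longrightarrow> finsum A (\<lambda>c. X d c \<otimes>\<^bsub>A\<^esub> Y e c) I = delta A d e"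
 proof (rule fin)
  note Z = km[OF X Y]
  have p: "(a, b) \<in> ?I" using ab by simp
  have rw: "rev w \<in> words" if "w \<in> words" for w using that by (simp only: in_lists_conv_set set_rev)
  have fc: "fev w (Emat ?I (kron X Y) (a, b) r) \<in> \<K>" if "w \<in> words" "r \<in> ?I" for w r
   by (rule fev_closed[OF that(1) Emat_closed[OF Z p that(2)]])
  show "Emat I X a c \<otimes>\<^bsub>TT\<^esub> Emat I Y b c \<in> carrier TT" if "c \<in> I" for c
   using Emat_closed[OF X ab(1) that] Emat_closed[OF Y ab(2) that] by (rule alg_simps(2)[OF algebra_TT])
  fix w assume w: "w \<in> words"
  have zc: "\<phi> (kron X Y s r) \<in> \<K>" if "fnl A \<phi>" "r \<in> ?I" "s \<in> ?I" for \<phi> r s by (rule fnl_closed[OF that(1) mat_inD[OF Z that(3,2)]])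
  have "ksum (\<lambda>c. fev (rev (rev w)) (Emat ?I (kron X Y) (a, b) (c, c))) I = fev (rev (rev w)) \<one>\<^bsub>TT\<^esub> \<otimes> (if a = b then \<one> else \<zero>)"
  proof (rule diagonal_sum[where rv=rev and Z="\<lambda>r s. kron X Y s r" and E="Emat ?I (kron X Y) (a, b)", OF I ab])
   show "fev (rev w) (Emat ?I (kron X Y) (a, b) r) \<in> \<K>" if "w \<in> words" "r \<in> ?I" for w r by (rule fc[OF rw[OF that(1)] that(2)])
   show "\<phi> (kron X Y s r) \<in> \<K>" if "fnl A \<phi>" "r \<in> ?I" "s \<in> ?I" for \<phi> r s by (rule zc[OF that])
   show "fev (rev w) \<one>\<^bsub>TT\<^esub> \<in> \<K>" if "w \<in> words" for w by (rule o[OF rw[OF that]])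
   show "rev w \<in> words" by (rule rw[OF w])
   show "ksum (\<lambda>c. \<phi> (kron X Y (d, e) (c, c))) I = (if d = e then \<phi> \<one>\<^bsub>A\<^esub> else \<zero>)" if "fnl A \<phi>" "d \<in> I" "e \<in> I" for \<phi> d e
    by (rule sum[OF that(1) mat_inD[OF Z]]) (use inv that in simp_all)
   fix \<phi> w assume \<phi>: "fnl A \<phi>" and w: "w \<in> words"
   have l: "[\<phi>] \<in> words" using \<phi> by simp
   note wr = rw[OF w]
   show "fev (rev (\<phi> # w)) (Emat ?I (kron X Y) (a, b) r) = ksum (\<lambda>s. \<phi> (kron X Y s r) \<otimes> fev (rev w) (Emat ?I (kron X Y) (a, b) s)) ?I" if r: "r \<in> ?I" for r
    unfolding rev.simps fev_Emat_append[OF II Z wr l p r]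
    by (rule ksum_cong[OF refl]) (use zc[OF \<phi> r] fc[OF wr] fev_single[OF II Z _ r \<phi>] in \<open>simp_all add: m_comm\<close>)
   have "fev (rev w @ [\<phi>]) (Emat {0} ?o 0 0) = fev (rev w) (Emat {0} ?o 0 0) \<otimes> fev [\<phi>] (Emat {0} ?o 0 0)"
    by (rule trans[OF fev_Emat_append[OF _ one wr l] ksum_delta]) (use o[OF l] o[OF wr] Emat_one[of "0 :: nat"] in simp_all)
   then show "fev (rev (\<phi> # w)) \<one>\<^bsub>TT\<^esub> = \<phi> \<one>\<^bsub>A\<^esub> \<otimes> fev (rev w) \<one>\<^bsub>TT\<^esub>"
    using fev_single[OF _ one _ _ \<phi>, of 0 0] fnl_closed[OF \<phi> oA] o[OF wr] unfolding Emat_one by (simp add: m_comm)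
  qed (auto simp: fev_Emat_Nil)
  then show "ksum (\<lambda>c. fev w (Emat I X a c \<otimes>\<^bsub>TT\<^esub> Emat I Y b c)) I = fev w \<one>\<^bsub>TT\<^esub> \<otimes> (if a = b then \<one> else \<zero>)"
   using fc[OF w] by (subst ksum_cong[OF refl]) (simp_all add: Emat_mult[OF I I X Y ab(1) _ ab(2)])
 qed
qed

lemma prod_fsum:
 assumes "finite I" "\<And>c. c \<in> I \<Longrightarrow> f c \<in> carrier A"
 shows "finsum A f I = (finsum G\<^sub>1 (\<lambda>c. fst (f c)) I, finsum G\<^sub>2 (\<lambda>c. snd (f c)) I)"
proof -
 have 1: "lin A G\<^sub>1 fst" and 2: "lin A G\<^sub>2 snd" by (auto simp: lin_def)
 show ?thesis using lin_fsum[OF 1 algebra_AA alg1 assms] lin_fsum[OF 2 algebra_AA alg2 assms] by (simp add: prod_eq_iff)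
qed

text \<open>On entries both axioms say that \<open>Emat\<close> of the contragredient is inverse to \<open>Emat I X\<close>; by
  \<open>Emat_inverse\<close> this reduces to the antipode axioms of \<open>G\<^sub>1\<close> and \<open>G\<^sub>2\<close> in degree one.\<close>

lemma antipode_axioms_P:
 assumes f: "f \<in> carrier P"
 shows "tlift P (\<lambda>xs. antipode P (xs ! 0) \<otimes>\<^bsub>P\<^esub> xs ! 1) (comult P f) = counit P f \<odot>\<^bsub>P\<^esub> \<one>\<^bsub>P\<^esub>"
  and "tlift P (\<lambda>xs. xs ! 0 \<otimes>\<^bsub>P\<^esub> antipode P (xs ! 1)) (comult P f) = counit P f \<odot>\<^bsub>P\<^esub> \<one>\<^bsub>P\<^esub>"
proof -
 note B = algebra_P and S = lin_antipode
 note Sc = linD(1)[OF S]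
 have PP: "algs [P, P]" using B by simp
 have g: "multilin [P, P] P (\<lambda>xs. antipode P (xs ! 0) \<otimes>\<^bsub>P\<^esub> xs ! 1)"
  using lin_mult_left[OF B _ S] lin_mult_right[OF B Sc lin_id] Sc B by (auto elim!: RD_ConsE)
 have g': "multilin [P, P] P (\<lambda>xs. xs ! 0 \<otimes>\<^bsub>P\<^esub> antipode P (xs ! 1))"
  using lin_mult_left[OF B Sc lin_id] lin_mult_right[OF B _ S] Sc B by (auto elim!: RD_ConsE)
 have c: "lin P P (\<lambda>f. counit P f \<odot>\<^bsub>P\<^esub> \<one>\<^bsub>P\<^esub>)"
  by (rule lin_smult_left[OF B]) (use B fnl_P[of "[]"] in \<open>simp_all add: counit_P\<close>)
 have fs: "finsum P h I = finsum TT h I" if "finite I" "\<And>i. i \<in> I \<Longrightarrow> h i \<in> carrier P" for h and I :: "nat set"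
  using lin_fsum[OF incl_P B algebra_TT that] by simp
 have e: "counit P (Emat I X a b) \<odot>\<^bsub>P\<^esub> \<one>\<^bsub>P\<^esub> = delta TT a b" for I :: "nat set" and X a b
  unfolding counit_P fev_Emat_Nil P_simps(3,6) U_simps by (simp add: delta_def)
 have inv: "finsum A (\<lambda>c. inv_mat X c d \<otimes>\<^bsub>A\<^esub> X c e) I = delta A d e" "finsum A (\<lambda>c. X d c \<otimes>\<^bsub>A\<^esub> inv_mat X e c) I = delta A d e"
  if X: "cohmat I X" and de: "d \<in> I" "e \<in> I" for I :: "nat set" and X d e
 proof -
  have m: "inv_mat X c d \<otimes>\<^bsub>A\<^esub> X c e = (antipode G\<^sub>1 (fst (X d c)) \<otimes>\<^bsub>G\<^sub>1\<^esub> fst (X c e), antipode G\<^sub>2 (snd (X d c)) \<otimes>\<^bsub>G\<^sub>2\<^esub> snd (X c e))"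
   "X d c \<otimes>\<^bsub>A\<^esub> inv_mat X e c = (fst (X d c) \<otimes>\<^bsub>G\<^sub>1\<^esub> antipode G\<^sub>1 (fst (X c e)), snd (X d c) \<otimes>\<^bsub>G\<^sub>2\<^esub> antipode G\<^sub>2 (snd (X c e)))" for c
   by (cases "X c e"; cases "X d c"; simp add: inv_mat_def)+
  note x = mat_inD[OF cohmatD(5)[OF X]] mat_inD[OF cohmatD(5)[OF cohmat_inv[OF X]]]
  have 1: "inv_mat X c d \<otimes>\<^bsub>A\<^esub> X c e \<in> carrier A" if "c \<in> I" for c
   by (rule alg_simps(2)[OF algebra_AA x(2)[OF that de(1)] x(1)[OF that de(2)]])
  have 2: "X d c \<otimes>\<^bsub>A\<^esub> inv_mat X e c \<in> carrier A" if "c \<in> I" for c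
   by (rule alg_simps(2)[OF algebra_AA x(1)[OF de(1) that] x(2)[OF de(2) that]])
  note i = comat_antipode_inverse[OF G1 cohmatD(1)[OF X] de] comat_antipode_inverse[OF G2 cohmatD(2)[OF X] de]
  have "finsum A (\<lambda>c. inv_mat X c d \<otimes>\<^bsub>A\<^esub> X c e) I = (finsum G\<^sub>1 (\<lambda>c. fst (inv_mat X c d \<otimes>\<^bsub>A\<^esub> X c e)) I, finsum G\<^sub>2 (\<lambda>c. snd (inv_mat X c d \<otimes>\<^bsub>A\<^esub> X c e)) I)"
   by (rule prod_fsum[OF cohmatD(4)[OF X] 1])
  then show "finsum A (\<lambda>c. inv_mat X c d \<otimes>\<^bsub>A\<^esub> X c e) I = delta A d e"
   using i(1,3) by (simp only: m fst_conv snd_conv mm_def) (simp add: delta_def)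
  have "finsum A (\<lambda>c. X d c \<otimes>\<^bsub>A\<^esub> inv_mat X e c) I = (finsum G\<^sub>1 (\<lambda>c. fst (X d c \<otimes>\<^bsub>A\<^esub> inv_mat X e c)) I, finsum G\<^sub>2 (\<lambda>c. snd (X d c \<otimes>\<^bsub>A\<^esub> inv_mat X e c)) I)"
   by (rule prod_fsum[OF cohmatD(4)[OF X] 2])
  then show "finsum A (\<lambda>c. X d c \<otimes>\<^bsub>A\<^esub> inv_mat X e c) I = delta A d e"
   using i(2,4) by (simp only: m fst_conv snd_conv mm_def) (simp add: delta_def)
 qed
 show "tlift P (\<lambda>xs. antipode P (xs ! 0) \<otimes>\<^bsub>P\<^esub> xs ! 1) (comult P f) = counit P f \<odot>\<^bsub>P\<^esub> \<one>\<^bsub>P\<^esub>"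
 proof (rule spans_ext[OF spans_P B B lin_comp[OF lin_comult lin_tensor_lift[OF PP B g]] c _ f], elim P_entryE)
  fix f and I :: "nat set" and X a b assume x: "f = Emat I X a b" "cohmat I X" "a \<in> I" "b \<in> I"
  note I = cohmatD(4)[OF x(2)] and E = Emat_P[OF x(2)]
  have "finsum P (\<lambda>c. antipode P (Emat I X a c) \<otimes>\<^bsub>P\<^esub> Emat I X c b) I = finsum TT (\<lambda>c. antipode P (Emat I X a c) \<otimes>\<^bsub>P\<^esub> Emat I X c b) I"
   by (rule fs[OF I]) (use B Sc E x in simp)
  also have "\<dots> = finsum TT (\<lambda>c. Emat I (inv_mat X) c a \<otimes>\<^bsub>TT\<^esub> Emat I X c b) I"
   by (rule fsum_cong[OF algebra_TT refl]) (use antipode_Emat[OF x(2,3)] Emat_TT[OF x(2)] Emat_TT[OF cohmat_inv[OF x(2)]] x alg_simps(2)[OF algebra_TT] in \<open>simp_all add: P_simps(2) U_simps\<close>)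
  also have "\<dots> = delta TT a b"
   by (rule Emat_inverse(1)[OF I cohmatD(5)[OF x(2)] cohmatD(5)[OF cohmat_inv[OF x(2)]] x(3,4) inv(1)[OF x(2)]])
  finally show "tlift P (\<lambda>xs. antipode P (xs ! 0) \<otimes>\<^bsub>P\<^esub> xs ! 1) (comult P f) = counit P f \<odot>\<^bsub>P\<^esub> \<one>\<^bsub>P\<^esub>"
   unfolding x(1) comult_Emat[OF x(2-4)] e using pair_lift[OF B B g I E[OF x(3)] E[OF _ x(4)]] by simp
 qed
 show "tlift P (\<lambda>xs. xs ! 0 \<otimes>\<^bsub>P\<^esub> antipode P (xs ! 1)) (comult P f) = counit P f \<odot>\<^bsub>P\<^esub> \<one>\<^bsub>P\<^esub>"
 proof (rule spans_ext[OF spans_P B B lin_comp[OF lin_comult lin_tensor_lift[OF PP B g']] c _ f], elim P_entryE)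
  fix f and I :: "nat set" and X a b assume x: "f = Emat I X a b" "cohmat I X" "a \<in> I" "b \<in> I"
  note I = cohmatD(4)[OF x(2)] and E = Emat_P[OF x(2)]
  have "finsum P (\<lambda>c. Emat I X a c \<otimes>\<^bsub>P\<^esub> antipode P (Emat I X c b)) I = finsum TT (\<lambda>c. Emat I X a c \<otimes>\<^bsub>P\<^esub> antipode P (Emat I X c b)) I"
   by (rule fs[OF I]) (use B Sc E x in simp)
  also have "\<dots> = finsum TT (\<lambda>c. Emat I X a c \<otimes>\<^bsub>TT\<^esub> Emat I (inv_mat X) b c) I"
   by (rule fsum_cong[OF algebra_TT refl]) (use antipode_Emat[OF x(2) _ x(4)] Emat_TT[OF x(2)] Emat_TT[OF cohmat_inv[OF x(2)]] x alg_simps(2)[OF algebra_TT] in \<open>simp_all add: P_simps(2) U_simps\<close>)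
  also have "\<dots> = delta TT a b"
   by (rule Emat_inverse(2)[OF I cohmatD(5)[OF x(2)] cohmatD(5)[OF cohmat_inv[OF x(2)]] x(3,4) inv(2)[OF x(2)]])
  finally show "tlift P (\<lambda>xs. xs ! 0 \<otimes>\<^bsub>P\<^esub> antipode P (xs ! 1)) (comult P f) = counit P f \<odot>\<^bsub>P\<^esub> \<one>\<^bsub>P\<^esub>"
   unfolding x(1) comult_Emat[OF x(2-4)] e using pair_lift[OF B B g' I E[OF x(3)] E[OF _ x(4)]] by simp
 qed
qed

lemma hopf_P: "hopf P"
proof -
 note S = linD[OF lin_antipode]
 show ?thesis
  by (intro hopf_algebra.intro hopf_algebra_axioms.intro field_axioms algebra_P alg_hom_comult alg_hom_counit S
    coassoc_P counit_axioms_P antipode_axioms_P)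
qed

end

context ground_field
begin

lemma comat_cong:
 assumes B: "alg B" and Y: "comat B I Y" and eq: "\<And>a b. a \<in> I \<Longrightarrow> b \<in> I \<Longrightarrow> Z a b = Y a b"
 shows "comat B I Z"
 unfolding comat_def
proof (intro conjI ballI comatD(1)[OF Y])
 have BB: "algs [B, B]" using B by simp
 fix a b assume ab: "a \<in> I" "b \<in> I"
 show "Z a b \<in> carrier B" "counit B (Z a b) = (if a = b then \<one> else \<zero>)" using comatD(2,4)[OF Y ab] eq[OF ab] by simp_all
 show "comult B (Z a b) = finsum (tens [B, B]) (\<lambda>c. pur [B, B] [Z a c, Z c b]) I"
  unfolding eq[OF ab] comatD(3)[OF Y ab]
  by (rule fsum_cong[OF alg_tens[OF BB] refl, symmetric]) (use comatD(2)[OF Y] eq ab pure_closed[OF BB] in simp_all)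
qed

end

context amalgam
begin

section \<open>The projections\<close>

lemma Emat_cong:
 assumes Y: "mat_in A I Y" and eq: "\<And>a b. a \<in> I \<Longrightarrow> b \<in> I \<Longrightarrow> X a b = Y a b" and ab: "a \<in> I" "b \<in> I"
 shows "Emat I X a b = Emat I Y a b"
proof -
 have "tpow I X n a b = tpow I Y n a b" if "a \<in> I" for n a
  using that
 proof (induction n arbitrary: a)
  case (Suc n)
  show ?case unfolding tpow.simps
   by (rule fsum_cong[OF algebra_power refl])
    (use Suc eq tcons_power_closed[OF mat_inD[OF Y Suc.prems] tpow_closed[OF Y _ ab(2)]] in simp_all)
 qed simp
 then show ?thesis using ab(1) by (simp add: Emat_def fun_eq_iff)
qed

lemma comat_P: "cohmat I X \<Longrightarrow> comat P I (Emat I X)"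
 unfolding comat_def by (simp add: cohmatD(4) Emat_P comult_Emat counit_P fev_Emat_Nil)

abbreviation "p\<^sub>1 \<equiv> coherent_proj\<^sub>1 K G\<^sub>1 G\<^sub>2"
abbreviation "p\<^sub>2 \<equiv> coherent_proj\<^sub>2 K G\<^sub>1 G\<^sub>2"

lemma lin_proj: "lin P G\<^sub>1 p\<^sub>1" "lin P G\<^sub>2 p\<^sub>2"
proof -
 have 1: "lin A G\<^sub>1 fst" and 2: "lin A G\<^sub>2 snd" by (auto simp: lin_def)
 note p = lin_comp[OF incl_P lin_cofree_proj]
 show "lin P G\<^sub>1 p\<^sub>1" "lin P G\<^sub>2 p\<^sub>2"
  using lin_comp[OF p 1] lin_comp[OF p 2] unfolding coherent_proj\<^sub>1_def[abs_def] coherent_proj\<^sub>2_def[abs_def] .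
qed

lemma proj_Emat:
 assumes X: "cohmat I X" and ab: "a \<in> I" "b \<in> I"
 shows "p\<^sub>1 (Emat I X a b) = fst (X a b)" and "p\<^sub>2 (Emat I X a b) = snd (X a b)"
 using cofree_proj_Emat[OF cohmatD(4,5)[OF X] ab] by (simp_all add: coherent_proj\<^sub>1_def coherent_proj\<^sub>2_def)

lemma proj_hom: "p\<^sub>1 \<in> homs P G\<^sub>1" "p\<^sub>2 \<in> homs P G\<^sub>2"
proof -
 have f: "fst (x \<otimes>\<^bsub>A\<^esub> y) = fst x \<otimes>\<^bsub>G\<^sub>1\<^esub> fst y" "snd (x \<otimes>\<^bsub>A\<^esub> y) = snd x \<otimes>\<^bsub>G\<^sub>2\<^esub> snd y" for x y
  by (cases x; cases y; simp)+
 have m: "p\<^sub>1 (x \<otimes>\<^bsub>P\<^esub> y) = p\<^sub>1 x \<otimes>\<^bsub>G\<^sub>1\<^esub> p\<^sub>1 y \<and> p\<^sub>2 (x \<otimes>\<^bsub>P\<^esub> y) = p\<^sub>2 x \<otimes>\<^bsub>G\<^sub>2\<^esub> p\<^sub>2 y"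
  if "x \<in> entries PE" "y \<in> entries PE" for x y
  using that
 proof (elim P_entryE)
  fix I J :: "nat set" and X a b Y c d
  assume x: "x = Emat I X a b" "cohmat I X" "a \<in> I" "b \<in> I" and y: "y = Emat J Y c d" "cohmat J Y" "c \<in> J" "d \<in> J"
  show ?thesis unfolding x(1) y(1) mult_Emat_P[OF x(2) y(2) x(3,4) y(3,4)]
   using proj_Emat[OF x(2-4)] proj_Emat[OF y(2-4)] proj_Emat[OF cohmat_kron[OF x(2) y(2)], of "(a, c)" "(b, d)"] x y by (simp add: f)
 qed
 have o: "p\<^sub>1 \<one>\<^bsub>P\<^esub> = \<one>\<^bsub>G\<^sub>1\<^esub>" "p\<^sub>2 \<one>\<^bsub>P\<^esub> = \<one>\<^bsub>G\<^sub>2\<^esub>"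
  unfolding one_P_eq using proj_Emat[OF cohmat_one[of "0 :: nat"], of 0 0] by simp_all
 show "p\<^sub>1 \<in> homs P G\<^sub>1"
 proof (rule hopf_homI[OF hopf_P G1 spans_P lin_proj(1)], rule m[THEN conjunct1], assumption+, rule o(1), elim exE conjE)
  fix Z I X assume X: "cohmat I X" and Z: "Z = Emat I X"
  show "comat P I Z \<and> comat G\<^sub>1 I (\<lambda>a b. p\<^sub>1 (Z a b))"
   using comat_P[OF X] comat_cong[OF alg1 cohmatD(1)[OF X] proj_Emat(1)[OF X]] Z by simp
 qed
 show "p\<^sub>2 \<in> homs P G\<^sub>2"
 proof (rule hopf_homI[OF hopf_P G2 spans_P lin_proj(2)], rule m[THEN conjunct2], assumption+, rule o(2), elim exE conjE)
  fix Z I X assume X: "cohmat I X" and Z: "Z = Emat I X"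
  show "comat P I Z \<and> comat G\<^sub>2 I (\<lambda>a b. p\<^sub>2 (Z a b))"
   using comat_P[OF X] comat_cong[OF alg2 cohmatD(2)[OF X] proj_Emat(2)[OF X]] Z by simp
 qed
qed

lemma proj_commute:
 assumes f: "f \<in> carrier P"
 shows "\<alpha>\<^sub>1 (p\<^sub>1 f) = \<alpha>\<^sub>2 (p\<^sub>2 f)"
proof (rule spans_ext[OF spans_P algebra_P algH lin_comp[OF lin_proj(1) hopf_homD(1)[OF \<alpha>1]] lin_comp[OF lin_proj(2) hopf_homD(1)[OF \<alpha>2]] _ f], elim P_entryE)
 fix f and I :: "nat set" and X a b assume x: "f = Emat I X a b" "cohmat I X" "a \<in> I" "b \<in> I"
 show "\<alpha>\<^sub>1 (p\<^sub>1 f) = \<alpha>\<^sub>2 (p\<^sub>2 f)" using cohmatD(3)[OF x(2-4)] unfolding x(1) proj_Emat[OF x(2-4)] .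
qed

section \<open>The universal property of the amalgam\<close>

context
 fixes B :: "('k, 't) hopf" and q\<^sub>1 q\<^sub>2
 assumes hB: "hopf B" and q1: "q\<^sub>1 \<in> homs B G\<^sub>1" and q2: "q\<^sub>2 \<in> homs B G\<^sub>2"
  and comm: "\<And>x. x \<in> carrier B \<Longrightarrow> \<alpha>\<^sub>1 (q\<^sub>1 x) = \<alpha>\<^sub>2 (q\<^sub>2 x)"
begin

definition q :: "'t \<Rightarrow> 'a \<times> 'b" where "q x = (q\<^sub>1 x, q\<^sub>2 x)"

lemma lin_q: "lin B A q"
 using linD[OF hopf_homD(1)[OF q1]] linD[OF hopf_homD(1)[OF q2]] by (simp add: lin_def q_def)

lemma cohmat_q: "comat B I Z \<Longrightarrow> cohmat I (\<lambda>a b. q (Z a b))"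
 using comat_hom[OF hB G1 q1, of I Z] comat_hom[OF hB G2 q2, of I Z] comm[OF comatD(2)[of B I Z]] by (simp add: cohmat_def q_def)

abbreviation "along w \<equiv> map (\<lambda>l y. l (q y)) w"

lemma along_fnl: "w \<in> words \<Longrightarrow> along w \<in> lists {\<phi>. fnl B \<phi>}"
 by (auto intro!: lin_comp[OF lin_q])

text \<open>The induced map dualizes to the extension of the dual maps of \<open>q\<^sub>1\<close> and \<open>q\<^sub>2\<close> from letters to
  words; this determines its value at \<open>x\<close>.\<close>

definition lifts :: "'t \<Rightarrow> (nat \<Rightarrow> ('k, 'a \<times> 'b) tensor) \<Rightarrow> bool" where
 "lifts x f \<longleftrightarrow> (\<forall>w\<in>LW. fev w f = conv B (along w) x)"

definition um :: "'t \<Rightarrow> nat \<Rightarrow> ('k, 'a \<times> 'b) tensor" where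
 "um = (\<lambda>x\<in>carrier B. THE f. f \<in> carrier TT \<and> lifts x f)"

lemma um_eq:
 assumes x: "x \<in> carrier B" and f: "f \<in> carrier TT" "lifts x f"
 shows "um x = f"
proof -
 have "(THE f. f \<in> carrier TT \<and> lifts x f) = f"
 proof (rule the_equality)
  show "g = f" if g: "g \<in> carrier TT \<and> lifts x g" for g
   by (rule TT_eqI[OF _ f(1)]) (use g f(2) in \<open>simp_all add: lifts_def\<close>)
 qed (use f in simp)
 then show ?thesis using x by (simp add: um_def)
qed

lemma lifts_Emat:
 assumes Z: "comat B I Z" and ab: "a \<in> I" "b \<in> I"
 shows "lifts (Z a b) (Emat I (\<lambda>a b. q (Z a b)) a b)"
 unfolding lifts_def
proof
 let ?X = "\<lambda>a b. q (Z a b)"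
 note X = cohmatD(5)[OF cohmat_q[OF Z]] and I = comatD(1)[OF Z]
 fix w assume "w \<in> LW"
 then have "w \<in> words" by (rule LW_words)
 then show "fev w (Emat I ?X a b) = conv B (along w) (Z a b)" using ab
 proof (induction w arbitrary: a rule: list.induct)
  case Nil
  then show ?case using comatD(4)[OF Z] by (simp add: fev_Emat_Nil)
 next
  case (Cons \<phi> w)
  have \<phi>: "fnl A \<phi>" and w: "w \<in> words" using Cons.prems(1) by simp_all
  note \<phi>q = lin_comp[OF lin_q \<phi>] and wq = fnl_conv[OF hB along_fnl[OF w]]
  have "fev (\<phi> # w) (Emat I ?X a b) = ksum (\<lambda>c. \<phi> (q (Z a c)) \<otimes> fev w (Emat I ?X c b)) I"
   by (rule fev_Emat_Cons[OF I X Cons.prems(2,3) \<phi> w])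
  also have "\<dots> = ksum (\<lambda>c. \<phi> (q (Z a c)) \<otimes> conv B (along w) (Z c b)) I"
   by (rule ksum_cong[OF refl])
    (use Cons.IH[OF w _ Cons.prems(3)] fnl_closed[OF \<phi>q comatD(2)[OF Z Cons.prems(2)]] fnl_closed[OF wq comatD(2)[OF Z _ Cons.prems(3)]] in simp_all)
  also have "\<dots> = conv B (along (\<phi> # w)) (Z a b)"
   using tev_comat[OF hB Z \<phi>q wq Cons.prems(2,3)] by simp
  finally show ?case .
 qed
qed

lemma um_Emat: "\<lbrakk>comat B I Z; a \<in> I; b \<in> I\<rbrakk> \<Longrightarrow> um (Z a b) = Emat I (\<lambda>a b. q (Z a b)) a b"
 by (rule um_eq[OF comatD(2) Emat_TT[OF cohmat_q] lifts_Emat])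

lemma lifts_lin:
 assumes x: "x \<in> carrier B" "f \<in> carrier TT" "lifts x f"
 shows "\<lbrakk>y \<in> carrier B; g \<in> carrier TT; lifts y g\<rbrakk> \<Longrightarrow> lifts (x \<oplus>\<^bsub>B\<^esub> y) (f \<oplus>\<^bsub>TT\<^esub> g)"
  and "c \<in> \<K> \<Longrightarrow> lifts (c \<odot>\<^bsub>B\<^esub> x) (c \<odot>\<^bsub>TT\<^esub> f)"
 using x linD(2,3)[OF fnl_conv[OF hB along_fnl[OF LW_words]]] unfolding lifts_def by (simp_all add: fev_lin)

lemma um_P: assumes x: "x \<in> carrier B" shows "um x \<in> carrier P" and "lifts x (um x)"
proof -
 note B = hopfD(1)[OF hB]
 let ?Q = "{x \<in> carrier B. \<exists>f\<in>carrier P. lifts x f}"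
 have z: "lifts \<zero>\<^bsub>B\<^esub> \<zero>\<^bsub>TT\<^esub>"
  using lin_zero[OF fnl_conv[OF hB along_fnl[OF LW_words]] B algebra_Ks] unfolding lifts_def by (simp add: fev_lin)
 have "subspace B ?Q"
  by (rule subspace_domain[where R=lifts, OF B subspace_P z]) (use lifts_lin P_TT in simp_all)
 then have "x \<in> ?Q"
 proof (rule comat_span[OF hB x])
  show "Z a b \<in> ?Q" if Z: "comat B I Z" "a \<in> I" "b \<in> I" for I :: "nat set" and Z a b
   using comatD(2)[OF Z] Emat_P[OF cohmat_q[OF Z(1)] Z(2,3)] lifts_Emat[OF Z] by blast
 qed
 then obtain f where f: "f \<in> carrier P" "lifts x f" by blast
 then have "um x = f" by (intro um_eq[OF x] P_TT)
 then show "um x \<in> carrier P" "lifts x (um x)" using f by simp_all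
qed

lemma lin_um: "lin B P um"
proof (rule linI)
 note B = hopfD(1)[OF hB]
 fix x assume x: "x \<in> carrier B"
 note f = x P_TT[OF um_P(1)[OF x]] um_P(2)[OF x]
 show "um x \<in> carrier P" by (rule um_P(1)[OF x])
 show "um (c \<odot>\<^bsub>B\<^esub> x) = c \<odot>\<^bsub>P\<^esub> um x" if "c \<in> \<K>" for c
  unfolding P_simps(6) U_simps by (rule um_eq[OF _ _ lifts_lin(2)[OF f that]]) (use f that B in simp_all)
 fix y assume y: "y \<in> carrier B"
 note g = y P_TT[OF um_P(1)[OF y]] um_P(2)[OF y]
 show "um (x \<oplus>\<^bsub>B\<^esub> y) = um x \<oplus>\<^bsub>P\<^esub> um y"
  unfolding P_simps(4) U_simps by (rule um_eq[OF _ _ lifts_lin(1)[OF f g]]) (use f g B in simp_all)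
qed

lemma um_hom: "um \<in> homs B P"
proof (rule hopf_homI[OF hB hopf_P spans_comat[OF hB] lin_um])
 note B = hopfD(1)[OF hB]
 have one: "q \<one>\<^bsub>B\<^esub> = \<one>\<^bsub>A\<^esub>" using hopf_homD(3)[OF q1] hopf_homD(3)[OF q2] by (simp add: q_def)
 show "um \<one>\<^bsub>B\<^esub> = \<one>\<^bsub>P\<^esub>"
  using um_Emat[OF comat_one[OF hB, of "0 :: nat"], of 0 0] unfolding one_P_eq one by simp
 show "comat B I Z \<and> comat P I (\<lambda>a b. um (Z a b))" if "comat B I Z" for I :: "nat set" and Z
  using comat_cong[OF algebra_P comat_P[OF cohmat_q[OF that]] um_Emat[OF that]] that by simp
 fix x y assume "x \<in> entries (\<lambda>Z (I :: nat set). comat B I Z)" "y \<in> entries (\<lambda>Z (I :: nat set). comat B I Z)"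
 then show "um (x \<otimes>\<^bsub>B\<^esub> y) = um x \<otimes>\<^bsub>P\<^esub> um y"
 proof (elim entriesE)
  fix I J :: "nat set" and Z Y a b c d
  assume x: "x = Z a b" "comat B I Z" "a \<in> I" "b \<in> I" and y: "y = Y c d" "comat B J Y" "c \<in> J" "d \<in> J"
  let ?W = "\<lambda>p r. Z (fst p) (fst r) \<otimes>\<^bsub>B\<^esub> Y (snd p) (snd r)" and ?IJ = "I \<times> J"
  let ?X = "\<lambda>a b. q (Z a b)" and ?Y = "\<lambda>a b. q (Y a b)"
  note X = cohmat_q[OF x(2)] and Yc = cohmat_q[OF y(2)]
  have p: "(a, c) \<in> ?IJ" "(b, d) \<in> ?IJ" using x y by simp_all
  have "um (Z a b \<otimes>\<^bsub>B\<^esub> Y c d) = Emat ?IJ (\<lambda>p r. q (?W p r)) (a, c) (b, d)"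
   using um_Emat[OF comat_mult[OF hB x(2) y(2)] p] by simp
  also have "\<dots> = Emat ?IJ (kron ?X ?Y) (a, c) (b, d)"
  proof (rule Emat_cong[OF cohmatD(5)[OF cohmat_kron[OF X Yc]] _ p])
   fix p r assume pr: "p \<in> ?IJ" "r \<in> ?IJ"
   have "Z (fst p) (fst r) \<in> carrier B" "Y (snd p) (snd r) \<in> carrier B" using comatD(2)[OF x(2)] comatD(2)[OF y(2)] pr by auto
   then show "q (?W p r) = kron ?X ?Y p r"
    using hopf_homD(2)[OF q1] hopf_homD(2)[OF q2] by (simp add: q_def)
  qed
  also have "\<dots> = um x \<otimes>\<^bsub>P\<^esub> um y"
   unfolding x(1) y(1) um_Emat[OF x(2-4)] um_Emat[OF y(2-4)] by (rule mult_Emat_P[OF X Yc x(3,4) y(3,4), symmetric])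
  finally show "um (x \<otimes>\<^bsub>B\<^esub> y) = um x \<otimes>\<^bsub>P\<^esub> um y" unfolding x(1) y(1) .
 qed
qed

lemma um_proj:
 assumes x: "x \<in> carrier B"
 shows "cofree_proj K A (um x) = q x"
proof (rule separating_eqI[OF separating_AA algebra_AA])
 note f = P_TT[OF um_P(1)[OF x]]
 show "cofree_proj K A (um x) \<in> carrier A" by (rule linD(1)[OF lin_cofree_proj f])
 show "q x \<in> carrier A" by (rule linD(1)[OF lin_q x])
 fix \<phi> assume \<phi>: "\<phi> \<in> \<Omega>"
 then have w: "[\<phi>] \<in> LW" by simp
 have "\<phi> (cofree_proj K A (um x)) = conv B [\<lambda>y. \<phi> (q y)] x"
  using fnl_cofree_proj[OF f \<Omega>_fnl[OF \<phi>]] um_P(2)[OF x] w unfolding lifts_def by simp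
 then show "\<phi> (cofree_proj K A (um x)) = \<phi> (q x)"
  using conv_single[OF hB lin_comp[OF lin_q \<Omega>_fnl[OF \<phi>]] x] by simp
qed

text \<open>A Hopf algebra morphism sends a representation over \<open>B\<close> to a comultiplicative matrix of
  coherent elements, whose degree one part is prescribed.\<close>

lemma um_unique:
 assumes v: "v \<in> homs B P" and p: "\<And>x. x \<in> carrier B \<Longrightarrow> cofree_proj K A (v x) = q x" and x: "x \<in> carrier B"
 shows "v x = um x"
proof (rule spans_ext[OF spans_comat[OF hB] hopfD(1)[OF hB] algebra_P hopf_homD(1)[OF v] lin_um _ x], elim entriesE)
 fix x and I :: "nat set" and Z a b assume x: "x = Z a b" "comat B I Z" "a \<in> I" "b \<in> I"
 note c = comat_hom[OF hB hopf_P v x(2)] and Zc = comatD(2)[OF x(2)]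
 show "v x = um x" unfolding x(1) um_Emat[OF x(2-4)]
 proof (rule Emat_unique[OF comatD(1)[OF c] cohmatD(5)[OF cohmat_q[OF x(2)]] _ _ _ p[OF Zc] x(3,4)])
  show "mat_in TT I (\<lambda>a b. v (Z a b))" using P_TT[OF comatD(2)[OF c]] by (simp add: mat_in_def)
  show "fev [] (v (Z a b)) = (if a = b then \<one> else \<zero>)" if "a \<in> I" "b \<in> I" for a b
   using comatD(4)[OF c that] by (simp add: counit_P)
  fix u w a b assume uw: "u \<in> LW" "w \<in> LW" and ab: "a \<in> I" "b \<in> I"
  show "fev (u @ w) (v (Z a b)) = ksum (\<lambda>c. fev u (v (Z a c)) \<otimes> fev w (v (Z c b))) I"
   using tev_comat[OF hopf_P c fnl_P[OF uw(1)] fnl_P[OF uw(2)] ab] tev_comult[OF comatD(2)[OF c ab] uw] by simp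
 qed
qed

lemma universal:
 "\<exists>!u. u \<in> homs B P \<inter> extensional (carrier B) \<and> (\<forall>x\<in>carrier B. p\<^sub>1 (u x) = q\<^sub>1 x \<and> p\<^sub>2 (u x) = q\<^sub>2 x)"
proof (rule ex1I)
 have q: "p\<^sub>1 (u x) = q\<^sub>1 x \<and> p\<^sub>2 (u x) = q\<^sub>2 x \<longleftrightarrow> cofree_proj K A (u x) = q x" for u :: "'t \<Rightarrow> _" and x
  by (auto simp: coherent_proj\<^sub>1_def coherent_proj\<^sub>2_def q_def prod_eq_iff)
 show "um \<in> homs B P \<inter> extensional (carrier B) \<and> (\<forall>x\<in>carrier B. p\<^sub>1 (um x) = q\<^sub>1 x \<and> p\<^sub>2 (um x) = q\<^sub>2 x)"
  unfolding q using um_hom um_proj by (simp add: um_def)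
 fix v assume v: "v \<in> homs B P \<inter> extensional (carrier B) \<and> (\<forall>x\<in>carrier B. p\<^sub>1 (v x) = q\<^sub>1 x \<and> p\<^sub>2 (v x) = q\<^sub>2 x)"
 then have "v x = um x" if "x \<in> carrier B" for x using um_unique[of v x] that unfolding q by blast
 moreover have "um \<in> extensional (carrier B)" by (simp add: um_def)
 ultimately show "v = um" using v by (intro extensionalityI[of v "carrier B" um]) auto
qed

end

end

theorem proposition2p4:
  fixes K :: "('k, 'm) ring_scheme"
    and G\<^sub>1 :: "('k, 'a) hopf" and G\<^sub>2 :: "('k, 'b) hopf" and H :: "('k, 'h) hopf"
    and \<alpha>\<^sub>1 :: "'a \<Rightarrow> 'h" and \<alpha>\<^sub>2 :: "'b \<Rightarrow> 'h"
  defines "P \<equiv> coherent_hopf K G\<^sub>1 G\<^sub>2 H \<alpha>\<^sub>1 \<alpha>\<^sub>2"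
    and "p\<^sub>1 \<equiv> coherent_proj\<^sub>1 K G\<^sub>1 G\<^sub>2" and "p\<^sub>2 \<equiv> coherent_proj\<^sub>2 K G\<^sub>1 G\<^sub>2"
  assumes "field K"
    and "hopf_algebra K G\<^sub>1" and "hopf_algebra K G\<^sub>2" and "hopf_algebra K H"
    and "\<alpha>\<^sub>1 \<in> hopf_hom K G\<^sub>1 H" and "\<alpha>\<^sub>2 \<in> hopf_hom K G\<^sub>2 H"
  shows "hopf_algebra K P \<and>
    p\<^sub>1 \<in> hopf_hom K P G\<^sub>1 \<and> p\<^sub>2 \<in> hopf_hom K P G\<^sub>2 \<and>
    (\<forall>f\<in>carrier P. \<alpha>\<^sub>1 (p\<^sub>1 f) = \<alpha>\<^sub>2 (p\<^sub>2 f)) \<and>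
    (\<forall>(B :: ('k, 't) hopf) q\<^sub>1 q\<^sub>2.
      hopf_algebra K B \<and> q\<^sub>1 \<in> hopf_hom K B G\<^sub>1 \<and> q\<^sub>2 \<in> hopf_hom K B G\<^sub>2 \<and>
      (\<forall>x\<in>carrier B. \<alpha>\<^sub>1 (q\<^sub>1 x) = \<alpha>\<^sub>2 (q\<^sub>2 x)) \<longrightarrow>
      (\<exists>!u. u \<in> hopf_hom K B P \<inter> extensional (carrier B) \<and>
         (\<forall>x\<in>carrier B. p\<^sub>1 (u x) = q\<^sub>1 x \<and> p\<^sub>2 (u x) = q\<^sub>2 x)))"
proof -
  interpret amalgam K G\<^sub>1 G\<^sub>2 H \<alpha>\<^sub>1 \<alpha>\<^sub>2
    by (rule amalgam.intro[OF ground_field.intro[OF assms(4)] amalgam_axioms.intro[OF assms(5-9)]])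
  show ?thesis unfolding P_def p\<^sub>1_def p\<^sub>2_def
    by (intro conjI ballI allI impI hopf_P proj_hom proj_commute universal; (elim conjE)?; (assumption | drule bspec, assumption+))
qed

end
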